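(* Let $M=\mathbb{R}^7$ with standard coordinates $u=(u^i)$, $1\le i\le7$, and let $\lambda$ be a real constant. Let $\pi:X\to\mathbb{R}^7$ be the bundle of pairs $(s,b)$ with $s\in\Lambda^3_+(T^*_m\mathbb{R}^7)$, $b\in\Lambda^2(T_m^*\mathbb{R}^7)$, $m\in\mathbb{R}^7$; let $\mathcal{I}_\lambda$ be the exterior differential system on $X$ generated by $\Upsilon_3,\Upsilon_4,\Upsilon_5,\Upsilon_6$, and let $\mathcal{I}_\lambda^+$ be the ideal generated by $\mathcal{I}_\lambda$ and the seven closed $7$-forms $d\Phi^i$, where $\Phi^i$ is the $6$-form on $X$ whose value at $(s,b)$ is $\pi^*\bigl(\ast_s(du^i)\bigr)$ (all as defined in the context). Then the exterior differential system $\mathcal{I}_\lambda^+$ on $X$, with independence condition $\omega$, is involutive with Cartan characters $$(s_0,s_1,s_2,s_3,s_4,s_5,s_6,s_7)=(0,0,1,3,7,15,30,0).$$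
   Context: **$\mathrm{G}_2$-structures.** A $3$-form $s\in\Lambda^3(T_m^*M)$ on a $7$-manifold $M$ is definite if $(v\lrcorner s)\wedge(v\lrcorner s)\wedge s\neq0$ for every nonzero $v\in T_mM$; here $v\lrcorner$ is interior product. The open subset of definite $3$-forms is $\Lambda^3_+(T^*M)\subset\Lambda^3(T^*M)$. A definite $s$ determines a unique inner product $g_s$ and orientation, with Hodge star $\ast_s$, such that $(v\lrcorner s)\wedge(w\lrcorner s)\wedge s=6\,\langle v,w\rangle_{g_s}\,{\ast_s}1$ for all $v,w\in T_mM$. **The space $X$ and tautological forms.** $X\subset\Lambda^3(T^*M)\oplus\Lambda^2(T^*M)$ is the open set of pairs $(s,b)$ with $s\in\Lambda^3_+(T_m^*M)$, $b\in\Lambda^2(T^*_mM)$ for some $m\in M$; $\pi:X\to M$, $\pi(s,b)=m$. It is a smooth fiber bundle with $56$-dimensional fibers. On $X$ define the smooth forms whose values at $(s,b)$ are $\mathsf{s}=\pi^*(s)$ (a $3$-form), $\mathsf{b}=\pi^*(b)$ (a $2$-form), $\mathsf{t}=\pi^*(\ast_s s)$ (a $4$-form), $\mathsf{p}=\pi^*(\ast_s b)$ (a $5$-form), $\omega=\pi^*(\ast_s 1)$ (a $7$-form). **The ideal $\mathcal{I}_\lambda$.** Put $\Upsilon_3=d\mathsf{b}-\lambda\,\mathsf{s}$, $\Upsilon_4=d\mathsf{s}$, $\Upsilon_5=d\mathsf{t}+\tfrac23\mathsf{p}-\tfrac13\mathsf{b}\wedge\mathsf{s}$, $\Upsilon_6=d\mathsf{p}$.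 $\mathcal{I}_\lambda$ is the algebraic ideal in $\Omega^*(X)$ generated by $\Upsilon_3,\dots,\Upsilon_6$; it is closed under $d$. The ideal $\mathcal{I}_\lambda^+$ is generated algebraically by $\mathcal{I}_\lambda$ and $d\Phi^1,\dots,d\Phi^7$. **Cartan's notions.** Let $\mathcal{I}$ be an exterior differential system on $X$ (a differentially closed ideal, here with no nonzero $0$-forms). A subspace $E\subset T_xX$ is an integral element if every form in $\mathcal{I}$ vanishes on $E$; a $7$-dimensional integral element is admissible if $\omega|_E\neq0$. Denote by $\mathcal{V}(\mathcal{I},\omega)\subset\mathrm{Gr}(7,TX)$ the set of admissible integral elements. For an integral element $E_k$ with basis $e_1,\dots,e_k$, its polar space is $H(E_k)=\{v\in T_xX:\psi(v,e_1,\dots,e_k)=0\ \text{for all } (k{+}1)\text{-forms }\psi\in\mathcal{I}\}$. For a flag $(0)=E_0\subset E_1\subset\dots\subset E_7=E$ of an admissible $E$, with $\dim E_k=k$, let $c_k$ be the codimension of $H(E_k)$ in $T_xX$ for $0\le k\le6$. The characters of the flag are $s_0=c_0$, $s_k=c_k-c_{k-1}$ for $1\le k\le 6$, and $s_7=56-c_6$. The flag is regular (Cartan's Test) if, near $E$, $\mathcal{V}(\mathcal{I},\omega)$ is a smooth submanifold of $\mathrm{Gr}(7,TX)$ of codimension $c_0+c_1+\dots+c_6$. The system $(\mathcal{I},\omega)$ is involutive with Cartan characters $(s_0,\dots,s_7)$ if at every $x\in X$ there are admissible integral elements and each of them is the terminus of a regular flag with those characters. *)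

theory Defs
  imports "HOL-Analysis.Analysis"
begin

section \<open>Exterior algebra of a real vector space\<close>

text \<open>
  An element of the exterior algebra of the dual space is represented by the function that evaluates
  it on lists of vectors; its degree-\<open>k\<close> component is the restriction to lists of length \<open>k\<close>.
\<close>

type_synonym 'a form = "'a list \<Rightarrow> real"

definition alternating :: "'a::real_vector form \<Rightarrow> bool" where
  "alternating \<phi> \<longleftrightarrow>
     (\<forall>vs. \<forall>i<length vs. linear (\<lambda>v. \<phi> (vs[i := v]))) \<and> (\<forall>vs. \<not> distinct vs \<longrightarrow> \<phi> vs = 0)"

definition homogeneous :: "nat \<Rightarrow> 'a form \<Rightarrow> bool" where
  "homogeneous k \<phi> \<longleftrightarrow> (\<forall>vs. length vs \<noteq> k \<longrightarrow> \<phi> vs = 0)"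

text \<open>
  The wedge product is the sum over shuffles, without further normalisation, so that
  \<open>(\<alpha> \<and> \<beta>)(v, w) = \<alpha>(v) \<beta>(w) - \<alpha>(w) \<beta>(v)\<close> for 1-forms. The set \<open>I\<close> collects the positions whose
  vectors go into the first factor.
\<close>

definition shuffle_sign :: "nat \<Rightarrow> nat set \<Rightarrow> real" where
  "shuffle_sign n I = (-1) ^ card {(i, j). i \<in> I \<and> j \<in> {..<n} - I \<and> j < i}"

definition wedge :: "'a form \<Rightarrow> 'a form \<Rightarrow> 'a form" where
  "wedge \<phi> \<psi> = (\<lambda>vs. \<Sum>I\<in>Pow {..<length vs}.
     shuffle_sign (length vs) I * \<phi> (nths vs I) * \<psi> (nths vs ({..<length vs} - I)))"

definition interior :: "'a \<Rightarrow> 'a form \<Rightarrow> 'a form" where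
  "interior v \<phi> = (\<lambda>vs. \<phi> (v # vs))"

definition unit_form :: "'a form" where
  "unit_form = (\<lambda>vs. if vs = [] then 1 else 0)"

definition pullback :: "('a \<Rightarrow> 'b) \<Rightarrow> 'b form \<Rightarrow> 'a form" where
  "pullback L \<phi> = (\<lambda>vs. \<phi> (map L vs))"

section \<open>Metrics, volume forms and the Hodge star\<close>

definition inner_product :: "('v::real_vector \<Rightarrow> 'v \<Rightarrow> real) \<Rightarrow> bool" where
  "inner_product g \<longleftrightarrow>
     (\<forall>v. linear (g v)) \<and> (\<forall>v w. g v w = g w v) \<and> (\<forall>v. v \<noteq> 0 \<longrightarrow> g v v > 0)"

definition orthonormal_basis :: "('v::euclidean_space \<Rightarrow> 'v \<Rightarrow> real) \<Rightarrow> 'v list \<Rightarrow> bool" where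
  "orthonormal_basis g E \<longleftrightarrow> length E = DIM('v) \<and>
     (\<forall>i<DIM('v). \<forall>j<DIM('v). g (E ! i) (E ! j) = (if i = j then 1 else 0))"

text \<open>The two unit volume forms of a metric correspond to the two orientations.\<close>

definition unit_volume :: "('v::euclidean_space \<Rightarrow> 'v \<Rightarrow> real) \<Rightarrow> 'v form \<Rightarrow> bool" where
  "unit_volume g vol \<longleftrightarrow> alternating vol \<and> homogeneous DIM('v) vol \<and>
     (\<forall>E. orthonormal_basis g E \<longrightarrow> \<bar>vol E\<bar> = 1)"

definition form_inner :: "'v list \<Rightarrow> 'v form \<Rightarrow> 'v form \<Rightarrow> real" where
  "form_inner E \<alpha> \<beta> = (\<Sum>I\<in>Pow {..<length E}. \<alpha> (nths E I) * \<beta> (nths E I))"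

text \<open>
  The Hodge star of a \<open>k\<close>-form \<open>\<beta>\<close> is characterised by \<open>\<alpha> \<and> \<star>\<beta> = \<langle>\<alpha>, \<beta>\<rangle> vol\<close> for all \<open>k\<close>-forms \<open>\<alpha>\<close>;
  the induced inner product of forms is computed in a \<open>g\<close>-orthonormal basis.
\<close>

definition hodge_star ::
  "('v::euclidean_space \<Rightarrow> 'v \<Rightarrow> real) \<Rightarrow> 'v form \<Rightarrow> nat \<Rightarrow> 'v form \<Rightarrow> 'v form" where
  "hodge_star g vol k \<beta> = (THE \<theta>. alternating \<theta> \<and> homogeneous (DIM('v) - k) \<theta> \<and>
     (\<forall>\<alpha> E. alternating \<alpha> \<and> homogeneous k \<alpha> \<and> orthonormal_basis g E \<longrightarrow>
        wedge \<alpha> \<theta> = (\<lambda>vs. form_inner E \<alpha> \<beta> * vol vs)))"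

section \<open>Definite 3-forms\<close>

definition definite :: "(real^7) form \<Rightarrow> bool" where
  "definite s \<longleftrightarrow> alternating s \<and> homogeneous 3 s \<and>
     (\<forall>v. v \<noteq> 0 \<longrightarrow> wedge (wedge (interior v s) (interior v s)) s \<noteq> (\<lambda>vs. 0))"

definition g2_metric_volume :: "(real^7) form \<Rightarrow> (real^7 \<Rightarrow> real^7 \<Rightarrow> real) \<times> (real^7) form" where
  "g2_metric_volume s = (THE (g, vol). inner_product g \<and> unit_volume g vol \<and>
     (\<forall>v w. wedge (wedge (interior v s) (interior w s)) s = (\<lambda>vs. 6 * g v w * vol vs)))"

text \<open>\<open>star s k \<beta>\<close> is \<open>\<star>\<^sub>s \<beta>\<close> for a \<open>k\<close>-form \<open>\<beta>\<close>.\<close>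

definition star :: "(real^7) form \<Rightarrow> nat \<Rightarrow> (real^7) form \<Rightarrow> (real^7) form" where
  "star s k \<beta> = hodge_star (fst (g2_metric_volume s)) (snd (g2_metric_volume s)) k \<beta>"

section \<open>Differential forms on open subsets of Euclidean spaces\<close>

primrec Ck_on :: "nat \<Rightarrow> 'a::real_normed_vector set \<Rightarrow> ('a \<Rightarrow> real) \<Rightarrow> bool" where
  "Ck_on 0 U f \<longleftrightarrow> continuous_on U f"
| "Ck_on (Suc k) U f \<longleftrightarrow> (\<forall>x\<in>U. f differentiable (at x)) \<and>
     (\<forall>v. Ck_on k U (\<lambda>x. frechet_derivative f (at x) v))"

definition smooth_on :: "'a::real_normed_vector set \<Rightarrow> ('a \<Rightarrow> real) \<Rightarrow> bool" where
  "smooth_on U f \<longleftrightarrow> (\<forall>k. Ck_on k U f)"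

text \<open>
  All tangent spaces of an open subset of \<open>'a\<close> are identified with \<open>'a\<close>. Only the values of a
  differential form at points of \<open>U\<close> are meaningful.
\<close>

type_synonym 'a dform = "'a \<Rightarrow> 'a form"

definition diff_form :: "'a::euclidean_space set \<Rightarrow> 'a dform \<Rightarrow> bool" where
  "diff_form U \<alpha> \<longleftrightarrow> (\<forall>x\<in>U. alternating (\<alpha> x)) \<and> (\<forall>vs. smooth_on U (\<lambda>x. \<alpha> x vs))"

definition ext_deriv :: "'a::euclidean_space dform \<Rightarrow> 'a dform" where
  "ext_deriv \<alpha> = (\<lambda>x vs. \<Sum>i<length vs. (-1) ^ i *
     frechet_derivative (\<lambda>y. \<alpha> y (take i vs @ drop (Suc i) vs)) (at x) (vs ! i))"

definition dwedge :: "'a dform \<Rightarrow> 'a dform \<Rightarrow> 'a dform" where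
  "dwedge \<alpha> \<beta> = (\<lambda>x. wedge (\<alpha> x) (\<beta> x))"

text \<open>
  The two-sided algebraic ideal of \<open>\<Omega>\<^sup>*(U)\<close> generated by \<open>G\<close>. The rule \<open>cong\<close> makes membership depend
  only on the values on \<open>U\<close>.
\<close>

inductive_set ideal_gen :: "'a::euclidean_space set \<Rightarrow> 'a dform set \<Rightarrow> 'a dform set"
  for U :: "'a::euclidean_space set" and G :: "'a dform set" where
  zero: "(\<lambda>x vs. 0) \<in> ideal_gen U G"
| gen: "\<alpha> \<in> G \<Longrightarrow> \<alpha> \<in> ideal_gen U G"
| add: "\<alpha> \<in> ideal_gen U G \<Longrightarrow> \<beta> \<in> ideal_gen U G \<Longrightarrow> (\<lambda>x vs. \<alpha> x vs + \<beta> x vs) \<in> ideal_gen U G"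
| wedge_left: "\<alpha> \<in> ideal_gen U G \<Longrightarrow> diff_form U \<beta> \<Longrightarrow> dwedge \<beta> \<alpha> \<in> ideal_gen U G"
| wedge_right: "\<alpha> \<in> ideal_gen U G \<Longrightarrow> diff_form U \<beta> \<Longrightarrow> dwedge \<alpha> \<beta> \<in> ideal_gen U G"
| cong: "\<alpha> \<in> ideal_gen U G \<Longrightarrow> (\<And>x. x \<in> U \<Longrightarrow> \<beta> x = \<alpha> x) \<Longrightarrow> \<beta> \<in> ideal_gen U G"

section \<open>Exterior differential systems\<close>

definition exterior_differential_system :: "'a::euclidean_space set \<Rightarrow> 'a dform set \<Rightarrow> bool" where
  "exterior_differential_system U \<I> \<longleftrightarrow>
     (\<forall>\<alpha>\<in>\<I>. diff_form U \<alpha>) \<and>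
     ideal_gen U \<I> = \<I> \<and>
     (\<forall>\<alpha>\<in>\<I>. ext_deriv \<alpha> \<in> \<I>) \<and>
     (\<forall>\<alpha>\<in>\<I>. (\<forall>x\<in>U. homogeneous 0 (\<alpha> x)) \<longrightarrow> (\<forall>x\<in>U. \<alpha> x = (\<lambda>vs. 0)))"

definition integral_element :: "'a::euclidean_space dform set \<Rightarrow> 'a \<Rightarrow> 'a set \<Rightarrow> bool" where
  "integral_element \<I> x E \<longleftrightarrow> subspace E \<and> (\<forall>\<psi>\<in>\<I>. \<forall>vs. set vs \<subseteq> E \<longrightarrow> \<psi> x vs = 0)"

text \<open>The set of admissible \<open>n\<close>-dimensional integral elements; \<open>(x, E)\<close> stands for \<open>E \<subseteq> T\<^sub>x U\<close>.\<close>

definition admissible ::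
  "nat \<Rightarrow> 'a::euclidean_space set \<Rightarrow> 'a dform set \<Rightarrow> 'a dform \<Rightarrow> ('a \<times> 'a set) set" where
  "admissible n U \<I> \<omega> = {(x, E). x \<in> U \<and> integral_element \<I> x E \<and> dim E = n \<and>
     (\<exists>vs. set vs \<subseteq> E \<and> \<omega> x vs \<noteq> 0)}"

definition polar_space :: "'a::euclidean_space set \<Rightarrow> 'a dform set \<Rightarrow> 'a \<Rightarrow> 'a set \<Rightarrow> 'a set" where
  "polar_space U \<I> x E = {v. \<forall>\<psi>\<in>\<I>. (\<forall>y\<in>U. homogeneous (Suc (dim E)) (\<psi> y)) \<longrightarrow>
     (\<forall>es. distinct es \<and> independent (set es) \<and> span (set es) = E \<longrightarrow> \<psi> x (v # es) = 0)}"

definition polar_codim :: "'a::euclidean_space set \<Rightarrow> 'a dform set \<Rightarrow> 'a \<Rightarrow> 'a set \<Rightarrow> nat" where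
  "polar_codim U \<I> x E = DIM('a) - dim (polar_space U \<I> x E)"

definition flag :: "nat \<Rightarrow> 'a::euclidean_space set \<Rightarrow> (nat \<Rightarrow> 'a set) \<Rightarrow> bool" where
  "flag n E F \<longleftrightarrow> (\<forall>k\<le>n. subspace (F k) \<and> dim (F k) = k) \<and> (\<forall>k<n. F k \<subseteq> F (Suc k)) \<and> F n = E"

text \<open>The characters \<open>s\<^sub>0, \<dots>, s\<^sub>n\<close> of a flag \<open>F\<close> whose terminus has dimension \<open>n \<ge> 1\<close>.\<close>

definition characters ::
  "nat \<Rightarrow> 'a::euclidean_space set \<Rightarrow> 'a dform set \<Rightarrow> 'a \<Rightarrow> (nat \<Rightarrow> 'a set) \<Rightarrow> int list" where
  "characters n U \<I> x F = (let c = (\<lambda>k. int (polar_codim U \<I> x (F k))) in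
     [c 0] @ map (\<lambda>k. c k - c (k - 1)) [1..<n] @ [int DIM('a) - int n - c (n - 1)])"

text \<open>
  The standard charts of the Grassmann bundle \<open>U \<times> Gr(n, T)\<close> with \<open>T = \<real>\<^sup>n \<times> 'w\<close>: a linear
  automorphism \<open>L\<close> of \<open>T\<close> yields the chart of all \<open>(x, L(graph of A))\<close>, with \<open>A : \<real>\<^sup>n \<rightarrow> 'w\<close> linear and
  given by the images \<open>A $ i\<close> of the standard basis vectors. Every linear splitting of \<open>T\<close> into an
  \<open>n\<close>-dimensional subspace and a complement arises from some \<open>L\<close>.
\<close>

definition graph_chart ::
  "((real^'n) \<times> 'w::euclidean_space \<Rightarrow> (real^'n) \<times> 'w) \<Rightarrow> 'w^'n \<Rightarrow> ((real^'n) \<times> 'w) set" where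
  "graph_chart L A = L ` {(v, \<Sum>i\<in>UNIV. (v $ i) *\<^sub>R (A $ i)) | v. True}"

text \<open>
  Near \<open>(x\<^sub>0, E\<^sub>0)\<close>, the set \<open>S\<close> is a smooth submanifold of codimension \<open>c\<close> of the Grassmann bundle: in
  a chart it is the common zero set of \<open>c\<close> smooth functions whose differentials are linearly
  independent at the point (hence in a neighbourhood of it).
\<close>

definition grassmann_submanifold_near ::
  "((real^'n) \<times> 'w::euclidean_space) set \<Rightarrow> (((real^'n) \<times> 'w) \<times> ((real^'n) \<times> 'w) set) set \<Rightarrow>
     (real^'n) \<times> 'w \<Rightarrow> ((real^'n) \<times> 'w) set \<Rightarrow> nat \<Rightarrow> bool" where
  "grassmann_submanifold_near U S x\<^sub>0 E\<^sub>0 c \<longleftrightarrow>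
     (\<exists>L A\<^sub>0 N f. linear L \<and> bij L \<and> E\<^sub>0 = graph_chart L A\<^sub>0 \<and>
        open N \<and> (x\<^sub>0, A\<^sub>0) \<in> N \<and> N \<subseteq> U \<times> UNIV \<and>
        (\<forall>j<c. smooth_on N (f j)) \<and>
        (\<forall>r :: nat \<Rightarrow> real.
           (\<forall>h. (\<Sum>j<c. r j * frechet_derivative (f j) (at (x\<^sub>0, A\<^sub>0)) h) = 0) \<longrightarrow> (\<forall>j<c. r j = 0)) \<and>
        (\<forall>(x, A)\<in>N. (x, graph_chart L A) \<in> S \<longleftrightarrow> (\<forall>j<c. f j (x, A) = 0)))"

definition regular_flag ::
  "((real^'n) \<times> 'w::euclidean_space) set \<Rightarrow> ((real^'n) \<times> 'w) dform set \<Rightarrow> ((real^'n) \<times> 'w) dform \<Rightarrow>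
     (real^'n) \<times> 'w \<Rightarrow> ((real^'n) \<times> 'w) set \<Rightarrow> (nat \<Rightarrow> ((real^'n) \<times> 'w) set) \<Rightarrow> bool" where
  "regular_flag U \<I> \<omega> x E F \<longleftrightarrow> flag CARD('n) E F \<and>
     grassmann_submanifold_near U (admissible CARD('n) U \<I> \<omega>) x E
       (\<Sum>k<CARD('n). polar_codim U \<I> x (F k))"

definition involutive ::
  "((real^'n) \<times> 'w::euclidean_space) set \<Rightarrow> ((real^'n) \<times> 'w) dform set \<Rightarrow> ((real^'n) \<times> 'w) dform \<Rightarrow>
     int list \<Rightarrow> bool" where
  "involutive U \<I> \<omega> cs \<longleftrightarrow> exterior_differential_system U \<I> \<and>
     (\<forall>x\<in>U. (\<exists>E. (x, E) \<in> admissible CARD('n) U \<I> \<omega>) \<and>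
        (\<forall>E. (x, E) \<in> admissible CARD('n) U \<I> \<omega> \<longrightarrow>
           (\<exists>F. regular_flag U \<I> \<omega> x E F \<and> characters CARD('n) U \<I> x F = cs)))"

section \<open>The bundle of pairs of a definite 3-form and a 2-form over \<open>\<real>\<^sup>7\<close>\<close>

text \<open>
  The vector spaces of 3-forms and of 2-forms on \<open>\<real>\<^sup>7\<close> are coordinatised by their coefficients with
  respect to the monomials \<open>du\<^sup>i \<and> du\<^sup>j \<and> du\<^sup>k\<close> and \<open>du\<^sup>i \<and> du\<^sup>j\<close> with increasing indices. The index type
  \<open>7\<close> consists of \<open>0, \<dots>, 6\<close>.
\<close>

typedef triples = "{I :: 7 set. card I = 3}"
proof -
  have "3 \<le> card (UNIV :: 7 set)" by simp
  then show ?thesis using obtain_subset_with_card_n by blast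
qed

typedef pairs = "{I :: 7 set. card I = 2}"
proof -
  have "2 \<le> card (UNIV :: 7 set)" by simp
  then show ?thesis using obtain_subset_with_card_n by blast
qed

instance triples :: finite
proof
  have "inj Rep_triples" by (simp add: inj_on_def Rep_triples_inject)
  then show "finite (UNIV :: triples set)" by (rule finite_imageD[rotated]) simp
qed

instance pairs :: finite
proof
  have "inj Rep_pairs" by (simp add: inj_on_def Rep_pairs_inject)
  then show "finite (UNIV :: pairs set)" by (rule finite_imageD[rotated]) simp
qed

definition du :: "7 \<Rightarrow> (real^7) form" where
  "du i = (\<lambda>vs. if length vs = 1 then hd vs $ i else 0)"

definition du_monomial :: "7 set \<Rightarrow> (real^7) form" where
  "du_monomial I = foldr (\<lambda>i. wedge (du i)) (sorted_list_of_set I) unit_form"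

definition form3 :: "real^triples \<Rightarrow> (real^7) form" where
  "form3 a = (\<lambda>vs. \<Sum>I\<in>UNIV. a $ I * du_monomial (Rep_triples I) vs)"

definition form2 :: "real^pairs \<Rightarrow> (real^7) form" where
  "form2 a = (\<lambda>vs. \<Sum>I\<in>UNIV. a $ I * du_monomial (Rep_pairs I) vs)"

type_synonym fiber = "(real^triples) \<times> (real^pairs)"
type_synonym total = "(real^7) \<times> fiber"

definition X :: "total set" where
  "X = {(m, a, b). definite (form3 a)}"

definition s_of :: "total \<Rightarrow> (real^7) form" where
  "s_of x = form3 (fst (snd x))"

definition b_of :: "total \<Rightarrow> (real^7) form" where
  "b_of x = form2 (snd (snd x))"

text \<open>The bundle projection is the linear map \<open>fst\<close>, which is its own differential at each point.\<close>

definition sform :: "total dform" where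
  "sform x = pullback fst (s_of x)"

definition bform :: "total dform" where
  "bform x = pullback fst (b_of x)"

definition tform :: "total dform" where
  "tform x = pullback fst (star (s_of x) 3 (s_of x))"

definition pform :: "total dform" where
  "pform x = pullback fst (star (s_of x) 2 (b_of x))"

definition omega :: "total dform" where
  "omega x = pullback fst (star (s_of x) 0 unit_form)"

definition Phi :: "7 \<Rightarrow> total dform" where
  "Phi i x = pullback fst (star (s_of x) 1 (du i))"

definition Upsilon3 :: "real \<Rightarrow> total dform" where
  "Upsilon3 l = (\<lambda>x vs. ext_deriv bform x vs - l * sform x vs)"

definition Upsilon4 :: "total dform" where
  "Upsilon4 = ext_deriv sform"

definition Upsilon5 :: "total dform" where
  "Upsilon5 = (\<lambda>x vs. ext_deriv tform x vs + 2/3 * pform x vs - 1/3 * dwedge bform sform x vs)"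

definition Upsilon6 :: "total dform" where
  "Upsilon6 = ext_deriv pform"

definition I_lambda :: "real \<Rightarrow> total dform set" where
  "I_lambda l = ideal_gen X {Upsilon3 l, Upsilon4, Upsilon5, Upsilon6}"

definition I_lambda_plus :: "real \<Rightarrow> total dform set" where
  "I_lambda_plus l = ideal_gen X (I_lambda l \<union> range (\<lambda>i. ext_deriv (Phi i)))"

end

(*
  The infinitesimal action of gl(7) on a definite 3-form s is onto, so equivariance determines the
  derivatives of the Hodge duals along the fibres of X and makes the polar equations explicit in a
  frame adapted to s. Over the first six vectors of such a frame, 56 of the polar equations restrict to
  independent functionals on the 56-dimensional fibre; for k < 6, those of them that involve only the
  first k vectors are all polar equations of the k-th member of the flag.

  An admissible integral element is the graph of a linear map from R^7 to the fibre. The 56 functionals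
  give 0 + 0 + 1 + 4 + 11 + 26 + 56 = 98 equations for such graphs, with block triangular differentials.
  Seven components of Upsilon_5 are not among them. They vanish because the interior products of s with
  vectors annihilate Upsilon_5 modulo Upsilon_4: the derivative of the Hodge dual of s is symmetric, as
  the volume form is a potential for it, and 2 (v _| s) /\ *b = (v _| s) /\ b /\ s.
*)
theory Submission
  imports Defs
begin

section \<open>Exterior algebra\<close>

definition hat :: "'a form \<Rightarrow> 'a form" where
  "hat \<phi> = (\<lambda>vs. (-1) ^ length vs * \<phi> vs)"

lemma interior_apply: "interior v \<phi> vs = \<phi> (v # vs)"
  by (simp add: interior_def)

lemma interior_hat: "interior v (hat \<phi>) = (\<lambda>vs. - hat (interior v \<phi>) vs)"
  by (auto simp: interior_def hat_def)

lemma hat_homogeneous: "homogeneous k \<phi> \<Longrightarrow> hat \<phi> = (\<lambda>vs. (-1) ^ k * \<phi> vs)"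
  by (rule ext) (metis hat_def homogeneous_def mult_zero_right)

lemma homogeneous_interior: "homogeneous (Suc k) \<phi> \<Longrightarrow> homogeneous k (interior v \<phi>)"
  by (auto simp: homogeneous_def interior_def)

lemma interior_homogeneous_0: "homogeneous 0 \<phi> \<Longrightarrow> interior v \<phi> = (\<lambda>_. 0)"
  by (auto simp: homogeneous_def interior_def)

lemma wedge_add_left: "wedge (\<lambda>l. a l + b l) c = (\<lambda>l. wedge a c l + wedge b c l)"
  by (auto simp: wedge_def algebra_simps sum.distrib)

lemma wedge_add_right: "wedge c (\<lambda>l. a l + b l) = (\<lambda>l. wedge c a l + wedge c b l)"
  by (auto simp: wedge_def algebra_simps sum.distrib)

lemma wedge_minus_left: "wedge (\<lambda>l. - a l) c = (\<lambda>l. - wedge a c l)"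
  by (auto simp: wedge_def algebra_simps sum_negf)

lemma wedge_minus_right: "wedge c (\<lambda>l. - a l) = (\<lambda>l. - wedge c a l)"
  by (auto simp: wedge_def algebra_simps sum_negf)

lemma wedge_diff_left: "wedge (\<lambda>l. a l - b l) c = (\<lambda>l. wedge a c l - wedge b c l)"
  by (auto simp: wedge_def algebra_simps sum_subtractf)

lemma wedge_diff_right: "wedge c (\<lambda>l. a l - b l) = (\<lambda>l. wedge c a l - wedge c b l)"
  by (auto simp: wedge_def algebra_simps sum_subtractf)

lemma wedge_scale_left: "wedge (\<lambda>l. r * a l) c = (\<lambda>l. r * wedge a c l)"
  by (auto simp: wedge_def algebra_simps sum_distrib_left)

lemma wedge_scale_right: "wedge c (\<lambda>l. r * a l) = (\<lambda>l. r * wedge c a l)"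
  by (auto simp: wedge_def algebra_simps sum_distrib_left)

lemma wedge_zero_left: "wedge (\<lambda>_. 0) c = (\<lambda>_. 0)"
  by (auto simp: wedge_def)

lemma wedge_zero_right: "wedge c (\<lambda>_. 0) = (\<lambda>_. 0)"
  by (auto simp: wedge_def)

lemma wedge_sum_left: "wedge (\<lambda>l. \<Sum>i\<in>S. a i l) c = (\<lambda>l. \<Sum>i\<in>S. wedge (a i) c l)"
  by (induction S rule: infinite_finite_induct) (simp_all add: wedge_zero_left wedge_add_left)

lemma wedge_sum_right: "wedge c (\<lambda>l. \<Sum>i\<in>S. a i l) = (\<lambda>l. \<Sum>i\<in>S. wedge c (a i) l)"
  by (induction S rule: infinite_finite_induct) (simp_all add: wedge_zero_right wedge_add_right)

lemma wedge_Nil [simp]: "wedge a b [] = a [] * b []"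
  by (simp add: wedge_def shuffle_sign_def)

lemma length_nths_subset: "J \<subseteq> {..<length vs} \<Longrightarrow> length (nths vs J) = card J"
  by (auto simp: length_nths intro!: arg_cong[where f=card])

lemma Pow_lessThan_Suc:
  "Pow {..<Suc n} = (\<lambda>J. insert 0 (Suc ` J)) ` Pow {..<n} \<union> (\<lambda>J. Suc ` J) ` Pow {..<n}"
proof -
  have "{..<Suc n} = insert 0 (Suc ` {..<n})"
    by (rule lessThan_Suc_eq_insert_0)
  moreover have "Pow (Suc ` {..<n}) = (\<lambda>J. Suc ` J) ` Pow {..<n}"
    by (simp add: image_Pow_surj)
  ultimately show ?thesis
    by (simp add: Pow_insert image_image Un_commute)
qed

lemma sum_Pow_lessThan_Suc:
  "(\<Sum>I\<in>Pow {..<Suc n}. f I) =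
    (\<Sum>J\<in>Pow {..<n}. f (insert 0 (Suc ` J))) + (\<Sum>J\<in>Pow {..<n}. (f (Suc ` J) :: real))"
proof -
  have i1: "inj_on (\<lambda>J. insert 0 (Suc ` J)) (Pow {..<n})"
    by (auto simp: inj_on_def)
  have i2: "inj_on (\<lambda>J. Suc ` J) (Pow {..<n})"
    by (auto simp: inj_on_def)
  show ?thesis
    unfolding Pow_lessThan_Suc
    by (subst sum.union_disjoint) (auto simp: sum.reindex[OF i1] sum.reindex[OF i2])
qed

lemma nths_insert_0: "nths (v # vs) (insert 0 (Suc ` J)) = v # nths vs J"
  by (simp add: nths_Cons image_iff)

lemma nths_Suc_image: "nths (v # vs) (Suc ` J) = nths vs J"
  by (simp add: nths_Cons image_iff)

lemma shuffle_sign_insert_0: "shuffle_sign (Suc n) (insert 0 (Suc ` J)) = shuffle_sign n J"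
proof -
  have "{(i, j). i \<in> insert 0 (Suc ` J) \<and> j \<in> {..<Suc n} - insert 0 (Suc ` J) \<and> j < i} =
     (\<lambda>(i, j). (Suc i, Suc j)) ` {(i, j). i \<in> J \<and> j \<in> {..<n} - J \<and> j < i}" (is "?A = ?f ` ?B")
  proof (rule set_eqI, clarify)
    fix a b
    show "(a, b) \<in> ?A \<longleftrightarrow> (a, b) \<in> ?f ` ?B"
      by (cases a; cases b) (auto simp: image_iff)
  qed
  moreover have "inj_on ?f ?B" by (auto simp: inj_on_def)
  ultimately show ?thesis by (simp add: shuffle_sign_def card_image)
qed

lemma shuffle_sign_Suc_image:
  assumes "J \<subseteq> {..<n}"
  shows "shuffle_sign (Suc n) (Suc ` J) = (-1) ^ card J * shuffle_sign n J"
proof -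
  let ?A = "{(i, j). i \<in> Suc ` J \<and> j \<in> {..<Suc n} - Suc ` J \<and> j < i}"
  let ?B = "{(i, j). i \<in> J \<and> j \<in> {..<n} - J \<and> j < i}"
  let ?f = "\<lambda>(i, j). (Suc i, Suc j)"
  let ?g = "\<lambda>i. (Suc i, 0::nat)"
  have fin: "finite J" using assms finite_subset by blast
  have "?A = ?f ` ?B \<union> ?g ` J"
  proof (rule set_eqI, clarify)
    fix a b
    show "(a, b) \<in> ?A \<longleftrightarrow> (a, b) \<in> ?f ` ?B \<union> ?g ` J"
      by (cases a; cases b) (auto simp: image_iff)
  qed
  moreover have "finite ?B"
    by (rule finite_subset[of _ "J \<times> {..<n}"]) (auto simp: fin)
  moreover have "inj_on ?f ?B" "inj_on ?g J" by (auto simp: inj_on_def)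
  ultimately have "card ?A = card ?B + card J"
    by (subst \<open>?A = _\<close>, subst card_Un_disjoint) (auto simp: fin card_image)
  then show ?thesis by (simp add: shuffle_sign_def power_add)
qed

text \<open>
  This recursion replaces the combinatorics of shuffles: contraction with a vector is an
  antiderivation.
\<close>

lemma wedge_Cons:
  "wedge a b (v # vs) = wedge (interior v a) b vs + wedge (hat a) (interior v b) vs"
proof -
  let ?n = "length vs"
  have c1: "{..<Suc n} - insert 0 (Suc ` J) = Suc ` ({..<n} - J)" for n J
    by (auto simp: lessThan_Suc_eq_insert_0)
  have c2: "{..<Suc n} - Suc ` J = insert 0 (Suc ` ({..<n} - J))" for n J
    by (auto simp: lessThan_Suc_eq_insert_0)
  have "wedge a b (v # vs) =
    (\<Sum>J\<in>Pow {..<?n}. shuffle_sign ?n J * a (v # nths vs J) * b (nths vs ({..<?n} - J))) +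
    (\<Sum>J\<in>Pow {..<?n}. shuffle_sign (Suc ?n) (Suc ` J) * a (nths vs J) * b (v # nths vs ({..<?n} - J)))"
    unfolding wedge_def length_Cons sum_Pow_lessThan_Suc c1 c2
      nths_insert_0 nths_Suc_image shuffle_sign_insert_0 ..
  also have "(\<Sum>J\<in>Pow {..<?n}. shuffle_sign (Suc ?n) (Suc ` J) * a (nths vs J) * b (v # nths vs ({..<?n} - J)))
    = wedge (hat a) (interior v b) vs"
    unfolding wedge_def
    by (rule sum.cong) (auto simp: hat_def interior_def shuffle_sign_Suc_image length_nths_subset)
  finally show ?thesis by (simp add: wedge_def interior_def)
qed

lemma interior_wedge:
  "interior v (wedge a b) = (\<lambda>l. wedge (interior v a) b l + wedge (hat a) (interior v b) l)"
  by (auto simp: interior_apply wedge_Cons)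

lemma hat_wedge: "hat (wedge a b) = wedge (hat a) (hat b)"
proof
  fix vs show "hat (wedge a b) vs = wedge (hat a) (hat b) vs"
  proof (induction vs arbitrary: a b)
    case (Cons v vs)
    have "hat (wedge a b) (v # vs) = - (hat (wedge (interior v a) b) vs + hat (wedge (hat a) (interior v b)) vs)"
      by (simp add: hat_def wedge_Cons algebra_simps)
    also have "\<dots> = - (wedge (hat (interior v a)) (hat b) vs + wedge (hat (hat a)) (hat (interior v b)) vs)"
      by (simp add: Cons.IH)
    also have "\<dots> = wedge (hat a) (hat b) (v # vs)"
      by (simp add: wedge_Cons interior_hat wedge_minus_left wedge_minus_right)
    finally show ?case .
  qed (simp add: hat_def)
qed

lemma wedge_assoc: "wedge (wedge a b) c = wedge a (wedge b c)"
proof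
  fix vs show "wedge (wedge a b) c vs = wedge a (wedge b c) vs"
    by (induction vs arbitrary: a b c)
      (simp_all add: wedge_Cons interior_wedge hat_wedge wedge_add_left wedge_add_right)
qed

lemma homogeneous_wedge:
  assumes "homogeneous p a" "homogeneous q b"
  shows "homogeneous (p + q) (wedge a b)"
proof -
  have "wedge a b vs = 0" if "length vs \<noteq> p + q" for vs
    using assms that
  proof (induction vs arbitrary: p q a b)
    case Nil
    then show ?case by (auto simp: homogeneous_def)
  next
    case (Cons v vs)
    have "wedge (interior v a) b vs = 0"
    proof (cases p)
      case 0
      then show ?thesis using Cons.prems by (simp add: interior_homogeneous_0 wedge_zero_left)
    next
      case (Suc p')
      then show ?thesis
        using Cons.prems Cons.IH[of p' "interior v a" q b] by (simp add: homogeneous_interior)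
    qed
    moreover have "wedge a (interior v b) vs = 0"
    proof (cases q)
      case 0
      then show ?thesis using Cons.prems by (simp add: interior_homogeneous_0 wedge_zero_right)
    next
      case (Suc q')
      then show ?thesis
        using Cons.prems Cons.IH[of p a q' "interior v b"] by (simp add: homogeneous_interior)
    qed
    ultimately show ?case
      using Cons.prems by (simp add: wedge_Cons hat_homogeneous wedge_scale_left)
  qed
  then show ?thesis by (simp add: homogeneous_def)
qed

lemma wedge_commute:
  assumes "homogeneous p a" "homogeneous q b"
  shows "wedge a b = (\<lambda>vs. (-1) ^ (p * q) * wedge b a vs)"
proof
  fix vs
  show "wedge a b vs = (-1) ^ (p * q) * wedge b a vs"
    using assms
  proof (induction vs arbitrary: p q a b)
    case (Cons v vs)
    have 1: "wedge (interior v a) b vs = (-1) ^ (p * q) * ((-1) ^ q * wedge b (interior v a) vs)"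
    proof (cases p)
      case 0
      then show ?thesis using Cons.prems by (simp add: interior_homogeneous_0 wedge_zero_left wedge_zero_right)
    next
      case (Suc p')
      then have "wedge (interior v a) b vs = (-1) ^ (p' * q) * wedge b (interior v a) vs"
        using Cons.prems by (intro Cons.IH) (auto simp: homogeneous_interior)
      then show ?thesis by (simp add: Suc power_add)
    qed
    have 2: "(-1) ^ p * wedge a (interior v b) vs = (-1) ^ (p * q) * wedge (interior v b) a vs"
    proof (cases q)
      case 0
      then show ?thesis using Cons.prems by (simp add: interior_homogeneous_0 wedge_zero_left wedge_zero_right)
    next
      case (Suc q')
      then have "wedge a (interior v b) vs = (-1) ^ (p * q') * wedge (interior v b) a vs"
        using Cons.prems by (intro Cons.IH) (auto simp: homogeneous_interior)
      then show ?thesis by (simp add: Suc power_add)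
    qed
    show ?case
      using 1 2 Cons.prems
      by (simp add: wedge_Cons hat_homogeneous wedge_scale_left distrib_left)
  next
    case Nil
    then show ?case by (cases "p = 0"; cases "q = 0") (auto simp: homogeneous_def)
  qed
qed

lemma pullback_wedge: "pullback L (wedge a b) = wedge (pullback L a) (pullback L b)"
  by (simp add: pullback_def wedge_def nths_map)

lemma homogeneous_pullback: "homogeneous k a \<Longrightarrow> homogeneous k (pullback L a)"
  by (simp add: homogeneous_def pullback_def)

subsection \<open>Alternating forms\<close>

lemma alternating_linear: "alternating \<phi> \<Longrightarrow> linear (\<lambda>v. \<phi> (xs @ v # ys))"
  unfolding alternating_def
  by (erule conjE, drule spec[of _ "xs @ undefined # ys"], drule spec[of _ "length xs"]) simp

lemma alternating_not_distinct: "alternating \<phi> \<Longrightarrow> \<not> distinct vs \<Longrightarrow> \<phi> vs = 0"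
  by (simp add: alternating_def)

lemma alternating_adjacent: "alternating \<phi> \<Longrightarrow> \<phi> (xs @ v # v # ys) = 0"
  by (rule alternating_not_distinct) auto

lemma
  assumes "alternating \<phi>"
  shows alternating_add: "\<phi> (xs @ (u + v) # ys) = \<phi> (xs @ u # ys) + \<phi> (xs @ v # ys)"
    and alternating_scale: "\<phi> (xs @ (r *\<^sub>R v) # ys) = r * \<phi> (xs @ v # ys)"
    and alternating_zero: "\<phi> (xs @ 0 # ys) = 0"
  using linear_add[OF alternating_linear[OF assms, of xs ys]]
    linear_scale[OF alternating_linear[OF assms, of xs ys]]
    linear_0[OF alternating_linear[OF assms, of xs ys]]
  by simp_all

lemma
  assumes "alternating \<phi>"
  shows alternating_sum: "\<phi> (xs @ (\<Sum>i\<in>S. c i *\<^sub>R w i) # ys) = (\<Sum>i\<in>S. c i * \<phi> (xs @ w i # ys))"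
proof -
  interpret linear "\<lambda>v. \<phi> (xs @ v # ys)" by (rule alternating_linear[OF assms])
  show ?thesis by (simp add: sum scale)
qed

lemma swap_of_adjacent_zero:
  fixes \<phi> :: "'a::real_vector form"
  assumes "\<And>xs ys. linear (\<lambda>v. \<phi> (xs @ v # ys))" and adj: "\<And>xs v ys. \<phi> (xs @ v # v # ys) = 0"
  shows "\<phi> (xs @ u # v # ys) = - \<phi> (xs @ v # u # ys)"
proof -
  have lin1: "\<phi> (xs @ (a + b) # ys) = \<phi> (xs @ a # ys) + \<phi> (xs @ b # ys)" for a b xs ys
    using linear_add[OF assms(1)] by fast
  have lin2: "\<phi> (xs @ x # (a + b) # ys) = \<phi> (xs @ x # a # ys) + \<phi> (xs @ x # b # ys)" for x a b xs ys
    using lin1[of "xs @ [x]"] by simp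
  have "0 = \<phi> (xs @ (u + v) # (u + v) # ys)" by (rule adj[symmetric])
  also have "\<dots> = \<phi> (xs @ u # v # ys) + \<phi> (xs @ v # u # ys)"
    by (simp only: lin1 lin2) (simp add: adj)
  finally show ?thesis by simp
qed

lemma alternatingI:
  fixes \<phi> :: "'a::real_vector form"
  assumes lin: "\<And>xs ys. linear (\<lambda>v. \<phi> (xs @ v # ys))"
    and adj: "\<And>xs v ys. \<phi> (xs @ v # v # ys) = 0"
  shows "alternating \<phi>"
proof -
  have "\<phi> (xs @ y # ys @ y # zs) = 0" for xs y ys zs
  proof (induction ys arbitrary: xs)
    case Nil
    then show ?case by (simp add: adj)
  next
    case (Cons z ys)
    have "\<phi> (xs @ y # z # ys @ y # zs) = - \<phi> ((xs @ [z]) @ y # ys @ y # zs)"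
      using swap_of_adjacent_zero[OF lin adj, of xs y z "ys @ y # zs"] by simp
    then show ?case using Cons.IH[of "xs @ [z]"] by simp
  qed
  then have "\<not> distinct vs \<longrightarrow> \<phi> vs = 0" for vs
    using not_distinct_decomp[of vs] by fastforce
  moreover have "linear (\<lambda>v. \<phi> (vs[i := v]))" if "i < length vs" for vs i
    using lin[of "take i vs" "drop (Suc i) vs"] that by (simp add: upd_conv_take_nth_drop)
  ultimately show ?thesis by (simp add: alternating_def)
qed

lemma alternating_swap:
  assumes "alternating \<phi>"
  shows "\<phi> (xs @ u # v # ys) = - \<phi> (xs @ v # u # ys)"
  by (rule swap_of_adjacent_zero) (auto intro: alternating_linear alternating_adjacent assms)

lemma alternating_move:
  assumes "alternating \<phi>"
  shows "\<phi> (xs @ v # ys) = (-1) ^ length xs * \<phi> (v # xs @ ys)"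
proof (induction xs arbitrary: ys rule: rev_induct)
  case (snoc x xs)
  have "\<phi> ((xs @ [x]) @ v # ys) = - \<phi> (xs @ v # x # ys)"
    using alternating_swap[OF assms, of xs x v ys] by simp
  also have "\<dots> = - ((-1) ^ length xs * \<phi> (v # xs @ x # ys))"
    by (simp only: snoc.IH)
  finally show ?case by simp
qed simp

lemma alternating_interior: "alternating \<phi> \<Longrightarrow> alternating (interior v \<phi>)"
  using alternating_linear[of \<phi> "v # _"] alternating_adjacent[of \<phi> "v # _"]
  by (intro alternatingI) (auto simp: interior_def)

lemma alternating_interior_interior: "alternating \<phi> \<Longrightarrow> interior v (interior v \<phi>) = (\<lambda>_. 0)"
  using alternating_adjacent[of \<phi> "[]"] by (auto simp: interior_def)

lemma alternating_hat: "alternating \<phi> \<Longrightarrow> alternating (hat \<phi>)"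
  by (intro alternatingI)
    (auto simp: hat_def alternating_add alternating_scale alternating_adjacent algebra_simps intro!: linearI)

lemma alternating_lincomb:
  "alternating \<phi> \<Longrightarrow> alternating \<psi> \<Longrightarrow> alternating (\<lambda>vs. a * \<phi> vs + b * \<psi> vs)"
  by (intro alternatingI)
    (auto simp: alternating_add alternating_scale alternating_adjacent algebra_simps intro!: linearI)

lemma alternating_const_zero [simp]: "alternating (\<lambda>_. 0)"
  by (intro alternatingI) (auto intro!: linearI)

lemma alternating_plus: "alternating \<phi> \<Longrightarrow> alternating \<psi> \<Longrightarrow> alternating (\<lambda>vs. \<phi> vs + \<psi> vs)"
  using alternating_lincomb[of \<phi> \<psi> 1 1] by simp

lemma alternating_diff: "alternating \<phi> \<Longrightarrow> alternating \<psi> \<Longrightarrow> alternating (\<lambda>vs. \<phi> vs - \<psi> vs)"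
  using alternating_lincomb[of \<phi> \<psi> 1 "-1"] by simp

lemma alternating_scaled: "alternating \<phi> \<Longrightarrow> alternating (\<lambda>vs. a * \<phi> vs)"
  using alternating_lincomb[of \<phi> \<phi> a 0] by simp

lemma alternating_sum_forms:
  "(\<And>i. i \<in> S \<Longrightarrow> alternating (a i)) \<Longrightarrow> alternating (\<lambda>vs. \<Sum>i\<in>S. a i vs)"
  by (induction S rule: infinite_finite_induct) (auto intro: alternating_plus)

lemma alternating_pullback:
  assumes "linear L" "alternating \<phi>"
  shows "alternating (pullback L \<phi>)"
  by (intro alternatingI linearI)
    (simp_all add: pullback_def linear_add[OF assms(1)] linear_scale[OF assms(1)] assms(2)
      alternating_add alternating_scale alternating_adjacent)

lemma interior_add_vec: "alternating a \<Longrightarrow> interior (u + v) a = (\<lambda>l. interior u a l + interior v a l)"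
  using alternating_add[of a "[]"] by (auto simp: interior_def)

lemma interior_scale_vec: "alternating a \<Longrightarrow> interior (r *\<^sub>R v) a = (\<lambda>l. r * interior v a l)"
  using alternating_scale[of a "[]"] by (auto simp: interior_def)

lemma alternating_wedge:
  assumes "alternating a" "alternating b"
  shows "alternating (wedge a b)"
proof -
  have "(\<forall>u v. wedge a b (xs @ (u + v) # ys) = wedge a b (xs @ u # ys) + wedge a b (xs @ v # ys)) \<and>
    (\<forall>r v. wedge a b (xs @ (r *\<^sub>R v) # ys) = r * wedge a b (xs @ v # ys)) \<and>
    (\<forall>v. wedge a b (xs @ v # v # ys) = 0)" for xs ys
    using assms
  proof (induction xs arbitrary: a b)
    case Nil
    have "wedge a b (v # v # ys) = 0" for v
      using Nil
      by (simp add: wedge_Cons interior_wedge interior_hat alternating_interior_interior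
          wedge_zero_left wedge_zero_right wedge_minus_left wedge_minus_right)
    then show ?case
      using Nil
      by (simp add: wedge_Cons interior_add_vec interior_scale_vec wedge_add_left wedge_add_right
          wedge_scale_left wedge_scale_right distrib_left)
  next
    case (Cons x xs)
    show ?case
      using Cons.IH[OF alternating_interior[OF Cons.prems(1)] Cons.prems(2)]
        Cons.IH[OF alternating_hat[OF Cons.prems(1)] alternating_interior[OF Cons.prems(2)]]
      by (simp add: wedge_Cons algebra_simps)
  qed
  then show ?thesis by (intro alternatingI linearI) auto
qed

lemma alternating_eq_zero_on_span:
  assumes alt: "alternating \<phi>"
    and zero: "\<And>is. set is \<subseteq> {..<length e} \<Longrightarrow> distinct is \<Longrightarrow> \<phi> (map ((!) e) is) = 0"
    and vs: "set vs \<subseteq> span (set e)"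
  shows "\<phi> vs = 0"
proof -
  have zero': "\<phi> (map ((!) e) is) = 0" if "set is \<subseteq> {..<length e}" for "is"
    using zero[OF that] alternating_not_distinct[OF alt, of "map ((!) e) is"]
    by (cases "distinct is") (auto simp: distinct_map)
  have "\<phi> (map ((!) e) is @ vs) = 0" if "set is \<subseteq> {..<length e}" for "is"
    using that vs
  proof (induction vs arbitrary: "is")
    case Nil
    then show ?case by (simp add: zero')
  next
    case (Cons v vs)
    have "\<phi> (map ((!) e) is @ w # vs) = 0" if w: "w \<in> set e" for w
    proof -
      obtain i where "i < length e" "e ! i = w" using w by (metis in_set_conv_nth)
      then show ?thesis using Cons.IH[of "is @ [i]"] Cons.prems by auto
    qed
    then show ?case
      using linear_eq_0_on_span[OF alternating_linear[OF alt], of "set e" "map ((!) e) is" vs v] Cons.prems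
      by auto
  qed
  from this[of "[]"] show ?thesis by simp
qed

primrec psign :: "nat list \<Rightarrow> real" where
  "psign [] = 1"
| "psign (x # xs) = (if x \<in> set xs then 0 else (-1) ^ length (filter (\<lambda>y. y < x) xs) * psign xs)"

lemma alternating_insort:
  assumes "alternating \<phi>" "sorted ys" "x \<notin> set ys"
  shows "\<phi> (map f (x # ys)) = (-1) ^ length (filter (\<lambda>y. y < x) ys) * \<phi> (map f (insort x ys))"
  using assms
proof (induction ys arbitrary: \<phi>)
  case (Cons y ys)
  show ?case
  proof (cases "x \<le> y")
    case True
    then have "filter (\<lambda>z. z < x) (y # ys) = []" using Cons.prems by (auto simp: filter_empty_conv)
    then show ?thesis using True by simp
  next
    case False
    have "\<phi> (map f (x # y # ys)) = - interior (f y) \<phi> (map f (x # ys))"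
      using alternating_swap[OF Cons.prems(1), of "[]" "f x" "f y" "map f ys"] by (simp add: interior_def)
    also have "\<dots> = - ((-1) ^ length (filter (\<lambda>z. z < x) ys) * interior (f y) \<phi> (map f (insort x ys)))"
      using Cons.prems by (subst Cons.IH) (auto intro: alternating_interior)
    finally show ?thesis using False by (simp add: interior_def)
  qed
qed simp

lemma alternating_sort:
  assumes "alternating \<phi>"
  shows "\<phi> (map f is) = psign is * \<phi> (map f (sort is))"
  using assms
proof (induction "is" arbitrary: \<phi>)
  case (Cons x xs)
  show ?case
  proof (cases "x \<in> set xs")
    case True
    then have "\<not> distinct (map f (x # xs))" by auto
    then show ?thesis using True alternating_not_distinct[OF Cons.prems] by simp
  next
    case False
    have "\<phi> (map f (x # xs)) = interior (f x) \<phi> (map f xs)" by (simp add: interior_def)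
    also have "\<dots> = psign xs * \<phi> (map f (x # sort xs))"
      using Cons.IH[OF alternating_interior[OF Cons.prems, of "f x"]] by (simp add: interior_def)
    also have "\<phi> (map f (x # sort xs)) =
        (-1) ^ length (filter (\<lambda>y. y < x) (sort xs)) * \<phi> (map f (insort x (sort xs)))"
      using False by (intro alternating_insort Cons.prems) auto
    also have "length (filter (\<lambda>y. y < x) (sort xs)) = length (filter (\<lambda>y. y < x) xs)"
      by (metis mset_filter mset_sort size_mset)
    finally show ?thesis using False by simp
  qed
qed simp

subsection \<open>Evaluation of wedge products\<close>

text \<open>
  \<open>shuf a b p xs ys vs\<close> sums over the shuffles that give \<open>p\<close> of the vectors \<open>vs\<close> to the first
  factor, whose first arguments are already \<open>xs\<close>, and the others to the second one.
\<close>

primrec shuf :: "'a form \<Rightarrow> 'a form \<Rightarrow> nat \<Rightarrow> 'a list \<Rightarrow> 'a list \<Rightarrow> 'a list \<Rightarrow> real" where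
  "shuf a b p xs ys [] = (if p = 0 then a xs * b ys else 0)"
| "shuf a b p xs ys (v # vs) =
    (if p > length (v # vs) then 0
     else (if p = 0 then 0 else shuf a b (p - 1) (xs @ [v]) ys vs) + (-1) ^ p * shuf a b p xs (ys @ [v]) vs)"

lemma shuf_eq_0: "p > length vs \<Longrightarrow> shuf a b p xs ys vs = 0"
  by (cases vs) auto

lemma wedge_eq_shuf_aux:
  assumes "homogeneous (length xs + p) a"
  shows "wedge (\<lambda>l. a (xs @ l)) (\<lambda>l. b (ys @ l)) vs = shuf a b p xs ys vs"
  using assms
proof (induction vs arbitrary: p xs ys)
  case Nil
  then show ?case by (auto simp: homogeneous_def)
next
  case (Cons v vs)
  have hat: "hat (\<lambda>l. a (xs @ l)) = (\<lambda>l. (-1) ^ p * a (xs @ l))"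
  proof
    fix l show "hat (\<lambda>l. a (xs @ l)) l = (-1) ^ p * a (xs @ l)"
      using Cons.prems by (cases "length l = p") (auto simp: hat_def homogeneous_def)
  qed
  have i: "interior v (\<lambda>l. a (xs @ l)) = (\<lambda>l. a ((xs @ [v]) @ l))"
    "interior v (\<lambda>l. b (ys @ l)) = (\<lambda>l. b ((ys @ [v]) @ l))" by (auto simp: interior_def)
  have 1: "wedge (\<lambda>l. a ((xs @ [v]) @ l)) (\<lambda>l. b (ys @ l)) vs =
    (if p = 0 then 0 else shuf a b (p - 1) (xs @ [v]) ys vs)"
  proof (cases p)
    case 0
    then have "(\<lambda>l. a ((xs @ [v]) @ l)) = (\<lambda>_. 0)" using Cons.prems by (auto simp: homogeneous_def)
    then show ?thesis using 0 by (simp only: wedge_zero_left) simp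
  next
    case (Suc p')
    then show ?thesis using Cons.prems by (subst Cons.IH[of _ p']) auto
  qed
  have 2: "wedge (\<lambda>l. a (xs @ l)) (\<lambda>l. b ((ys @ [v]) @ l)) vs = shuf a b p xs (ys @ [v]) vs"
    using Cons by blast
  show ?case
    unfolding wedge_Cons hat i wedge_scale_left 1 2 shuf.simps(2)
    by (auto simp: shuf_eq_0)
qed

lemma wedge_eq_shuf: "homogeneous p a \<Longrightarrow> wedge a b vs = shuf a b p [] [] vs"
  using wedge_eq_shuf_aux[of "[]" p a b "[]" vs] by simp

section \<open>Smooth functions\<close>

lemma has_derivative_frechet:
  "f differentiable (at x) \<Longrightarrow> (f has_derivative frechet_derivative f (at x)) (at x)"
  by (simp add: frechet_derivative_works[symmetric])

lemma frechet_derivative_eq: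
  "(f has_derivative f') (at x) \<Longrightarrow> frechet_derivative f (at x) = f'"
  by (rule frechet_derivative_at[symmetric])

lemma frechet_derivative_cong_open:
  assumes "open U" "x \<in> U" "\<And>y. y \<in> U \<Longrightarrow> f y = g y"
  shows "frechet_derivative f (at x) = frechet_derivative g (at x)"
proof -
  have "(f has_derivative f') (at x) \<longleftrightarrow> (g has_derivative f') (at x)" for f'
    using has_derivative_transform_within_open[of f f' x UNIV U g]
      has_derivative_transform_within_open[of g f' x UNIV U f] assms by auto
  then show ?thesis by (simp add: frechet_derivative_def)
qed

lemma differentiable_cong_open:
  assumes "open U" "x \<in> U" "\<And>y. y \<in> U \<Longrightarrow> f y = g y" "f differentiable (at x)"
  shows "g differentiable (at x)"
  using assms has_derivative_transform_within_open[of f _ x UNIV U g]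
  unfolding differentiable_def by blast

lemma Ck_on_imp_continuous_on: "Ck_on k U f \<Longrightarrow> continuous_on U f"
  by (cases k) (auto intro!: continuous_at_imp_continuous_on differentiable_imp_continuous_within)

lemma Ck_on_SucD: "Ck_on (Suc k) U f \<Longrightarrow> Ck_on k U f"
proof (induction k arbitrary: f)
  case 0
  then show ?case using Ck_on_imp_continuous_on[of "Suc 0"] by simp
next
  case (Suc k)
  from Suc.prems have "\<forall>x\<in>U. f differentiable (at x)"
    "\<And>v. Ck_on (Suc k) U (\<lambda>x. frechet_derivative f (at x) v)"
    by (subst (asm) Ck_on.simps(2), blast)+
  then show ?case using Suc.IH by simp
qed

lemma Ck_on_cong:
  assumes "open U" "Ck_on k U f" "\<And>x. x \<in> U \<Longrightarrow> f x = g x"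
  shows "Ck_on k U g"
  using assms(2,3)
proof (induction k arbitrary: f g)
  case 0
  then show ?case using continuous_on_cong[of U U f g] by simp
next
  case (Suc k)
  have "g differentiable (at x)" if "x \<in> U" for x
    using differentiable_cong_open[OF assms(1) that, of f g] Suc.prems that by simp
  moreover have "Ck_on k U (\<lambda>x. frechet_derivative g (at x) v)" for v
    by (rule Suc.IH[of "\<lambda>x. frechet_derivative f (at x) v"])
      (use Suc.prems frechet_derivative_cong_open[OF assms(1), of _ f g] in auto)
  ultimately show ?case by simp
qed

lemma Ck_on_SucI:
  assumes "open U" "\<And>x. x \<in> U \<Longrightarrow> (f has_derivative f' x) (at x)"
    "\<And>v. Ck_on k U (\<lambda>x. f' x v)"
  shows "Ck_on (Suc k) U f"
proof -
  have "Ck_on k U (\<lambda>x. frechet_derivative f (at x) v)" for v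
    using Ck_on_cong[OF assms(1,3), of v "\<lambda>x. frechet_derivative f (at x) v"]
      frechet_derivative_eq[OF assms(2)] by simp
  then show ?thesis using assms(2) by (auto simp: differentiable_def)
qed

lemma Ck_on_Suc_has_derivative:
  "Ck_on (Suc k) U f \<Longrightarrow> x \<in> U \<Longrightarrow> (f has_derivative frechet_derivative f (at x)) (at x)"
  by (auto intro: has_derivative_frechet)

lemma Ck_on_const: "Ck_on k U (\<lambda>x. c)"
  by (induction k arbitrary: c) auto

lemma Ck_on_add:
  assumes "open U"
  shows "Ck_on k U f \<Longrightarrow> Ck_on k U g \<Longrightarrow> Ck_on k U (\<lambda>x. f x + g x)"
proof (induction k arbitrary: f g)
  case (Suc k)
  show ?case
    by (rule Ck_on_SucI[OF assms, where f' = "\<lambda>x v. frechet_derivative f (at x) v + frechet_derivative g (at x) v"])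
      (use Suc in \<open>auto intro!: has_derivative_add has_derivative_frechet\<close>)
qed (auto intro: continuous_on_add)

lemma Ck_on_mult:
  assumes "open U"
  shows "Ck_on k U f \<Longrightarrow> Ck_on k U g \<Longrightarrow> Ck_on k U (\<lambda>x. f x * g x)"
proof (induction k arbitrary: f g)
  case (Suc k)
  show ?case
  proof (rule Ck_on_SucI[OF assms])
    show "((\<lambda>x. f x * g x) has_derivative
      (\<lambda>v. f x * frechet_derivative g (at x) v + frechet_derivative f (at x) v * g x)) (at x)"
      if "x \<in> U" for x
      using that Suc.prems by (intro has_derivative_mult) (auto intro!: has_derivative_frechet)
    show "Ck_on k U (\<lambda>x. f x * frechet_derivative g (at x) v + frechet_derivative f (at x) v * g x)" for v
      using Suc.prems Ck_on_SucD[of k U] by (intro Ck_on_add[OF assms] Suc.IH) auto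
  qed
qed (auto intro: continuous_on_mult)

lemma Ck_on_sum:
  assumes "open U" "\<And>i. i \<in> S \<Longrightarrow> Ck_on k U (f i)"
  shows "Ck_on k U (\<lambda>x. \<Sum>i\<in>S. f i x)"
  using assms(2)
  by (induction S rule: infinite_finite_induct) (auto intro: Ck_on_const Ck_on_add[OF assms(1)])

lemma Ck_on_prod:
  assumes "open U" "\<And>i. i \<in> S \<Longrightarrow> Ck_on k U (f i)"
  shows "Ck_on k U (\<lambda>x. \<Prod>i\<in>S. f i x)"
  using assms(2)
  by (induction S rule: infinite_finite_induct) (auto intro: Ck_on_const Ck_on_mult[OF assms(1)])

lemma Ck_on_linear:
  assumes "open U" "bounded_linear f"
  shows "Ck_on k U f"
proof (cases k)
  case 0
  then show ?thesis using assms(2) by (simp add: linear_continuous_on)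
next
  case (Suc k')
  show ?thesis unfolding Suc
    by (rule Ck_on_SucI[OF assms(1), where f' = "\<lambda>x. f"])
      (auto intro: bounded_linear_imp_has_derivative assms Ck_on_const)
qed

lemma Ck_on_inverse:
  assumes "open U" "\<And>x. x \<in> U \<Longrightarrow> f x \<noteq> 0"
  shows "Ck_on k U f \<Longrightarrow> Ck_on k U (\<lambda>x. inverse (f x))"
proof (induction k)
  case 0
  then show ?case using assms by (auto intro!: continuous_on_inverse)
next
  case (Suc k)
  show ?case
  proof (rule Ck_on_SucI[OF assms(1)])
    show "((\<lambda>x. inverse (f x)) has_derivative
      (\<lambda>v. (-1) * (inverse (f x) * (frechet_derivative f (at x) v * inverse (f x))))) (at x)"
      if "x \<in> U" for x
      using Deriv.has_derivative_inverse[OF assms(2)[OF that] Ck_on_Suc_has_derivative[OF Suc.prems that]]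
      by (simp add: mult.assoc)
    show "Ck_on k U (\<lambda>x. (-1) * (inverse (f x) * (frechet_derivative f (at x) v * inverse (f x))))" for v
      using Suc.IH Suc.prems Ck_on_SucD[OF Suc.prems] by (intro Ck_on_mult Ck_on_const assms(1)) auto
  qed
qed

lemma Ck_on_power: "open U \<Longrightarrow> Ck_on k U f \<Longrightarrow> Ck_on k U (\<lambda>x. f x ^ n)"
  by (induction n) (auto intro: Ck_on_const Ck_on_mult)

lemma Ck_on_root:
  assumes "open U" "\<And>x. x \<in> U \<Longrightarrow> f x \<noteq> 0" "odd n"
  shows "Ck_on k U f \<Longrightarrow> Ck_on k U (\<lambda>x. root n (f x))"
proof (induction k)
  case 0
  then show ?case by (auto intro!: continuous_on_real_root)
next
  case (Suc k)
  have n: "n > 0" using assms(3) by (rule odd_pos)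
  show ?case
  proof (rule Ck_on_SucI[OF assms(1)])
    show "((\<lambda>x. root n (f x)) has_derivative
      (\<lambda>v. frechet_derivative f (at x) v * inverse (real n * root n (f x) ^ (n - Suc 0)))) (at x)"
      if "x \<in> U" for x
      by (rule DERIV_compose_FDERIV[where f = "root n" and g = f,
          OF DERIV_odd_real_root[OF assms(3) assms(2)[OF that]] Ck_on_Suc_has_derivative[OF Suc.prems that]])
    have nz: "real n * root n (f x) ^ (n - Suc 0) \<noteq> 0" if "x \<in> U" for x
      using assms(2)[OF that] n by simp
    show "Ck_on k U (\<lambda>x. frechet_derivative f (at x) v * inverse (real n * root n (f x) ^ (n - Suc 0)))" for v
      using Suc.IH Suc.prems Ck_on_SucD[OF Suc.prems] nz
      by (intro Ck_on_mult Ck_on_const assms(1) Ck_on_inverse Ck_on_power) auto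
  qed
qed

lemma Ck_on_compose_affine:
  assumes "open U" "open V" "h ` V \<subseteq> U" "\<And>x. x \<in> V \<Longrightarrow> (h has_derivative L) (at x)"
  shows "Ck_on k U f \<Longrightarrow> Ck_on k V (\<lambda>x. f (h x))"
proof (induction k arbitrary: f)
  case 0
  have "continuous_on V h"
    using assms(4) has_derivative_continuous by (intro continuous_at_imp_continuous_on) blast
  then show ?case using 0 assms(3) by (auto intro: continuous_on_compose2)
next
  case (Suc k)
  show ?case
  proof (rule Ck_on_SucI[OF assms(2)])
    show "((\<lambda>x. f (h x)) has_derivative (\<lambda>v. frechet_derivative f (at (h x)) (L v))) (at x)"
      if "x \<in> V" for x
      using diff_chain_at[OF assms(4)[OF that] Ck_on_Suc_has_derivative[OF Suc.prems]] that assms(3)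
      by (auto simp: o_def)
    show "Ck_on k V (\<lambda>x. frechet_derivative f (at (h x)) (L v))" for v
      using Suc.IH[of "\<lambda>y. frechet_derivative f (at y) (L v)"] Suc.prems by simp
  qed
qed

lemma smooth_on_const: "smooth_on U (\<lambda>x. c)"
  by (simp add: smooth_on_def Ck_on_const)

lemma smooth_on_cong: "open U \<Longrightarrow> smooth_on U f \<Longrightarrow> (\<And>x. x \<in> U \<Longrightarrow> f x = g x) \<Longrightarrow> smooth_on U g"
  unfolding smooth_on_def using Ck_on_cong by blast

lemma smooth_on_add: "open U \<Longrightarrow> smooth_on U f \<Longrightarrow> smooth_on U g \<Longrightarrow> smooth_on U (\<lambda>x. f x + g x)"
  by (simp add: smooth_on_def Ck_on_add)

lemma smooth_on_mult: "open U \<Longrightarrow> smooth_on U f \<Longrightarrow> smooth_on U g \<Longrightarrow> smooth_on U (\<lambda>x. f x * g x)"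
  by (simp add: smooth_on_def Ck_on_mult)

lemma smooth_on_sum:
  "open U \<Longrightarrow> (\<And>i. i \<in> S \<Longrightarrow> smooth_on U (f i)) \<Longrightarrow> smooth_on U (\<lambda>x. \<Sum>i\<in>S. f i x)"
  by (simp add: smooth_on_def Ck_on_sum)

lemma smooth_on_prod:
  "open U \<Longrightarrow> (\<And>i. i \<in> S \<Longrightarrow> smooth_on U (f i)) \<Longrightarrow> smooth_on U (\<lambda>x. \<Prod>i\<in>S. f i x)"
  by (simp add: smooth_on_def Ck_on_prod)

lemma smooth_on_linear:
  fixes f :: "'a::euclidean_space \<Rightarrow> real"
  shows "open U \<Longrightarrow> linear f \<Longrightarrow> smooth_on U f"
  by (simp add: smooth_on_def Ck_on_linear linear_conv_bounded_linear)

lemma smooth_on_inverse: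
  "open U \<Longrightarrow> (\<And>x. x \<in> U \<Longrightarrow> f x \<noteq> 0) \<Longrightarrow> smooth_on U f \<Longrightarrow> smooth_on U (\<lambda>x. inverse (f x))"
  by (simp add: smooth_on_def Ck_on_inverse)

lemma smooth_on_root:
  "open U \<Longrightarrow> (\<And>x. x \<in> U \<Longrightarrow> f x \<noteq> 0) \<Longrightarrow> odd n \<Longrightarrow> smooth_on U f \<Longrightarrow> smooth_on U (\<lambda>x. root n (f x))"
  by (simp add: smooth_on_def Ck_on_root)

lemma smooth_on_compose_affine:
  assumes "open U" "open V" "h ` V \<subseteq> U" "\<And>x. x \<in> V \<Longrightarrow> (h has_derivative L) (at x)" "smooth_on U f"
  shows "smooth_on V (\<lambda>x. f (h x))"
  using Ck_on_compose_affine[OF assms(1-4)] assms(5) by (simp add: smooth_on_def)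

lemma smooth_on_differentiable: "smooth_on U f \<Longrightarrow> x \<in> U \<Longrightarrow> f differentiable (at x)"
  unfolding smooth_on_def by (drule spec[of _ "Suc 0"]) auto

lemma smooth_on_has_derivative:
  "smooth_on U f \<Longrightarrow> x \<in> U \<Longrightarrow> (f has_derivative frechet_derivative f (at x)) (at x)"
  by (simp add: has_derivative_frechet smooth_on_differentiable)

lemma smooth_on_continuous_on: "smooth_on U f \<Longrightarrow> continuous_on U f"
  unfolding smooth_on_def by (drule spec[of _ 0]) auto

lemma smooth_on_frechet: "smooth_on U f \<Longrightarrow> smooth_on U (\<lambda>x. frechet_derivative f (at x) v)"
  unfolding smooth_on_def
proof
  fix k assume "\<forall>k. Ck_on k U f"
  then have "Ck_on (Suc k) U f" by blast
  then show "Ck_on k U (\<lambda>x. frechet_derivative f (at x) v)" by simp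
qed

subsection \<open>Symmetry of second derivatives\<close>

lemma DERIV_line:
  fixes f :: "'a::real_normed_vector \<Rightarrow> real"
  assumes "f differentiable (at (a + t *\<^sub>R v))"
  shows "((\<lambda>t. f (a + t *\<^sub>R v)) has_real_derivative frechet_derivative f (at (a + t *\<^sub>R v)) v) (at t)"
proof -
  have 1: "((\<lambda>t. a + t *\<^sub>R v) has_derivative (\<lambda>r. r *\<^sub>R v)) (at t)"
    by (auto intro!: derivative_eq_intros)
  have 2: "linear (frechet_derivative f (at (a + t *\<^sub>R v)))"
    by (rule linear_frechet_derivative[OF assms])
  show ?thesis
    using diff_chain_at[OF 1 has_derivative_frechet[OF assms]]
    by (simp add: has_field_derivative_def o_def linear_scale[OF 2] mult.commute[of _ "frechet_derivative _ _ _"])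
qed

lemma second_difference:
  fixes f :: "'a::euclidean_space \<Rightarrow> real"
  assumes C: "Ck_on (Suc (Suc 0)) U f" and h: "h > 0"
    and in_U: "\<And>s t. s \<in> {0..h} \<Longrightarrow> t \<in> {0..h} \<Longrightarrow> x + s *\<^sub>R v + t *\<^sub>R w \<in> U"
  shows "\<exists>s\<in>{0..h}. \<exists>t\<in>{0..h}. f (x + h *\<^sub>R v + h *\<^sub>R w) - f (x + h *\<^sub>R v) - f (x + h *\<^sub>R w) + f x =
    h * h * frechet_derivative (\<lambda>y. frechet_derivative f (at y) v) (at (x + s *\<^sub>R v + t *\<^sub>R w)) w"
proof -
  let ?D = "\<lambda>y. frechet_derivative f (at y) v"
  have d1: "f differentiable (at y)" if "y \<in> U" for y using C that by simp
  have d2: "?D differentiable (at y)" if "y \<in> U" for y using C that by simp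
  let ?g = "\<lambda>t. f (x + h *\<^sub>R w + t *\<^sub>R v) - f (x + t *\<^sub>R v)"
  have dg: "DERIV ?g t :> ?D (x + h *\<^sub>R w + t *\<^sub>R v) - ?D (x + t *\<^sub>R v)" if "0 \<le> t" "t \<le> h" for t
    using in_U[of t h] in_U[of t 0] that h
    by (intro DERIV_diff DERIV_line d1) (auto simp: algebra_simps)
  then obtain s where s: "0 < s" "s < h"
    "?g h - ?g 0 = (h - 0) * (?D (x + h *\<^sub>R w + s *\<^sub>R v) - ?D (x + s *\<^sub>R v))"
    using MVT2[of 0 h ?g "\<lambda>t. ?D (x + h *\<^sub>R w + t *\<^sub>R v) - ?D (x + t *\<^sub>R v)", OF h dg] by blast
  let ?k = "\<lambda>t. ?D (x + s *\<^sub>R v + t *\<^sub>R w)"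
  have dk: "DERIV ?k t :> frechet_derivative ?D (at (x + s *\<^sub>R v + t *\<^sub>R w)) w" if "0 \<le> t" "t \<le> h" for t
    using in_U[of s t] that s by (intro DERIV_line d2) auto
  then obtain t where t: "0 < t" "t < h"
    "?k h - ?k 0 = (h - 0) * frechet_derivative ?D (at (x + s *\<^sub>R v + t *\<^sub>R w)) w"
    using MVT2[of 0 h ?k "\<lambda>t. frechet_derivative ?D (at (x + s *\<^sub>R v + t *\<^sub>R w)) w", OF h dk] by blast
  have "f (x + h *\<^sub>R v + h *\<^sub>R w) - f (x + h *\<^sub>R v) - f (x + h *\<^sub>R w) + f x = ?g h - ?g 0"
    by (simp add: algebra_simps)
  also have "\<dots> = h * (?k h - ?k 0)"
    unfolding s(3) by (simp add: algebra_simps)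
  finally show ?thesis
    unfolding t(3) using s t by (intro bexI[of _ s] bexI[of _ t]) auto
qed

lemma frechet_derivative_commute:
  fixes f :: "'a::euclidean_space \<Rightarrow> real"
  assumes U: "open U" "x \<in> U" and C: "Ck_on (Suc (Suc 0)) U f"
  shows "frechet_derivative (\<lambda>y. frechet_derivative f (at y) v) (at x) w =
    frechet_derivative (\<lambda>y. frechet_derivative f (at y) w) (at x) v"
proof (rule ccontr)
  let ?P = "\<lambda>y. frechet_derivative (\<lambda>y. frechet_derivative f (at y) v) (at y) w"
  let ?Q = "\<lambda>y. frechet_derivative (\<lambda>y. frechet_derivative f (at y) w) (at y) v"
  assume neq: "?P x \<noteq> ?Q x"
  define e where "e = \<bar>?P x - ?Q x\<bar> / 2"
  have e: "e > 0" using neq by (simp add: e_def)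
  have "continuous_on U ?P" "continuous_on U ?Q" using C by simp_all
  then have "isCont ?P x" "isCont ?Q x"
    using U continuous_on_eq_continuous_at by blast+
  then obtain d1 d2 where d1: "d1 > 0" "\<And>y. dist y x < d1 \<Longrightarrow> dist (?P y) (?P x) < e"
    and d2: "d2 > 0" "\<And>y. dist y x < d2 \<Longrightarrow> dist (?Q y) (?Q x) < e"
    using e unfolding continuous_at_eps_delta by metis
  obtain d3 where d3: "d3 > 0" "ball x d3 \<subseteq> U" using U open_contains_ball by blast
  define d where "d = min d1 (min d2 d3)"
  define h where "h = d / (2 * (norm v + norm w + 1))"
  have d: "d > 0" using d1 d2 d3 by (simp add: d_def)
  have n: "norm v + norm w + 1 > 0" by (simp add: add_nonneg_pos)
  have h: "h > 0" using d n by (simp add: h_def)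
  have close: "dist (x + s *\<^sub>R v + t *\<^sub>R w) x < d" "dist (x + t *\<^sub>R w + s *\<^sub>R v) x < d"
    if "s \<in> {0..h}" "t \<in> {0..h}" for s t
  proof -
    have "norm (s *\<^sub>R v + t *\<^sub>R w) \<le> s * norm v + t * norm w"
      using norm_triangle_ineq[of "s *\<^sub>R v" "t *\<^sub>R w"] that by simp
    also have "\<dots> \<le> h * norm v + h * norm w" using that by (intro add_mono mult_right_mono) auto
    also have "\<dots> \<le> h * (norm v + norm w + 1)" using h by (simp add: algebra_simps)
    also have "\<dots> = d / 2" using n by (simp add: h_def field_simps)
    also have "\<dots> < d" using d by simp
    finally show "dist (x + s *\<^sub>R v + t *\<^sub>R w) x < d" by (simp add: dist_norm)
    then show "dist (x + t *\<^sub>R w + s *\<^sub>R v) x < d" by (simp add: add.commute add.left_commute add.assoc)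
  qed
  have inU: "x + s *\<^sub>R v + t *\<^sub>R w \<in> U" "x + t *\<^sub>R w + s *\<^sub>R v \<in> U"
    if "s \<in> {0..h}" "t \<in> {0..h}" for s t
    using close[OF that] d3(2) by (auto simp: d_def dist_commute)
  obtain s t where st: "s \<in> {0..h}" "t \<in> {0..h}"
    "f (x + h *\<^sub>R v + h *\<^sub>R w) - f (x + h *\<^sub>R v) - f (x + h *\<^sub>R w) + f x = h * h * ?P (x + s *\<^sub>R v + t *\<^sub>R w)"
    using second_difference[OF C h, of x v w] inU by blast
  obtain s' t' where st': "s' \<in> {0..h}" "t' \<in> {0..h}"
    "f (x + h *\<^sub>R w + h *\<^sub>R v) - f (x + h *\<^sub>R w) - f (x + h *\<^sub>R v) + f x = h * h * ?Q (x + s' *\<^sub>R w + t' *\<^sub>R v)"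
    using second_difference[OF C h, of x w v] inU by blast
  have "f (x + h *\<^sub>R w + h *\<^sub>R v) = f (x + h *\<^sub>R v + h *\<^sub>R w)" by (simp add: algebra_simps)
  then have "h * h * ?P (x + s *\<^sub>R v + t *\<^sub>R w) = h * h * ?Q (x + s' *\<^sub>R w + t' *\<^sub>R v)"
    using st(3) st'(3) by linarith
  then have "?P (x + s *\<^sub>R v + t *\<^sub>R w) = ?Q (x + s' *\<^sub>R w + t' *\<^sub>R v)" using h by simp
  moreover have "dist (?P (x + s *\<^sub>R v + t *\<^sub>R w)) (?P x) < e"
    using d1(2) close(1)[OF st(1,2)] by (simp add: d_def)
  moreover have "dist (?Q (x + s' *\<^sub>R w + t' *\<^sub>R v)) (?Q x) < e"
    using d2(2) close(2)[OF st'(2,1)] by (simp add: d_def)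
  ultimately show False unfolding dist_real_def e_def by (simp add: abs_if field_simps split: if_splits)
qed

section \<open>Differential forms\<close>

definition dir_deriv :: "'a::euclidean_space \<Rightarrow> 'a dform \<Rightarrow> 'a dform" where
  "dir_deriv h \<alpha> = (\<lambda>x vs. frechet_derivative (\<lambda>y. \<alpha> y vs) (at x) h)"

lemma diff_form_alternating: "diff_form U \<alpha> \<Longrightarrow> x \<in> U \<Longrightarrow> alternating (\<alpha> x)"
  by (simp add: diff_form_def)

lemma diff_form_smooth: "diff_form U \<alpha> \<Longrightarrow> smooth_on U (\<lambda>x. \<alpha> x vs)"
  by (simp add: diff_form_def)

lemma diff_form_has_derivative:
  "diff_form U \<alpha> \<Longrightarrow> x \<in> U \<Longrightarrow> ((\<lambda>y. \<alpha> y vs) has_derivative (\<lambda>h. dir_deriv h \<alpha> x vs)) (at x)"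
  unfolding dir_deriv_def by (rule smooth_on_has_derivative[OF diff_form_smooth])

lemma dir_deriv_eq:
  "((\<lambda>y. \<alpha> y vs) has_derivative f') (at x) \<Longrightarrow> dir_deriv h \<alpha> x vs = f' h"
  unfolding dir_deriv_def by (simp add: frechet_derivative_eq)

lemma dir_deriv_cong:
  "open U \<Longrightarrow> x \<in> U \<Longrightarrow> (\<And>y. y \<in> U \<Longrightarrow> \<alpha> y vs = \<beta> y vs) \<Longrightarrow> dir_deriv h \<alpha> x vs = dir_deriv h \<beta> x vs"
  unfolding dir_deriv_def
  using frechet_derivative_cong_open[of U x "\<lambda>y. \<alpha> y vs" "\<lambda>y. \<beta> y vs"] by simp

lemma linear_dir_deriv: "diff_form U \<alpha> \<Longrightarrow> x \<in> U \<Longrightarrow> linear (\<lambda>h. dir_deriv h \<alpha> x vs)"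
  by (rule has_derivative_linear[OF diff_form_has_derivative])

lemma diff_form_cong:
  "open U \<Longrightarrow> diff_form U \<alpha> \<Longrightarrow> (\<And>x. x \<in> U \<Longrightarrow> \<beta> x = \<alpha> x) \<Longrightarrow> diff_form U \<beta>"
  unfolding diff_form_def using smooth_on_cong[of U] by metis

lemma diff_form_lincomb:
  "open U \<Longrightarrow> diff_form U \<alpha> \<Longrightarrow> diff_form U \<beta> \<Longrightarrow> diff_form U (\<lambda>x vs. a * \<alpha> x vs + b * \<beta> x vs)"
  by (simp add: diff_form_def alternating_lincomb smooth_on_add smooth_on_mult smooth_on_const)

lemma diff_form_add:
  "open U \<Longrightarrow> diff_form U \<alpha> \<Longrightarrow> diff_form U \<beta> \<Longrightarrow> diff_form U (\<lambda>x vs. \<alpha> x vs + \<beta> x vs)"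
  using diff_form_lincomb[of U \<alpha> \<beta> 1 1] by simp

lemma diff_form_zero: "diff_form U (\<lambda>x vs. 0)"
  by (simp add: diff_form_def smooth_on_const)

lemma diff_form_const: "alternating \<phi> \<Longrightarrow> diff_form U (\<lambda>x. \<phi>)"
  by (simp add: diff_form_def smooth_on_const)

lemma diff_form_hat: "open U \<Longrightarrow> diff_form U \<alpha> \<Longrightarrow> diff_form U (\<lambda>x. hat (\<alpha> x))"
  by (simp add: diff_form_def alternating_hat) (simp add: hat_def smooth_on_mult smooth_on_const)

lemma diff_form_interior: "diff_form U \<alpha> \<Longrightarrow> diff_form U (\<lambda>x. interior v (\<alpha> x))"
  by (simp add: diff_form_def alternating_interior) (simp add: interior_def)

lemma diff_form_dwedge:
  "open U \<Longrightarrow> diff_form U \<alpha> \<Longrightarrow> diff_form U \<beta> \<Longrightarrow> diff_form U (dwedge \<alpha> \<beta>)"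
  unfolding diff_form_def dwedge_def
  by (auto simp: alternating_wedge) (auto simp: wedge_def intro!: smooth_on_sum smooth_on_mult smooth_on_const)

lemma dir_deriv_scale:
  assumes "diff_form U \<alpha>" "x \<in> U"
  shows "dir_deriv h (\<lambda>x vs. a * \<alpha> x vs) x vs = a * dir_deriv h \<alpha> x vs"
  by (rule dir_deriv_eq) (intro has_derivative_mult_right diff_form_has_derivative[where U=U] assms)

lemma diff_form_dir_deriv:
  assumes U: "open U" and \<alpha>: "diff_form U \<alpha>"
  shows "diff_form U (dir_deriv h \<alpha>)"
proof -
  have "alternating (dir_deriv h \<alpha> x)" if x: "x \<in> U" for x
  proof (intro alternatingI linearI)
    fix xs ys u v
    have "dir_deriv h \<alpha> x (xs @ (u + v) # ys) = dir_deriv h (\<lambda>y _. \<alpha> y (xs @ u # ys) + \<alpha> y (xs @ v # ys)) x (xs @ (u + v) # ys)"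
      by (rule dir_deriv_cong[OF U x]) (simp add: alternating_add[OF diff_form_alternating[OF \<alpha>]])
    also have "\<dots> = dir_deriv h \<alpha> x (xs @ u # ys) + dir_deriv h \<alpha> x (xs @ v # ys)"
      by (rule dir_deriv_eq) (intro has_derivative_add diff_form_has_derivative[OF \<alpha> x])
    finally show "dir_deriv h \<alpha> x (xs @ (u + v) # ys) = dir_deriv h \<alpha> x (xs @ u # ys) + dir_deriv h \<alpha> x (xs @ v # ys)" .
  next
    fix xs ys r v
    have "dir_deriv h \<alpha> x (xs @ (r *\<^sub>R v) # ys) = dir_deriv h (\<lambda>y _. r * \<alpha> y (xs @ v # ys)) x (xs @ (r *\<^sub>R v) # ys)"
      by (rule dir_deriv_cong[OF U x]) (simp add: alternating_scale[OF diff_form_alternating[OF \<alpha>]])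
    also have "\<dots> = r * dir_deriv h \<alpha> x (xs @ v # ys)"
      by (rule dir_deriv_eq) (intro has_derivative_mult_right diff_form_has_derivative[OF \<alpha> x])
    finally show "dir_deriv h \<alpha> x (xs @ (r *\<^sub>R v) # ys) = r *\<^sub>R dir_deriv h \<alpha> x (xs @ v # ys)" by simp
  next
    fix xs ys v
    have "dir_deriv h \<alpha> x (xs @ v # v # ys) = dir_deriv h (\<lambda>y _. 0) x (xs @ v # v # ys)"
      by (rule dir_deriv_cong[OF U x]) (simp add: alternating_adjacent[OF diff_form_alternating[OF \<alpha>]])
    also have "\<dots> = 0"
      by (subst dir_deriv_eq[where f' = "\<lambda>_. 0"]) auto
    finally show "dir_deriv h \<alpha> x (xs @ v # v # ys) = 0" .
  qed
  then show ?thesis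
    using smooth_on_frechet[OF diff_form_smooth[OF \<alpha>]] by (simp add: diff_form_def dir_deriv_def)
qed

lemma dir_deriv_interior: "dir_deriv h (\<lambda>x. interior v (\<alpha> x)) = (\<lambda>x. interior v (dir_deriv h \<alpha> x))"
  by (simp add: dir_deriv_def interior_def)

lemma dir_deriv_hat:
  assumes "diff_form U \<alpha>" "x \<in> U"
  shows "dir_deriv h (\<lambda>x. hat (\<alpha> x)) x = hat (dir_deriv h \<alpha> x)"
proof
  fix vs show "dir_deriv h (\<lambda>x. hat (\<alpha> x)) x vs = hat (dir_deriv h \<alpha> x) vs"
    unfolding hat_def using dir_deriv_scale[OF assms, of h "(-1) ^ length vs" vs]
    by (simp add: dir_deriv_def)
qed

lemma dir_deriv_dwedge:
  assumes \<alpha>: "diff_form U \<alpha>" and \<beta>: "diff_form U \<beta>" and x: "x \<in> U"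
  shows "dir_deriv h (dwedge \<alpha> \<beta>) x vs = wedge (dir_deriv h \<alpha> x) (\<beta> x) vs + wedge (\<alpha> x) (dir_deriv h \<beta> x) vs"
proof -
  let ?n = "{..<length vs}"
  have "((\<lambda>y. dwedge \<alpha> \<beta> y vs) has_derivative (\<lambda>h. \<Sum>I\<in>Pow ?n.
    shuffle_sign (length vs) I * \<alpha> x (nths vs I) * dir_deriv h \<beta> x (nths vs (?n - I)) +
    shuffle_sign (length vs) I * dir_deriv h \<alpha> x (nths vs I) * \<beta> x (nths vs (?n - I)))) (at x)"
    unfolding dwedge_def wedge_def
    by (intro has_derivative_sum has_derivative_mult has_derivative_mult_right
        diff_form_has_derivative[OF \<alpha> x] diff_form_has_derivative[OF \<beta> x])
  then show ?thesis
    by (subst dir_deriv_eq, assumption) (simp add: wedge_def sum.distrib)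
qed

lemma ext_deriv_Nil [simp]: "ext_deriv \<alpha> x [] = 0"
  by (simp add: ext_deriv_def)

text \<open>Cartan's formula for a constant vector field; it makes induction on the argument list work.\<close>

lemma ext_deriv_Cons:
  "ext_deriv \<alpha> x (v # vs) = dir_deriv v \<alpha> x vs - ext_deriv (\<lambda>x. interior v (\<alpha> x)) x vs"
  unfolding ext_deriv_def dir_deriv_def interior_def
  by (simp only: length_Cons sum.lessThan_Suc_shift) (simp add: sum_negf)

lemma ext_deriv_lincomb:
  assumes "diff_form U \<alpha>" "diff_form U \<beta>" "x \<in> U"
  shows "ext_deriv (\<lambda>x vs. a * \<alpha> x vs + b * \<beta> x vs) x = (\<lambda>vs. a * ext_deriv \<alpha> x vs + b * ext_deriv \<beta> x vs)"
proof
  fix vs show "ext_deriv (\<lambda>x vs. a * \<alpha> x vs + b * \<beta> x vs) x vs = a * ext_deriv \<alpha> x vs + b * ext_deriv \<beta> x vs"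
    using assms(1,2)
  proof (induction vs arbitrary: \<alpha> \<beta>)
    case (Cons v vs)
    have "dir_deriv v (\<lambda>x vs. a * \<alpha> x vs + b * \<beta> x vs) x vs = a * dir_deriv v \<alpha> x vs + b * dir_deriv v \<beta> x vs"
      by (rule dir_deriv_eq)
        (intro has_derivative_add has_derivative_mult_right diff_form_has_derivative[where U=U] Cons.prems assms(3))
    moreover have "(\<lambda>x. interior v (\<lambda>vs. a * \<alpha> x vs + b * \<beta> x vs)) =
        (\<lambda>x vs. a * interior v (\<alpha> x) vs + b * interior v (\<beta> x) vs)"
      by (simp add: interior_def)
    ultimately show ?case
      using Cons.IH[OF diff_form_interior[OF Cons.prems(1), of v] diff_form_interior[OF Cons.prems(2), of v]]
      by (simp add: ext_deriv_Cons algebra_simps)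
  qed simp
qed

lemma ext_deriv_add:
  assumes "diff_form U \<alpha>" "diff_form U \<beta>" "x \<in> U"
  shows "ext_deriv (\<lambda>x vs. \<alpha> x vs + \<beta> x vs) x = (\<lambda>vs. ext_deriv \<alpha> x vs + ext_deriv \<beta> x vs)"
  using ext_deriv_lincomb[OF assms, of 1 1] by simp

lemma ext_deriv_scale:
  assumes "diff_form U \<alpha>" "x \<in> U"
  shows "ext_deriv (\<lambda>x vs. a * \<alpha> x vs) x = (\<lambda>vs. a * ext_deriv \<alpha> x vs)"
  using ext_deriv_lincomb[OF assms(1,1,2), of a 0] by simp

lemma ext_deriv_cong:
  assumes "open U" "x \<in> U" "\<And>y. y \<in> U \<Longrightarrow> \<alpha> y = \<beta> y"
  shows "ext_deriv \<alpha> x = ext_deriv \<beta> x"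
proof
  fix vs
  have "frechet_derivative (\<lambda>y. \<alpha> y ws) (at x) = frechet_derivative (\<lambda>y. \<beta> y ws) (at x)" for ws
    by (rule frechet_derivative_cong_open[OF assms(1,2)]) (simp add: assms(3))
  then show "ext_deriv \<alpha> x vs = ext_deriv \<beta> x vs" by (simp add: ext_deriv_def)
qed

lemma diff_form_ext_deriv:
  assumes U: "open U" and \<alpha>: "diff_form U \<alpha>"
  shows "diff_form U (ext_deriv \<alpha>)"
proof -
  have sm: "smooth_on U (\<lambda>x. ext_deriv \<alpha> x vs)" for vs
    unfolding ext_deriv_def
    by (intro smooth_on_sum smooth_on_mult smooth_on_const smooth_on_frechet diff_form_smooth[OF \<alpha>] U)
  have "(\<forall>u v. ext_deriv \<alpha> x (xs @ (u + v) # ys) = ext_deriv \<alpha> x (xs @ u # ys) + ext_deriv \<alpha> x (xs @ v # ys)) \<and>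
    (\<forall>r v. ext_deriv \<alpha> x (xs @ (r *\<^sub>R v) # ys) = r * ext_deriv \<alpha> x (xs @ v # ys)) \<and>
    (\<forall>v. ext_deriv \<alpha> x (xs @ v # v # ys) = 0)" if x: "x \<in> U" for x xs ys
    using \<alpha>
  proof (induction xs arbitrary: \<alpha>)
    case Nil
    have a: "ext_deriv \<alpha> x ((u + v) # ys) = ext_deriv \<alpha> x (u # ys) + ext_deriv \<alpha> x (v # ys)" for u v
    proof -
      have "ext_deriv (\<lambda>x. interior (u + v) (\<alpha> x)) x =
        ext_deriv (\<lambda>x vs. interior u (\<alpha> x) vs + interior v (\<alpha> x) vs) x"
        by (rule ext_deriv_cong[OF U x]) (simp add: interior_add_vec diff_form_alternating[OF Nil])
      then show ?thesis
        using linear_add[OF linear_dir_deriv[OF Nil x]]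
        by (simp add: ext_deriv_Cons ext_deriv_add[OF diff_form_interior[OF Nil] diff_form_interior[OF Nil] x])
    qed
    have s: "ext_deriv \<alpha> x ((r *\<^sub>R v) # ys) = r * ext_deriv \<alpha> x (v # ys)" for r v
    proof -
      have "ext_deriv (\<lambda>x. interior (r *\<^sub>R v) (\<alpha> x)) x =
        ext_deriv (\<lambda>x vs. r * interior v (\<alpha> x) vs) x"
        by (rule ext_deriv_cong[OF U x]) (simp add: interior_scale_vec diff_form_alternating[OF Nil])
      then show ?thesis
        using linear_scale[OF linear_dir_deriv[OF Nil x]]
        by (simp add: ext_deriv_Cons ext_deriv_scale[OF diff_form_interior[OF Nil] x] algebra_simps)
    qed
    have z: "ext_deriv \<alpha> x (v # v # ys) = 0" for v
    proof -
      have "ext_deriv (\<lambda>x. interior v (interior v (\<alpha> x))) x ys = ext_deriv (\<lambda>x vs. 0) x ys"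
        using ext_deriv_cong[OF U x, of "\<lambda>x. interior v (interior v (\<alpha> x))" "\<lambda>x vs. 0"]
        by (simp add: alternating_interior_interior diff_form_alternating[OF Nil])
      also have "\<dots> = 0" by (simp add: ext_deriv_def)
      finally show ?thesis
        by (simp add: ext_deriv_Cons dir_deriv_interior) (simp add: interior_def)
    qed
    show ?case using a s z by simp
  next
    case (Cons w xs)
    show ?case
      using Cons.IH[OF diff_form_interior[OF Cons.prems, of w]]
        diff_form_alternating[OF diff_form_dir_deriv[OF U Cons.prems, of w] x]
      by (simp add: ext_deriv_Cons alternating_add alternating_scale alternating_adjacent algebra_simps)
  qed
  then have "alternating (ext_deriv \<alpha> x)" if "x \<in> U" for x
    using that by (intro alternatingI linearI) auto
  then show ?thesis using sm by (simp add: diff_form_def)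
qed

lemma ext_deriv_hat:
  assumes "diff_form U \<alpha>" "x \<in> U"
  shows "ext_deriv (\<lambda>x. hat (\<alpha> x)) x vs = - hat (ext_deriv \<alpha> x) vs"
  using assms(1)
proof (induction vs arbitrary: \<alpha>)
  case (Cons v vs)
  have "ext_deriv (\<lambda>x. interior v (hat (\<alpha> x))) x vs = - ext_deriv (\<lambda>x. hat (interior v (\<alpha> x))) x vs"
    unfolding interior_hat by (simp add: ext_deriv_def dir_deriv_def sum_negf[symmetric])
      (rule sum.cong, simp, subst frechet_derivative_eq[OF has_derivative_minus[OF has_derivative_frechet]],
        use smooth_on_differentiable[OF diff_form_smooth[OF Cons.prems] assms(2)] in
        \<open>auto simp: hat_def interior_def intro!: differentiable_mult\<close>)
  also have "\<dots> = hat (ext_deriv (\<lambda>x. interior v (\<alpha> x)) x) vs"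
    by (simp add: Cons.IH[OF diff_form_interior[OF Cons.prems]])
  finally show ?case
    by (simp add: ext_deriv_Cons dir_deriv_hat[OF Cons.prems assms(2)]) (simp add: hat_def ext_deriv_Cons algebra_simps)
qed (simp add: hat_def)

theorem ext_deriv_dwedge:
  assumes U: "open U" and \<alpha>: "diff_form U \<alpha>" and \<beta>: "diff_form U \<beta>" and x: "x \<in> U"
  shows "ext_deriv (dwedge \<alpha> \<beta>) x =
    (\<lambda>vs. wedge (ext_deriv \<alpha> x) (\<beta> x) vs + wedge (hat (\<alpha> x)) (ext_deriv \<beta> x) vs)"
proof
  fix vs
  show "ext_deriv (dwedge \<alpha> \<beta>) x vs =
    wedge (ext_deriv \<alpha> x) (\<beta> x) vs + wedge (hat (\<alpha> x)) (ext_deriv \<beta> x) vs"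
    using \<alpha> \<beta>
  proof (induction vs arbitrary: \<alpha> \<beta>)
    case (Cons v vs)
    note i\<alpha> = diff_form_interior[OF Cons.prems(1), of v] and i\<beta> = diff_form_interior[OF Cons.prems(2), of v]
    note h\<alpha> = diff_form_hat[OF U Cons.prems(1)]
    have e: "interior v (ext_deriv \<alpha> x) = (\<lambda>vs. dir_deriv v \<alpha> x vs - ext_deriv (\<lambda>x. interior v (\<alpha> x)) x vs)" for \<alpha>
      by (simp add: interior_def ext_deriv_Cons)
    have "(\<lambda>x. interior v (dwedge \<alpha> \<beta> x)) =
      (\<lambda>x vs. dwedge (\<lambda>x. interior v (\<alpha> x)) \<beta> x vs + dwedge (\<lambda>x. hat (\<alpha> x)) (\<lambda>x. interior v (\<beta> x)) x vs)"
      by (simp add: dwedge_def interior_wedge)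
    then have "ext_deriv (\<lambda>x. interior v (dwedge \<alpha> \<beta> x)) x vs =
      ext_deriv (dwedge (\<lambda>x. interior v (\<alpha> x)) \<beta>) x vs +
      ext_deriv (dwedge (\<lambda>x. hat (\<alpha> x)) (\<lambda>x. interior v (\<beta> x))) x vs"
      using diff_form_dwedge[OF U i\<alpha> Cons.prems(2)] diff_form_dwedge[OF U h\<alpha> i\<beta>] x
      by (simp add: ext_deriv_add)
    also have "\<dots> = wedge (ext_deriv (\<lambda>x. interior v (\<alpha> x)) x) (\<beta> x) vs
      + wedge (hat (interior v (\<alpha> x))) (ext_deriv \<beta> x) vs
      + wedge (ext_deriv (\<lambda>x. hat (\<alpha> x)) x) (interior v (\<beta> x)) vs
      + wedge (hat (hat (\<alpha> x))) (ext_deriv (\<lambda>x. interior v (\<beta> x)) x) vs"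
      by (simp add: Cons.IH[OF i\<alpha> Cons.prems(2)] Cons.IH[OF h\<alpha> i\<beta>])
    finally have 1: "ext_deriv (\<lambda>x. interior v (dwedge \<alpha> \<beta> x)) x vs = \<dots>" .
    have hh: "hat (hat (\<alpha> x)) = \<alpha> x" by (auto simp: hat_def simp flip: power_add mult.assoc)
    have he: "ext_deriv (\<lambda>x. hat (\<alpha> x)) x = (\<lambda>vs. - hat (ext_deriv \<alpha> x) vs)"
      using ext_deriv_hat[OF Cons.prems(1) x] by auto
    show ?case
      unfolding ext_deriv_Cons[of "dwedge \<alpha> \<beta>"] 1 dir_deriv_dwedge[OF Cons.prems x] wedge_Cons e interior_hat hh he
      by (simp add: wedge_diff_left wedge_diff_right wedge_minus_left wedge_minus_right)
  qed simp
qed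

theorem ext_deriv_ext_deriv:
  assumes U: "open U" and \<alpha>: "diff_form U \<alpha>" and x: "x \<in> U"
  shows "ext_deriv (ext_deriv \<alpha>) x = (\<lambda>vs. 0)"
proof
  have comm: "dir_deriv v (ext_deriv \<alpha>) x vs = ext_deriv (dir_deriv v \<alpha>) x vs"
    if \<alpha>: "diff_form U \<alpha>" for \<alpha> v vs
  proof -
    have d: "((\<lambda>y. ext_deriv \<alpha> y vs) has_derivative (\<lambda>h. \<Sum>i<length vs. (-1) ^ i *
      frechet_derivative (\<lambda>y. frechet_derivative (\<lambda>y. \<alpha> y (take i vs @ drop (Suc i) vs)) (at y) (vs ! i)) (at x) h)) (at x)"
      unfolding ext_deriv_def
      by (intro has_derivative_sum has_derivative_mult_right smooth_on_has_derivative[OF _ x] smooth_on_frechet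
          diff_form_smooth[OF \<alpha>])
    have C: "Ck_on (Suc (Suc 0)) U (\<lambda>y. \<alpha> y ws)" for ws
      using diff_form_smooth[OF \<alpha>] unfolding smooth_on_def by blast
    show ?thesis
      unfolding dir_deriv_eq[where \<alpha> = "ext_deriv \<alpha>" and vs = vs, OF d] by (simp only: ext_deriv_def dir_deriv_def frechet_derivative_commute[OF U x C])
  qed
  fix vs show "ext_deriv (ext_deriv \<alpha>) x vs = 0"
    using \<alpha>
  proof (induction vs arbitrary: \<alpha>)
    case (Cons v vs)
    have "(\<lambda>x. interior v (ext_deriv \<alpha> x)) =
        (\<lambda>x vs. 1 * dir_deriv v \<alpha> x vs + (-1) * ext_deriv (\<lambda>x. interior v (\<alpha> x)) x vs)"
      by (simp add: interior_def ext_deriv_Cons)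
    then have "ext_deriv (\<lambda>x. interior v (ext_deriv \<alpha> x)) x vs =
      ext_deriv (dir_deriv v \<alpha>) x vs - ext_deriv (ext_deriv (\<lambda>x. interior v (\<alpha> x))) x vs"
      using ext_deriv_lincomb[OF diff_form_dir_deriv[OF U Cons.prems, of v]
          diff_form_ext_deriv[OF U diff_form_interior[OF Cons.prems, of v]] x, of 1 "-1"]
      by simp
    then show ?case
      by (simp add: ext_deriv_Cons[of "ext_deriv \<alpha>"] comm[OF Cons.prems] Cons.IH[OF diff_form_interior[OF Cons.prems]])
  qed simp
qed

lemma smooth_on_diff_form_eval:
  assumes U: "open U" and V: "open V" and h: "h ` V \<subseteq> U" "\<And>y. y \<in> V \<Longrightarrow> (h has_derivative L) (at y)"
    and \<alpha>: "diff_form U \<alpha>" and gs: "\<And>g b. g \<in> set gs \<Longrightarrow> b \<in> Basis \<Longrightarrow> smooth_on V (\<lambda>y. g y \<bullet> b)"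
  shows "smooth_on V (\<lambda>y. \<alpha> (h y) (map (\<lambda>g. g y) gs))"
  using \<alpha> gs
proof (induction gs arbitrary: \<alpha>)
  case Nil
  then show ?case
    using smooth_on_compose_affine[OF U V h diff_form_smooth[OF Nil(1), of "[]"]] by simp
next
  case (Cons g gs)
  have "smooth_on V (\<lambda>y. \<Sum>b\<in>Basis. (g y \<bullet> b) * interior b (\<alpha> (h y)) (map (\<lambda>g. g y) gs))"
    using Cons.prems by (intro smooth_on_sum smooth_on_mult V Cons.IH diff_form_interior) auto
  moreover have "(\<Sum>b\<in>Basis. (g y \<bullet> b) * interior b (\<alpha> (h y)) (map (\<lambda>g. g y) gs)) =
    \<alpha> (h y) (map (\<lambda>g. g y) (g # gs))" if "y \<in> V" for y
  proof -
    have "h y \<in> U" using h(1) that by blast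
    then have "\<alpha> (h y) ((\<Sum>b\<in>Basis. (g y \<bullet> b) *\<^sub>R b) # map (\<lambda>g. g y) gs) =
      (\<Sum>b\<in>Basis. (g y \<bullet> b) * \<alpha> (h y) (b # map (\<lambda>g. g y) gs))"
      using alternating_sum[OF diff_form_alternating[OF Cons.prems(1)], of "h y" "[]"] by simp
    then show ?thesis by (simp add: euclidean_representation interior_def)
  qed
  ultimately show ?case by (rule smooth_on_cong[OF V])
qed

subsection \<open>Ideals\<close>

lemma ideal_gen_mono_generators:
  assumes "\<And>\<alpha>. \<alpha> \<in> G \<Longrightarrow> \<alpha> \<in> ideal_gen U G'"
  shows "ideal_gen U G \<subseteq> ideal_gen U G'"
proof
  fix \<alpha> assume "\<alpha> \<in> ideal_gen U G"
  then show "\<alpha> \<in> ideal_gen U G'"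
    by induction (auto intro: ideal_gen.intros assms)
qed

lemma ideal_gen_ideal_gen_Un: "ideal_gen U (ideal_gen U G \<union> H) = ideal_gen U (G \<union> H)"
proof (rule antisym)
  have "ideal_gen U G \<subseteq> ideal_gen U (G \<union> H)"
    by (rule ideal_gen_mono_generators) (auto intro: ideal_gen.gen)
  then show "ideal_gen U (ideal_gen U G \<union> H) \<subseteq> ideal_gen U (G \<union> H)"
    by (intro ideal_gen_mono_generators) (auto intro: ideal_gen.gen)
  show "ideal_gen U (G \<union> H) \<subseteq> ideal_gen U (ideal_gen U G \<union> H)"
    by (intro ideal_gen_mono_generators) (auto intro: ideal_gen.gen)
qed

lemma ideal_gen_idem: "ideal_gen U (ideal_gen U G) = ideal_gen U G"
  using ideal_gen_ideal_gen_Un[of U G "{}"] by simp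

lemma ideal_gen_diff_form:
  assumes "open U" "\<And>\<alpha>. \<alpha> \<in> G \<Longrightarrow> diff_form U \<alpha>" "\<alpha> \<in> ideal_gen U G"
  shows "diff_form U \<alpha>"
  using assms(3)
  by induction (auto intro: assms diff_form_zero diff_form_add diff_form_dwedge diff_form_cong)

lemma wedge_unit_form_left: "wedge unit_form a = a"
proof
  fix vs show "wedge unit_form a vs = a vs"
  proof (induction vs arbitrary: a)
    case (Cons v vs)
    have i: "interior v unit_form = (\<lambda>_. 0)" by (auto simp: interior_def unit_form_def)
    have h: "hat (unit_form :: 'a form) = unit_form" by (auto simp: unit_form_def hat_def)
    show ?case unfolding wedge_Cons i h wedge_zero_left Cons.IH by (simp add: interior_def)
  qed (simp add: unit_form_def)
qed

lemma alternating_unit_form: "alternating unit_form"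
  by (intro alternatingI linearI) (auto simp: unit_form_def)

lemma homogeneous_unit_form: "homogeneous 0 unit_form"
  by (simp add: homogeneous_def unit_form_def)

lemma ideal_gen_scale:
  assumes "\<alpha> \<in> ideal_gen U G"
  shows "(\<lambda>x vs. r * \<alpha> x vs) \<in> ideal_gen U G"
proof -
  have "diff_form U (\<lambda>x vs. r * unit_form vs)"
    by (intro diff_form_const alternating_scaled alternating_unit_form)
  moreover have "dwedge (\<lambda>x vs. r * unit_form vs) \<alpha> = (\<lambda>x vs. r * \<alpha> x vs)"
    by (simp add: dwedge_def wedge_scale_left wedge_unit_form_left)
  ultimately show ?thesis using ideal_gen.wedge_left[OF assms] by metis
qed

lemma ideal_gen_ext_deriv:
  assumes U: "open U" and G: "\<And>\<alpha>. \<alpha> \<in> G \<Longrightarrow> diff_form U \<alpha>"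
    and dG: "\<And>\<alpha>. \<alpha> \<in> G \<Longrightarrow> ext_deriv \<alpha> \<in> ideal_gen U G"
    and hom: "\<And>\<alpha>. \<alpha> \<in> G \<Longrightarrow> \<exists>k. \<forall>x\<in>U. homogeneous k (\<alpha> x)"
    and "\<alpha> \<in> ideal_gen U G"
  shows "ext_deriv \<alpha> \<in> ideal_gen U G"
  using assms(5)
proof induction
  case zero
  have "ext_deriv (\<lambda>x vs. 0) = (\<lambda>(x :: 'a) vs. 0)" by (simp add: ext_deriv_def)
  then show ?case by (simp add: ideal_gen.zero)
next
  case (gen \<alpha>)
  then show ?case by (rule dG)
next
  case (add \<alpha> \<beta>)
  show ?case
    by (rule ideal_gen.cong[OF ideal_gen.add[OF add.IH]])
      (rule ext_deriv_add[OF ideal_gen_diff_form[OF U G add.hyps(1)] ideal_gen_diff_form[OF U G add.hyps(2)]])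
next
  case (wedge_left \<alpha> \<beta>)
  have "(\<lambda>x vs. dwedge (ext_deriv \<beta>) \<alpha> x vs + dwedge (\<lambda>x. hat (\<beta> x)) (ext_deriv \<alpha>) x vs) \<in> ideal_gen U G"
    by (intro ideal_gen.add ideal_gen.wedge_left wedge_left diff_form_hat diff_form_ext_deriv U)
  then show ?case
    by (rule ideal_gen.cong)
      (simp add: ext_deriv_dwedge[OF U wedge_left.hyps(2) ideal_gen_diff_form[OF U G wedge_left.hyps(1)]], simp add: dwedge_def)
next
  case (wedge_right \<alpha> \<beta>)
  have "(\<lambda>x. hat (\<alpha> x)) \<in> ideal_gen U G"
    using wedge_right.hyps(1)
  proof induction
    case (add \<alpha> \<beta>)
    then show ?case using ideal_gen.add by (fastforce simp: hat_def algebra_simps)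
  next
    case (wedge_left \<alpha> \<beta>)
    then show ?case
      using ideal_gen.wedge_left[OF wedge_left.IH diff_form_hat[OF U wedge_left.hyps(2)]] by (simp add: dwedge_def hat_wedge)
  next
    case (wedge_right \<alpha> \<beta>)
    then show ?case
      using ideal_gen.wedge_right[OF wedge_right.IH diff_form_hat[OF U wedge_right.hyps(2)]] by (simp add: dwedge_def hat_wedge)
  next
    case (gen \<alpha>)
    obtain k where "\<forall>x\<in>U. homogeneous k (\<alpha> x)" using hom[OF gen] by blast
    then show ?case
      by (intro ideal_gen.cong[OF ideal_gen_scale[OF ideal_gen.gen[OF gen], of "(-1) ^ k"]])
        (simp add: hat_homogeneous)
  next
    case (cong \<alpha> \<beta>)
    show ?case by (rule ideal_gen.cong[OF cong.IH]) (simp add: cong.hyps)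
  qed (simp add: hat_def ideal_gen.zero)
  then have "(\<lambda>x vs. dwedge (ext_deriv \<alpha>) \<beta> x vs + dwedge (\<lambda>x. hat (\<alpha> x)) (ext_deriv \<beta>) x vs) \<in> ideal_gen U G"
    by (intro ideal_gen.add ideal_gen.wedge_right wedge_right diff_form_ext_deriv U)
  then show ?case
    by (rule ideal_gen.cong)
      (simp add: ext_deriv_dwedge[OF U ideal_gen_diff_form[OF U G wedge_right.hyps(1)] wedge_right.hyps(2)], simp add: dwedge_def)
next
  case (cong \<alpha> \<beta>)
  show ?case
    by (rule ideal_gen.cong[OF cong.IH]) (rule ext_deriv_cong[OF U], use cong.hyps in auto)
qed

section \<open>Bases and top-degree forms\<close>

lemma nths_eq_map_filter: "nths xs K = map ((!) xs) (filter (\<lambda>i. i \<in> K) [0..<length xs])"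
proof (induction xs arbitrary: K)
  case (Cons x xs)
  have "[0..<length (x # xs)] = 0 # map Suc [0..<length xs]"
    by (simp add: upt_conv_Cons map_Suc_upt del: upt_Suc)
  then show ?case by (simp add: nths_Cons Cons.IH filter_map o_def del: upt_Suc)
qed simp

lemma alternating_eq_zero_on_span_nths:
  assumes "alternating \<phi>" and zero: "\<And>K. K \<subseteq> {..<length e} \<Longrightarrow> \<phi> (nths e K) = 0"
    and "set vs \<subseteq> span (set e)"
  shows "\<phi> vs = 0"
proof (rule alternating_eq_zero_on_span[OF assms(1) _ assms(3)])
  fix "is" assume "is": "set is \<subseteq> {..<length e}" "distinct is"
  have "sort is = filter (\<lambda>i. i \<in> set is) [0..<length e]"
    using "is" by (intro sorted_distinct_set_unique sorted_wrt_filter) auto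
  then show "\<phi> (map ((!) e) is) = 0"
    using zero[of "set is"] "is" alternating_sort[OF assms(1), of "(!) e" "is"]
    by (simp add: nths_eq_map_filter)
qed

lemma dual_basis_span:
  fixes f :: "'a::euclidean_space list"
  assumes len: "length f = DIM('a)" and lin: "\<And>i. i < length f \<Longrightarrow> linear (\<theta> i)"
    and dual: "\<And>i j. i < length f \<Longrightarrow> j < length f \<Longrightarrow> \<theta> i (f ! j) = (if i = j then 1 else 0 :: real)"
  shows "span (set f) = UNIV" and "v = (\<Sum>i<length f. \<theta> i v *\<^sub>R f ! i)"
    and "independent (set f)" and "distinct f"
proof -
  show d: "distinct f" unfolding distinct_conv_nth using dual by (metis zero_neq_one)
  show ind: "independent (set f)"
  proof (rule independent_if_scalars_zero)
    fix c x assume s: "(\<Sum>x\<in>set f. c x *\<^sub>R x) = 0" and "x \<in> set f"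
    then obtain i where i: "i < length f" "x = f ! i" by (metis in_set_conv_nth)
    have "0 = \<theta> i (\<Sum>x\<in>set f. c x *\<^sub>R x)" using s linear_0[OF lin[OF i(1)]] by simp
    also have "\<dots> = (\<Sum>x\<in>set f. c x * \<theta> i x)"
      by (simp add: linear_sum[OF lin[OF i(1)]] linear_scale[OF lin[OF i(1)]])
    also have "\<dots> = (\<Sum>y\<in>set f. if y = x then c x else 0)"
    proof (rule sum.cong)
      fix y assume "y \<in> set f"
      then obtain j where "j < length f" "y = f ! j" by (metis in_set_conv_nth)
      then show "c y * \<theta> i y = (if y = x then c x else 0)" using i dual d by (auto simp: nth_eq_iff_index_eq)
    qed simp
    finally show "c x = 0" using \<open>x \<in> set f\<close> by simp
  qed simp
  have "UNIV \<subseteq> span (set f)"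
    by (rule card_ge_dim_independent[OF _ ind]) (use d len in \<open>auto simp: distinct_card\<close>)
  then show sp: "span (set f) = UNIV" by blast
  let ?g = "\<lambda>v. v - (\<Sum>i<length f. \<theta> i v *\<^sub>R f ! i)"
  have "linear ?g"
    by (intro linear_compose_sub linear_ident linear_compose_sum ballI linear_compose_scale_right
        linearI) (auto simp: linear_add[OF lin] linear_scale[OF lin] scaleR_add_left)
  moreover have "?g x = 0" if x: "x \<in> set f" for x
  proof -
    obtain j where j: "j < length f" "x = f ! j" using x by (metis in_set_conv_nth)
    have "(\<Sum>i<length f. \<theta> i x *\<^sub>R f ! i) = (\<Sum>i<length f. if i = j then x else 0)"
      using j dual by (intro sum.cong) auto
    then show ?thesis using j by simp
  qed
  ultimately have "?g v = 0" using linear_eq_0_on_span[of ?g "set f" v] sp by blast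
  then show "v = (\<Sum>i<length f. \<theta> i v *\<^sub>R f ! i)" by simp
qed

definition ix :: "nat \<Rightarrow> 7" where
  "ix = (!) (sorted_list_of_set UNIV)"

definition pos7 :: "7 \<Rightarrow> nat" where
  "pos7 = inv_into {..<7} ix"

lemma ix_strict_mono: "i < j \<Longrightarrow> j < 7 \<Longrightarrow> ix i < ix j"
  unfolding ix_def by (rule sorted_wrt_nth_less[OF strict_sorted_list_of_set]) auto

lemma bij_ix: "bij_betw ix {..<7} UNIV"
proof -
  have "bij_betw ((!) (sorted_list_of_set (UNIV :: 7 set))) {..<7} (set (sorted_list_of_set (UNIV :: 7 set)))"
    by (rule bij_betw_nth) auto
  then show ?thesis by (simp add: ix_def)
qed

lemma ix_pos7 [simp]: "ix (pos7 i) = i"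
  unfolding pos7_def using bij_ix by (metis UNIV_I bij_betw_imp_surj_on f_inv_into_f)

lemma pos7_ix [simp]: "i < 7 \<Longrightarrow> pos7 (ix i) = i"
  unfolding pos7_def using bij_ix by (simp add: bij_betw_def inv_into_f_f)

lemma pos7_less [simp]: "pos7 i < 7"
  unfolding pos7_def using bij_ix by (metis UNIV_I bij_betw_imp_surj_on inv_into_into lessThan_iff)

lemma ix_eq_iff: "i < 7 \<Longrightarrow> j < 7 \<Longrightarrow> ix i = ix j \<longleftrightarrow> i = j"
  by (metis pos7_ix)

lemma sum_7: "(\<Sum>i\<in>UNIV. F i) = (\<Sum>i<7. F (ix i))"
  by (rule sum.reindex_bij_betw[OF bij_ix, symmetric])

definition ax :: "nat \<Rightarrow> real^7" where
  "ax i = axis (ix i) 1"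

definition std :: "(real^7) list" where
  "std = map ax [0..<7]"

lemma length_std [simp]: "length std = 7" by (simp add: std_def)

lemma nth_std [simp]: "i < 7 \<Longrightarrow> std ! i = ax i" by (simp add: std_def)

lemma ax_component: "i < 7 \<Longrightarrow> j < 7 \<Longrightarrow> ax i $ ix j = (if i = j then 1 else 0)"
  by (auto simp: ax_def axis_def ix_eq_iff)

definition vol0 :: "(real^7) form" where
  "vol0 vs = (if length vs = 7 then det (\<chi> i. vs ! pos7 i) else 0)"

lemma vol0_std [simp]: "vol0 std = 1"
proof -
  have "(\<chi> i. std ! pos7 i) = (mat 1 :: real^7^7)"
    by (simp add: vec_eq_iff mat_def ax_def axis_def eq_commute)
  then show ?thesis by (simp add: vol0_def)
qed

lemma homogeneous_vol0: "homogeneous 7 vol0"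
  by (simp add: homogeneous_def vol0_def)

lemma alternating_vol0: "alternating vol0"
proof (rule alternatingI)
  fix xs ys :: "(real^7) list"
  show "linear (\<lambda>v. vol0 (xs @ v # ys))"
  proof (cases "length xs + length ys = 6")
    case True
    let ?k = "ix (length xs)"
    have k: "length xs < 7" using True by simp
    have row: "(\<chi> i. (xs @ v # ys) ! pos7 i) = (\<chi> i. if i = ?k then v else (xs @ 0 # ys) ! pos7 i)" for v
    proof (rule iffD2[OF vec_eq_iff], rule allI, simp only: vec_lambda_beta)
      fix i
      show "(xs @ v # ys) ! pos7 i = (if i = ?k then v else (xs @ 0 # ys) ! pos7 i)"
      proof (cases "pos7 i = length xs")
        case True
        then have "i = ?k" by (metis ix_pos7)
        then show ?thesis using k by simp
      next
        case False
        then have "i \<noteq> ?k" using k by auto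
        then show ?thesis using False by (auto simp: nth_append nth_Cons split: nat.split)
      qed
    qed
    have mul: "det (\<chi> i. if i = k then r *\<^sub>R b else c i) = r * det (\<chi> i. if i = k then b else c i)"
      for k r and b :: "real^7" and c
      using det_row_mul[of k r "\<lambda>_. b" c] unfolding scalar_mult_eq_scaleR .
    show ?thesis
      unfolding vol0_def row using True
      by (intro linearI) (simp_all add: det_row_add mul)
  qed (auto simp: vol0_def intro: linearI)
next
  fix xs ys :: "(real^7) list" and v
  show "vol0 (xs @ v # v # ys) = 0"
  proof (cases "length xs + length ys = 5")
    case True
    have "ix (length xs) \<noteq> ix (Suc (length xs))" using True by (subst ix_eq_iff) auto
    then show ?thesis
      unfolding vol0_def using True
      by (simp, intro det_identical_rows[of "ix (length xs)" "ix (Suc (length xs))"])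
        (simp_all add: row_def nth_append)
  qed (simp add: vol0_def)
qed

definition frame :: "(real^7) list \<Rightarrow> bool" where
  "frame f \<longleftrightarrow> vol0 f \<noteq> 0"

lemma frame_std: "frame std" by (simp add: frame_def)

lemma frame_length: "frame f \<Longrightarrow> length f = 7"
  unfolding frame_def vol0_def by (auto split: if_splits)

definition coord :: "(real^7) list \<Rightarrow> nat \<Rightarrow> real^7 \<Rightarrow> real" where
  "coord f i v = vol0 (f[i := v]) / vol0 f"

lemma linear_coord: "i < length f \<Longrightarrow> linear (coord f i)"
proof -
  assume "i < length f"
  then have l: "linear (\<lambda>v. vol0 (f[i := v]))" using alternating_vol0 by (simp add: alternating_def)
  show ?thesis unfolding coord_def
    by (intro linearI) (simp_all add: linear_add[OF l] linear_scale[OF l] add_divide_distrib)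
qed

lemma coord_nth:
  assumes "frame f" "i < 7" "j < 7"
  shows "coord f i (f ! j) = (if i = j then 1 else 0)"
proof (cases "i = j")
  case True
  then show ?thesis using assms frame_length[OF assms(1)] by (simp add: coord_def frame_def)
next
  case False
  have "f[i := f ! j] ! i = f[i := f ! j] ! j" using False assms frame_length[OF assms(1)] by simp
  then have "\<not> distinct (f[i := f ! j])"
    using False assms frame_length[OF assms(1)] nth_eq_iff_index_eq[of "f[i := f ! j]" i j] by auto
  then show ?thesis using False by (simp add: coord_def alternating_not_distinct[OF alternating_vol0])
qed

lemma frame_span: "frame f \<Longrightarrow> span (set f) = UNIV"
  and frame_expand: "frame f \<Longrightarrow> v = (\<Sum>i<7. coord f i v *\<^sub>R f ! i)"
  and frame_independent: "frame f \<Longrightarrow> independent (set f)"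
  and frame_distinct: "frame f \<Longrightarrow> distinct f"
  using dual_basis_span[of f "coord f"] linear_coord[of _ f] coord_nth[of f] frame_length[of f] by auto

lemma alternating_frame_eqI:
  assumes "alternating \<phi>" "alternating \<psi>" "frame f"
    and "\<And>K. K \<subseteq> {..<7} \<Longrightarrow> \<phi> (nths f K) = \<psi> (nths f K)"
  shows "\<phi> = \<psi>"
proof
  fix vs
  have "\<phi> vs - \<psi> vs = 0"
    using alternating_eq_zero_on_span_nths[OF alternating_diff[OF assms(1,2)], of f vs] assms(4)
      frame_length[OF assms(3)] frame_span[OF assms(3)]
    by simp
  then show "\<phi> vs = \<psi> vs" by simp
qed

lemma homogeneous_frame_eqI:
  assumes "alternating \<phi>" "alternating \<psi>" "homogeneous k \<phi>" "homogeneous k \<psi>" "frame f"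
    and eq: "\<And>K. K \<subseteq> {..<7} \<Longrightarrow> card K = k \<Longrightarrow> \<phi> (nths f K) = \<psi> (nths f K)"
  shows "\<phi> = \<psi>"
proof (rule alternating_frame_eqI[OF assms(1,2,5)])
  fix K :: "nat set" assume K: "K \<subseteq> {..<7}"
  then have "length (nths f K) = card K" using frame_length[OF assms(5)] by (simp add: length_nths_subset)
  then show "\<phi> (nths f K) = \<psi> (nths f K)"
    using eq[OF K] assms(3,4) by (cases "card K = k") (auto simp: homogeneous_def)
qed

lemma top_form_eqI:
  assumes "alternating \<phi>" "alternating \<psi>" "homogeneous 7 \<phi>" "homogeneous 7 \<psi>" "frame f" "\<phi> f = \<psi> f"
  shows "\<phi> = \<psi>"
proof (rule homogeneous_frame_eqI[OF assms(1-5)])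
  fix K :: "nat set" assume "K \<subseteq> {..<7}" "card K = 7"
  then have "K = {..<7}" by (intro card_subset_eq) auto
  then show "\<phi> (nths f K) = \<psi> (nths f K)"
    using assms(6) frame_length[OF assms(5)] by (simp add: nths_all)
qed

lemma top_form_eq:
  assumes "alternating \<phi>" "homogeneous 7 \<phi>" "frame f"
  shows "\<phi> = (\<lambda>vs. \<phi> f / vol0 f * vol0 vs)"
  using assms
  by (intro top_form_eqI[OF assms(1) alternating_scaled[OF alternating_vol0] assms(2) _ assms(3)])
    (simp_all add: frame_def homogeneous_def vol0_def)

lemma top_form_eq_std:
  assumes "alternating \<phi>" "homogeneous 7 \<phi>"
  shows "\<phi> vs = \<phi> std * vol0 vs"
  using fun_cong[OF top_form_eq[OF assms frame_std], of vs] by simp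

lemma frame_of_dual:
  assumes len: "length f = 7" and lin: "\<And>i. i < 7 \<Longrightarrow> linear (\<theta> i)"
    and dual: "\<And>i j. i < 7 \<Longrightarrow> j < 7 \<Longrightarrow> \<theta> i (f ! j) = (if i = j then 1 else 0 :: real)"
  shows "frame f"
proof (rule ccontr)
  assume "\<not> frame f"
  then have 0: "vol0 f = 0" by (simp add: frame_def)
  have sp: "span (set f) = UNIV" using dual_basis_span(1)[of f \<theta>] assms by simp
  have "vol0 std = 0"
  proof (rule alternating_eq_zero_on_span_nths[OF alternating_vol0])
    fix K assume K: "K \<subseteq> {..<length f}"
    show "vol0 (nths f K) = 0"
    proof (cases "card K = 7")
      case True
      then have "K = {..<7}" using K len by (intro card_subset_eq) auto
      then show ?thesis using 0 len by (simp add: nths_all)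
    next
      case False
      then show ?thesis using K by (simp add: vol0_def length_nths_subset)
    qed
  qed (simp add: sp)
  then show False by simp
qed

lemma sort_eq_upt: "distinct is \<Longrightarrow> set is = {..<n} \<Longrightarrow> sort is = [0..<n]"
  by (intro sorted_distinct_set_unique) (auto simp: atLeast0LessThan)

lemma vol_psign:
  assumes "alternating vol" "length f = 7" "vol f = 1" "length is = 7" "set is \<subseteq> {..<7}"
  shows "vol (map ((!) f) is) = psign is"
proof (cases "distinct is")
  case True
  then have "card (set is) = 7" using assms(4) by (simp add: distinct_card)
  then have "set is = {..<7}" using assms(5) by (intro card_subset_eq) auto
  then have "sort is = [0..<7]" by (rule sort_eq_upt[OF True])
  moreover have "map ((!) f) [0..<7] = f" using assms(2) by (metis map_nth)
  ultimately show ?thesis using assms(3) alternating_sort[OF assms(1), of "(!) f" "is"] by (simp only: mult_1_right)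
next
  case False
  then have "\<not> distinct (map ((!) f) is)" by (auto simp: distinct_map)
  moreover have "psign is = 0" using False by (induction "is") auto
  ultimately show ?thesis by (simp add: alternating_not_distinct[OF assms(1)])
qed

section \<open>The Hodge star\<close>

lemma form_inner_Nil [simp]: "form_inner [] \<alpha> \<beta> = \<alpha> [] * \<beta> []"
  by (simp add: form_inner_def)

lemma form_inner_Cons:
  "form_inner (e # E) \<alpha> \<beta> = form_inner E \<alpha> \<beta> + form_inner E (interior e \<alpha>) (interior e \<beta>)"
  by (simp add: form_inner_def sum_Pow_lessThan_Suc nths_insert_0 nths_Suc_image interior_def)

lemma form_inner_zero_left [simp]: "form_inner E (\<lambda>_. 0) \<beta> = 0"
  by (simp add: form_inner_def)

lemma form_inner_homogeneous_0: "homogeneous 0 \<alpha> \<Longrightarrow> form_inner E \<alpha> \<beta> = \<alpha> [] * \<beta> []"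
  by (induction E) (simp_all add: form_inner_Cons interior_homogeneous_0)

lemma form_inner_interior_commute:
  assumes "alternating \<alpha>" "alternating \<beta>"
  shows "form_inner E (interior u (interior v \<alpha>)) (interior u (interior v \<beta>)) =
    form_inner E (interior v (interior u \<alpha>)) (interior v (interior u \<beta>))"
proof -
  have "interior u (interior v \<gamma>) vs = - interior v (interior u \<gamma>) vs" if "alternating \<gamma>" for \<gamma> vs
    using alternating_swap[OF that, of "[]" v u vs] by (simp add: interior_def)
  then show ?thesis using assms by (simp add: form_inner_def)
qed

lemma form_inner_contract:
  assumes "alternating \<alpha>" "alternating \<beta>" "homogeneous k \<alpha>"
  shows "(\<Sum>x\<leftarrow>E. form_inner E (interior x \<alpha>) (interior x \<beta>)) = real k * form_inner E \<alpha> \<beta>"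
  using assms
proof (induction E arbitrary: \<alpha> \<beta> k)
  case Nil
  then show ?case by (cases "k = 0") (auto simp: homogeneous_def)
next
  case (Cons e E)
  show ?case
  proof (cases k)
    case 0
    then have "interior x \<alpha> = (\<lambda>_. 0)" for x using Cons.prems by (simp add: interior_homogeneous_0)
    then show ?thesis using 0 by (simp add: sum_list_0)
  next
    case (Suc l)
    note ae = alternating_interior[OF Cons.prems(1), of e] and be = alternating_interior[OF Cons.prems(2), of e]
    have "(\<Sum>x\<leftarrow>e # E. form_inner (e # E) (interior x \<alpha>) (interior x \<beta>)) =
      form_inner E (interior e \<alpha>) (interior e \<beta>) +
      ((\<Sum>x\<leftarrow>E. form_inner E (interior x \<alpha>) (interior x \<beta>)) +
       (\<Sum>x\<leftarrow>E. form_inner E (interior x (interior e \<alpha>)) (interior x (interior e \<beta>))))"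
      using Cons.prems(1,2)
      by (simp add: form_inner_Cons alternating_interior_interior form_inner_interior_commute[of \<alpha> \<beta> _ e] sum_list_addf)
    also have "\<dots> = form_inner E (interior e \<alpha>) (interior e \<beta>) + (real k * form_inner E \<alpha> \<beta> +
       real l * form_inner E (interior e \<alpha>) (interior e \<beta>))"
      using Cons.IH[OF Cons.prems] Cons.IH[OF ae be, of l] Cons.prems(3) Suc by (simp add: homogeneous_interior)
    finally show ?thesis by (simp add: form_inner_Cons Suc algebra_simps)
  qed
qed

definition cogram :: "(real^7) list \<Rightarrow> 7 \<Rightarrow> 7 \<Rightarrow> real" where
  "cogram E a b = (\<Sum>x\<leftarrow>E. x $ a * x $ b)"

lemma linear_axis_expand: "linear u \<Longrightarrow> u x = (\<Sum>a\<in>UNIV. x $ a * u (axis a (1::real)))" for u :: "real^'n \<Rightarrow> real"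
proof -
  assume u: "linear u"
  have "u (\<Sum>a\<in>UNIV. x $ a *\<^sub>R axis a 1) = (\<Sum>a\<in>UNIV. x $ a * u (axis a 1))"
    by (simp add: linear_sum[OF u] linear_scale[OF u])
  moreover have "(\<Sum>a\<in>UNIV. x $ a *\<^sub>R axis a 1) = x"
    using basis_expansion[of x] by (simp add: scalar_mult_eq_scaleR)
  ultimately show ?thesis by simp
qed

lemma sum_list_cogram:
  assumes "linear u" "linear w"
  shows "(\<Sum>x\<leftarrow>E. u x * w x) = (\<Sum>a\<in>UNIV. \<Sum>b\<in>UNIV. cogram E a b * (u (axis a 1) * w (axis b 1)))"
proof -
  have "(\<Sum>x\<leftarrow>E. u x * w x) = (\<Sum>x\<leftarrow>E. \<Sum>a\<in>UNIV. \<Sum>b\<in>UNIV. (x $ a * x $ b) * (u (axis a 1) * w (axis b 1)))"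
  proof (rule arg_cong[where f = sum_list], rule map_cong, simp)
    fix x
    show "u x * w x = (\<Sum>a\<in>UNIV. \<Sum>b\<in>UNIV. (x $ a * x $ b) * (u (axis a 1) * w (axis b 1)))"
      by (subst linear_axis_expand[OF assms(1)], subst linear_axis_expand[OF assms(2)])
        (simp add: sum_product algebra_simps)
  qed
  also have "\<dots> = (\<Sum>a\<in>UNIV. \<Sum>b\<in>UNIV. cogram E a b * (u (axis a 1) * w (axis b 1)))"
    by (induction E) (simp_all add: cogram_def sum.distrib distrib_right)
  finally show ?thesis .
qed

lemma inner_product_linear: "inner_product g \<Longrightarrow> linear (g v)"
  and inner_product_sym: "inner_product g \<Longrightarrow> g v w = g w v"
  by (auto simp: inner_product_def)

lemma orthonormal_expand:
  assumes "inner_product g" "orthonormal_basis g E"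
  shows "v = (\<Sum>i<length E. g (E ! i) v *\<^sub>R E ! i)"
  by (rule dual_basis_span(2)) (use assms in \<open>auto simp: orthonormal_basis_def inner_product_linear\<close>)

lemma cogram_inverse:
  fixes g :: "real^7 \<Rightarrow> real^7 \<Rightarrow> real"
  assumes "inner_product g" "orthonormal_basis g E"
  shows "(\<Sum>b\<in>UNIV. cogram E a b * g (axis b 1) v) = v $ a"
proof -
  have "v $ a = (\<Sum>i<length E. g (E ! i) v * E ! i $ a)"
    by (subst orthonormal_expand[OF assms, of v]) simp
  also have "\<dots> = (\<Sum>x\<leftarrow>E. x $ a * g x v)"
    by (simp add: sum_list_sum_nth atLeast0LessThan mult.commute)
  also have "\<dots> = (\<Sum>x\<leftarrow>E. \<Sum>b\<in>UNIV. (x $ a * x $ b) * g (axis b 1) v)"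
  proof (rule arg_cong[where f = sum_list], rule map_cong, simp)
    fix x
    show "x $ a * g x v = (\<Sum>b\<in>UNIV. (x $ a * x $ b) * g (axis b 1) v)"
      using linear_axis_expand[OF inner_product_linear[OF assms(1)], of v x]
      by (simp add: inner_product_sym[OF assms(1), of _ v] sum_distrib_left mult.assoc)
  qed
  also have "\<dots> = (\<Sum>b\<in>UNIV. cogram E a b * g (axis b 1) v)"
    by (induction E) (simp_all add: cogram_def sum.distrib distrib_right)
  finally show ?thesis by simp
qed

lemma cogram_unique:
  fixes g :: "real^7 \<Rightarrow> real^7 \<Rightarrow> real"
  assumes g: "inner_product g" and E: "orthonormal_basis g E" and E': "orthonormal_basis g E'"
  shows "cogram E = cogram E'"
proof (intro ext)
  fix a c
  have "(\<Sum>b\<in>UNIV. cogram E a b * (\<Sum>d\<in>UNIV. cogram E' c d * g (axis d 1) (axis b 1))) = cogram E a c"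
    unfolding cogram_inverse[OF g E'] by (simp add: axis_def if_distrib cong: if_cong)
  moreover have "(\<Sum>b\<in>UNIV. cogram E a b * (\<Sum>d\<in>UNIV. cogram E' c d * g (axis d 1) (axis b 1))) =
    (\<Sum>d\<in>UNIV. cogram E' c d * (\<Sum>b\<in>UNIV. cogram E a b * g (axis b 1) (axis d 1)))"
    unfolding sum_distrib_left by (subst sum.swap) (simp add: inner_product_sym[OF g] algebra_simps)
  moreover have "\<dots> = cogram E' c a"
    unfolding cogram_inverse[OF g E] by (simp add: axis_def if_distrib cong: if_cong)
  moreover have "cogram E' c a = cogram E' a c" by (simp add: cogram_def mult.commute)
  ultimately show "cogram E a c = cogram E' a c" by simp
qed

lemma form_inner_invariant:
  fixes g :: "real^7 \<Rightarrow> real^7 \<Rightarrow> real"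
  assumes g: "inner_product g" and E: "orthonormal_basis g E" and E': "orthonormal_basis g E'"
    and "alternating \<alpha>" "alternating \<beta>" "homogeneous k \<alpha>"
  shows "form_inner E \<alpha> \<beta> = form_inner E' \<alpha> \<beta>"
  using assms(4-6)
proof (induction k arbitrary: \<alpha> \<beta>)
  case 0
  then show ?case by (simp add: form_inner_homogeneous_0)
next
  case (Suc k)
  have lin: "linear (\<lambda>x. interior x \<gamma> vs)" if "alternating \<gamma>" for \<gamma> :: "(real^7) form" and vs
    using alternating_linear[OF that, of "[]"] by (simp add: interior_def)
  have sw: "(\<Sum>x\<leftarrow>F. form_inner E' (interior x \<alpha>) (interior x \<beta>)) =
    (\<Sum>I\<in>Pow {..<length E'}. \<Sum>x\<leftarrow>F. interior x \<alpha> (nths E' I) * interior x \<beta> (nths E' I))" for F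
    unfolding form_inner_def by (induction F) (simp_all add: sum.distrib)
  have "real (Suc k) * form_inner E \<alpha> \<beta> = (\<Sum>x\<leftarrow>E. form_inner E (interior x \<alpha>) (interior x \<beta>))"
    by (rule form_inner_contract[OF Suc.prems, symmetric])
  also have "\<dots> = (\<Sum>x\<leftarrow>E. form_inner E' (interior x \<alpha>) (interior x \<beta>))"
    using Suc.IH Suc.prems by (simp add: alternating_interior homogeneous_interior)
  also have "\<dots> = (\<Sum>x\<leftarrow>E'. form_inner E' (interior x \<alpha>) (interior x \<beta>))"
    unfolding sw sum_list_cogram[OF lin[OF Suc.prems(1)] lin[OF Suc.prems(2)]] cogram_unique[OF g E E'] ..
  also have "\<dots> = real (Suc k) * form_inner E' \<alpha> \<beta>"
    by (rule form_inner_contract[OF Suc.prems])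
  finally show ?case by (simp del: of_nat_Suc)
qed

text \<open>The Hodge star computed in an orthonormal basis \<open>E\<close>.\<close>

definition star_formula :: "'a list \<Rightarrow> 'a form \<Rightarrow> 'a form \<Rightarrow> 'a form" where
  "star_formula E vol \<beta> = (\<lambda>w. form_inner E \<beta> (\<lambda>vs. vol (vs @ w)))"

lemma alternating_star_formula:
  assumes "alternating vol"
  shows "alternating (star_formula E vol \<beta>)"
proof -
  have "alternating (\<lambda>w. \<beta> (nths E I) * vol (nths E I @ w))" for I
    using alternating_linear[OF assms, of "nths E I @ _"] alternating_adjacent[OF assms, of "nths E I @ _"]
    by (intro alternating_scaled alternatingI) auto
  then show ?thesis unfolding star_formula_def form_inner_def by (rule alternating_sum_forms)
qed

lemma homogeneous_star_formula:
  assumes "homogeneous k \<beta>" "homogeneous n vol"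
  shows "homogeneous (n - k) (star_formula E vol \<beta>)"
proof -
  have "\<beta> (nths E I) * vol (nths E I @ w) = 0" if "length w \<noteq> n - k" for I w
    using assms that by (cases "length (nths E I) = k") (auto simp: homogeneous_def)
  then show ?thesis
    unfolding homogeneous_def star_formula_def form_inner_def by (intro allI impI sum.neutral ballI)
qed

lemma alternating_shuffle:
  assumes "alternating \<phi>" "J \<subseteq> {..<length E}"
  shows "\<phi> (nths E J @ nths E ({..<length E} - J)) = shuffle_sign (length E) J * \<phi> E"
  using assms
proof (induction E arbitrary: \<phi> J)
  case Nil
  then show ?case by (simp add: shuffle_sign_def)
next
  case (Cons e E)
  let ?n = "length E"
  from Cons.prems(2) have "J \<in> Pow {..<Suc ?n}" by simp
  then obtain K where K: "K \<subseteq> {..<?n}" and "J = insert 0 (Suc ` K) \<or> J = Suc ` K"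
    unfolding Pow_lessThan_Suc by blast
  then consider "J = insert 0 (Suc ` K)" | "J = Suc ` K" by blast
  then show ?case
  proof cases
    case 1
    have "{..<Suc ?n} - insert 0 (Suc ` K) = Suc ` ({..<?n} - K)"
      by (auto simp: lessThan_Suc_eq_insert_0)
    then show ?thesis
      using Cons.IH[OF alternating_interior[OF Cons.prems(1), of e] K] 1
      by (simp add: nths_insert_0 nths_Suc_image shuffle_sign_insert_0 interior_def)
  next
    case 2
    have "{..<Suc ?n} - Suc ` K = insert 0 (Suc ` ({..<?n} - K))"
      by (auto simp: lessThan_Suc_eq_insert_0)
    then show ?thesis
      using Cons.IH[OF alternating_interior[OF Cons.prems(1), of e] K] 2 K
        alternating_move[OF Cons.prems(1), of "nths E K" e "nths E ({..<?n} - K)"]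
      by (simp add: nths_insert_0 nths_Suc_image shuffle_sign_Suc_image interior_def length_nths_subset)
  qed
qed

lemma alternating_nths_overlap:
  assumes "alternating \<phi>" "I \<subseteq> {..<length E}" "J \<subseteq> {..<length E}" "card I = card J" "I \<noteq> J"
  shows "\<phi> (nths E I @ nths E ({..<length E} - J)) = 0"
proof -
  have "finite I" "finite J" using assms finite_subset by blast+
  then have "\<not> I \<subseteq> J" using assms(4,5) card_subset_eq by blast
  then obtain i where "i \<in> I" "i \<notin> J" by blast
  then have "E ! i \<in> set (nths E I) \<inter> set (nths E ({..<length E} - J))"
    using assms(2) by (auto simp: set_nths)
  then show ?thesis by (intro alternating_not_distinct[OF assms(1)]) auto
qed

lemma wedge_star_formula:
  assumes "alternating vol" "alternating \<alpha>" "homogeneous k \<alpha>" "homogeneous k \<beta>"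
  shows "wedge \<alpha> (star_formula E vol \<beta>) E = form_inner E \<alpha> \<beta> * vol E"
proof -
  let ?n = "{..<length E}"
  have star: "star_formula E vol \<beta> (nths E (?n - J)) = \<beta> (nths E J) * (shuffle_sign (length E) J * vol E)"
    if J: "J \<subseteq> ?n" "card J = k" for J
  proof -
    have "star_formula E vol \<beta> (nths E (?n - J)) =
      (\<Sum>I\<in>Pow ?n. if I = J then \<beta> (nths E J) * vol (nths E J @ nths E (?n - J)) else 0)"
      unfolding star_formula_def form_inner_def
    proof (rule sum.cong)
      fix I assume "I \<in> Pow ?n"
      then show "\<beta> (nths E I) * vol (nths E I @ nths E (?n - J)) =
        (if I = J then \<beta> (nths E J) * vol (nths E J @ nths E (?n - J)) else 0)"
        using J alternating_nths_overlap[OF assms(1), of I E J] assms(4)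
        by (cases "card I = k") (auto simp: homogeneous_def length_nths_subset)
    qed simp
    also have "\<dots> = \<beta> (nths E J) * vol (nths E J @ nths E (?n - J))"
      using J by (simp add: finite_Pow_iff)
    finally show ?thesis by (simp add: alternating_shuffle[OF assms(1) J(1)])
  qed
  have s2: "shuffle_sign n J * shuffle_sign n J = 1" for n J
    by (simp add: shuffle_sign_def flip: power_add mult_2)
  show ?thesis
    unfolding wedge_def form_inner_def sum_distrib_right
  proof (rule sum.cong)
    fix J assume "J \<in> Pow ?n"
    then show "shuffle_sign (length E) J * \<alpha> (nths E J) * star_formula E vol \<beta> (nths E (?n - J)) =
      \<alpha> (nths E J) * \<beta> (nths E J) * vol E"
      using star[of J] s2[of "length E" J] assms(3)
      by (cases "card J = k") (auto simp: homogeneous_def length_nths_subset algebra_simps)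
  qed simp
qed

lemma wedge_nondegenerate:
  fixes \<theta> :: "(real^7) form"
  assumes f: "frame f" and \<theta>: "alternating \<theta>" "homogeneous (7 - k) \<theta>" and k: "k \<le> 7"
    and zero: "\<And>\<alpha>. alternating \<alpha> \<Longrightarrow> homogeneous k \<alpha> \<Longrightarrow> wedge \<alpha> \<theta> f = 0"
  shows "\<theta> = (\<lambda>_. 0)"
proof (rule homogeneous_frame_eqI[OF \<theta>(1) _ \<theta>(2) _ f])
  fix K :: "nat set" assume K: "K \<subseteq> {..<7}" "card K = 7 - k"
  define J where "J = {..<7} - K"
  have len: "length f = 7" by (rule frame_length[OF f])
  have J: "J \<subseteq> {..<length f}" "{..<7} - J = K" "card J = k"
    using K k len by (auto simp: J_def card_Diff_subset finite_subset[OF K(1)])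
  let ?\<alpha> = "\<lambda>vs. vol0 (vs @ nths f K)"
  have "alternating ?\<alpha>"
    using alternating_linear[OF alternating_vol0, of _ "_ @ nths f K"]
      alternating_adjacent[OF alternating_vol0, of _ _ "_ @ nths f K"]
    by (intro alternatingI) auto
  moreover have "homogeneous k ?\<alpha>"
    using K k len by (auto simp: homogeneous_def vol0_def length_nths_subset)
  ultimately have "wedge ?\<alpha> \<theta> f = 0" by (rule zero)
  moreover have "wedge ?\<alpha> \<theta> f = (\<Sum>I\<in>Pow {..<length f}.
    if I = J then shuffle_sign 7 J * (shuffle_sign 7 J * vol0 f) * \<theta> (nths f K) else 0)"
    unfolding wedge_def
  proof (rule sum.cong)
    fix I assume I: "I \<in> Pow {..<length f}"
    show "shuffle_sign (length f) I * vol0 (nths f I @ nths f K) * \<theta> (nths f ({..<length f} - I)) =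
      (if I = J then shuffle_sign 7 J * (shuffle_sign 7 J * vol0 f) * \<theta> (nths f K) else 0)"
    proof (cases "card I = k")
      case True
      then show ?thesis
        using I J len alternating_nths_overlap[OF alternating_vol0, of I f J]
          alternating_shuffle[OF alternating_vol0 J(1)] by auto
    next
      case False
      then have "length (nths f I @ nths f K) \<noteq> 7" using I K len k by (simp add: length_nths_subset)
      then show ?thesis using False J by (auto simp: vol0_def)
    qed
  qed simp
  ultimately show "\<theta> (nths f K) = 0"
    using J f by (auto simp: frame_def shuffle_sign_def split: if_splits)
qed (auto simp: homogeneous_def)

lemma hodge_star_eq:
  fixes g :: "real^7 \<Rightarrow> real^7 \<Rightarrow> real"
  assumes g: "inner_product g" and vol: "unit_volume g vol" and E: "orthonormal_basis g E"
    and \<beta>: "alternating \<beta>" "homogeneous k \<beta>" and k: "k \<le> 7"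
  shows "hodge_star g vol k \<beta> = star_formula E vol \<beta>"
proof -
  have a: "alternating vol" "homogeneous 7 vol" and "vol E \<noteq> 0"
    using vol E by (auto simp: unit_volume_def)
  then have f: "frame E" using top_form_eq_std[OF a, of E] by (auto simp: frame_def)
  have S: "alternating (star_formula E vol \<beta>)" "homogeneous (7 - k) (star_formula E vol \<beta>)"
    by (rule alternating_star_formula[OF a(1)], rule homogeneous_star_formula[OF \<beta>(2) a(2)])
  have top: "homogeneous 7 (wedge \<alpha> \<theta>)" if "homogeneous k \<alpha>" "homogeneous (7 - k) \<theta>" for \<alpha> \<theta> :: "(real^7) form"
    using homogeneous_wedge[OF that] k by simp
  show ?thesis
    unfolding hodge_star_def
  proof (rule the_equality)
    have "wedge \<alpha> (star_formula E vol \<beta>) = (\<lambda>vs. form_inner E' \<alpha> \<beta> * vol vs)"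
      if \<alpha>: "alternating \<alpha>" "homogeneous k \<alpha>" and E': "orthonormal_basis g E'" for \<alpha> E'
    proof (rule top_form_eqI[OF _ _ _ _ f])
      show "wedge \<alpha> (star_formula E vol \<beta>) E = form_inner E' \<alpha> \<beta> * vol E"
        using wedge_star_formula[OF a(1) \<alpha> \<beta>(2)] form_inner_invariant[OF g E E' \<alpha>(1) \<beta>(1) \<alpha>(2)] by simp
    qed (use \<alpha> a S top in \<open>auto intro: alternating_wedge alternating_scaled simp: homogeneous_def\<close>)
    then show "alternating (star_formula E vol \<beta>) \<and> homogeneous (DIM(real^7) - k) (star_formula E vol \<beta>) \<and>
      (\<forall>\<alpha> E'. alternating \<alpha> \<and> homogeneous k \<alpha> \<and> orthonormal_basis g E' \<longrightarrow>
        wedge \<alpha> (star_formula E vol \<beta>) = (\<lambda>vs. form_inner E' \<alpha> \<beta> * vol vs))"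
      using S by simp
  next
    fix \<theta> :: "(real^7) form"
    assume \<theta>: "alternating \<theta> \<and> homogeneous (DIM(real^7) - k) \<theta> \<and>
      (\<forall>\<alpha> E'. alternating \<alpha> \<and> homogeneous k \<alpha> \<and> orthonormal_basis g E' \<longrightarrow>
        wedge \<alpha> \<theta> = (\<lambda>vs. form_inner E' \<alpha> \<beta> * vol vs))"
    have "(\<lambda>w. \<theta> w - star_formula E vol \<beta> w) = (\<lambda>_. 0)"
    proof (rule wedge_nondegenerate[OF f _ _ k])
      fix \<alpha> :: "(real^7) form" assume \<alpha>: "alternating \<alpha>" "homogeneous k \<alpha>"
      then have "wedge \<alpha> \<theta> E = form_inner E \<alpha> \<beta> * vol E" using \<theta> E by metis
      then show "wedge \<alpha> (\<lambda>w. \<theta> w - star_formula E vol \<beta> w) E = 0"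
        using wedge_star_formula[OF a(1) \<alpha> \<beta>(2)] by (simp add: wedge_diff_right)
    qed (use \<theta> S in \<open>auto intro: alternating_diff simp: homogeneous_def\<close>)
    then show "\<theta> = star_formula E vol \<beta>" by (simp add: fun_eq_iff)
  qed
qed

section \<open>Coordinates on 3-forms and 2-forms\<close>

lemma interior_du: "interior v (du i) = (\<lambda>vs. v $ i * unit_form vs)"
  by (auto simp: interior_def du_def unit_form_def)

lemma homogeneous_du: "homogeneous 1 (du i)"
  by (simp add: homogeneous_def du_def)

lemma hat_du: "hat (du i) = (\<lambda>vs. - du i vs)"
  using hat_homogeneous[OF homogeneous_du] by simp

lemma alternating_du: "alternating (du i)"
proof (rule alternatingI)
  show "linear (\<lambda>v. du i (xs @ v # ys))" for xs ys
    by (cases xs) (auto simp: du_def intro!: linearI)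
qed (simp add: du_def)

lemma wedge_du_Cons: "wedge (du i) \<psi> (v # vs) = v $ i * \<psi> vs - wedge (du i) (interior v \<psi>) vs"
  by (simp add: wedge_Cons interior_du hat_du wedge_scale_left wedge_minus_left wedge_unit_form_left)

lemma wedge_du_zero: "\<forall>v\<in>set vs. v $ i = 0 \<Longrightarrow> wedge (du i) \<psi> vs = 0"
  by (induction vs arbitrary: \<psi>) (simp_all add: wedge_du_Cons, simp add: du_def)

abbreviation du_list :: "7 list \<Rightarrow> (real^7) form" where
  "du_list is \<equiv> foldr (\<lambda>i. wedge (du i)) is unit_form"

lemma alternating_du_list: "alternating (du_list is)"
  by (induction "is") (simp_all add: alternating_unit_form alternating_wedge alternating_du)

lemma homogeneous_du_list: "homogeneous (length is) (du_list is)"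
  by (induction "is") (use homogeneous_wedge[OF homogeneous_du] in \<open>simp_all add: homogeneous_unit_form\<close>)

lemma interior_du_list_zero: "\<forall>i\<in>set is. v $ i = 0 \<Longrightarrow> interior v (du_list is) = (\<lambda>_. 0)"
proof (induction "is")
  case Nil
  then show ?case by (auto simp: interior_def unit_form_def)
next
  case (Cons i "is")
  then show ?case
    by (simp add: interior_wedge interior_du wedge_zero_left wedge_zero_right)
qed

lemma du_list_axis:
  assumes "sorted_wrt (<) is" "sorted_wrt (<) js" "length is = length js"
  shows "du_list is (map (\<lambda>j. axis j 1) js) = (if is = js then 1 else 0)"
  using assms
proof (induction "is" arbitrary: js)
  case Nil
  then show ?case by (simp add: unit_form_def)
next
  case (Cons i "is")
  then obtain j js' where js: "js = j # js'" by (cases js) auto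
  let ?m = "map (\<lambda>j. axis j (1::real))"
  have IH: "du_list is (?m js') = (if is = js' then 1 else 0)"
    using Cons js by simp
  have 0: "wedge (du i) (interior (axis j 1) (du_list is)) (?m js') = 0"
  proof (cases "i < j")
    case True
    then show ?thesis using Cons.prems js by (intro wedge_du_zero) (auto simp: axis_def)
  next
    case False
    then have "interior (axis j 1) (du_list is) = (\<lambda>_. 0)"
      using Cons.prems js by (intro interior_du_list_zero) (auto simp: axis_def)
    then show ?thesis by (simp add: wedge_zero_right)
  qed
  show ?case unfolding js by (simp add: wedge_du_Cons 0 IH) (auto simp: axis_def)
qed

definition axis_list :: "7 set \<Rightarrow> (real^7) list" where
  "axis_list I = map (\<lambda>i. axis i 1) (sorted_list_of_set I)"

lemma length_axis_list [simp]: "length (axis_list I) = card I"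
  by (simp add: axis_list_def)

lemma du_monomial_axis_list:
  "card I = card J \<Longrightarrow> du_monomial I (axis_list J) = (if I = J then 1 else 0)"
  unfolding du_monomial_def axis_list_def
  by (subst du_list_axis) (auto dest: arg_cong[where f = set])

lemma nths_std:
  assumes "K \<subseteq> {..<7}"
  shows "nths std K = axis_list (ix ` K)"
proof -
  let ?l = "filter (\<lambda>i. i \<in> K) [0..<7]"
  have "sorted_wrt (<) (map ix ?l)"
    unfolding sorted_wrt_map
    by (rule sorted_wrt_mono_rel[of _ "(<)"]) (auto simp: ix_strict_mono intro: sorted_wrt_filter)
  moreover have "set (map ix ?l) = ix ` K" using assms by auto
  ultimately have "map ix ?l = sorted_list_of_set (ix ` K)"
    by (metis sorted_list_of_set.idem_if_sorted_distinct strict_sorted_iff)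
  moreover have "nths std K = map (\<lambda>i. axis i 1) (map ix ?l)"
    unfolding nths_eq_map_filter length_std map_map o_def by (rule map_cong) (auto simp: ax_def)
  ultimately show ?thesis by (simp only: axis_list_def)
qed

lemma card_ix: "K \<subseteq> {..<7} \<Longrightarrow> card (ix ` K) = card K"
  by (rule card_image) (meson bij_betw_imp_inj_on bij_ix inj_on_subset)

lemma homogeneous_axis_eqI:
  assumes "alternating \<phi>" "alternating \<psi>" "homogeneous k \<phi>" "homogeneous k \<psi>"
    and "\<And>I. card I = k \<Longrightarrow> \<phi> (axis_list I) = \<psi> (axis_list I)"
  shows "\<phi> = \<psi>"
  by (rule homogeneous_frame_eqI[OF assms(1-4) frame_std]) (simp add: nths_std assms(5) card_ix)

lemma alternating_du_monomial: "alternating (du_monomial I)"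
  by (simp add: du_monomial_def alternating_du_list)

lemma homogeneous_du_monomial: "homogeneous (card I) (du_monomial I)"
  unfolding du_monomial_def using homogeneous_du_list[of "sorted_list_of_set I"] by simp

lemma card_Rep_triples [simp]: "card (Rep_triples I) = 3"
  using Rep_triples[of I] by simp

lemma card_Rep_pairs [simp]: "card (Rep_pairs I) = 2"
  using Rep_pairs[of I] by simp

lemma alternating_form3: "alternating (form3 a)"
  unfolding form3_def by (intro alternating_sum_forms alternating_scaled alternating_du_monomial)

lemma alternating_form2: "alternating (form2 a)"
  unfolding form2_def by (intro alternating_sum_forms alternating_scaled alternating_du_monomial)

lemma homogeneous_form3: "homogeneous 3 (form3 a)"
  using homogeneous_du_monomial[of "Rep_triples _"] by (auto simp: homogeneous_def form3_def)

lemma homogeneous_form2: "homogeneous 2 (form2 a)"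
  using homogeneous_du_monomial[of "Rep_pairs _"] by (auto simp: homogeneous_def form2_def)

lemma form3_axis_list: "form3 a (axis_list (Rep_triples J)) = a $ J"
  by (simp add: form3_def du_monomial_axis_list Rep_triples_inject if_distrib cong: if_cong)

lemma form2_axis_list: "form2 a (axis_list (Rep_pairs J)) = a $ J"
  by (simp add: form2_def du_monomial_axis_list Rep_pairs_inject if_distrib cong: if_cong)

definition coords3 :: "(real^7) form \<Rightarrow> real^triples" where
  "coords3 s = (\<chi> I. s (axis_list (Rep_triples I)))"

definition coords2 :: "(real^7) form \<Rightarrow> real^pairs" where
  "coords2 s = (\<chi> I. s (axis_list (Rep_pairs I)))"

lemma form3_coords3:
  assumes "alternating s" "homogeneous 3 s"
  shows "form3 (coords3 s) = s"
proof (rule homogeneous_axis_eqI[OF alternating_form3 assms(1) homogeneous_form3 assms(2)])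
  fix I :: "7 set" assume "card I = 3"
  then have "I = Rep_triples (Abs_triples I)" by (simp add: Abs_triples_inverse)
  then show "form3 (coords3 s) (axis_list I) = s (axis_list I)"
    using form3_axis_list[of "coords3 s" "Abs_triples I"] by (simp add: coords3_def)
qed

lemma form2_coords2:
  assumes "alternating s" "homogeneous 2 s"
  shows "form2 (coords2 s) = s"
proof (rule homogeneous_axis_eqI[OF alternating_form2 assms(1) homogeneous_form2 assms(2)])
  fix I :: "7 set" assume "card I = 2"
  then have "I = Rep_pairs (Abs_pairs I)" by (simp add: Abs_pairs_inverse)
  then show "form2 (coords2 s) (axis_list I) = s (axis_list I)"
    using form2_axis_list[of "coords2 s" "Abs_pairs I"] by (simp add: coords2_def)
qed

lemma coords3_form3 [simp]: "coords3 (form3 a) = a"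
  by (simp add: coords3_def form3_axis_list)

lemma coords2_form2 [simp]: "coords2 (form2 a) = a"
  by (simp add: coords2_def form2_axis_list)

lemma linear_form3: "linear (\<lambda>a. form3 a vs)"
  by (intro linearI) (simp_all add: form3_def algebra_simps sum.distrib sum_distrib_left)

lemma linear_form2: "linear (\<lambda>a. form2 a vs)"
  by (intro linearI) (simp_all add: form2_def algebra_simps sum.distrib sum_distrib_left)

lemma form3_zero_iff: "form3 a = (\<lambda>_. 0) \<longleftrightarrow> a = 0"
proof -
  have "form3 0 = (\<lambda>_. 0)" by (simp add: form3_def)
  then show ?thesis by (metis coords3_form3)
qed

lemma form2_zero_iff: "form2 a = (\<lambda>_. 0) \<longleftrightarrow> a = 0"
proof -
  have "form2 0 = (\<lambda>_. 0)" by (simp add: form2_def)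
  then show ?thesis by (metis coords2_form2)
qed

lemma CARD_triples: "CARD(triples) = 35"
proof -
  have "CARD(triples) = card {I :: 7 set. card I = 3}"
    using type_definition.card[OF type_definition_triples] by simp
  also have "\<dots> = card {I. I \<subseteq> (UNIV :: 7 set) \<and> card I = 3}" by simp
  also have "\<dots> = 7 choose 3" by (subst n_subsets) auto
  finally show ?thesis by (simp add: numeral_eq_Suc)
qed

lemma CARD_pairs: "CARD(pairs) = 21"
proof -
  have "CARD(pairs) = card {I :: 7 set. card I = 2}"
    using type_definition.card[OF type_definition_pairs] by simp
  also have "\<dots> = card {I. I \<subseteq> (UNIV :: 7 set) \<and> card I = 2}" by simp
  also have "\<dots> = 7 choose 2" by (subst n_subsets) auto
  finally show ?thesis by (simp add: numeral_eq_Suc)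
qed

section \<open>The normal form of definite 3-forms\<close>

text \<open>The sign of \<open>\<phi>\<^sub>0\<close> is chosen such that the adapted frames have volume \<open>1\<close>.\<close>

definition phi0 :: "nat list \<Rightarrow> real" where
  "phi0 is = (if is \<in> {[0,1,2], [0,3,4], [1,3,5], [1,4,6], [2,3,6]} then -1
    else if is \<in> {[0,5,6], [2,4,5]} then 1 else 0)"

definition phi :: "nat list \<Rightarrow> real" where
  "phi is = psign is * phi0 (sort is)"

definition adapted :: "(real^7) form \<Rightarrow> (real^7) list \<Rightarrow> bool" where
  "adapted s f \<longleftrightarrow> frame f \<and>
    (\<forall>i j k. i < j \<and> j < k \<and> k < 7 \<longrightarrow> s [f ! i, f ! j, f ! k] = phi0 [i, j, k])"

definition cub :: "(real^7) form \<Rightarrow> real^7 \<Rightarrow> real^7 \<Rightarrow> real" where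
  "cub s v w = wedge (wedge (interior v s) (interior w s)) s std"

context
  fixes s :: "(real^7) form"
  assumes s: "alternating s" "homogeneous 3 s"
begin

lemma homogeneous_interior_s: "homogeneous 2 (interior v s)"
  using homogeneous_interior[of 2 s v] s by (simp add: numeral_eq_Suc)

lemma homogeneous_cub: "homogeneous 4 (wedge (interior v s) (interior w s))"
  using homogeneous_wedge[OF homogeneous_interior_s homogeneous_interior_s] by simp

lemma cub_vol: "wedge (wedge (interior v s) (interior w s)) s vs = cub s v w * vol0 vs"
proof -
  have "homogeneous 7 (wedge (wedge (interior v s) (interior w s)) s)"
    using homogeneous_wedge[OF homogeneous_cub s(2)] by simp
  then show ?thesis
    unfolding cub_def using s by (intro top_form_eq_std alternating_wedge alternating_interior)
qed

lemma cub_shuf: "cub s v w * vol0 vs = shuf (wedge (interior v s) (interior w s)) s 4 [] [] vs"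
  by (simp only: cub_vol[symmetric] wedge_eq_shuf[OF homogeneous_cub])

lemma wedge_interior_shuf: "wedge (interior v s) b vs = shuf (interior v s) b 2 [] [] vs"
  by (rule wedge_eq_shuf[OF homogeneous_interior_s])

lemma cub_sym: "cub s v w = cub s w v"
  unfolding cub_def using wedge_commute[OF homogeneous_interior_s homogeneous_interior_s, of v w] by simp

lemma linear_cub: "linear (cub s v)"
  by (intro linearI)
    (simp_all add: cub_def interior_add_vec interior_scale_vec s(1) wedge_add_left wedge_add_right
      wedge_scale_left wedge_scale_right)

lemma cub_add_right: "cub s v (x + y) = cub s v x + cub s v y"
  and cub_scale_right: "cub s v (r *\<^sub>R x) = r * cub s v x"
  using linear_add[OF linear_cub] linear_scale[OF linear_cub] by auto

lemma cub_add_left: "cub s (x + y) v = cub s x v + cub s y v"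
  and cub_scale_left: "cub s (r *\<^sub>R x) v = r * cub s x v"
  using cub_add_right cub_scale_right cub_sym by metis+

lemma trilinear:
  "s [x + x', y, z] = s [x, y, z] + s [x', y, z]"
  "s [x, y + y', z] = s [x, y, z] + s [x, y', z]"
  "s [x, y, z + z'] = s [x, y, z] + s [x, y, z']"
  "s [r *\<^sub>R x, y, z] = r * s [x, y, z]"
  "s [x, r *\<^sub>R y, z] = r * s [x, y, z]"
  "s [x, y, r *\<^sub>R z] = r * s [x, y, z]"
  "s [x, x, z] = 0" "s [x, z, z] = 0" "s [x, y, x] = 0"
  using alternating_add[OF s(1), of "[]"] alternating_add[OF s(1), of "[x]"] alternating_add[OF s(1), of "[x, y]"]
    alternating_scale[OF s(1), of "[]"] alternating_scale[OF s(1), of "[x]"] alternating_scale[OF s(1), of "[x, y]"]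
    alternating_not_distinct[OF s(1), of "[x, x, z]"] alternating_not_distinct[OF s(1), of "[x, z, z]"]
    alternating_not_distinct[OF s(1), of "[x, y, x]"]
  by simp_all

lemma swap12: "s [x, y, z] = - s [y, x, z]"
  and swap23: "s [x, y, z] = - s [x, z, y]"
  using alternating_swap[OF s(1), of "[]" x y "[z]"] alternating_swap[OF s(1), of "[x]" y z "[]"] by simp_all

end

lemma definite_forms: "definite s \<Longrightarrow> alternating s" "definite s \<Longrightarrow> homogeneous 3 s"
  by (auto simp: definite_def)

lemma definite_cub:
  assumes "definite s" "v \<noteq> 0"
  shows "cub s v v \<noteq> 0"
proof
  assume "cub s v v = 0"
  then have "wedge (wedge (interior v s) (interior v s)) s = (\<lambda>vs. 0)"
    using cub_vol[OF definite_forms[OF assms(1)], of v v] by auto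
  then show False using assms by (simp add: definite_def)
qed

lemma definite_sign:
  assumes d: "definite s"
  obtains e :: real where "e = 1 \<or> e = -1" "\<And>v. v \<noteq> 0 \<Longrightarrow> e * cub s v v > 0"
proof -
  note s = definite_forms[OF d]
  have "\<not> (cub s v v > 0 \<and> cub s w w < 0)" if "v \<noteq> 0" "w \<noteq> 0" for v w
  proof
    assume vw: "cub s v v > 0 \<and> cub s w w < 0"
    let ?p = "\<lambda>t. (1 - t) *\<^sub>R v + t *\<^sub>R w"
    have eq: "cub s (?p t) (?p t) = (1 - t)\<^sup>2 * cub s v v + 2 * t * (1 - t) * cub s v w + t\<^sup>2 * cub s w w" for t
      by (simp only: cub_add_left[OF s] cub_add_right[OF s] cub_scale_left[OF s] cub_scale_right[OF s]
          cub_sym[OF s, of w v]) (simp add: power2_eq_square algebra_simps)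
    have "\<exists>t\<ge>0. t \<le> 1 \<and> cub s (?p t) (?p t) = 0"
      by (rule IVT2) (use vw in \<open>auto simp: eq\<close>)
    then obtain t where t: "0 \<le> t" "t \<le> 1" "cub s (?p t) (?p t) = 0" by blast
    then have z: "?p t = 0" using definite_cub[OF d] by blast
    have "t \<noteq> 0" using z that by auto
    have "cub s (t *\<^sub>R w) (t *\<^sub>R w) = cub s ((1 - t) *\<^sub>R v) ((1 - t) *\<^sub>R v)"
    proof -
      have "t *\<^sub>R w = - ((1 - t) *\<^sub>R v)" using z by (simp only: eq_neg_iff_add_eq_0 add.commute)
      then have "t *\<^sub>R w = (-1) *\<^sub>R ((1 - t) *\<^sub>R v)" by (simp only: scaleR_minus1_left)
      then show ?thesis by (simp only: cub_scale_left[OF s] cub_scale_right[OF s])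
    qed
    then have "t * t * cub s w w = (1 - t) * (1 - t) * cub s v v"
      by (simp add: cub_scale_left[OF s] cub_scale_right[OF s])
    moreover have "t * t * cub s w w < 0" using \<open>t \<noteq> 0\<close> t vw by (simp add: mult_pos_neg)
    moreover have "(1 - t) * (1 - t) * cub s v v \<ge> 0" using vw by simp
    ultimately show False by linarith
  qed
  then have "(\<forall>v. v \<noteq> 0 \<longrightarrow> cub s v v > 0) \<or> (\<forall>v. v \<noteq> 0 \<longrightarrow> cub s v v < 0)"
    using definite_cub[OF d] by (metis linorder_neqE_linordered_idom)
  then show thesis using that[of 1] that[of "-1"] by auto
qed

lemma definite_inner_product:
  assumes d: "definite s" and e: "\<And>v. v \<noteq> 0 \<Longrightarrow> e * cub s v v > (0::real)"
  shows "inner_product (\<lambda>v w. e * cub s v w)"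
  unfolding inner_product_def
  using e cub_sym[OF definite_forms[OF d]]
  by (auto intro!: linearI simp: cub_add_right[OF definite_forms[OF d]] cub_scale_right[OF definite_forms[OF d]]
      distrib_left)

lemma inner_product_bound:
  fixes g :: "real^'n \<Rightarrow> real^'n \<Rightarrow> real"
  assumes g: "inner_product g"
  obtains k where "k > 0" "\<And>v. k * (norm v)\<^sup>2 \<le> g v v" and "continuous_on UNIV (\<lambda>v. g v v)"
proof -
  have lin: "linear (g v)" for v using g by (simp add: inner_product_def)
  have sym: "g v w = g w v" for v w using g by (simp add: inner_product_def)
  have "g v v = (\<Sum>a\<in>UNIV. \<Sum>b\<in>UNIV. v $ a * (v $ b * g (axis a 1) (axis b 1)))" for v
    by (subst linear_axis_expand[OF lin], subst sym, subst linear_axis_expand[OF lin]) (simp add: sum_distrib_left)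
  then have cont: "continuous_on UNIV (\<lambda>v. g v v)"
    by (simp only:) (intro continuous_intros)
  have "compact (sphere (0::real^'n) 1)" "sphere (0::real^'n) 1 \<noteq> {}"
    by (simp_all add: sphere_eq_empty)
  then obtain x where x: "x \<in> sphere 0 1" "\<forall>y\<in>sphere 0 1. g x x \<le> g y y"
    using continuous_attains_inf[OF _ _ continuous_on_subset[OF cont]] by blast
  have scale: "g (r *\<^sub>R v) (r *\<^sub>R v) = r\<^sup>2 * g v v" for r v
    using linear_scale[OF lin] by (simp add: sym[of "_ *\<^sub>R _"] power2_eq_square)
  show thesis
  proof (rule that[OF _ _ cont])
    have "x \<noteq> 0" using x(1) by auto
    then show "g x x > 0" using g by (simp add: inner_product_def)
    show "g x x * (norm v)\<^sup>2 \<le> g v v" for v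
    proof (cases "v = 0")
      case True
      then show ?thesis using linear_0[OF lin] by simp
    next
      case False
      then have "g x x \<le> g ((1 / norm v) *\<^sub>R v) ((1 / norm v) *\<^sub>R v)" using x(2) by simp
      then show ?thesis unfolding scale using False by (simp add: field_simps power2_eq_square)
    qed
  qed
qed

lemma linear_max_on_ball:
  assumes g: "inner_product g" and f: "linear f" and max: "\<And>x. g x x \<le> 1 \<Longrightarrow> f x \<le> c"
    and u: "g u u \<le> 1" "f u = c" and c: "c > (0::real)"
  shows "f x = c * g u x" and "g u u = 1"
proof -
  have lin: "linear (g v)" for v using g by (simp add: inner_product_def)
  have sym: "g v w = g w v" for v w using g by (simp add: inner_product_def)
  have pos: "v \<noteq> 0 \<Longrightarrow> g v v > 0" for v using g by (simp add: inner_product_def)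
  have add: "g v (a + b) = g v a + g v b" and sc: "g v (r *\<^sub>R a) = r * g v a" for v a b r
    using linear_add[OF lin] linear_scale[OF lin] by auto
  have add': "g (a + b) v = g a v + g b v" and sc': "g (r *\<^sub>R a) v = r * g a v" for v a b r
    using add sc sym by metis+
  have bound: "(f y)\<^sup>2 \<le> c\<^sup>2 * g y y" for y
  proof (cases "y = 0")
    case True
    then show ?thesis using linear_0[OF f] linear_0[OF lin] by simp
  next
    case False
    let ?q = "sqrt (g y y)"
    have q: "?q > 0" "?q * ?q = g y y" using pos[OF False] by auto
    have 1: "f (r *\<^sub>R y) = r * f y" "g (r *\<^sub>R y) (r *\<^sub>R y) = r * r * g y y" for r
      using linear_scale[OF f] by (simp_all add: sc sc')
    have "(1 / ?q) * (1 / ?q) * g y y = 1" "(- 1 / ?q) * (- 1 / ?q) * g y y = 1" using q pos[OF False] by auto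
    then have "1 / ?q * f y \<le> c" "- 1 / ?q * f y \<le> c"
      using max[of "(1 / ?q) *\<^sub>R y"] max[of "(- 1 / ?q) *\<^sub>R y"] unfolding 1 by simp_all
    then have "\<bar>f y\<bar> \<le> c * ?q" using q by (auto simp: field_simps abs_if)
    then have "(f y)\<^sup>2 \<le> (c * ?q)\<^sup>2" using power_mono[of "\<bar>f y\<bar>" "c * ?q" 2] by simp
    also have "(c * ?q)\<^sup>2 = c\<^sup>2 * (?q * ?q)" by (simp add: power2_eq_square)
    finally show ?thesis unfolding q(2) .
  qed
  show uu: "g u u = 1"
  proof -
    have "c\<^sup>2 \<le> c\<^sup>2 * g u u" using bound[of u] u by simp
    then have "1 \<le> g u u" using c by simp
    then show ?thesis using u by simp
  qed
  let ?k = "2 * c * (c * g u x - f x)"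
  have ineq: "0 \<le> t * ?k + t\<^sup>2 * (c\<^sup>2 * g x x)" for t
  proof -
    have "(c + t * f x)\<^sup>2 \<le> c\<^sup>2 * (1 + 2 * t * g u x + t\<^sup>2 * g x x)"
      using bound[of "u + t *\<^sub>R x"] linear_add[OF f] linear_scale[OF f] u(2)
      by (simp add: add add' sc sc' uu sym[of x u] power2_eq_square algebra_simps)
    moreover have "0 \<le> (t * f x)\<^sup>2" by simp
    ultimately show ?thesis by (simp add: power2_eq_square algebra_simps)
  qed
  let ?m = "c\<^sup>2 * g x x"
  have m: "?m \<ge> 0" using pos[of x] linear_0[OF lin] by (cases "x = 0") (auto simp: less_imp_le)
  have "?k = 0"
  proof (rule ccontr)
    assume k: "?k \<noteq> 0"
    define t where "t = - ?k / (2 * (?m + 1))"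
    have "t * ?k + t\<^sup>2 * ?m = ?k\<^sup>2 * (?m - 2 * (?m + 1)) / (4 * (?m + 1)\<^sup>2)"
      using m unfolding t_def by (simp add: power2_eq_square divide_simps) (simp add: algebra_simps)
    moreover have "?k\<^sup>2 * (?m - 2 * (?m + 1)) < 0"
    proof (rule mult_pos_neg)
      show "0 < ?k\<^sup>2" by (rule zero_less_power2[THEN iffD2, OF k])
      have "a - 2 * (a + 1) < 0" if "a \<ge> 0" for a :: real using that by simp
      then show "?m - 2 * (?m + 1) < 0" using m by blast
    qed
    moreover have "4 * (?m + 1)\<^sup>2 > 0" using m by (simp add: zero_less_power2)
    ultimately have "t * ?k + t\<^sup>2 * ?m < 0" by (simp only: divide_neg_pos)
    then show False using ineq[of t] by linarith
  qed
  then show "f x = c * g u x" using c by simp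
qed

lemma orthonormal_extend:
  fixes g :: "real^'n \<Rightarrow> real^'n \<Rightarrow> real"
  assumes g: "inner_product g"
  shows "length E \<le> CARD('n) \<Longrightarrow> (\<And>i j. i < length E \<Longrightarrow> j < length E \<Longrightarrow> g (E ! i) (E ! j) = (if i = j then 1 else 0)) \<Longrightarrow>
    \<exists>F. orthonormal_basis g (E @ F)"
proof (induction "CARD('n) - length E" arbitrary: E)
  case 0
  then show ?case by (intro exI[of _ "[]"]) (auto simp: orthonormal_basis_def)
next
  case (Suc n)
  have lin: "linear (g v)" for v using g by (simp add: inner_product_def)
  have sym: "g v w = g w v" for v w using g by (simp add: inner_product_def)
  let ?y = "\<lambda>v. \<chi> a. g v (axis a 1)"
  have "dim (?y ` set E) \<le> card (?y ` set E)" by (rule dim_le_card') simp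
  also have "\<dots> \<le> length E" by (meson card_image_le card_length finite_set le_trans)
  also have "\<dots> < DIM(real^'n)" using Suc.hyps(2) by simp
  finally obtain x where x: "x \<noteq> 0" "\<And>y. y \<in> span (?y ` set E) \<Longrightarrow> orthogonal x y"
    using orthogonal_to_subspace_exists by blast
  have orth: "g v x = 0" if "v \<in> set E" for v
  proof -
    have "x \<bullet> ?y v = 0" using x(2)[of "?y v"] that by (simp add: span_base orthogonal_def)
    moreover have "g v x = x \<bullet> ?y v"
      using linear_axis_expand[OF lin, of v x] by (simp add: inner_vec_def)
    ultimately show ?thesis by simp
  qed
  define z where "z = (1 / sqrt (g x x)) *\<^sub>R x"
  have "g x x > 0" using g x(1) by (simp add: inner_product_def)
  then have zz: "g z z = 1"
    unfolding z_def using linear_scale[OF lin] by (simp add: sym[of "_ *\<^sub>R _"])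
  have "\<exists>F. orthonormal_basis g ((E @ [z]) @ F)"
  proof (rule Suc.hyps(1))
    fix i j assume ij: "i < length (E @ [z])" "j < length (E @ [z])"
    have zE: "g v z = 0" "g z v = 0" if "v \<in> set E" for v
    proof -
      show "g v z = 0" unfolding z_def using orth[OF that] linear_scale[OF lin] by simp
      then show "g z v = 0" using sym[of z v] by simp
    qed
    show "g ((E @ [z]) ! i) ((E @ [z]) ! j) = (if i = j then 1 else 0)"
      using ij Suc.prems(2)[of i j] zz zE by (auto simp: nth_append less_Suc_eq)
  qed (use Suc in auto)
  then obtain F where "orthonormal_basis g (E @ z # F)" by auto
  then show ?case by blast
qed

lemma calibrated_cub:
  assumes s: "alternating s" "homogeneous 3 s" and c: "s [u, v, w] = c"
    and n: "\<And>x. x \<in> {p, q, r, t} \<Longrightarrow> s [u, v, x] = 0 \<and> s [u, w, x] = 0 \<and> s [v, w, x] = 0"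
  shows "cub s u u * vol0 [u, v, w, p, q, r, t] =
      6 * c * (s [u,p,q] * s [u,r,t] - s [u,p,r] * s [u,q,t] + s [u,p,t] * s [u,q,r])"
    and "cub s v v * vol0 [u, v, w, p, q, r, t] =
      6 * c * (s [v,p,q] * s [v,r,t] - s [v,p,r] * s [v,q,t] + s [v,p,t] * s [v,q,r])"
    and "cub s w w * vol0 [u, v, w, p, q, r, t] =
      6 * c * (s [w,p,q] * s [w,r,t] - s [w,p,r] * s [w,q,t] + s [w,p,t] * s [w,q,r])"
    and "cub s u v * vol0 [u, v, w, p, q, r, t] =
      3 * c * (s [u,p,q] * s [v,r,t] + s [u,r,t] * s [v,p,q] - s [u,p,r] * s [v,q,t] - s [u,q,t] * s [v,p,r]
        + s [u,p,t] * s [v,q,r] + s [u,q,r] * s [v,p,t])"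
    and "cub s u w * vol0 [u, v, w, p, q, r, t] =
      3 * c * (s [u,p,q] * s [w,r,t] + s [u,r,t] * s [w,p,q] - s [u,p,r] * s [w,q,t] - s [u,q,t] * s [w,p,r]
        + s [u,p,t] * s [w,q,r] + s [u,q,r] * s [w,p,t])"
    and "cub s v w * vol0 [u, v, w, p, q, r, t] =
      3 * c * (s [v,p,q] * s [w,r,t] + s [v,r,t] * s [w,p,q] - s [v,p,r] * s [w,q,t] - s [v,q,t] * s [w,p,r]
        + s [v,p,t] * s [w,q,r] + s [v,q,r] * s [w,p,t])"
    and "cub s u p * vol0 [u, v, w, p, q, r, t] =
      3 * c * (s [u,p,q] * s [p,r,t] - s [u,p,r] * s [p,q,t] + s [u,p,t] * s [p,q,r])"
    and "s [p,q,r] = 0 \<Longrightarrow> s [p,q,t] = 0 \<Longrightarrow> s [p,r,t] = 0 \<Longrightarrow> s [q,r,t] = 0 \<Longrightarrow>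
      cub s p p * vol0 [u, v, w, p, q, r, t] = - 6 *
        (s [u,p,q] * (s [v,p,r] * s [w,p,t] - s [v,p,t] * s [w,p,r])
        - s [u,p,r] * (s [v,p,q] * s [w,p,t] - s [v,p,t] * s [w,p,q])
        + s [u,p,t] * (s [v,p,q] * s [w,p,r] - s [v,p,r] * s [w,p,q]))"
proof -
  note srt = swap12[OF s, of v u] swap23[OF s, of _ v u] swap12[OF s, of w u] swap23[OF s, of _ w u] swap12[OF s, of p u] swap23[OF s, of _ p u] swap12[OF s, of q u] swap23[OF s, of _ q u] swap12[OF s, of r u] swap23[OF s, of _ r u] swap12[OF s, of t u] swap23[OF s, of _ t u] swap12[OF s, of w v] swap23[OF s, of _ w v] swap12[OF s, of p v] swap23[OF s, of _ p v] swap12[OF s, of q v] swap23[OF s, of _ q v] swap12[OF s, of r v] swap23[OF s, of _ r v] swap12[OF s, of t v] swap23[OF s, of _ t v] swap12[OF s, of p w] swap23[OF s, of _ p w] swap12[OF s, of q w] swap23[OF s, of _ q w] swap12[OF s, of r w] swap23[OF s, of _ r w] swap12[OF s, of t w] swap23[OF s, of _ t w] swap12[OF s, of q p] swap23[OF s, of _ q p] swap12[OF s, of r p] swap23[OF s, of _ r p] swap12[OF s, of t p] swap23[OF s, of _ t p] swap12[OF s, of r q] swap23[OF s, of _ r q] swap12[OF s, of t q] swap23[OF s, of _ t q] swap12[OF s, of t r] swap23[OF s, of _ t r]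
  have n': "s [u, v, p] = 0" "s [u, v, q] = 0" "s [u, v, r] = 0" "s [u, v, t] = 0"
    "s [u, w, p] = 0" "s [u, w, q] = 0" "s [u, w, r] = 0" "s [u, w, t] = 0"
    "s [v, w, p] = 0" "s [v, w, q] = 0" "s [v, w, r] = 0" "s [v, w, t] = 0"
    using n by auto
  note ev = cub_shuf[OF s] wedge_interior_shuf[OF s] interior_apply srt n' c trilinear(7-9)[OF s]
  show "cub s u u * vol0 [u, v, w, p, q, r, t] =
      6 * c * (s [u,p,q] * s [u,r,t] - s [u,p,r] * s [u,q,t] + s [u,p,t] * s [u,q,r])"
    by (simp add: ev) (simp add: algebra_simps)?
  show "cub s v v * vol0 [u, v, w, p, q, r, t] =
      6 * c * (s [v,p,q] * s [v,r,t] - s [v,p,r] * s [v,q,t] + s [v,p,t] * s [v,q,r])"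
    by (simp add: ev) (simp add: algebra_simps)?
  show "cub s w w * vol0 [u, v, w, p, q, r, t] =
      6 * c * (s [w,p,q] * s [w,r,t] - s [w,p,r] * s [w,q,t] + s [w,p,t] * s [w,q,r])"
    by (simp add: ev) (simp add: algebra_simps)?
  show "cub s u v * vol0 [u, v, w, p, q, r, t] =
      3 * c * (s [u,p,q] * s [v,r,t] + s [u,r,t] * s [v,p,q] - s [u,p,r] * s [v,q,t] - s [u,q,t] * s [v,p,r]
        + s [u,p,t] * s [v,q,r] + s [u,q,r] * s [v,p,t])"
    by (simp add: ev) (simp add: algebra_simps)?
  show "cub s u w * vol0 [u, v, w, p, q, r, t] =
      3 * c * (s [u,p,q] * s [w,r,t] + s [u,r,t] * s [w,p,q] - s [u,p,r] * s [w,q,t] - s [u,q,t] * s [w,p,r]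
        + s [u,p,t] * s [w,q,r] + s [u,q,r] * s [w,p,t])"
    by (simp add: ev) (simp add: algebra_simps)?
  show "cub s v w * vol0 [u, v, w, p, q, r, t] =
      3 * c * (s [v,p,q] * s [w,r,t] + s [v,r,t] * s [w,p,q] - s [v,p,r] * s [w,q,t] - s [v,q,t] * s [w,p,r]
        + s [v,p,t] * s [w,q,r] + s [v,q,r] * s [w,p,t])"
    by (simp add: ev) (simp add: algebra_simps)?
  show "cub s u p * vol0 [u, v, w, p, q, r, t] =
      3 * c * (s [u,p,q] * s [p,r,t] - s [u,p,r] * s [p,q,t] + s [u,p,t] * s [p,q,r])"
    by (simp add: ev) (simp add: algebra_simps)?
  show "cub s p p * vol0 [u, v, w, p, q, r, t] = - 6 *
        (s [u,p,q] * (s [v,p,r] * s [w,p,t] - s [v,p,t] * s [w,p,r])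
        - s [u,p,r] * (s [v,p,q] * s [w,p,t] - s [v,p,t] * s [w,p,q])
        + s [u,p,t] * (s [v,p,q] * s [w,p,r] - s [v,p,r] * s [w,p,q]))"
    if "s [p,q,r] = 0" "s [p,q,t] = 0" "s [p,r,t] = 0" "s [q,r,t] = 0"
    using that by (simp add: ev) (simp add: algebra_simps)?
qed

lemma definite_calibrated:
  assumes d: "definite s"
  obtains e c u v w where "e = 1 \<or> e = (-1::real)" "\<forall>x. x \<noteq> 0 \<longrightarrow> e * cub s x x > 0" "c > 0"
    "\<forall>x. s [x, v, w] = c * (e * cub s u x)" "\<forall>x. s [u, x, w] = c * (e * cub s v x)"
    "\<forall>x. s [u, v, x] = c * (e * cub s w x)"
    "e * cub s u u = 1" "e * cub s v v = 1" "e * cub s w w = 1"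
proof -
  note s = definite_forms[OF d]
  obtain e :: real where e: "e = 1 \<or> e = -1" "\<And>x. x \<noteq> 0 \<Longrightarrow> e * cub s x x > 0"
    using definite_sign[OF d] by blast
  define g where "g = (\<lambda>x y. e * cub s x y)"
  have ip: "inner_product g" unfolding g_def by (rule definite_inner_product[OF d e(2)])
  obtain k where k: "k > 0" "\<And>x. k * (norm x)\<^sup>2 \<le> g x x" and cont: "continuous_on UNIV (\<lambda>x. g x x)"
    using inner_product_bound[OF ip] by blast
  define K where "K = {x. g x x \<le> 1}"
  have "closed K" unfolding K_def by (intro closed_Collect_le cont continuous_on_const)
  moreover have "bounded K"
  proof (rule boundedI)
    fix x assume "x \<in> K"
    then have "k * (norm x)\<^sup>2 \<le> 1" using k(2)[of x] by (simp add: K_def)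
    then have "(norm x)\<^sup>2 \<le> 1 / k" using k(1) by (simp add: field_simps)
    then show "norm x \<le> sqrt (1 / k)" by (rule real_le_rsqrt)
  qed
  ultimately have K: "compact K" by (simp add: compact_eq_bounded_closed)
  have scale: "g (r *\<^sub>R x) (r *\<^sub>R x) = r * r * g x x" for r x
    by (simp add: g_def cub_scale_left[OF s] cub_scale_right[OF s])
  let ?f = "\<lambda>z. s [fst z, fst (snd z), snd (snd z)]"
  have "smooth_on UNIV (\<lambda>z. (\<lambda>_. s) (fst z) (map (\<lambda>h. h z) [fst, \<lambda>z. fst (snd z), \<lambda>z. snd (snd z)]))"
    by (rule smooth_on_diff_form_eval[where \<alpha> = "\<lambda>_. s" and h = fst and L = fst and U = UNIV])
      (auto intro!: smooth_on_linear diff_form_const s linearI has_derivative_fst has_derivative_ident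
        simp: inner_add_left)
  then have "continuous_on (K \<times> K \<times> K) ?f"
    using smooth_on_continuous_on continuous_on_subset by fastforce
  moreover have "compact (K \<times> K \<times> K)" by (intro compact_Times K)
  moreover have "0 \<in> K" using inner_product_linear[OF ip, of 0] by (simp add: K_def linear_0)
  ultimately obtain z where z: "z \<in> K \<times> K \<times> K" "\<And>y. y \<in> K \<times> K \<times> K \<Longrightarrow> ?f y \<le> ?f z"
    using continuous_attains_sup[of "K \<times> K \<times> K" ?f] by blast
  obtain u v w where uvw: "z = (u, v, w)" by (cases z)
  define c where "c = s [u, v, w]"
  have inK: "g u u \<le> 1" "g v v \<le> 1" "g w w \<le> 1" using z(1) by (auto simp: uvw K_def)
  have max: "s [x, y, t] \<le> c" if "g x x \<le> 1" "g y y \<le> 1" "g t t \<le> 1" for x y t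
    using z(2)[of "(x, y, t)"] that by (simp add: uvw K_def c_def)
  have "\<exists>x y t. s [x, y, t] \<noteq> 0"
  proof (rule ccontr)
    assume "\<not> (\<exists>x y t. s [x, y, t] \<noteq> 0)"
    then have "s vs = 0" if "length vs = 3" for vs
      using that by (auto simp: numeral_3_eq_3 length_Suc_conv)
    then have "s = (\<lambda>_. 0)" using s(2) by (auto simp: homogeneous_def)
    then have "cub s (ax 0) (ax 0) = 0" unfolding cub_def by (simp only: wedge_zero_right)
    moreover have "ax 0 \<noteq> 0" by (simp add: ax_def axis_eq_0_iff)
    ultimately show False using definite_cub[OF d] by blast
  qed
  then obtain x y t where xyt: "s [x, y, t] \<noteq> 0" by blast
  define x' where "x' = sgn (s [x, y, t]) *\<^sub>R x"
  have pos: "s [x', y, t] > 0" using xyt by (simp add: x'_def trilinear[OF s] sgn_real_def)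
  have gx: "g x' x' = g x x" using xyt by (simp add: x'_def scale sgn_real_def)
  have nn: "g x x \<ge> 0" for x
    using e(2)[of x] linear_0[OF linear_cub[OF s]] by (cases "x = 0") (auto simp: g_def less_imp_le)
  define r where "r = 1 / (1 + g x x + g y y + g t t)"
  have r: "r > 0" "r \<le> 1" using nn[of x] nn[of y] nn[of t] by (auto simp: r_def)
  have "r * r * g a a \<le> 1" if "g a a \<le> g x x + g y y + g t t" for a
  proof -
    have "r * g a a \<le> 1" using that nn[of x] nn[of y] nn[of t] by (simp add: r_def field_simps)
    then have "r * (r * g a a) \<le> 1 * 1" using r nn[of a] by (intro mult_mono) auto
    then show ?thesis by (simp add: mult.assoc)
  qed
  then have "s [r *\<^sub>R x', r *\<^sub>R y, r *\<^sub>R t] \<le> c"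
    using nn[of x] nn[of y] nn[of t] by (intro max) (simp_all add: scale gx)
  moreover have "s [r *\<^sub>R x', r *\<^sub>R y, r *\<^sub>R t] > 0" using r pos by (simp add: trilinear[OF s])
  ultimately have c: "c > 0" by linarith
  have l1: "linear (\<lambda>x. s [x, v, w])" and l2: "linear (\<lambda>x. s [u, x, w])" and l3: "linear (\<lambda>x. s [u, v, x])"
    by (auto intro!: linearI simp: trilinear[OF s])
  have A1: "s [x, v, w] = c * g u x" and B1: "g u u = 1" for x
    by (rule linear_max_on_ball[OF ip l1 max[OF _ inK(2) inK(3)] inK(1) c_def[symmetric] c], assumption)+
  have A2: "s [u, x, w] = c * g v x" and B2: "g v v = 1" for x
    by (rule linear_max_on_ball[OF ip l2 max[OF inK(1) _ inK(3)] inK(2) c_def[symmetric] c], assumption)+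
  have A3: "s [u, v, x] = c * g w x" and B3: "g w w = 1" for x
    by (rule linear_max_on_ball[OF ip l3 max[OF inK(1) inK(2)] inK(3) c_def[symmetric] c], assumption)+
  show thesis
    by (rule that[where e = e and c = c and u = u and v = v and w = w]) (use e c A1 A2 A3 B1 B2 B3 in \<open>simp_all add: g_def\<close>)
qed

lemma less_7: "i < 7 \<longleftrightarrow> i \<in> {0, 1, 2, 3, 4, 5, 6 :: nat}"
  by auto

lemma all_less_7: "(\<forall>i<7. P i) \<longleftrightarrow> P 0 \<and> P 1 \<and> P 2 \<and> P 3 \<and> P 4 \<and> P 5 \<and> P (6::nat)"
  unfolding less_7 Ball_def[symmetric] by simp

lemma frame_scale:
  assumes f: "frame f" and c: "\<And>i. i < 7 \<Longrightarrow> c i \<noteq> 0"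
  shows "frame (map (\<lambda>i. c i *\<^sub>R f ! i) [0..<7])"
proof (rule frame_of_dual[where \<theta> = "\<lambda>i v. coord f i v / c i"])
  fix i :: nat assume i: "i < 7"
  then have l: "linear (coord f i)" using linear_coord frame_length[OF f] by simp
  show "linear (\<lambda>v. coord f i v / c i)"
    by (intro linearI) (simp_all add: linear_add[OF l] linear_scale[OF l] add_divide_distrib)
  fix j :: nat assume j: "j < 7"
  show "coord f i (map (\<lambda>i. c i *\<^sub>R f ! i) [0..<7] ! j) / c i = (if i = j then 1 else 0)"
    using coord_nth[OF f i j] c[OF i] c[OF j] j by (simp add: linear_scale[OF l] del: upt_Suc)
qed simp

lemma definite_adapted:
  assumes d: "definite s"
  obtains f where "adapted s f"
proof -
  note s = definite_forms[OF d]
  obtain e c u v w where e': "e = 1 \<or> e = (-1::real)" "\<forall>x. x \<noteq> 0 \<longrightarrow> e * cub s x x > 0" and c: "c > 0"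
    and su': "\<forall>x. s [x, v, w] = c * (e * cub s u x)" and sv': "\<forall>x. s [u, x, w] = c * (e * cub s v x)"
    and sw': "\<forall>x. s [u, v, x] = c * (e * cub s w x)"
    and n1: "e * cub s u u = 1" "e * cub s v v = 1" "e * cub s w w = 1"
    by (rule definite_calibrated[OF d])
  have e: "e = 1 \<or> e = -1" "\<And>x. x \<noteq> 0 \<Longrightarrow> e * cub s x x > 0" using e' by auto
  note su = su'[rule_format] and sv = sv'[rule_format] and sw = sw'[rule_format]
  have e0: "e \<noteq> 0" "e * e = 1" using e(1) by auto
  define g where "g = (\<lambda>x y. e * cub s x y)"
  have ip: "inner_product g" unfolding g_def by (rule definite_inner_product[OF d e(2)])
  have glin: "linear (g x)" for x by (rule inner_product_linear[OF ip])
  have gsym: "g x y = g y x" for x y by (rule inner_product_sym[OF ip])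
  have uv: "g u v = 0" "g u w = 0" "g v w = 0" and uu: "g u u = 1" "g v v = 1" "g w w = 1"
    using su[of v] su[of w] sv[of w] c n1 by (auto simp: g_def trilinear[OF s])
  then have vu: "g v u = 0" "g w u = 0" "g w v = 0" using gsym[of v u] gsym[of w u] gsym[of w v] by auto
  have cuv: "s [u, v, w] = c" using su[of u] n1 by simp
  define N where "N = {x. g u x = 0 \<and> g v x = 0 \<and> g w x = 0}"
  have subN: "subspace N"
    unfolding N_def using glin by (auto simp: subspace_def linear_0 linear_add linear_scale)
  have Nuv: "s [u, v, x] = 0" "s [u, w, x] = 0" "s [v, w, x] = 0" if "x \<in> N" for x
  proof -
    show "s [u, v, x] = 0" using that sw[of x] by (simp add: N_def g_def)
    show "s [u, w, x] = 0" using that sv[of x] swap23[OF s, of u w x] by (simp add: N_def g_def)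
    have "s [v, w, x] = s [x, v, w]" using swap12[OF s, of x v w] swap23[OF s, of v x w] by simp
    then show "s [v, w, x] = 0" using that su[of x] by (simp add: N_def g_def)
  qed
  have Ncub: "cub s u x = 0" "cub s v x = 0" "cub s w x = 0" if "x \<in> N" for x
    using that e0 by (auto simp: N_def g_def)
  have cub0: "cub s u v = 0" "cub s u w = 0" "cub s v w = 0" using uv e0 by (auto simp: g_def)
  have cube: "cub s u u = e" "cub s v v = e" "cub s w w = e"
    using n1 e(1) by auto
  note calib = calibrated_cub[OF s cuv]
  have eps: "s [q, r, t] = 0 \<and> s [p, r, t] = 0 \<and> s [p, q, t] = 0 \<and> s [p, q, r] = 0"
    if "p \<in> N" "q \<in> N" "r \<in> N" "t \<in> N" and fr: "frame [u, v, w, p, q, r, t]" for p q r t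
  proof -
    have Nn: "s [u, v, x] = 0 \<and> s [u, w, x] = 0 \<and> s [v, w, x] = 0" if "x \<in> {p, q, r, t}" for x
      using that Nuv \<open>p \<in> N\<close> \<open>q \<in> N\<close> \<open>r \<in> N\<close> \<open>t \<in> N\<close> by auto
    have pf: "s [u,p,q] * s [u,r,t] - s [u,p,r] * s [u,q,t] + s [u,p,t] * s [u,q,r] \<noteq> 0"
      using calib(1)[of p q r t] Nn cube e0 fr by (auto simp: frame_def)
    have E1: "s [u,p,q] * s [p,r,t] - s [u,p,r] * s [p,q,t] + s [u,p,t] * s [p,q,r] = 0"
      using calib(7)[of p q r t] Nn Ncub[OF that(1)] c by auto
    have E2: "s [u,q,p] * s [q,r,t] - s [u,q,r] * s [q,p,t] + s [u,q,t] * s [q,p,r] = 0"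
      using calib(7)[of q p r t] Nn Ncub[OF that(2)] c by auto
    have E3: "s [u,r,p] * s [r,q,t] - s [u,r,q] * s [r,p,t] + s [u,r,t] * s [r,p,q] = 0"
      using calib(7)[of r p q t] Nn Ncub[OF that(3)] c by auto
    have E4: "s [u,t,p] * s [t,q,r] - s [u,t,q] * s [t,p,r] + s [u,t,r] * s [t,p,q] = 0"
      using calib(7)[of t p q r] Nn Ncub[OF that(4)] c by auto
    note srt = swap23[OF s, of u q p] swap23[OF s, of u r p] swap23[OF s, of u t p] swap23[OF s, of u r q]
      swap23[OF s, of u t q] swap23[OF s, of u t r] swap12[OF s, of q p] swap12[OF s, of r p] swap12[OF s, of t p]
      swap12[OF s, of r q] swap12[OF s, of t q] swap12[OF s, of t r]
      swap23[OF s, of _ q p] swap23[OF s, of _ r p] swap23[OF s, of _ t p]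
      swap23[OF s, of _ r q] swap23[OF s, of _ t q] swap23[OF s, of _ t r]
    define a b c' d' e' f' where "a = s [u,p,q]" "b = s [u,p,r]" "c' = s [u,p,t]" "d' = s [u,q,r]" "e' = s [u,q,t]" "f' = s [u,r,t]"
    define x1 x2 x3 x4 where "x1 = s [q,r,t]" "x2 = s [p,r,t]" "x3 = s [p,q,t]" "x4 = s [p,q,r]"
    note df = a_b_c'_d'_e'_f'_def[symmetric] x1_x2_x3_x4_def[symmetric]
    have F1: "a * x2 - b * x3 + c' * x4 = 0" using E1 by (simp add: df)
    have F2: "- a * x1 + d' * x3 - e' * x4 = 0" using E2 by (simp add: srt df)
    have F3: "b * x1 - d' * x2 + f' * x4 = 0" using E3 by (simp add: srt df)
    have F4: "- c' * x1 + e' * x2 - f' * x3 = 0" using E4 by (simp add: srt df)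
    let ?P = "a * f' - b * e' + c' * d'"
    have P: "?P \<noteq> 0" using pf by (simp add: df)
    have "?P * x1 = 0" "?P * x2 = 0" "?P * x3 = 0" "?P * x4 = 0"
      using F1 F2 F3 F4 by algebra+
    then show ?thesis using P unfolding df by simp
  qed
  have fr: "frame [u, v, w, p, q, r, t]"
    if N: "p \<in> N" "q \<in> N" "r \<in> N" "t \<in> N" and p: "p \<noteq> 0"
      and q: "s [u,p,q] = 1" "s [v,p,q] = 0" "s [w,p,q] = 0"
      and r: "s [u,p,r] = 0" "s [v,p,r] = 1" "s [w,p,r] = 0"
      and t: "s [u,p,t] = 0" "s [v,p,t] = 0" "s [w,p,t] = 1" for p q r t
  proof -
    have gp: "g p p \<noteq> 0" using less_imp_neq[OF e(2)[OF p]] unfolding g_def by (rule not_sym)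
    define h where "h = (\<lambda>x. (g p x - g p q * s [u,p,x] - g p r * s [v,p,x] - g p t * s [w,p,x]) / g p p)"
    define th where "th = [g u, g v, g w, h, \<lambda>x. s [u,p,x], \<lambda>x. s [v,p,x], \<lambda>x. s [w,p,x]]"
    have gp0: "g p u = 0" "g p v = 0" "g p w = 0"
      using N(1) gsym[of p u] gsym[of p v] gsym[of p w] by (auto simp: N_def)
    have sp: "s [u,p,v] = 0" "s [u,p,w] = 0" "s [v,p,u] = 0" "s [v,p,w] = 0" "s [w,p,u] = 0" "s [w,p,v] = 0"
      using Nuv[OF N(1)] swap23[OF s, of u p v] swap23[OF s, of u p w] swap23[OF s, of v p w]
        swap23[OF s, of v p u] swap12[OF s, of v u p] swap23[OF s, of w p u] swap12[OF s, of w u p]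
        swap23[OF s, of w p v] swap12[OF s, of w v p] by simp_all
    have hl: "linear h"
      unfolding h_def
      by (intro linearI)
        (simp_all add: trilinear[OF s] linear_add[OF glin] linear_scale[OF glin] diff_divide_distrib add_divide_distrib algebra_simps)
    have lin: "\<forall>i<7. linear (th ! i)"
      unfolding all_less_7 th_def by (auto intro!: linearI glin hl simp: trilinear[OF s])
    have "\<forall>i<7. \<forall>j<7. (th ! i) ([u, v, w, p, q, r, t] ! j) = (if i = j then 1 else 0)"
      unfolding all_less_7 th_def
      using N q r t uv vu uu sp gp0 gp by (simp add: h_def trilinear[OF s] N_def)
    then show ?thesis using lin by (intro frame_of_dual[where \<theta> = "\<lambda>i. th ! i"]) auto
  qed
  obtain F where F: "orthonormal_basis g ([u, v, w] @ F)"
  proof -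
    have "\<exists>F. orthonormal_basis g ([u, v, w] @ F)"
    proof (rule orthonormal_extend[OF ip])
      fix i j assume "i < length [u, v, w]" "j < length [u, v, w]"
      then have "i \<in> {0, 1, 2}" "j \<in> {0, 1, 2}" by auto
      then show "g ([u, v, w] ! i) ([u, v, w] ! j) = (if i = j then 1 else 0)" using uv vu uu by auto
    qed simp
    then show thesis using that by blast
  qed
  then have lenF: "length F = 4" by (simp add: orthonormal_basis_def)
  then obtain p q r t where Fe: "F = [p, q, r, t]"
    by (auto simp: numeral_eq_Suc length_Suc_conv)
  have on: "\<forall>i<7. \<forall>j<7. g ([u, v, w, p, q, r, t] ! i) ([u, v, w, p, q, r, t] ! j) = (if i = j then 1 else 0)"
    using F by (simp add: orthonormal_basis_def Fe)
  then have pqrt: "p \<in> N" "q \<in> N" "r \<in> N" "t \<in> N" "g p p = 1"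
    unfolding all_less_7 by (auto simp: N_def)
  have p0: "p \<noteq> 0" using pqrt(5) linear_0[OF glin] by auto
  have fr1: "frame [u, v, w, p, q, r, t]"
    by (rule frame_of_dual[where \<theta> = "\<lambda>i. g ([u, v, w, p, q, r, t] ! i)"]) (use on glin in auto)
  have Nn: "s [u, v, x] = 0 \<and> s [u, w, x] = 0 \<and> s [v, w, x] = 0"
    if "x \<in> {p, q, r, t}" "p \<in> N" "q \<in> N" "r \<in> N" "t \<in> N" for x p q r t
    using that Nuv by auto
  define D where "D = s [u,p,q] * (s [v,p,r] * s [w,p,t] - s [v,p,t] * s [w,p,r])
        - s [u,p,r] * (s [v,p,q] * s [w,p,t] - s [v,p,t] * s [w,p,q])
        + s [u,p,t] * (s [v,p,q] * s [w,p,r] - s [v,p,r] * s [w,p,q])"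
  have D: "D \<noteq> 0"
  proof -
    have "cub s p p * vol0 [u, v, w, p, q, r, t] = - 6 * D"
      unfolding D_def by (rule calib(8)) (use Nn[OF _ pqrt(1-4)] eps[OF pqrt(1-4) fr1] in auto)
    then show ?thesis using definite_cub[OF d p0] fr1 by (auto simp: frame_def)
  qed
  define comb where "comb = (\<lambda>a b c. (1 / D) *\<^sub>R (a *\<^sub>R q + b *\<^sub>R r + c *\<^sub>R t))"
  have combN: "comb a b c \<in> N" for a b c
    unfolding comb_def using subN pqrt by (intro subspace_scale subspace_add) auto
  have combs: "s [x, p, comb a b c] = (a * s [x,p,q] + b * s [x,p,r] + c * s [x,p,t]) / D" for x a b c
    by (simp add: comb_def trilinear[OF s] add_divide_distrib)
  define q' r' t' where
    "q' = comb (s [v,p,r] * s [w,p,t] - s [v,p,t] * s [w,p,r]) (s [v,p,t] * s [w,p,q] - s [v,p,q] * s [w,p,t])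
      (s [v,p,q] * s [w,p,r] - s [v,p,r] * s [w,p,q])"
    "r' = comb (s [w,p,r] * s [u,p,t] - s [w,p,t] * s [u,p,r]) (s [w,p,t] * s [u,p,q] - s [w,p,q] * s [u,p,t])
      (s [w,p,q] * s [u,p,r] - s [w,p,r] * s [u,p,q])"
    "t' = comb (s [u,p,r] * s [v,p,t] - s [u,p,t] * s [v,p,r]) (s [u,p,t] * s [v,p,q] - s [u,p,q] * s [v,p,t])
      (s [u,p,q] * s [v,p,r] - s [u,p,r] * s [v,p,q])"
  have N': "q' \<in> N" "r' \<in> N" "t' \<in> N" by (auto simp: q'_r'_t'_def combN)
  have rel: "s [u,p,q'] = 1" "s [v,p,q'] = 0" "s [w,p,q'] = 0"
    "s [u,p,r'] = 0" "s [v,p,r'] = 1" "s [w,p,r'] = 0"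
    "s [u,p,t'] = 0" "s [v,p,t'] = 0" "s [w,p,t'] = 1"
    unfolding q'_r'_t'_def combs using D
    by (simp_all only: divide_eq_eq_1 divide_eq_0_iff right_inverse_eq) (simp_all add: D_def algebra_simps)
  note fr2 = fr[OF pqrt(1) N' p0 rel]
  define E where "E = vol0 [u, v, w, p, q', r', t']"
  have E0: "E \<noteq> 0" using fr2 by (simp add: E_def frame_def)
  note Nn2 = Nn[OF _ pqrt(1) N']
  define m where "m = s [u,r',t']"
  have R1: "e * E = 6 * c * m" using calib(1)[of p q' r' t'] Nn2 rel cube by (simp add: E_def m_def)
  have R2: "e * E = 6 * c * (- s [v,q',t'])" using calib(2)[of p q' r' t'] Nn2 rel cube by (simp add: E_def)
  have R3: "e * E = 6 * c * s [w,q',r']" using calib(3)[of p q' r' t'] Nn2 rel cube by (simp add: E_def)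
  have m: "s [v,q',t'] = - m" "s [w,q',r'] = m"
  proof -
    have c6: "6 * c \<noteq> 0" using c by simp
    have "m = - s [v,q',t']" by (rule mult_left_cancel[OF c6, THEN iffD1]) (use R1 R2 in simp)
    then show "s [v,q',t'] = - m" by simp
    show "s [w,q',r'] = m" by (rule mult_left_cancel[OF c6, THEN iffD1]) (use R1 R3 in simp)
  qed
  have R4: "s [v,r',t'] = s [u,q',t']" using calib(4)[of p q' r' t'] Nn2 rel cub0 c by auto
  have R5: "s [w,r',t'] = - s [u,q',r']" using calib(5)[of p q' r' t'] Nn2 rel cub0 c by auto
  have R6: "s [v,q',r'] = s [w,q',t']" using calib(6)[of p q' r' t'] Nn2 rel cub0 c by auto
  have R8: "cub s p p * E = - 6" using calib(8)[of p q' r' t'] Nn2 rel eps[OF pqrt(1) N' fr2] by (simp add: E_def)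
  have mneg: "m < 0"
  proof -
    have "0 < E * E" using not_real_square_gt_zero[of E] E0 by blast
    then have "0 < (e * cub s p p) * (E * E)" by (rule mult_pos_pos[OF e(2)[OF p0]])
    also have "\<dots> = (cub s p p * E) * (e * E)" by simp
    also have "\<dots> = - 36 * c * m" unfolding R8 R1 by simp
    finally show ?thesis using c by (simp add: mult_less_0_iff zero_less_mult_iff)
  qed
  define b where "b = - s [v,q',r']"
  have bb: "s [v,q',r'] = - b" "s [w,q',t'] = - b" using R6 by (simp_all add: b_def)
  define q2 r2 t2 where "q2 = q' + b *\<^sub>R p" "r2 = r' + s [u,q',r'] *\<^sub>R p" "t2 = t' + s [u,q',t'] *\<^sub>R p"
  have N2: "q2 \<in> N" "r2 \<in> N" "t2 \<in> N"
    unfolding q2_r2_t2_def by (rule subspace_add[OF subN _ subspace_scale[OF subN pqrt(1)]], fact N')+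
  have rel2: "s [u,p,q2] = 1" "s [v,p,q2] = 0" "s [w,p,q2] = 0"
    "s [u,p,r2] = 0" "s [v,p,r2] = 1" "s [w,p,r2] = 0"
    "s [u,p,t2] = 0" "s [v,p,t2] = 0" "s [w,p,t2] = 1"
    unfolding q2_r2_t2_def by (simp_all add: trilinear[OF s] rel)
  have sp: "s [x,q',p] = - s [x,p,q']" "s [x,r',p] = - s [x,p,r']" "s [x,t',p] = - s [x,p,t']" for x
    using swap23[OF s] by blast+
  have rel3: "s [u,q2,r2] = 0" "s [u,q2,t2] = 0" "s [u,r2,t2] = m"
    "s [v,q2,r2] = 0" "s [v,q2,t2] = - m" "s [v,r2,t2] = 0"
    "s [w,q2,r2] = m" "s [w,q2,t2] = 0" "s [w,r2,t2] = 0"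
    unfolding q2_r2_t2_def by (simp_all add: trilinear[OF s] rel sp m R4 R5 bb m_def)
  note fr3 = fr[OF pqrt(1) N2 p0 rel2]
  note ep3 = eps[OF pqrt(1) N2 fr3]
  define P where "P = - (1 / root 3 c)"
  have P3: "c * (P * P * P) = - 1" and P: "P < 0"
  proof -
    have "root 3 c ^ 3 = c" using c by simp
    then have "root 3 c * root 3 c * root 3 c = c" by (simp add: power3_eq_cube)
    moreover have "root 3 c > 0" using c by simp
    ultimately show "c * (P * P * P) = - 1" "P < 0" by (auto simp: P_def field_simps)
  qed
  define R where "R = sqrt (1 / (m * P))"
  have mP: "m * P > 0" using mneg P by (simp add: mult_neg_neg)
  then have R: "R > 0" "m * (P * (R * R)) = 1" by (auto simp: R_def)
  define Q where "Q = - 1 / (P * R)"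
  have Q: "Q \<noteq> 0" "P * Q * R = - 1" using P R by (auto simp: Q_def)
  define f where "f = map (\<lambda>i. ([P, P, P, Q, R, R, R] ! i) *\<^sub>R ([u, v, w, p, q2, r2, t2] ! i)) [0..<7]"
  have "\<forall>i<7. [P, P, P, Q, R, R, R] ! i \<noteq> 0" unfolding all_less_7 using P Q R by simp
  then have ff: "frame f" unfolding f_def by (intro frame_scale fr3) auto
  have fl: "f = [P *\<^sub>R u, P *\<^sub>R v, P *\<^sub>R w, Q *\<^sub>R p, R *\<^sub>R q2, R *\<^sub>R r2, R *\<^sub>R t2]"
    by (simp add: f_def upt_rec)
  have PQR: "P * (Q * R) = - 1" "Q * (P * R) = -1" using Q(2) by (simp_all add: algebra_simps)
  have "\<forall>i<7. \<forall>j<7. \<forall>k<7. i < j \<and> j < k \<longrightarrow> s [f ! i, f ! j, f ! k] = phi0 [i, j, k]"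
    unfolding all_less_7 fl
    using P3 R(2) PQR Nuv[OF pqrt(1)] Nuv[OF N2(1)] Nuv[OF N2(2)] Nuv[OF N2(3)]
    by (simp add: trilinear[OF s] rel2 rel3 ep3 cuv phi0_def) (simp add: mult_ac)
  then have "adapted s f"
    unfolding adapted_def using ff by (meson less_trans)
  then show thesis by (rule that)
qed

section \<open>The metric and the Hodge star of a definite 3-form\<close>

lemma frame_cases:
  assumes "frame f"
  obtains a b c d e g h where "f = [a, b, c, d, e, g, h]"
  using frame_length[OF assms] by (auto simp: numeral_eq_Suc length_Suc_conv)

lemma adapted_frame: "adapted s f \<Longrightarrow> frame f"
  by (simp add: adapted_def)

lemma adapted_values:
  assumes "adapted s [a, b, c, d, e, g, h]"
  shows "s [a,b,c] = -1" "s [a,b,d] = 0" "s [a,b,e] = 0" "s [a,b,g] = 0" "s [a,b,h] = 0"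
    "s [a,c,d] = 0" "s [a,c,e] = 0" "s [a,c,g] = 0" "s [a,c,h] = 0" "s [a,d,e] = -1"
    "s [a,d,g] = 0" "s [a,d,h] = 0" "s [a,e,g] = 0" "s [a,e,h] = 0" "s [a,g,h] = 1"
    "s [b,c,d] = 0" "s [b,c,e] = 0" "s [b,c,g] = 0" "s [b,c,h] = 0" "s [b,d,e] = 0"
    "s [b,d,g] = -1" "s [b,d,h] = 0" "s [b,e,g] = 0" "s [b,e,h] = -1" "s [b,g,h] = 0"
    "s [c,d,e] = 0" "s [c,d,g] = 0" "s [c,d,h] = -1" "s [c,e,g] = 1" "s [c,e,h] = 0" "s [c,g,h] = 0"
    "s [d,e,g] = 0" "s [d,e,h] = 0" "s [d,g,h] = 0" "s [e,g,h] = 0"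
proof -
  let ?f = "[a, b, c, d, e, g, h]"
  have *: "s [?f ! i, ?f ! j, ?f ! k] = phi0 [i, j, k]" if "i < j" "j < k" "k < 7" for i j k
    using assms that unfolding adapted_def by blast
  show "s [a,b,c] = -1" "s [a,b,d] = 0" "s [a,b,e] = 0" "s [a,b,g] = 0" "s [a,b,h] = 0"
    "s [a,c,d] = 0" "s [a,c,e] = 0" "s [a,c,g] = 0" "s [a,c,h] = 0" "s [a,d,e] = -1"
    "s [a,d,g] = 0" "s [a,d,h] = 0" "s [a,e,g] = 0" "s [a,e,h] = 0" "s [a,g,h] = 1"
    "s [b,c,d] = 0" "s [b,c,e] = 0" "s [b,c,g] = 0" "s [b,c,h] = 0" "s [b,d,e] = 0"
    "s [b,d,g] = -1" "s [b,d,h] = 0" "s [b,e,g] = 0" "s [b,e,h] = -1" "s [b,g,h] = 0"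
    "s [c,d,e] = 0" "s [c,d,g] = 0" "s [c,d,h] = -1" "s [c,e,g] = 1" "s [c,e,h] = 0" "s [c,g,h] = 0"
    "s [d,e,g] = 0" "s [d,e,h] = 0" "s [d,g,h] = 0" "s [e,g,h] = 0"
    using *[of 0 1 2] *[of 0 1 3] *[of 0 1 4] *[of 0 1 5] *[of 0 1 6] *[of 0 2 3] *[of 0 2 4] *[of 0 2 5]
      *[of 0 2 6] *[of 0 3 4] *[of 0 3 5] *[of 0 3 6] *[of 0 4 5] *[of 0 4 6] *[of 0 5 6] *[of 1 2 3]
      *[of 1 2 4] *[of 1 2 5] *[of 1 2 6] *[of 1 3 4] *[of 1 3 5] *[of 1 3 6] *[of 1 4 5] *[of 1 4 6]
      *[of 1 5 6] *[of 2 3 4] *[of 2 3 5] *[of 2 3 6] *[of 2 4 5] *[of 2 4 6] *[of 2 5 6] *[of 3 4 5]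
      *[of 3 4 6] *[of 3 5 6] *[of 4 5 6]
    by (simp_all add: phi0_def)
qed

lemma form_inner_2:
  assumes "homogeneous 2 \<alpha>"
  shows "form_inner [a, b, c, d, e, g, h] \<alpha> \<beta> =
    \<alpha> [a,b] * \<beta> [a,b] + \<alpha> [a,c] * \<beta> [a,c] + \<alpha> [a,d] * \<beta> [a,d] + \<alpha> [a,e] * \<beta> [a,e] + \<alpha> [a,g] * \<beta> [a,g]
    + \<alpha> [a,h] * \<beta> [a,h] + \<alpha> [b,c] * \<beta> [b,c] + \<alpha> [b,d] * \<beta> [b,d] + \<alpha> [b,e] * \<beta> [b,e] + \<alpha> [b,g] * \<beta> [b,g]
    + \<alpha> [b,h] * \<beta> [b,h] + \<alpha> [c,d] * \<beta> [c,d] + \<alpha> [c,e] * \<beta> [c,e] + \<alpha> [c,g] * \<beta> [c,g] + \<alpha> [c,h] * \<beta> [c,h]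
    + \<alpha> [d,e] * \<beta> [d,e] + \<alpha> [d,g] * \<beta> [d,g] + \<alpha> [d,h] * \<beta> [d,h] + \<alpha> [e,g] * \<beta> [e,g] + \<alpha> [e,h] * \<beta> [e,h]
    + \<alpha> [g,h] * \<beta> [g,h]"
  using assms by (simp add: form_inner_Cons interior_apply homogeneous_def)

definition met :: "(real^7) list \<Rightarrow> real^7 \<Rightarrow> real^7 \<Rightarrow> real" where
  "met f v w = (\<Sum>i<7. coord f i v * coord f i w)"

definition fvol :: "(real^7) list \<Rightarrow> (real^7) form" where
  "fvol f vs = vol0 vs / vol0 f"

context
  fixes s :: "(real^7) form" and f :: "(real^7) list"
  assumes s: "alternating s" "homogeneous 3 s" and f: "adapted s f"
begin

lemma frame_f: "frame f" using f by (rule adapted_frame)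

lemma linear_eqI_frame:
  assumes "linear F" "linear G" "\<And>i. i < 7 \<Longrightarrow> F (f ! i) = G (f ! i)"
  shows "F (x :: real^7) = (G x :: real)"
  using linear_eq_on_span[OF assms(1,2), of "set f" x] assms(3) frame_span[OF frame_f] frame_length[OF frame_f]
  by (force simp: in_set_conv_nth)

lemma wedge_s_b_s:
  assumes b: "homogeneous 2 b"
  shows "wedge (wedge (interior x s) b) s f = 2 * form_inner f (interior x s) b"
proof (rule linear_eqI_frame)
  show "linear (\<lambda>x. wedge (wedge (interior x s) b) s f)"
    by (intro linearI)
      (simp_all add: interior_add_vec interior_scale_vec s wedge_add_left wedge_scale_left)
  show "linear (\<lambda>x. 2 * form_inner f (interior x s) b)"
    by (intro linearI)
      (simp_all add: form_inner_def interior_add_vec interior_scale_vec s distrib_left distrib_right sum.distrib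
        sum_distrib_left mult_ac)
  obtain a0 a1 a2 a3 a4 a5 a6 where fe: "f = [a0, a1, a2, a3, a4, a5, a6]" using frame_cases[OF frame_f] .
  note v = adapted_values[OF f[unfolded fe]]
  note srt = swap12[OF s, of a1 a0] swap23[OF s, of _ a1 a0] swap12[OF s, of a2 a0] swap23[OF s, of _ a2 a0] swap12[OF s, of a3 a0] swap23[OF s, of _ a3 a0] swap12[OF s, of a4 a0] swap23[OF s, of _ a4 a0] swap12[OF s, of a5 a0] swap23[OF s, of _ a5 a0] swap12[OF s, of a6 a0] swap23[OF s, of _ a6 a0] swap12[OF s, of a2 a1] swap23[OF s, of _ a2 a1] swap12[OF s, of a3 a1] swap23[OF s, of _ a3 a1] swap12[OF s, of a4 a1] swap23[OF s, of _ a4 a1] swap12[OF s, of a5 a1] swap23[OF s, of _ a5 a1] swap12[OF s, of a6 a1] swap23[OF s, of _ a6 a1] swap12[OF s, of a3 a2] swap23[OF s, of _ a3 a2] swap12[OF s, of a4 a2] swap23[OF s, of _ a4 a2] swap12[OF s, of a5 a2] swap23[OF s, of _ a5 a2] swap12[OF s, of a6 a2] swap23[OF s, of _ a6 a2] swap12[OF s, of a4 a3] swap23[OF s, of _ a4 a3] swap12[OF s, of a5 a3] swap23[OF s, of _ a5 a3] swap12[OF s, of a6 a3] swap23[OF s, of _ a6 a3] swap12[OF s, of a5 a4] swap23[OF s, of _ a5 a4] swap12[OF s, of a6 a4] swap23[OF s, of _ a6 a4] swap12[OF s, of a6 a5] swap23[OF s, of _ a6 a5]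
  have h4: "homogeneous 4 (wedge (interior x s) b)" for x
    using homogeneous_wedge[OF homogeneous_interior_s[OF s, of x] b] by simp
  have "\<forall>i<7. wedge (wedge (interior (f ! i) s) b) s f = 2 * form_inner f (interior (f ! i) s) b"
    unfolding all_less_7 wedge_eq_shuf[OF h4] fe form_inner_2[OF homogeneous_interior_s[OF s]]
    by (simp add: wedge_interior_shuf[OF s] interior_apply srt v trilinear(7-9)[OF s])
  then show "wedge (wedge (interior (f ! i) s) b) s f = 2 * form_inner f (interior (f ! i) s) b" if "i < 7" for i
    using that by blast
qed

lemma linear_coord_f: "i < 7 \<Longrightarrow> linear (coord f i)"
  using linear_coord frame_length[OF frame_f] by simp

lemma linear_met: "linear ((met f) v)"
  unfolding met_def
  by (intro linearI)
    (simp_all add: linear_add[OF linear_coord_f] linear_scale[OF linear_coord_f] distrib_left sum.distrib sum_distrib_left mult_ac)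

lemma met_sym: "(met f) v w = (met f) w v"
  by (simp add: met_def mult.commute)

lemma met_frame: "i < 7 \<Longrightarrow> j < 7 \<Longrightarrow> (met f) (f ! i) (f ! j) = (if i = j then 1 else 0)"
proof -
  assume ij: "i < 7" "j < 7"
  have "(\<Sum>k<7. coord f k (f ! i) * coord f k (f ! j)) = (\<Sum>k<7. if k = i then (if i = j then 1 else 0) else 0)"
    by (rule sum.cong) (auto simp: coord_nth[OF frame_f] ij)
  then show ?thesis using ij by (simp add: met_def)
qed

lemma inner_product_met: "inner_product (met f)"
proof -
  have "(met f) v v > 0" if v: "v \<noteq> 0" for v
  proof -
    have "\<exists>i<7. coord f i v \<noteq> 0"
    proof (rule ccontr)
      assume "\<not> (\<exists>i<7. coord f i v \<noteq> 0)"
      then have "v = 0" by (subst frame_expand[OF frame_f, of v]) simp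
      then show False using v by blast
    qed
    then obtain i where i: "i < 7" "coord f i v \<noteq> 0" by blast
    then have "coord f i v * coord f i v > 0" using not_real_square_gt_zero by blast
    then show ?thesis unfolding met_def using i(1) by (intro sum_pos2[where i = i]) auto
  qed
  then show ?thesis using linear_met met_sym by (auto simp: inner_product_def)
qed

lemma orthonormal_met: "orthonormal_basis (met f) f"
  by (simp add: orthonormal_basis_def met_frame frame_length[OF frame_f])

lemma vol_f: "(fvol f) f = 1"
  using frame_f by (simp add: fvol_def frame_def)

lemma alternating_vol: "alternating (fvol f)"
  unfolding fvol_def using alternating_scaled[OF alternating_vol0, of "1 / vol0 f"] by simp

lemma homogeneous_vol: "homogeneous 7 (fvol f)"
  using homogeneous_vol0 by (simp add: fvol_def homogeneous_def)

lemma form_inner_top: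
  assumes "homogeneous 7 \<alpha>" "length E = 7"
  shows "form_inner E \<alpha> \<alpha> = \<alpha> E * \<alpha> E"
proof -
  have "form_inner E \<alpha> \<alpha> = (\<Sum>I\<in>Pow {..<length E}. if I = {..<length E} then \<alpha> E * \<alpha> E else 0)"
    unfolding form_inner_def
  proof (rule sum.cong)
    fix I assume I: "I \<in> Pow {..<length E}"
    show "\<alpha> (nths E I) * \<alpha> (nths E I) = (if I = {..<length E} then \<alpha> E * \<alpha> E else 0)"
    proof (cases "I = {..<length E}")
      case True
      then show ?thesis by (simp add: nths_all)
    next
      case False
      then have "card I < card {..<length E}" using I by (intro psubset_card_mono) auto
      then show ?thesis using False I assms by (simp add: homogeneous_def length_nths_subset)
    qed
  qed simp
  also have "\<dots> = \<alpha> E * \<alpha> E" by (simp add: finite_Pow_iff)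
  finally show ?thesis .
qed

lemma unit_volume_vol: "unit_volume (met f) (fvol f)"
proof -
  have "\<bar>(fvol f) E\<bar> = 1" if E: "orthonormal_basis (met f) E" for E
  proof -
    have "(fvol f) E * (fvol f) E = (fvol f) f * (fvol f) f"
      using form_inner_invariant[OF inner_product_met E orthonormal_met alternating_vol alternating_vol homogeneous_vol]
        form_inner_top[OF homogeneous_vol] E frame_length[OF frame_f] by (simp add: orthonormal_basis_def)
    then show ?thesis using vol_f by (auto simp: square_eq_1_iff)
  qed
  then show ?thesis using alternating_vol homogeneous_vol by (simp add: unit_volume_def)
qed

lemma cub_met: "cub s v w * vol0 f = 6 * (met f) v w"
proof -
  obtain a0 a1 a2 a3 a4 a5 a6 where fe: "f = [a0, a1, a2, a3, a4, a5, a6]" using frame_cases[OF frame_f] .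
  note va = adapted_values[OF f[unfolded fe]]
  note srt = swap12[OF s, of a1 a0] swap23[OF s, of _ a1 a0] swap12[OF s, of a2 a0] swap23[OF s, of _ a2 a0] swap12[OF s, of a3 a0] swap23[OF s, of _ a3 a0] swap12[OF s, of a4 a0] swap23[OF s, of _ a4 a0] swap12[OF s, of a5 a0] swap23[OF s, of _ a5 a0] swap12[OF s, of a6 a0] swap23[OF s, of _ a6 a0] swap12[OF s, of a2 a1] swap23[OF s, of _ a2 a1] swap12[OF s, of a3 a1] swap23[OF s, of _ a3 a1] swap12[OF s, of a4 a1] swap23[OF s, of _ a4 a1] swap12[OF s, of a5 a1] swap23[OF s, of _ a5 a1] swap12[OF s, of a6 a1] swap23[OF s, of _ a6 a1] swap12[OF s, of a3 a2] swap23[OF s, of _ a3 a2] swap12[OF s, of a4 a2] swap23[OF s, of _ a4 a2] swap12[OF s, of a5 a2] swap23[OF s, of _ a5 a2] swap12[OF s, of a6 a2] swap23[OF s, of _ a6 a2] swap12[OF s, of a4 a3] swap23[OF s, of _ a4 a3] swap12[OF s, of a5 a3] swap23[OF s, of _ a5 a3] swap12[OF s, of a6 a3] swap23[OF s, of _ a6 a3] swap12[OF s, of a5 a4] swap23[OF s, of _ a5 a4] swap12[OF s, of a6 a4] swap23[OF s, of _ a6 a4] swap12[OF s, of a6 a5] swap23[OF s, of _ a6 a5]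
  have eq: "cub s v w * vol0 f = 2 * form_inner f (interior v s) (interior w s)" for v w
    using cub_vol[OF s, of v w f] wedge_s_b_s[OF homogeneous_interior_s[OF s]] by simp
  have "\<forall>i<7. \<forall>j<7. 2 * form_inner f (interior (f ! i) s) (interior (f ! j) s) = (if i = j then 6 else 0)"
    unfolding all_less_7 fe form_inner_2[OF homogeneous_interior_s[OF s]]
    by (simp add: interior_apply srt va trilinear(7-9)[OF s])
  then have "cub s (f ! i) (f ! j) * vol0 f = 6 * (met f) (f ! i) (f ! j)" if "i < 7" "j < 7" for i j
    using that by (simp add: eq met_frame)
  note base = this
  have l1: "linear (\<lambda>w. cub s v w * vol0 f)" for v
    by (intro linearI) (simp_all add: cub_add_right[OF s] cub_scale_right[OF s] distrib_right)
  have l2: "linear (\<lambda>w. 6 * met f v w)" for v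
    by (intro linearI) (simp_all add: linear_add[OF linear_met] linear_scale[OF linear_met])
  have "cub s (f ! i) w * vol0 f = 6 * met f (f ! i) w" if "i < 7" for i w
    by (rule linear_eqI_frame[OF l1[of "f ! i"] l2[of "f ! i"], of w]) (rule base[OF that])
  then have "cub s v (f ! i) * vol0 f = 6 * met f v (f ! i)" if "i < 7" for i
    using that cub_sym[OF s, of v "f ! i"] met_sym[of v "f ! i"] by simp
  then show ?thesis by (rule linear_eqI_frame[OF l1[of v] l2[of v], of w])
qed

lemma alternating_map_scale:
  "alternating \<phi> \<Longrightarrow> \<phi> (map (\<lambda>v. r *\<^sub>R v) vs) = r ^ length vs * \<phi> vs"
proof (induction vs arbitrary: \<phi>)
  case (Cons v vs)
  then show ?case
    using alternating_scale[OF Cons.prems, of "[]" r v] Cons.IH[OF alternating_interior[OF Cons.prems, of v]]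
    by (simp add: interior_def)
qed simp

lemma g2_metric_volume_eq: "g2_metric_volume s = ((met f), (fvol f))"
  unfolding g2_metric_volume_def
proof (rule the_equality)
  have "wedge (wedge (interior v s) (interior w s)) s = (\<lambda>vs. 6 * (met f) v w * (fvol f) vs)" for v w
  proof
    fix vs
    have "cub s v w = 6 * (met f) v w / vol0 f" using cub_met[of v w] frame_f by (simp add: frame_def field_simps)
    then show "wedge (wedge (interior v s) (interior w s)) s vs = 6 * (met f) v w * (fvol f) vs"
      by (simp add: cub_vol[OF s] fvol_def)
  qed
  then show "case ((met f), (fvol f)) of (g, v') \<Rightarrow> inner_product g \<and> unit_volume g v' \<and>
    (\<forall>v w. wedge (wedge (interior v s) (interior w s)) s = (\<lambda>vs. 6 * g v w * v' vs))"
    using inner_product_met unit_volume_vol by simp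
next
  fix gv :: "(real^7 \<Rightarrow> real^7 \<Rightarrow> real) \<times> (real^7) form"
  assume gv: "case gv of (g, v') \<Rightarrow> inner_product g \<and> unit_volume g v' \<and>
    (\<forall>v w. wedge (wedge (interior v s) (interior w s)) s = (\<lambda>vs. 6 * g v w * v' vs))"
  obtain g vl where e: "gv = (g, vl)" by (cases gv)
  have g: "inner_product g" and u: "unit_volume g vl"
    and eq: "\<And>v w vs. wedge (wedge (interior v s) (interior w s)) s vs = 6 * g v w * vl vs"
    using gv by (auto simp: e)
  define k where "k = vl f"
  have gk: "g v w * k = (met f) v w" for v w
    using eq[of v w f] cub_met[of v w] cub_vol[OF s, of v w f] by (simp add: k_def)
  have "(met f) (f ! 0) (f ! 0) = 1" using met_frame[of 0 0] by simp
  then have "g (f ! 0) (f ! 0) * k = 1" by (simp add: gk)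
  moreover have "g (f ! 0) (f ! 0) \<ge> 0"
    using g linear_0[OF inner_product_linear[OF g]] by (cases "f ! 0 = 0") (auto simp: inner_product_def less_imp_le)
  ultimately have k: "k > 0" by (metis mult_eq_0_iff mult_le_0_iff not_le not_one_le_zero order.order_iff_strict zero_less_one)
  let ?E = "map (\<lambda>v. sqrt k *\<^sub>R v) f"
  have gm: "g v w = (met f) v w / k" for v w using gk[of v w] k by (simp add: field_simps)
  have sc: "(met f) (r *\<^sub>R v) (r *\<^sub>R w) = r * r * (met f) v w" for r v w
    using linear_scale[OF linear_met] met_sym by (metis mult.assoc real_scaleR_def)
  have "orthonormal_basis g ?E"
    using k by (simp add: orthonormal_basis_def frame_length[OF frame_f] gm sc met_frame)
  then have "\<bar>vl ?E\<bar> = 1" using u by (simp add: unit_volume_def)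
  moreover have "vl ?E = sqrt k ^ 7 * k"
    using u alternating_map_scale[of vl "sqrt k" f] by (simp add: unit_volume_def frame_length[OF frame_f] k_def)
  ultimately have "sqrt k ^ 7 * (sqrt k * sqrt k) = 1" using k by (simp add: abs_mult)
  then have "sqrt k ^ 9 = 1 ^ 9" by (simp add: numeral_eq_Suc mult_ac)
  then have "sqrt k = 1" using k by (intro power_eq_imp_eq_base[of "sqrt k" 9 1]) auto
  then have k1: "k = 1" by simp
  then have "g = (met f)" using gk by (intro ext) simp
  moreover have "vl = (fvol f)"
    using u by (intro top_form_eqI[OF _ alternating_vol _ homogeneous_vol frame_f])
      (auto simp: unit_volume_def vol_f k1[unfolded k_def])
  ultimately show "gv = ((met f), (fvol f))" by (simp add: e)
qed

lemma star_eq: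
  assumes "alternating \<beta>" "homogeneous k \<beta>" "k \<le> 7"
  shows "star s k \<beta> = star_formula f (fvol f) \<beta>"
  unfolding star_def g2_metric_volume_eq fst_conv snd_conv
  by (rule hodge_star_eq[OF inner_product_met unit_volume_vol orthonormal_met assms])

lemma det_cub: "det (\<chi> i j. cub s (axis i 1) (axis j 1) / 6) = (1 / vol0 f) ^ 9"
proof -
  define M :: "real^7^7" where "M = (\<chi> k. f ! pos7 k)"
  define C :: "real^7^7" where "C = (\<chi> k i. coord f (pos7 k) (axis i 1))"
  have v: "vol0 f = det M" using frame_length[OF frame_f] by (simp add: vol0_def M_def)
  have "C ** transpose M = mat 1"
  proof (simp add: vec_eq_iff, intro allI)
    fix l k
    have "(C ** transpose M) $ l $ k = coord f (pos7 l) (f ! pos7 k)"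
      using linear_axis_expand[OF linear_coord_f, of "pos7 l" "f ! pos7 k"]
      by (simp add: matrix_matrix_mult_def C_def M_def transpose_def mult.commute)
    also have "\<dots> = mat 1 $ l $ k"
      by (simp add: coord_nth[OF frame_f] mat_def) (metis ix_pos7)
    finally show "(C ** transpose M) $ l $ k = mat 1 $ l $ k" .
  qed
  then have "det C * det M = 1" using det_mul[of C "transpose M"] by simp
  then have C: "det C = 1 / vol0 f" using frame_f by (simp add: v frame_def field_simps)
  have "cub s (axis i 1) (axis j 1) / 6 = (1 / vol0 f) * (transpose C ** C) $ i $ j" for i j
  proof -
    have "(transpose C ** C) $ i $ j = (met f) (axis i 1) (axis j 1)"
      unfolding met_def by (simp add: matrix_matrix_mult_def C_def transpose_def sum_7)
    then show ?thesis using cub_met[of "axis i 1" "axis j 1"] frame_f by (simp add: frame_def field_simps)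
  qed
  then have "(\<chi> i j. cub s (axis i 1) (axis j 1) / 6) = (\<chi> i. (1 / vol0 f) *s ((transpose C ** C) $ i))"
    by (simp add: vec_eq_iff)
  then show ?thesis
    using det_rows_mul[of "\<lambda>_. 1 / vol0 f" "\<lambda>i. (transpose C ** C) $ i"]
    by (simp add: det_mul C power_eq_if vec_lambda_eta)
qed

lemma vol_std: "(fvol f) std = root 9 (det (\<chi> i j. cub s (axis i 1) (axis j 1) / 6))"
  by (simp add: det_cub fvol_def odd_real_root_power_cancel del: power_one_over)

lemma cogram_cramer:
  "cogram f a k = det (\<chi> i j. if j = k then (if i = a then 6 * (fvol f) std else 0) else cub s (axis i 1) (axis j 1)) /
    det (\<chi> i j. cub s (axis i 1) (axis j 1))"
proof -
  let ?A = "(\<chi> i j. cub s (axis i 1) (axis j 1)) :: real^7^7"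
  have cub_eq: "cub s v w = (met f) v w * (6 * (fvol f) std)" for v w
    using cub_met[of v w] frame_f by (simp add: fvol_def frame_def field_simps)
  have "(\<chi> i j. cub s (axis i 1) (axis j 1) / 6) = (\<chi> i. (1 / 6) *s (?A $ i))" by (simp add: vec_eq_iff)
  then have "det ?A \<noteq> 0"
    using det_cub frame_f det_rows_mul[of "\<lambda>_. 1 / 6" "\<lambda>i. ?A $ i"] by (auto simp: frame_def vec_lambda_eta)
  moreover have "?A *v (\<chi> b. cogram f a b) = (\<chi> i. if i = a then 6 * fvol f std else 0)"
  proof (rule iffD2[OF vec_eq_iff], rule allI)
    fix i
    have "(?A *v (\<chi> b. cogram f a b)) $ i = (\<Sum>b\<in>UNIV. cogram f a b * cub s (axis b 1) (axis i 1))"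
      by (simp add: matrix_vector_mult_def mult.commute cub_sym[OF s, of _ "axis i 1"])
    also have "\<dots> = (\<Sum>b\<in>UNIV. cogram f a b * met f (axis b 1) (axis i 1)) * (6 * fvol f std)"
      by (simp only: cub_eq sum_distrib_right mult.assoc)
    also have "\<dots> = axis i 1 $ a * (6 * fvol f std)"
      unfolding cogram_inverse[OF inner_product_met orthonormal_met] ..
    finally show "(?A *v (\<chi> b. cogram f a b)) $ i = (\<chi> i. if i = a then 6 * fvol f std else 0) $ i"
      by (auto simp: axis_def)
  qed
  ultimately have "(\<chi> b. cogram f a b) = (\<chi> k. det (\<chi> i j. if j = k then (\<chi> i. if i = a then 6 * fvol f std else 0) $ i
      else ?A $ i $ j) / det ?A)"
    using cramer by blast
  then show ?thesis by (simp add: vec_eq_iff cong: if_cong)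
qed

end

section \<open>The tautological forms\<close>

lemma mem_X: "x \<in> X \<longleftrightarrow> definite (s_of x)"
  by (cases x) (auto simp: X_def s_of_def)

lemma s_of_forms: "alternating (s_of x)" "homogeneous 3 (s_of x)"
  by (simp_all add: s_of_def alternating_form3 homogeneous_form3)

lemma b_of_forms: "alternating (b_of x)" "homogeneous 2 (b_of x)"
  by (simp_all add: b_of_def alternating_form2 homogeneous_form2)

lemma definite_iff_cub:
  assumes "alternating s" "homogeneous 3 s"
  shows "definite s \<longleftrightarrow> (\<forall>v. v \<noteq> 0 \<longrightarrow> cub s v v \<noteq> 0)"
proof -
  have "wedge (wedge (interior v s) (interior v s)) s = (\<lambda>vs. 0) \<longleftrightarrow> cub s v v = 0" for v
  proof
    show "cub s v v = 0" if "wedge (wedge (interior v s) (interior v s)) s = (\<lambda>vs. 0)"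
      unfolding cub_def that ..
    show "wedge (wedge (interior v s) (interior v s)) s = (\<lambda>vs. 0)" if "cub s v v = 0"
      by (rule ext) (simp only: cub_vol[OF assms] that mult_zero_left)
  qed
  then show ?thesis using assms by (simp add: definite_def)
qed

lemma open_X: "open X"
proof -
  have lin: "continuous_on UNIV (\<lambda>z::(real^7) \<times> (real^triples). du_monomial I (fst z # vs))" for I vs
  proof -
    have "linear (\<lambda>v. du_monomial I (v # vs))"
      using alternating_linear[OF alternating_du_monomial, of I "[]" vs] by simp
    then have "linear (\<lambda>z::(real^7) \<times> (real^triples). du_monomial I (fst z # vs))"
      using linear_compose[OF linear_fst, of "\<lambda>v. du_monomial I (v # vs)"] by (simp add: o_def)
    then show ?thesis by (simp add: linear_continuous_on linear_conv_bounded_linear)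
  qed
  have f1: "continuous_on UNIV (\<lambda>z::(real^7) \<times> (real^triples). form3 (snd z) (fst z # vs))" for vs
    unfolding form3_def by (intro continuous_on_sum continuous_on_mult lin continuous_intros)
  have f2: "continuous_on UNIV (\<lambda>z::(real^7) \<times> (real^triples). form3 (snd z) vs)" for vs
    unfolding form3_def by (intro continuous_on_sum continuous_on_mult continuous_intros)
  have "continuous_on UNIV (\<lambda>z. cub (form3 (snd z)) (fst z) (fst z))"
    unfolding cub_def wedge_def interior_def
    by (intro continuous_on_sum continuous_on_mult continuous_on_const f1 f2)
  then have "closed {z. cub (form3 (snd z)) (fst z) (fst z) = 0}"
    by (intro closed_Collect_eq continuous_on_const)
  then have cl: "closed {a. \<exists>v. v \<in> sphere 0 1 \<and> (v, a) \<in> {z. cub (form3 (snd z)) (fst z) (fst z) = 0}}"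
    by (intro closed_compact_projection compact_sphere)
  have "definite (form3 a) \<longleftrightarrow> a \<notin> {a. \<exists>v. v \<in> sphere 0 1 \<and> (v, a) \<in> {z. cub (form3 (snd z)) (fst z) (fst z) = 0}}" for a
  proof -
    note fa = alternating_form3[of a] homogeneous_form3[of a]
    have "(\<exists>v. v \<noteq> 0 \<and> cub (form3 a) v v = 0) \<longleftrightarrow> (\<exists>v. v \<in> sphere 0 1 \<and> cub (form3 a) v v = 0)"
    proof
      assume "\<exists>v. v \<noteq> 0 \<and> cub (form3 a) v v = 0"
      then obtain v where "v \<noteq> 0" "cub (form3 a) v v = 0" by blast
      then show "\<exists>v. v \<in> sphere 0 1 \<and> cub (form3 a) v v = 0"
        by (intro exI[of _ "(1 / norm v) *\<^sub>R v"]) (simp add: cub_scale_left[OF fa] cub_scale_right[OF fa])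
    next
      assume "\<exists>v. v \<in> sphere 0 1 \<and> cub (form3 a) v v = 0"
      then obtain v where "norm v = 1" "cub (form3 a) v v = 0" by auto
      then show "\<exists>v. v \<noteq> 0 \<and> cub (form3 a) v v = 0" by (intro exI[of _ v]) auto
    qed
    then show ?thesis by (auto simp: definite_iff_cub[OF fa])
  qed
  then have o: "open {a. definite (form3 a)}"
    using cl by (simp add: open_closed Compl_eq) 
  have "continuous_on UNIV (\<lambda>x::total. fst (snd x))" by (intro continuous_intros)
  from open_vimage[OF o this] show ?thesis by (simp add: X_def vimage_def case_prod_beta')
qed

lemma linear_s_of: "linear (\<lambda>x. s_of x vs)"
  and linear_b_of: "linear (\<lambda>x. b_of x vs)"
  unfolding s_of_def b_of_def
  by (intro linearI; simp add: linear_add[OF linear_form3] linear_scale[OF linear_form3]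
      linear_add[OF linear_form2] linear_scale[OF linear_form2])+

lemma smooth_s_of: "smooth_on X (\<lambda>x. s_of x vs)"
  and smooth_b_of: "smooth_on X (\<lambda>x. b_of x vs)"
  by (intro smooth_on_linear open_X linear_s_of linear_b_of)+

lemma smooth_cub: "smooth_on X (\<lambda>x. cub (s_of x) v w)"
  unfolding cub_def wedge_def interior_def
  by (intro smooth_on_sum smooth_on_mult smooth_on_const smooth_s_of open_X)

definition fr :: "total \<Rightarrow> (real^7) list" where
  "fr x = (SOME f. adapted (s_of x) f)"

lemma adapted_fr: "x \<in> X \<Longrightarrow> adapted (s_of x) (fr x)"
  unfolding fr_def mem_X by (metis definite_adapted someI_ex)

lemma frame_fr: "x \<in> X \<Longrightarrow> frame (fr x)"
  using adapted_fr adapted_frame by blast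

lemma smooth_det:
  fixes A :: "total \<Rightarrow> 7 \<Rightarrow> 7 \<Rightarrow> real"
  assumes "\<And>i j. smooth_on X (\<lambda>x. A x i j)"
  shows "smooth_on X (\<lambda>x. det (\<chi> i j. A x i j))"
  unfolding det_def by (simp, intro smooth_on_sum smooth_on_mult smooth_on_prod smooth_on_const assms open_X)

lemma det_cub_nonzero: "x \<in> X \<Longrightarrow> det (\<chi> i j. cub (s_of x) (axis i 1) (axis j 1) / 6) \<noteq> 0"
  using det_cub[OF s_of_forms adapted_fr] frame_fr[of x] by (simp add: frame_def)

lemma smooth_vol_std: "smooth_on X (\<lambda>x. fvol (fr x) std)"
proof (rule smooth_on_cong[OF open_X])
  show "smooth_on X (\<lambda>x. root 9 (det (\<chi> i j. (1 / 6) * cub (s_of x) (axis i 1) (axis j 1))))"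
    using det_cub_nonzero
    by (intro smooth_on_root open_X smooth_det smooth_on_mult smooth_on_const smooth_cub) auto
  show "root 9 (det (\<chi> i j. (1 / 6) * cub (s_of x) (axis i 1) (axis j 1))) = fvol (fr x) std" if "x \<in> X" for x
    using vol_std[OF s_of_forms adapted_fr[OF that]] by simp
qed

lemma smooth_vol: "smooth_on X (\<lambda>x. fvol (fr x) vs)"
proof -
  have "fvol (fr x) vs = fvol (fr x) std * vol0 vs" for x by (simp add: fvol_def)
  then show ?thesis by (simp only:) (intro smooth_on_mult smooth_vol_std smooth_on_const open_X)
qed

lemma smooth_cogram: "smooth_on X (\<lambda>x. cogram (fr x) a b)"
proof (rule smooth_on_cong[OF open_X])
  let ?A = "\<lambda>x i j. cub (s_of x) (axis i 1) (axis j 1)"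
  let ?B = "\<lambda>x i j. if j = b then (if i = a then 6 * fvol (fr x) std else 0) else ?A x i j"
  show "smooth_on X (\<lambda>x. det (\<chi> i j. ?B x i j) * inverse (det (\<chi> i j. ?A x i j)))"
  proof (intro smooth_on_mult smooth_on_inverse smooth_det open_X smooth_cub)
    show "smooth_on X (\<lambda>x. ?B x i j)" for i j
      by (cases "j = b"; cases "i = a") (simp_all add: smooth_cub smooth_on_const smooth_on_mult smooth_vol_std open_X)
    fix x assume "x \<in> X"
    have "(\<chi> i j. ?A x i j / 6) = (\<chi> i. (1 / 6) *s (\<chi> j. ?A x i j))" by (simp add: vec_eq_iff)
    then show "det (\<chi> i j. ?A x i j) \<noteq> 0"
      using det_cub_nonzero[OF \<open>x \<in> X\<close>] det_rows_mul[of "\<lambda>_. 1 / 6" "\<lambda>i. \<chi> j. ?A x i j"] by auto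
  qed
  show "det (\<chi> i j. ?B x i j) * inverse (det (\<chi> i j. ?A x i j)) = cogram (fr x) a b" if "x \<in> X" for x
    using cogram_cramer[OF s_of_forms adapted_fr[OF that]] by (simp add: field_simps)
qed

lemma form_inner_contract_cogram:
  fixes \<alpha> \<beta> :: "(real^7) form"
  assumes "alternating \<alpha>" "alternating \<beta>" "homogeneous (Suc k) \<alpha>"
  shows "form_inner E \<alpha> \<beta> = 1 / real (Suc k) *
    (\<Sum>a\<in>UNIV. \<Sum>b\<in>UNIV. cogram E a b * form_inner E (interior (axis a 1) \<alpha>) (interior (axis b 1) \<beta>))"
proof -
  have lin: "linear (\<lambda>x. interior x \<gamma> vs)" if "alternating \<gamma>" for \<gamma> :: "(real^7) form" and vs
    using alternating_linear[OF that, of "[]"] by (simp add: interior_def)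
  have sw: "(\<Sum>x\<leftarrow>F. form_inner E (interior x \<alpha>) (interior x \<beta>)) =
    (\<Sum>I\<in>Pow {..<length E}. \<Sum>x\<leftarrow>F. interior x \<alpha> (nths E I) * interior x \<beta> (nths E I))" for F
    unfolding form_inner_def by (induction F) (simp_all add: sum.distrib)
  have "real (Suc k) * form_inner E \<alpha> \<beta> = (\<Sum>I\<in>Pow {..<length E}. \<Sum>a\<in>UNIV. \<Sum>b\<in>UNIV.
    cogram E a b * (interior (axis a 1) \<alpha> (nths E I) * interior (axis b 1) \<beta> (nths E I)))"
    using form_inner_contract[OF assms, of E]
    unfolding sw sum_list_cogram[OF lin[OF assms(1)] lin[OF assms(2)]] by simp
  also have "\<dots> = (\<Sum>a\<in>UNIV. \<Sum>b\<in>UNIV. cogram E a b *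
    form_inner E (interior (axis a 1) \<alpha>) (interior (axis b 1) \<beta>))"
    unfolding form_inner_def sum_distrib_left
    by (subst sum.swap, rule sum.cong[OF refl], subst sum.swap, rule refl)
  finally show ?thesis by (simp add: field_simps)
qed

lemma smooth_form_inner:
  assumes "\<And>x. x \<in> X \<Longrightarrow> alternating (\<beta> x)" "\<And>x. x \<in> X \<Longrightarrow> homogeneous k (\<beta> x)" "\<And>vs. smooth_on X (\<lambda>x. \<beta> x vs)"
    and "\<And>x. x \<in> X \<Longrightarrow> alternating (\<psi> x)" "\<And>vs. smooth_on X (\<lambda>x. \<psi> x vs)"
  shows "smooth_on X (\<lambda>x. form_inner (fr x) (\<beta> x) (\<psi> x))"
  using assms
proof (induction k arbitrary: \<beta> \<psi>)
  case 0
  have "smooth_on X (\<lambda>x. \<beta> x [] * \<psi> x [])" by (intro smooth_on_mult open_X 0)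
  then show ?case by (rule smooth_on_cong[OF open_X]) (simp add: form_inner_homogeneous_0 0)
next
  case (Suc k)
  have "smooth_on X (\<lambda>x. 1 / real (Suc k) * (\<Sum>a\<in>UNIV. \<Sum>b\<in>UNIV. cogram (fr x) a b *
    form_inner (fr x) (interior (axis a 1) (\<beta> x)) (interior (axis b 1) (\<psi> x))))"
    by (intro smooth_on_mult smooth_on_sum smooth_cogram smooth_on_const open_X Suc.IH alternating_interior
        homogeneous_interior Suc.prems) (simp_all add: interior_def Suc.prems)
  then show ?case
    by (rule smooth_on_cong[OF open_X]) (rule form_inner_contract_cogram[symmetric]; simp add: Suc.prems)
qed

lemma star_fr:
  "x \<in> X \<Longrightarrow> alternating \<beta> \<Longrightarrow> homogeneous k \<beta> \<Longrightarrow> k \<le> 7 \<Longrightarrow>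
    star (s_of x) k \<beta> = star_formula (fr x) (fvol (fr x)) \<beta>"
  using star_eq[OF s_of_forms adapted_fr] .

lemma alternating_star:
  "x \<in> X \<Longrightarrow> alternating \<beta> \<Longrightarrow> homogeneous k \<beta> \<Longrightarrow> k \<le> 7 \<Longrightarrow> alternating (star (s_of x) k \<beta>)"
  by (simp add: star_fr alternating_star_formula alternating_vol[OF s_of_forms adapted_fr])

lemma homogeneous_star:
  "x \<in> X \<Longrightarrow> alternating \<beta> \<Longrightarrow> homogeneous k \<beta> \<Longrightarrow> k \<le> 7 \<Longrightarrow> homogeneous (7 - k) (star (s_of x) k \<beta>)"
  by (simp add: star_fr homogeneous_star_formula homogeneous_vol[OF s_of_forms adapted_fr])

lemma smooth_star:
  assumes "\<And>x. x \<in> X \<Longrightarrow> alternating (\<beta> x)" "\<And>x. x \<in> X \<Longrightarrow> homogeneous k (\<beta> x)"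
    "\<And>vs. smooth_on X (\<lambda>x. \<beta> x vs)" "k \<le> 7"
  shows "smooth_on X (\<lambda>x. star (s_of x) k (\<beta> x) w)"
proof (rule smooth_on_cong[OF open_X])
  show "smooth_on X (\<lambda>x. form_inner (fr x) (\<beta> x) (\<lambda>vs. fvol (fr x) (vs @ w)))"
  proof (intro smooth_form_inner[OF assms(1-3)] smooth_vol)
    fix x assume "x \<in> X"
    then have a: "alternating (fvol (fr x))" by (rule alternating_vol[OF s_of_forms adapted_fr])
    show "alternating (\<lambda>vs. fvol (fr x) (vs @ w))"
      using alternating_linear[OF a, of _ "_ @ w"] alternating_adjacent[OF a, of _ _ "_ @ w"]
      by (intro alternatingI) auto
  qed
  show "form_inner (fr x) (\<beta> x) (\<lambda>vs. fvol (fr x) (vs @ w)) = star (s_of x) k (\<beta> x) w" if "x \<in> X" for x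
    using star_fr[OF that assms(1,2)[OF that] assms(4)] by (simp add: star_formula_def)
qed

lemma diff_form_pullback:
  assumes "\<And>x. x \<in> X \<Longrightarrow> alternating (\<eta> x)" "\<And>vs. smooth_on X (\<lambda>x. \<eta> x vs)"
  shows "diff_form X (\<lambda>x. pullback fst (\<eta> x))"
  unfolding diff_form_def
  by (intro conjI ballI allI alternating_pullback linear_fst assms(1)) (simp_all add: pullback_def assms(2))

abbreviation star_s :: "total \<Rightarrow> (real^7) form" where
  "star_s x \<equiv> star (s_of x) 3 (s_of x)"

abbreviation star_b :: "total \<Rightarrow> (real^7) form" where
  "star_b x \<equiv> star (s_of x) 2 (b_of x)"

abbreviation star_du :: "7 \<Rightarrow> total \<Rightarrow> (real^7) form" where
  "star_du i x \<equiv> star (s_of x) 1 (du i)"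

abbreviation star_1 :: "total \<Rightarrow> (real^7) form" where
  "star_1 x \<equiv> star (s_of x) 0 unit_form"

lemma smooth_stars:
  "smooth_on X (\<lambda>x. star_s x vs)" "smooth_on X (\<lambda>x. star_b x vs)"
  "smooth_on X (\<lambda>x. star_du i x vs)" "smooth_on X (\<lambda>x. star_1 x vs)"
  by (intro smooth_star s_of_forms b_of_forms smooth_s_of smooth_b_of smooth_on_const alternating_du homogeneous_du
      alternating_unit_form homogeneous_unit_form; simp)+

lemma alternating_stars:
  assumes "x \<in> X"
  shows "alternating (star_s x)" "alternating (star_b x)" "alternating (star_du i x)" "alternating (star_1 x)"
  using alternating_star[OF assms s_of_forms] alternating_star[OF assms b_of_forms]
    alternating_star[OF assms alternating_du homogeneous_du]
    alternating_star[OF assms alternating_unit_form homogeneous_unit_form]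
  by simp_all

lemma homogeneous_stars:
  assumes "x \<in> X"
  shows "homogeneous 4 (star_s x)" "homogeneous 5 (star_b x)" "homogeneous 6 (star_du i x)" "homogeneous 7 (star_1 x)"
  using homogeneous_star[OF assms s_of_forms] homogeneous_star[OF assms b_of_forms]
    homogeneous_star[OF assms alternating_du homogeneous_du] homogeneous_star[OF assms alternating_unit_form homogeneous_unit_form]
  by simp_all

lemma diff_forms:
  "diff_form X sform" "diff_form X bform" "diff_form X tform" "diff_form X pform" "diff_form X (Phi i)"
proof -
  have eq: "sform = (\<lambda>x. pullback fst (s_of x))" "bform = (\<lambda>x. pullback fst (b_of x))"
    "tform = (\<lambda>x. pullback fst (star_s x))" "pform = (\<lambda>x. pullback fst (star_b x))"
    "Phi i = (\<lambda>x. pullback fst (star_du i x))"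
    by (auto simp: sform_def bform_def tform_def pform_def Phi_def)
  show "diff_form X sform" "diff_form X bform" "diff_form X tform" "diff_form X pform" "diff_form X (Phi i)"
    unfolding eq
    by (intro diff_form_pullback s_of_forms b_of_forms smooth_s_of smooth_b_of smooth_stars alternating_stars; assumption)+
qed

lemma star_1_eq_vol:
  assumes "x \<in> X"
  shows "star_1 x = fvol (fr x)"
proof -
  have "star_1 x = star_formula (fr x) (fvol (fr x)) unit_form"
    by (rule star_fr[OF assms alternating_unit_form homogeneous_unit_form]) simp
  also have "\<dots> = fvol (fr x)"
    unfolding star_formula_def form_inner_homogeneous_0[OF homogeneous_unit_form] by (simp add: unit_form_def)
  finally show ?thesis .
qed

section \<open>Equivariance of the Hodge star and its derivative\<close>

definition lie :: "('a \<Rightarrow> 'a) \<Rightarrow> 'a form \<Rightarrow> 'a form" where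
  "lie A \<phi> vs = (\<Sum>i<length vs. \<phi> (vs[i := A (vs ! i)]))"

lemma lie_Nil [simp]: "lie A \<phi> [] = 0"
  by (simp add: lie_def)

lemma lie_Cons: "lie A \<phi> (v # vs) = \<phi> (A v # vs) + lie A (interior v \<phi>) vs"
  by (simp add: lie_def interior_def sum.lessThan_Suc_shift del: sum.lessThan_Suc)

lemma lie_add: "lie A (\<lambda>l. \<phi> l + \<psi> l) vs = lie A \<phi> vs + lie A \<psi> vs"
  by (simp add: lie_def sum.distrib)

lemma lie_scale: "lie A (\<lambda>l. r * \<phi> l) vs = r * lie A \<phi> vs"
  by (simp add: lie_def sum_distrib_left)

lemma lie_zero [simp]: "lie A (\<lambda>l. 0) vs = 0"
  by (simp add: lie_def)

lemma homogeneous_lie: "homogeneous k \<phi> \<Longrightarrow> homogeneous k (lie A \<phi>)"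
  by (simp add: homogeneous_def lie_def)

lemma alternating_lie:
  assumes A: "linear A" and \<phi>: "alternating \<phi>"
  shows "alternating (lie A \<phi>)"
proof -
  have "(\<forall>u v. lie A \<phi> (xs @ (u + v) # ys) = lie A \<phi> (xs @ u # ys) + lie A \<phi> (xs @ v # ys)) \<and>
    (\<forall>r v. lie A \<phi> (xs @ (r *\<^sub>R v) # ys) = r * lie A \<phi> (xs @ v # ys)) \<and>
    (\<forall>v. lie A \<phi> (xs @ v # v # ys) = 0)" for xs ys
    using \<phi>
  proof (induction xs arbitrary: \<phi>)
    case Nil
    have sw: "\<phi> (A v # v # ys) = - \<phi> (v # A v # ys)" for v
      using alternating_swap[OF Nil, of "[]" "A v" v ys] by simp
    have lin: "\<phi> ((u + w) # ys) = \<phi> (u # ys) + \<phi> (w # ys)" "\<phi> ((r *\<^sub>R u) # ys) = r * \<phi> (u # ys)" for u w r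
      using alternating_add[OF Nil, of "[]"] alternating_scale[OF Nil, of "[]"] by simp_all
    have il: "lie A (interior (u + w) \<phi>) l = lie A (interior u \<phi>) l + lie A (interior w \<phi>) l"
      "lie A (interior (r *\<^sub>R u) \<phi>) l = r * lie A (interior u \<phi>) l" for u w r l
      by (simp_all add: interior_add_vec[OF Nil] interior_scale_vec[OF Nil] lie_add lie_scale)
    have iv: "lie A (interior v \<phi>) (v # ys) = \<phi> (v # A v # ys)" for v
      unfolding lie_Cons alternating_interior_interior[OF Nil] by (simp add: interior_def)
    show ?case
      by (simp add: lie_Cons[of A \<phi>] linear_add[OF A] linear_scale[OF A] lin sw il iv distrib_left)
  next
    case (Cons x xs)
    show ?case
      using Cons.IH[OF alternating_interior[OF Cons.prems, of x]]
      using alternating_add[OF Cons.prems, of "A x # xs" _ _ ys] alternating_scale[OF Cons.prems, of "A x # xs" _ _ ys]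
        alternating_adjacent[OF Cons.prems, of "A x # xs" _ ys]
      by (simp add: lie_Cons algebra_simps)
  qed
  then show ?thesis by (intro alternatingI linearI) auto
qed

lemma lie_has_derivative:
  assumes \<phi>: "alternating \<phi>"
  shows "((\<lambda>r. \<phi> (map (\<lambda>v. v + r *\<^sub>R A v) vs)) has_real_derivative lie A \<phi> vs) (at 0)"
  using \<phi>
proof (induction vs arbitrary: \<phi>)
  case (Cons v vs)
  let ?m = "\<lambda>r. map (\<lambda>v. v + r *\<^sub>R A v) vs"
  have d: "((\<lambda>r. interior v \<phi> (?m r) + r * interior (A v) \<phi> (?m r)) has_real_derivative
    lie A (interior v \<phi>) vs + (1 * interior (A v) \<phi> (?m 0) + lie A (interior (A v) \<phi>) vs * 0)) (at 0)"
    by (intro DERIV_add DERIV_mult Cons.IH alternating_interior Cons.prems DERIV_ident)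
  have "(\<lambda>r. \<phi> (map (\<lambda>v. v + r *\<^sub>R A v) (v # vs))) = (\<lambda>r. interior v \<phi> (?m r) + r * interior (A v) \<phi> (?m r))"
    using alternating_add[OF Cons.prems, of "[]" v] alternating_scale[OF Cons.prems, of "[]"]
    by (simp add: interior_apply)
  then show ?case using d by (simp add: lie_Cons interior_apply add.commute)
qed simp

lemma perturbed_identity_inj:
  fixes A :: "'a::euclidean_space \<Rightarrow> 'a"
  assumes "linear A"
  obtains d where "d > 0" "\<And>r. \<bar>r\<bar> < d \<Longrightarrow> inj (\<lambda>v. v + r *\<^sub>R A v)"
proof -
  obtain B where B: "B > 0" "\<And>v. norm (A v) \<le> B * norm v"
    using linear_bounded_pos[OF assms] by blast
  have "inj (\<lambda>v. v + r *\<^sub>R A v)" if r: "\<bar>r\<bar> < 1 / B" for r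
  proof -
    have lin: "linear (\<lambda>v. v + r *\<^sub>R A v)"
      by (intro linear_compose_add linear_ident linear_compose_scale_right assms)
    have "v = 0" if "v + r *\<^sub>R A v = 0" for v
    proof (rule ccontr)
      assume "v \<noteq> 0"
      have "norm v = norm (r *\<^sub>R A v)" using that by (metis add_eq_0_iff2 norm_minus_cancel)
      also have "\<dots> \<le> \<bar>r\<bar> * (B * norm v)" using B(2) by (simp add: mult_left_mono)
      also have "\<dots> < 1 / B * (B * norm v)" using r B(1) \<open>v \<noteq> 0\<close> by (intro mult_strict_right_mono) auto
      finally show False using B(1) by simp
    qed
    then show ?thesis using linear_injective_0[OF lin] by blast
  qed
  then show thesis using that[of "1 / B"] B(1) by simp
qed

lemma star_pullback:
  assumes s: "alternating s" "homogeneous 3 s" and f: "adapted s f" and P: "linear P" "inj P"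
    and \<beta>: "alternating \<beta>" "homogeneous k \<beta>" "k \<le> 7"
  shows "star (pullback P s) k (pullback P \<beta>) = pullback P (star s k \<beta>)"
proof -
  obtain Q where Q: "linear Q" "\<And>v. P (Q v) = v"
    using linear_injective_isomorphism[OF P] by blast
  note ff = adapted_frame[OF f]
  note len = frame_length[OF ff]
  have PQ: "map P (map Q l) = l" for l using Q(2) by (induction l) auto
  let ?f = "map Q f"
  have fr: "frame ?f"
    by (rule frame_of_dual[where \<theta> = "\<lambda>i v. coord f i (P v)"])
      (use len Q(2) coord_nth[OF ff] in \<open>auto intro!: linear_compose[OF P(1), unfolded o_def] linear_coord\<close>)
  have ad: "adapted (pullback P s) ?f"
    unfolding adapted_def
  proof (intro conjI fr allI impI)
    fix i j k :: nat assume "i < j \<and> j < k \<and> k < 7"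
    then show "pullback P s [?f ! i, ?f ! j, ?f ! k] = phi0 [i, j, k]"
      using f len Q(2) by (simp add: adapted_def pullback_def)
  qed
  have ps: "alternating (pullback P s)" "homogeneous 3 (pullback P s)"
    using alternating_pullback[OF P(1)] homogeneous_pullback s by blast+
  have pv: "fvol ?f = pullback P (fvol f)"
  proof (rule top_form_eqI[OF _ _ _ _ fr])
    show "fvol ?f ?f = pullback P (fvol f) ?f"
      using vol_f[OF s f] vol_f[OF ps ad] by (simp add: pullback_def PQ del: map_map)
  qed (use alternating_pullback[OF P(1)] homogeneous_pullback alternating_vol[OF s f] homogeneous_vol[OF s f]
      alternating_vol[OF ps ad] homogeneous_vol[OF ps ad] in blast)+
  have "star (pullback P s) k (pullback P \<beta>) = star_formula ?f (fvol ?f) (pullback P \<beta>)"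
    using alternating_pullback[OF P(1)] homogeneous_pullback \<beta> by (intro star_eq[OF ps ad]) auto
  also have "\<dots> = pullback P (star_formula f (fvol f) \<beta>)"
    unfolding pv by (rule ext) (simp add: star_formula_def form_inner_def pullback_def nths_map PQ del: map_map)
  also have "\<dots> = pullback P (star s k \<beta>)"
    using star_eq[OF s f \<beta>] by simp
  finally show ?thesis .
qed

definition fd :: "(total \<Rightarrow> (real^7) form) \<Rightarrow> total \<Rightarrow> total \<Rightarrow> (real^7) form" where
  "fd \<eta> x h vs = frechet_derivative (\<lambda>y. \<eta> y vs) (at x) h"

lemma fd_has_derivative:
  "x \<in> X \<Longrightarrow> smooth_on X (\<lambda>y. \<eta> y vs) \<Longrightarrow> ((\<lambda>y. \<eta> y vs) has_derivative (\<lambda>h. fd \<eta> x h vs)) (at x)"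
  unfolding fd_def by (rule smooth_on_has_derivative)

lemma linear_fd: "x \<in> X \<Longrightarrow> smooth_on X (\<lambda>y. \<eta> y vs) \<Longrightarrow> linear (\<lambda>h. fd \<eta> x h vs)"
  by (rule has_derivative_linear[OF fd_has_derivative])

lemma fd_eq: "((\<lambda>y. \<eta> y vs) has_derivative f') (at x) \<Longrightarrow> fd \<eta> x h vs = f' h"
  unfolding fd_def by (simp add: frechet_derivative_eq)

lemma fd_line_constant:
  assumes x: "x \<in> X" and sm: "smooth_on X (\<lambda>y. \<eta> y vs)" and const: "\<And>r. \<eta> (x + r *\<^sub>R h) vs = \<eta> x vs"
  shows "fd \<eta> x h vs = 0"
proof -
  have "((\<lambda>r. \<eta> (x + r *\<^sub>R h) vs) has_real_derivative frechet_derivative (\<lambda>y. \<eta> y vs) (at (x + 0 *\<^sub>R h)) h) (at 0)"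
    using smooth_on_differentiable[OF sm x] by (intro DERIV_line) simp
  moreover have "((\<lambda>r. \<eta> (x + r *\<^sub>R h) vs) has_real_derivative 0) (at 0)" by (simp add: const)
  ultimately have "frechet_derivative (\<lambda>y. \<eta> y vs) (at (x + 0 *\<^sub>R h)) h = 0" by (rule DERIV_unique)
  then show ?thesis by (simp add: fd_def)
qed

definition dirs :: "(real^triples) \<Rightarrow> total" where
  "dirs \<sigma> = (0, \<sigma>, 0)"

definition orbit :: "(real^7 \<Rightarrow> real^7) \<Rightarrow> total \<Rightarrow> real \<Rightarrow> total" where
  "orbit A x r = (fst x, coords3 (pullback (\<lambda>v. v + r *\<^sub>R A v) (s_of x)), snd (snd x))"

lemma linear_perturbed: "linear A \<Longrightarrow> linear (\<lambda>v. v + r *\<^sub>R A v)"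
  by (intro linear_compose_add linear_ident linear_compose_scale_right)

lemma s_of_orbit: "linear A \<Longrightarrow> s_of (orbit A x r) = pullback (\<lambda>v. v + r *\<^sub>R A v) (s_of x)"
  unfolding s_of_def orbit_def fst_conv snd_conv
  by (intro form3_coords3 alternating_pullback linear_perturbed homogeneous_pullback alternating_form3 homogeneous_form3)

lemma orbit_0: "orbit A x 0 = x"
  by (cases x) (simp add: orbit_def pullback_def s_of_def)

lemma orbit_has_derivative:
  "(orbit A x has_derivative (\<lambda>h. h *\<^sub>R dirs (coords3 (lie A (s_of x))))) (at 0)"
proof -
  have "((\<lambda>r. coords3 (pullback (\<lambda>v. v + r *\<^sub>R A v) (s_of x))) has_derivative (\<lambda>h. h *\<^sub>R coords3 (lie A (s_of x)))) (at 0)"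
  proof (subst has_derivative_componentwise_within, rule ballI)
    fix i :: "real^triples" assume "i \<in> Basis"
    then obtain J where i: "i = axis J 1" by (auto simp: Basis_vec_def)
    have "((\<lambda>r. s_of x (map (\<lambda>v. v + r *\<^sub>R A v) (axis_list (Rep_triples J)))) has_derivative
      (\<lambda>h. h * lie A (s_of x) (axis_list (Rep_triples J)))) (at 0)"
      using lie_has_derivative[OF s_of_forms(1)[of x], of A "axis_list (Rep_triples J)"]
      by (simp add: has_field_derivative_def mult.commute[of _ "lie _ _ _"])
    then show "((\<lambda>r. coords3 (pullback (\<lambda>v. v + r *\<^sub>R A v) (s_of x)) \<bullet> i) has_derivative
      (\<lambda>h. h *\<^sub>R coords3 (lie A (s_of x)) \<bullet> i)) (at 0)"
      by (simp add: i inner_axis coords3_def pullback_def)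
  qed
  then have "((\<lambda>r. (fst x, coords3 (pullback (\<lambda>v. v + r *\<^sub>R A v) (s_of x)), snd (snd x))) has_derivative
    (\<lambda>h. (0, h *\<^sub>R coords3 (lie A (s_of x)), 0))) (at 0)"
    by (intro has_derivative_Pair has_derivative_const)
  then show ?thesis by (simp add: orbit_def[abs_def] dirs_def)
qed

lemma along_orbit_DERIV:
  assumes "x \<in> X" "smooth_on X (\<lambda>y. \<eta> y vs)"
  shows "((\<lambda>r. \<eta> (orbit A x r) vs) has_real_derivative fd \<eta> x (dirs (coords3 (lie A (s_of x)))) vs) (at 0)"
proof -
  have "((\<lambda>y. \<eta> y vs) has_derivative (\<lambda>h. fd \<eta> x h vs)) (at (orbit A x 0))"
    using fd_has_derivative[where \<eta> = \<eta> and vs = vs, OF assms] by (simp add: orbit_0)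
  from diff_chain_at[OF orbit_has_derivative this] show ?thesis
    using linear_scale[OF linear_fd[where \<eta> = \<eta> and vs = vs, OF assms]] by (simp add: o_def has_field_derivative_def mult.commute[of _ "fd _ _ _ _"])
qed

lemma DERIV_unique_near:
  assumes "(f has_real_derivative a) (at 0)" "(g has_real_derivative b) (at 0)" "d > 0" "\<And>r. \<bar>r\<bar> < d \<Longrightarrow> f r = g r"
  shows "a = (b::real)"
proof -
  have "(g has_real_derivative a) (at 0)"
    by (rule has_field_derivative_transform_within[OF assms(1,3)]) (use assms(4) in \<open>auto simp: dist_real_def\<close>)
  then show ?thesis using assms(2) by (rule DERIV_unique)
qed

lemma fd_star_s:
  assumes x: "x \<in> X" and A: "linear A"
  shows "fd star_s x (dirs (coords3 (lie A (s_of x)))) = lie A (star_s x)"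
proof
  fix vs
  obtain d where d: "d > 0" "\<And>r. \<bar>r\<bar> < d \<Longrightarrow> inj (\<lambda>v. v + r *\<^sub>R A v)"
    using perturbed_identity_inj[OF A] by blast
  have "star_s (orbit A x r) vs = star_s x (map (\<lambda>v. v + r *\<^sub>R A v) vs)" if "\<bar>r\<bar> < d" for r
    unfolding s_of_orbit[OF A]
    using star_pullback[OF s_of_forms adapted_fr[OF x] linear_perturbed[OF A] d(2)[OF that] s_of_forms[of x]]
    by (simp add: pullback_def)
  then show "fd star_s x (dirs (coords3 (lie A (s_of x)))) vs = lie A (star_s x) vs"
    by (intro DERIV_unique_near[OF along_orbit_DERIV[OF x smooth_stars(1)]
          lie_has_derivative[OF alternating_stars(1)[OF x]] d(1)])
qed

lemma fd_star_1:
  assumes x: "x \<in> X" and A: "linear A"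
  shows "fd star_1 x (dirs (coords3 (lie A (s_of x)))) = lie A (star_1 x)"
proof
  fix vs
  obtain d where d: "d > 0" "\<And>r. \<bar>r\<bar> < d \<Longrightarrow> inj (\<lambda>v. v + r *\<^sub>R A v)"
    using perturbed_identity_inj[OF A] by blast
  have u: "pullback P unit_form = unit_form" for P :: "real^7 \<Rightarrow> real^7" by (auto simp: pullback_def unit_form_def)
  have "star_1 (orbit A x r) vs = star_1 x (map (\<lambda>v. v + r *\<^sub>R A v) vs)" if "\<bar>r\<bar> < d" for r
    unfolding s_of_orbit[OF A]
    using star_pullback[OF s_of_forms adapted_fr[OF x] linear_perturbed[OF A] d(2)[OF that]
        alternating_unit_form homogeneous_unit_form]
    by (simp add: u) (simp add: pullback_def)
  then show "fd star_1 x (dirs (coords3 (lie A (s_of x)))) vs = lie A (star_1 x) vs"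
    by (intro DERIV_unique_near[OF along_orbit_DERIV[OF x smooth_stars(4)]
          lie_has_derivative[OF alternating_stars(4)[OF x]] d(1)])
qed

lemma form_inner_lincomb_left:
  "form_inner E (\<lambda>l. a l + r * b l) c = form_inner E a c + r * form_inner E b c"
  by (simp add: form_inner_def algebra_simps sum.distrib sum_distrib_left)

lemma star_lincomb:
  assumes x: "x \<in> X" and "alternating a" "alternating b" "homogeneous k a" "homogeneous k b" "k \<le> 7"
  shows "star (s_of x) k (\<lambda>l. a l + r * b l) vs = star (s_of x) k a vs + r * star (s_of x) k b vs"
proof -
  have "alternating (\<lambda>l. a l + r * b l)" "homogeneous k (\<lambda>l. a l + r * b l)"
    using alternating_lincomb[of a b 1 r] assms by (simp_all add: homogeneous_def)
  then show ?thesis using assms by (simp add: star_fr star_formula_def form_inner_lincomb_left)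
qed

lemma fd_star_du:
  assumes x: "x \<in> X" and A: "linear A"
  shows "fd (star_du i) x (dirs (coords3 (lie A (s_of x)))) vs =
    lie A (star_du i x) vs - star (s_of x) 1 (pullback A (du i)) vs"
proof -
  obtain d where d: "d > 0" "\<And>r. \<bar>r\<bar> < d \<Longrightarrow> inj (\<lambda>v. v + r *\<^sub>R A v)"
    using perturbed_identity_inj[OF A] by blast
  have pa: "alternating (pullback A (du i))" "homogeneous 1 (pullback A (du i))"
    by (intro alternating_pullback A alternating_du homogeneous_pullback homogeneous_du)+
  have pd: "pullback (\<lambda>v. v + r *\<^sub>R A v) (du i) = (\<lambda>l. du i l + r * pullback A (du i) l)" for r
    by (rule ext, rename_tac l, case_tac l) (auto simp: pullback_def du_def)
  have sb: "smooth_on X (\<lambda>y. star (s_of y) 1 (pullback A (du i)) vs)"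
    by (intro smooth_star pa smooth_on_const) auto
  let ?\<eta> = "\<lambda>y. star (s_of y) 1 (pullback A (du i))"
  have cont: "\<exists>e>0. \<forall>r. \<bar>r\<bar> < e \<longrightarrow> orbit A x r \<in> X"
  proof -
    have "isCont (orbit A x) 0" by (rule has_derivative_continuous[OF orbit_has_derivative])
    then have "\<forall>\<^sub>F r in at 0. orbit A x r \<in> X"
      using open_X x by (simp add: isCont_def orbit_0 topological_tendstoD)
    then obtain e where "e > 0" "\<And>r. r \<noteq> 0 \<Longrightarrow> dist r 0 < e \<Longrightarrow> orbit A x r \<in> X"
      unfolding eventually_at by blast
    then show ?thesis using x by (intro exI[of _ e]) (metis dist_real_def diff_zero orbit_0)
  qed
  then obtain e where e: "e > 0" "\<And>r. \<bar>r\<bar> < e \<Longrightarrow> orbit A x r \<in> X" by blast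
  have eq: "star_du i (orbit A x r) vs + r * ?\<eta> (orbit A x r) vs = star_du i x (map (\<lambda>v. v + r *\<^sub>R A v) vs)"
    if r: "\<bar>r\<bar> < min d e" for r
  proof -
    have "star (s_of (orbit A x r)) 1 (pullback (\<lambda>v. v + r *\<^sub>R A v) (du i)) vs = star_du i x (map (\<lambda>v. v + r *\<^sub>R A v) vs)"
      unfolding s_of_orbit[OF A]
      using star_pullback[OF s_of_forms adapted_fr[OF x] linear_perturbed[OF A] d(2) alternating_du homogeneous_du, of r] r
      by (simp add: pullback_def)
    then show ?thesis
      unfolding pd using star_lincomb[OF e(2) alternating_du pa(1) homogeneous_du pa(2)] r by simp
  qed
  have "((\<lambda>r. star_du i (orbit A x r) vs + r * ?\<eta> (orbit A x r) vs) has_real_derivative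
    fd (star_du i) x (dirs (coords3 (lie A (s_of x)))) vs +
      (1 * ?\<eta> (orbit A x 0) vs + fd ?\<eta> x (dirs (coords3 (lie A (s_of x)))) vs * 0)) (at 0)"
    by (intro DERIV_add DERIV_mult DERIV_ident along_orbit_DERIV[OF x] smooth_stars sb)
  then have "fd (star_du i) x (dirs (coords3 (lie A (s_of x)))) vs + ?\<eta> x vs = lie A (star_du i x) vs"
    using DERIV_unique_near[OF _ lie_has_derivative[OF alternating_stars(3)[OF x]] _ eq, of _ "min d e"] d(1) e(1)
    by (simp add: orbit_0)
  then show ?thesis by simp
qed

section \<open>Computations in an adapted frame\<close>

definition ev :: "(real^7) list \<Rightarrow> (real^7) form \<Rightarrow> nat list \<Rightarrow> real" where
  "ev f \<phi> is = \<phi> (map ((!) f) is)"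

lemma ev_sort: "alternating \<phi> \<Longrightarrow> ev f \<phi> is = psign is * ev f \<phi> (sort is)"
  unfolding ev_def by (rule alternating_sort)

lemma ev_unsorted:
  "alternating \<phi> \<Longrightarrow> distinct is \<Longrightarrow> \<not> sorted is \<Longrightarrow> ev f \<phi> is = psign is * ev f \<phi> (sort is)"
  by (rule ev_sort)

lemma ev_not_distinct: "alternating \<phi> \<Longrightarrow> \<not> distinct is \<Longrightarrow> ev f \<phi> is = 0"
  unfolding ev_def by (rule alternating_not_distinct) (auto simp: distinct_map)

lemma all_less_7': "(\<forall>i<7. P i) \<longleftrightarrow> P 0 \<and> P (Suc 0) \<and> P 2 \<and> P 3 \<and> P 4 \<and> P 5 \<and> P (6::nat)"
  by (simp add: all_less_7)

lemma phi_unfold: "\<forall>i<7. \<forall>j<7. \<forall>k<7. phi [i, j, k] = psign [i, j, k] * phi0 (sort [i, j, k])"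
  by (simp add: phi_def)

lemmas phi_values = phi_unfold[unfolded all_less_7' psign.simps phi0_def, simplified]

lemma length_3_cases: "length xs = 3 \<Longrightarrow> \<exists>i j k. xs = [i, j, k]"
  by (auto simp: numeral_3_eq_3 length_Suc_conv)

lemma ev_s:
  assumes "alternating s" "adapted s f" "length is = 3" "set is \<subseteq> {..<7}"
  shows "ev f s is = phi is"
proof (cases "distinct is")
  case True
  obtain i j k where ijk: "sort is = [i, j, k]"
    using length_3_cases[of "sort is"] assms(3) by auto
  have "sorted (sort is)" "distinct (sort is)" "set (sort is) \<subseteq> {..<7}" using True assms(4) by auto
  then have "i < j \<and> j < k \<and> k < 7" unfolding ijk by auto
  then have "s [f ! i, f ! j, f ! k] = phi0 [i, j, k]" using assms(2) by (simp add: adapted_def)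
  then have "ev f s (sort is) = phi0 (sort is)" by (simp add: ijk ev_def)
  then show ?thesis unfolding ev_sort[OF assms(1), of f "is"] phi_def by simp
next
  case False
  then have "psign is = 0" by (induction "is") auto
  then show ?thesis unfolding ev_sort[OF assms(1), of f "is"] phi_def by simp
qed

lemma ev_vol:
  assumes "alternating s" "homogeneous 3 s" "adapted s f" "length is = 7" "set is \<subseteq> {..<7}"
  shows "ev f (fvol f) is = psign is"
  unfolding ev_def
  by (rule vol_psign[OF alternating_vol[OF assms(1-3)] _ vol_f[OF assms(1-3)] assms(4,5)])
    (rule frame_length[OF adapted_frame[OF assms(3)]])

lemma form_inner_3:
  assumes "homogeneous 3 \<alpha>"
  shows "form_inner [a, b, c, d, e, g, h] \<alpha> \<beta> =
    \<alpha> [a,b,c] * \<beta> [a,b,c] + \<alpha> [a,b,d] * \<beta> [a,b,d] + \<alpha> [a,b,e] * \<beta> [a,b,e] + \<alpha> [a,b,g] * \<beta> [a,b,g] + \<alpha> [a,b,h] * \<beta> [a,b,h]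
    + \<alpha> [a,c,d] * \<beta> [a,c,d] + \<alpha> [a,c,e] * \<beta> [a,c,e] + \<alpha> [a,c,g] * \<beta> [a,c,g] + \<alpha> [a,c,h] * \<beta> [a,c,h]
    + \<alpha> [a,d,e] * \<beta> [a,d,e] + \<alpha> [a,d,g] * \<beta> [a,d,g] + \<alpha> [a,d,h] * \<beta> [a,d,h] + \<alpha> [a,e,g] * \<beta> [a,e,g]
    + \<alpha> [a,e,h] * \<beta> [a,e,h] + \<alpha> [a,g,h] * \<beta> [a,g,h]
    + \<alpha> [b,c,d] * \<beta> [b,c,d] + \<alpha> [b,c,e] * \<beta> [b,c,e] + \<alpha> [b,c,g] * \<beta> [b,c,g] + \<alpha> [b,c,h] * \<beta> [b,c,h]
    + \<alpha> [b,d,e] * \<beta> [b,d,e] + \<alpha> [b,d,g] * \<beta> [b,d,g] + \<alpha> [b,d,h] * \<beta> [b,d,h] + \<alpha> [b,e,g] * \<beta> [b,e,g]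
    + \<alpha> [b,e,h] * \<beta> [b,e,h] + \<alpha> [b,g,h] * \<beta> [b,g,h]
    + \<alpha> [c,d,e] * \<beta> [c,d,e] + \<alpha> [c,d,g] * \<beta> [c,d,g] + \<alpha> [c,d,h] * \<beta> [c,d,h] + \<alpha> [c,e,g] * \<beta> [c,e,g]
    + \<alpha> [c,e,h] * \<beta> [c,e,h] + \<alpha> [c,g,h] * \<beta> [c,g,h]
    + \<alpha> [d,e,g] * \<beta> [d,e,g] + \<alpha> [d,e,h] * \<beta> [d,e,h] + \<alpha> [d,g,h] * \<beta> [d,g,h] + \<alpha> [e,g,h] * \<beta> [e,g,h]"
  using assms by (simp add: form_inner_Cons interior_apply homogeneous_def)

lemma form_inner_1:
  assumes "homogeneous 1 \<alpha>"
  shows "form_inner [a, b, c, d, e, g, h] \<alpha> \<beta> = \<alpha> [a] * \<beta> [a] + \<alpha> [b] * \<beta> [b] + \<alpha> [c] * \<beta> [c] + \<alpha> [d] * \<beta> [d]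
    + \<alpha> [e] * \<beta> [e] + \<alpha> [g] * \<beta> [g] + \<alpha> [h] * \<beta> [h]"
  using assms by (simp add: form_inner_Cons interior_apply homogeneous_def)

lemma sum_less_7: "(\<Sum>j<7. F j) = F 0 + F (Suc 0) + F 2 + F 3 + F 4 + F 5 + (F (6::nat) :: 'b::comm_monoid_add)"
  by (simp add: numeral_eq_Suc add_ac)

lemma sum_less_small:
  "(\<Sum>j<2. F j) = F 0 + (F (Suc 0) :: 'b::comm_monoid_add)"
  "(\<Sum>j<3. F j) = F 0 + F (Suc 0) + F 2"
  "(\<Sum>j<4. F j) = F 0 + F (Suc 0) + F 2 + F 3"
  "(\<Sum>j<6. F j) = F 0 + F (Suc 0) + F 2 + F 3 + F 4 + F 5"
  by (simp_all add: numeral_eq_Suc add_ac)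

definition endo :: "(real^7) list \<Rightarrow> (nat \<Rightarrow> nat \<Rightarrow> real) \<Rightarrow> real^7 \<Rightarrow> real^7" where
  "endo f a v = (\<Sum>i<7. coord f i v *\<^sub>R (\<Sum>j<7. a i j *\<^sub>R f ! j))"

lemma linear_endo: "frame f \<Longrightarrow> linear (endo f a)"
  unfolding endo_def using linear_coord[of _ f] frame_length[of f]
  by (intro linear_compose_sum ballI linearI) (auto simp: linear_add linear_scale scaleR_add_left)

lemma endo_nth:
  assumes "frame f" "i < 7"
  shows "endo f a (f ! i) = (\<Sum>j<7. a i j *\<^sub>R f ! j)"
proof -
  have "endo f a (f ! i) = (\<Sum>k<7. if k = i then (\<Sum>j<7. a i j *\<^sub>R f ! j) else 0)"
    unfolding endo_def by (rule sum.cong) (auto simp: coord_nth assms)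
  then show ?thesis using assms(2) by simp
qed

lemma ev_lie_endo:
  assumes f: "frame f" and \<phi>: "alternating \<phi>" and "is": "set is \<subseteq> {..<7}"
  shows "ev f (lie (endo f a) \<phi>) is = (\<Sum>n<length is. \<Sum>j<7. a (is ! n) j * ev f \<phi> (is[n := j]))"
  unfolding ev_def lie_def length_map
proof (rule sum.cong)
  fix n assume "n \<in> {..<length is}"
  then have n: "n < length is" by simp
  then have "is ! n < 7" using "is" nth_mem by blast
  then have e: "endo f a (map ((!) f) is ! n) = (\<Sum>j<7. a (is ! n) j *\<^sub>R f ! j)"
    using endo_nth[OF f] n by simp
  show "\<phi> ((map ((!) f) is)[n := endo f a (map ((!) f) is ! n)]) = (\<Sum>j<7. a (is ! n) j * \<phi> (map ((!) f) (is[n := j])))"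
    unfolding e using n
    by (simp add: upd_conv_take_nth_drop alternating_sum[OF \<phi>] take_map drop_map)
qed simp

definition nmat :: "(nat list \<Rightarrow> real) \<Rightarrow> nat \<Rightarrow> nat \<Rightarrow> real" where
  "nmat \<sigma> i j = (\<Sum>a<7. \<Sum>b<7. if a < b then phi [j, a, b] * \<sigma> [i, a, b] else 0)"

text \<open>
  Up to the factor 18, a right inverse of the infinitesimal action \<open>\<lambda>A. lie A s\<close> of the linear
  group. By equivariance it is a combination of the matrix \<open>nmat\<close>, its transpose and its trace.
\<close>

definition amat :: "(nat list \<Rightarrow> real) \<Rightarrow> nat \<Rightarrow> nat \<Rightarrow> real" where
  "amat \<sigma> i j = 6 * nmat \<sigma> i j + 3 * nmat \<sigma> j i - (if i = j then (\<Sum>k<7. nmat \<sigma> k k) else 0)"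

lemma frame_form_eqI:
  assumes "frame f" "alternating \<phi>" "alternating \<psi>" "homogeneous k \<phi>" "homogeneous k \<psi>"
    and eq: "\<And>is. sorted_wrt (<) is \<Longrightarrow> length is = k \<Longrightarrow> set is \<subseteq> {..<7} \<Longrightarrow> ev f \<phi> is = ev f \<psi> is"
  shows "\<phi> = \<psi>"
proof (rule homogeneous_frame_eqI[OF assms(2-5,1)])
  fix K :: "nat set" assume K: "K \<subseteq> {..<7}" "card K = k"
  let ?l = "filter (\<lambda>i. i \<in> K) [0..<7]"
  have n: "nths f K = map ((!) f) ?l" using frame_length[OF assms(1)] by (simp add: nths_eq_map_filter)
  have "length ?l = k" using K frame_length[OF assms(1)] length_nths_subset[of K f] by (simp add: n)
  moreover have "sorted_wrt (<) ?l" by (intro sorted_wrt_filter) simp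
  ultimately show "\<phi> (nths f K) = \<psi> (nths f K)" using eq[of ?l] unfolding n ev_def by auto
qed

definition triples7 :: "nat list list" where
  "triples7 = [[0,1,2], [0,1,3], [0,1,4], [0,1,5], [0,1,6], [0,2,3], [0,2,4], [0,2,5], [0,2,6], [0,3,4], [0,3,5], [0,3,6], [0,4,5], [0,4,6], [0,5,6], [1,2,3], [1,2,4], [1,2,5], [1,2,6], [1,3,4], [1,3,5], [1,3,6], [1,4,5], [1,4,6], [1,5,6], [2,3,4], [2,3,5], [2,3,6], [2,4,5], [2,4,6], [2,5,6], [3,4,5], [3,4,6], [3,5,6], [4,5,6]]"

lemma form_inner_ev:
  assumes "frame f" "homogeneous 3 \<alpha>"
  shows "form_inner f \<alpha> \<beta> = (\<Sum>is\<leftarrow>triples7. ev f \<alpha> is * ev f \<beta> is)"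
proof -
  obtain a b c d e g h where f: "f = [a, b, c, d, e, g, h]" using frame_cases[OF assms(1)] .
  show ?thesis unfolding f form_inner_3[OF assms(2)] triples7_def ev_def by simp
qed

context
  fixes s :: "(real^7) form" and f :: "(real^7) list"
  assumes s: "alternating s" "homogeneous 3 s" and f: "adapted s f"
begin

lemma frame_f': "frame f" by (rule adapted_frame[OF f])

lemma nmat_unfold:
  "\<forall>i<7. \<forall>j<7. nmat \<sigma> i j = (\<Sum>a<7. \<Sum>b<7. if a < b then phi [j, a, b] * \<sigma> [i, a, b] else 0)"
  by (simp only: nmat_def) simp

lemmas nmat_values = nmat_unfold[unfolded all_less_7' sum_less_7, simplified phi_values, simplified]

lemma ev_lie_endo_s:
  assumes "length is = 3" "set is \<subseteq> {..<7}"
  shows "ev f (lie (endo f a) s) is = (\<Sum>n<3. \<Sum>l<7. a (is ! n) l * phi (is[n := l]))"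
proof -
  have "ev f (lie (endo f a) s) is = (\<Sum>n<3. \<Sum>l<7. a (is ! n) l * ev f s (is[n := l]))"
    using ev_lie_endo[OF frame_f' s(1) assms(2)] assms(1) by simp
  also have "\<dots> = (\<Sum>n<3. \<Sum>l<7. a (is ! n) l * phi (is[n := l]))"
  proof (intro sum.cong refl arg_cong2[where f = times] ev_s[OF s(1) f])
    fix n l assume "n \<in> {..<3::nat}" "l \<in> {..<7::nat}"
    then show "set (is[n := l]) \<subseteq> {..<7}" using assms(2) set_update_subset_insert[of "is" n l] by auto
  qed (use assms(1) in auto)
  finally show ?thesis .
qed

lemma lie_amat:
  assumes \<sigma>: "alternating \<sigma>" "homogeneous 3 \<sigma>"
  shows "lie (endo f (amat (ev f \<sigma>))) s = (\<lambda>l. 18 * \<sigma> l)"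
proof (rule frame_form_eqI[OF frame_f' alternating_lie[OF linear_endo[OF frame_f'] s(1)] alternating_scaled[OF \<sigma>(1)] homogeneous_lie[OF s(2)]])
  let ?S = "ev f \<sigma>"
  define T where "T = (\<Sum>k<7. nmat ?S k k)"
  note ev_unsorted[OF \<sigma>(1), simp] ev_not_distinct[OF \<sigma>(1), simp]
  note N = nmat_values[of ?S, simplified]
  note ev_unsorted[OF \<sigma>(1), simp del] ev_not_distinct[OF \<sigma>(1), simp del]
  have rawA: "\<forall>i<7. \<forall>j<7. amat ?S i j = 6 * nmat ?S i j + 3 * nmat ?S j i - (if i = j then T else 0)"
    by (simp add: amat_def T_def)
  note A = rawA[unfolded all_less_7', simplified]
  have T: "T = nmat ?S 0 0 + nmat ?S (Suc 0) (Suc 0) + nmat ?S 2 2 + nmat ?S 3 3 + nmat ?S 4 4 + nmat ?S 5 5 + nmat ?S 6 6"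
    unfolding T_def sum_less_7 ..
  have "\<forall>i<7. \<forall>j<7. \<forall>k<7. i < j \<longrightarrow> j < k \<longrightarrow>
    (\<Sum>n<3. \<Sum>l<7. amat ?S ([i, j, k] ! n) l * phi ([i, j, k][n := l])) = 18 * ?S [i, j, k]"
    unfolding all_less_7' sum_less_small sum_less_7
    by (simp add: phi_values) (simp only: A T N, simp)
  then have *: "i < 7 \<Longrightarrow> j < 7 \<Longrightarrow> k < 7 \<Longrightarrow> i < j \<Longrightarrow> j < k \<Longrightarrow>
    (\<Sum>n<3. \<Sum>l<7. amat ?S ([i, j, k] ! n) l * phi ([i, j, k][n := l])) = 18 * ?S [i, j, k]" for i j k
    by blast
  fix "is" :: "nat list" assume hyp: "sorted_wrt (<) is" "length is = 3" "set is \<subseteq> {..<7}"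
  obtain i j k where ijk: "is = [i, j, k]" using length_3_cases[OF hyp(2)] by blast
  have "(\<Sum>n<3. \<Sum>l<7. amat ?S (is ! n) l * phi (is[n := l])) = 18 * ?S is"
    using *[of i j k] hyp unfolding ijk by simp
  then show "ev f (lie (endo f (amat ?S)) s) is = ev f (\<lambda>l. 18 * \<sigma> l) is"
    unfolding ev_lie_endo_s[OF hyp(2,3)] by (simp add: ev_def)
qed (use \<sigma>(2) in \<open>simp add: homogeneous_def\<close>)

end

section \<open>The relation between \<open>\<Upsilon>\<^sub>4\<close> and \<open>\<Upsilon>\<^sub>5\<close>\<close>

lemma ev_s_phi: "x \<in> X \<Longrightarrow> adapted (s_of x) f \<Longrightarrow> length is = 3 \<Longrightarrow> set is \<subseteq> {..<7} \<Longrightarrow> ev f (s_of x) is = phi is"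
  by (rule ev_s[OF s_of_forms(1)])

lemma form_inner_lie_s:
  assumes x: "x \<in> X" and f: "adapted (s_of x) f"
  shows "form_inner f (lie (endo f a) (s_of x)) (s_of x) = 3 * (\<Sum>i<7. a i i)"
  unfolding form_inner_ev[OF adapted_frame[OF f] homogeneous_lie[OF s_of_forms(2)]] triples7_def
  by (simp add: ev_s_phi[OF x f] phi_values)
    (simp add: ev_lie_endo_s[OF s_of_forms f] sum_less_small sum_less_7 phi_values)

lemma lie_vol_trace:
  assumes x: "x \<in> X" and f: "adapted (s_of x) f"
  shows "lie (endo f a) (fvol f) f = (\<Sum>i<7. a i i)"
proof -
  have "map ((!) f) [0,1,2,3,4,5,6] = f"
    using frame_length[OF adapted_frame[OF f]] by (auto simp: numeral_eq_Suc length_Suc_conv)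
  then have "lie (endo f a) (fvol f) f = ev f (lie (endo f a) (fvol f)) [0,1,2,3,4,5,6]" by (simp add: ev_def)
  also have "\<dots> = (\<Sum>n<7. \<Sum>j<7. a ([0,1,2,3,4,5,6] ! n) j * ev f (fvol f) ([0,1,2,3,4,5,6][n := j]))"
  proof -
    have "length [0,1,2,3,4,5,6::nat] = 7" "set [0,1,2,3,4,5,6] \<subseteq> {..<7::nat}" by simp_all
    with ev_lie_endo[OF adapted_frame[OF f] alternating_vol[OF s_of_forms f] this(2), of a] show ?thesis by (simp only:)
  qed
  also have "\<dots> = (\<Sum>n<7. \<Sum>j<7. if j = n then a n n else 0)"
    unfolding sum_less_7
    by (simp add: ev_vol[OF s_of_forms f] ev_not_distinct[OF alternating_vol[OF s_of_forms f]])
  finally show ?thesis by simp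
qed

lemma wedge_lie_star:
  assumes x: "x \<in> X"
  shows "wedge (lie (endo (fr x) a) (s_of x)) (star_s x) = (\<lambda>vs. 3 * lie (endo (fr x) a) (star_1 x) vs)"
proof (rule top_form_eqI[OF _ _ _ _ frame_fr[OF x]])
  note f = adapted_fr[OF x]
  note lin = linear_endo[OF frame_fr[OF x], of a]
  note a = alternating_lie[OF lin s_of_forms(1)] and h = homogeneous_lie[OF s_of_forms(2)]
  show "alternating (wedge (lie (endo (fr x) a) (s_of x)) (star_s x))"
    by (intro alternating_wedge a alternating_stars x)
  show "alternating (\<lambda>vs. 3 * lie (endo (fr x) a) (star_1 x) vs)"
    by (intro alternating_scaled alternating_lie lin alternating_stars x)
  show "homogeneous 7 (wedge (lie (endo (fr x) a) (s_of x)) (star_s x))"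
    using homogeneous_wedge[OF h homogeneous_stars(1)[OF x]] by simp
  show "homogeneous 7 (\<lambda>vs. 3 * lie (endo (fr x) a) (star_1 x) vs)"
    using homogeneous_lie[OF homogeneous_stars(4)[OF x]] by (simp add: homogeneous_def)
  show "wedge (lie (endo (fr x) a) (s_of x)) (star_s x) (fr x) = 3 * lie (endo (fr x) a) (star_1 x) (fr x)"
    using wedge_star_formula[where E = "fr x", OF alternating_vol[OF s_of_forms f] a h s_of_forms(2)[of x]]
    by (simp add: star_fr[OF x s_of_forms] star_1_eq_vol[OF x] vol_f[OF s_of_forms f] form_inner_lie_s[OF x f] lie_vol_trace[OF x f])
qed

lemma lie_onto:
  assumes x: "x \<in> X"
  obtains a where "lie (endo (fr x) a) (s_of x) = form3 \<sigma>"
proof -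
  have a: "alternating (\<lambda>l. 1 / 18 * form3 \<sigma> l)" by (rule alternating_scaled[OF alternating_form3])
  have h: "homogeneous 3 (\<lambda>l. 1 / 18 * form3 \<sigma> l)"
    using homogeneous_form3[of \<sigma>] by (simp add: homogeneous_def)
  from lie_amat[OF s_of_forms adapted_fr[OF x] a h] show thesis by (intro that) simp
qed

text \<open>The volume form is a potential for \<open>s \<mapsto> \<star>\<^sub>s s\<close>, so the derivative of the latter is symmetric.\<close>

lemma hitchin_potential:
  assumes x: "x \<in> X"
  shows "wedge (form3 \<sigma>) (star_s x) std = 3 * fd star_1 x (dirs \<sigma>) std"
proof -
  obtain a where a: "lie (endo (fr x) a) (s_of x) = form3 \<sigma>" using lie_onto[OF x] by blast
  show ?thesis
    using wedge_lie_star[OF x, of a] fd_star_1[OF x linear_endo[OF frame_fr[OF x]], of a] unfolding a by simp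
qed

lemma fd_star_s_symmetric:
  assumes x: "x \<in> X"
  shows "wedge (form3 \<sigma>) (fd star_s x (dirs \<rho>)) std = wedge (form3 \<rho>) (fd star_s x (dirs \<sigma>)) std"
proof -
  have d: "frechet_derivative (\<lambda>y. wedge \<phi> (star_s y) std) (at x) h = wedge \<phi> (fd star_s x h) std" for \<phi> h
  proof -
    have "((\<lambda>y. wedge \<phi> (star_s y) std) has_derivative (\<lambda>h. wedge \<phi> (fd star_s x h) std)) (at x)"
      unfolding wedge_def
      by (intro has_derivative_sum has_derivative_mult_right fd_has_derivative x smooth_stars)
    then show ?thesis by (simp add: frechet_derivative_eq)
  qed
  let ?V = "\<lambda>y. star_1 y std"
  have e: "frechet_derivative (\<lambda>y. wedge (form3 \<sigma>) (star_s y) std) (at x) h =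
    3 * frechet_derivative (\<lambda>y. frechet_derivative ?V (at y) (dirs \<sigma>)) (at x) h" for \<sigma> h
  proof -
    have "frechet_derivative (\<lambda>y. wedge (form3 \<sigma>) (star_s y) std) (at x) =
      frechet_derivative (\<lambda>y. 3 * frechet_derivative ?V (at y) (dirs \<sigma>)) (at x)"
      by (rule frechet_derivative_cong_open[OF open_X x]) (simp add: hitchin_potential fd_def)
    also have "\<dots> = (\<lambda>h. 3 * frechet_derivative (\<lambda>y. frechet_derivative ?V (at y) (dirs \<sigma>)) (at x) h)"
      by (intro frechet_derivative_eq has_derivative_mult_right smooth_on_has_derivative[OF _ x] smooth_on_frechet smooth_stars)
    finally show ?thesis by simp
  qed
  have "Ck_on (Suc (Suc 0)) X ?V" using smooth_stars(4) unfolding smooth_on_def by blast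
  from frechet_derivative_commute[OF open_X x this, of "dirs \<sigma>" "dirs \<rho>"] show ?thesis
    using e[of \<sigma> "dirs \<rho>"] e[of \<rho> "dirs \<sigma>"] by (simp add: d)
qed

definition covec :: "('a \<Rightarrow> real) \<Rightarrow> 'a form" where
  "covec \<theta> = (\<lambda>vs. if length vs = 1 then \<theta> (hd vs) else 0)"

lemma homogeneous_covec: "homogeneous 1 (covec \<theta>)"
  by (simp add: homogeneous_def covec_def)

lemma alternating_covec: "linear \<theta> \<Longrightarrow> alternating (covec \<theta>)"
proof (rule alternatingI)
  show "linear \<theta> \<Longrightarrow> linear (\<lambda>v. covec \<theta> (xs @ v # ys))" for xs ys
    by (cases xs) (auto simp: covec_def linear_add linear_scale intro!: linearI)
qed (simp add: covec_def)

lemma wedge_covec_Cons: "wedge (covec \<theta>) \<psi> (v # vs) = \<theta> v * \<psi> vs - wedge (covec \<theta>) (interior v \<psi>) vs"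
proof -
  have "interior v (covec \<theta>) = (\<lambda>l. \<theta> v * unit_form l)" by (auto simp: interior_def covec_def unit_form_def)
  moreover have "hat (covec \<theta>) = (\<lambda>l. - covec \<theta> l)" using hat_homogeneous[OF homogeneous_covec] by simp
  ultimately show ?thesis by (simp add: wedge_Cons wedge_scale_left wedge_minus_left wedge_unit_form_left)
qed

lemma wedge_covec: "wedge (covec \<theta>) \<psi> vs = (\<Sum>k<length vs. (-1) ^ k * \<theta> (vs ! k) * \<psi> (take k vs @ drop (Suc k) vs))"
proof (induction vs arbitrary: \<psi>)
  case Nil
  then show ?case by (simp add: covec_def)
next
  case (Cons v vs)
  show ?case
    by (simp add: wedge_covec_Cons Cons.IH interior_def sum.lessThan_Suc_shift sum_negf del: sum.lessThan_Suc)
qed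

lemma lie_rank_one:
  assumes "alternating \<phi>"
  shows "lie (\<lambda>v. \<theta> v *\<^sub>R u) \<phi> = wedge (covec \<theta>) (interior u \<phi>)"
proof
  fix vs show "lie (\<lambda>v. \<theta> v *\<^sub>R u) \<phi> vs = wedge (covec \<theta>) (interior u \<phi>) vs"
    using assms
  proof (induction vs arbitrary: \<phi>)
    case Nil
    then show ?case by (simp add: covec_def)
  next
    case (Cons v vs)
    have "interior v (interior u \<phi>) = (\<lambda>l. - interior u (interior v \<phi>) l)"
      using alternating_swap[OF Cons.prems, of "[]" u v] by (auto simp: interior_def)
    then show ?case
      using Cons.IH[OF alternating_interior[OF Cons.prems, of v]] alternating_scale[OF Cons.prems, of "[]" "\<theta> v" u vs]
      by (simp add: lie_Cons wedge_covec_Cons wedge_minus_right interior_apply[of u \<phi> vs])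
  qed
qed

lemma fd_s_of: "fd s_of x h = form3 (fst (snd h))"
proof
  fix vs
  have "((\<lambda>y. s_of y vs) has_derivative (\<lambda>y. s_of y vs)) (at x)"
    by (rule linear_imp_has_derivative[OF linear_s_of])
  then show "fd s_of x h vs = form3 (fst (snd h)) vs" by (simp add: fd_eq s_of_def)
qed

lemma fd_b_of: "fd b_of x h = form2 (snd (snd h))"
proof
  fix vs
  have "((\<lambda>y. b_of y vs) has_derivative (\<lambda>y. b_of y vs)) (at x)"
    by (rule linear_imp_has_derivative[OF linear_b_of])
  then show "fd b_of x h vs = form2 (snd (snd h)) vs" by (simp add: fd_eq b_of_def)
qed

lemma fd_only_s:
  assumes x: "x \<in> X" and sm: "\<And>vs. smooth_on X (\<lambda>y. \<eta> y vs)"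
    and dep: "\<And>y z. s_of y = s_of z \<Longrightarrow> \<eta> y = \<eta> z"
  shows "fd \<eta> x h = fd \<eta> x (dirs (fst (snd h)))"
proof
  fix vs
  let ?h = "(fst h, 0, snd (snd h)) :: total"
  have "fd \<eta> x ?h vs = 0"
    by (rule fd_line_constant[OF x sm]) (rule fun_cong[OF dep], simp add: s_of_def)
  moreover have "h = dirs (fst (snd h)) + ?h" by (simp add: dirs_def prod_eq_iff)
  ultimately show "fd \<eta> x h vs = fd \<eta> x (dirs (fst (snd h))) vs"
    using linear_add[OF linear_fd[where \<eta> = \<eta> and vs = vs, OF x sm], of "dirs (fst (snd h))" ?h] by simp
qed

lemma pullback_ext_deriv:
  assumes x: "x \<in> X" and sm: "\<And>vs. smooth_on X (\<lambda>y. \<eta> y vs)"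
    and \<gamma>: "linear \<gamma>" "\<And>v. fst (\<gamma> v) = v"
  shows "pullback \<gamma> (ext_deriv (\<lambda>y. pullback fst (\<eta> y)) x) =
    (\<lambda>vs. \<Sum>i<7. wedge (covec (coord std i)) (fd \<eta> x (\<gamma> (ax i))) vs)"
proof
  fix vs :: "(real^7) list"
  have exp: "fd \<eta> x (\<gamma> v) ws = (\<Sum>i<7. coord std i v * fd \<eta> x (\<gamma> (ax i)) ws)" for v ws
  proof -
    have l: "linear (\<lambda>v. fd \<eta> x (\<gamma> v) ws)"
      using linear_compose[OF \<gamma>(1) linear_fd[where \<eta> = \<eta> and vs = ws, OF x sm]] by (simp add: o_def)
    show ?thesis
      by (subst frame_expand[OF frame_std, of v]) (simp add: linear_sum[OF l] linear_scale[OF l])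
  qed
  have map: "map fst (take i (map \<gamma> vs) @ drop (Suc i) (map \<gamma> vs)) = take i vs @ drop (Suc i) vs" for i
    using \<gamma>(2) by (simp add: take_map drop_map o_def)
  have "pullback \<gamma> (ext_deriv (\<lambda>y. pullback fst (\<eta> y)) x) vs =
    (\<Sum>k<length vs. (-1) ^ k * fd \<eta> x (\<gamma> (vs ! k)) (take k vs @ drop (Suc k) vs))"
    by (simp add: pullback_def ext_deriv_def map fd_def del: map_append)
  also have "\<dots> = (\<Sum>k<length vs. \<Sum>i<7. (-1) ^ k * coord std i (vs ! k) * fd \<eta> x (\<gamma> (ax i)) (take k vs @ drop (Suc k) vs))"
    by (rule sum.cong[OF refl], subst exp) (simp only: sum_distrib_left mult.assoc)
  also have "\<dots> = (\<Sum>i<7. wedge (covec (coord std i)) (fd \<eta> x (\<gamma> (ax i))) vs)"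
    unfolding wedge_covec by (rule sum.swap)
  finally show "pullback \<gamma> (ext_deriv (\<lambda>y. pullback fst (\<eta> y)) x) vs =
    (\<Sum>i<7. wedge (covec (coord std i)) (fd \<eta> x (\<gamma> (ax i))) vs)" .
qed

lemma sform_eq: "sform = (\<lambda>x. pullback fst (s_of x))"
  and bform_eq: "bform = (\<lambda>x. pullback fst (b_of x))"
  and tform_eq: "tform = (\<lambda>x. pullback fst (star_s x))"
  and pform_eq: "pform = (\<lambda>x. pullback fst (star_b x))"
  and Phi_eq: "Phi i = (\<lambda>x. pullback fst (star_du i x))"
  by (auto simp: sform_def bform_def tform_def pform_def Phi_def)

lemma interior_s_dt:
  assumes x: "x \<in> X" and \<gamma>: "linear \<gamma>" "\<And>v. fst (\<gamma> v) = v"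
  shows "wedge (interior u (s_of x)) (pullback \<gamma> (ext_deriv tform x)) std =
    - wedge (pullback \<gamma> (ext_deriv sform x)) (interior u (star_s x)) std"
proof -
  let ?e = "\<lambda>i. covec (coord std i)"
  let ?\<sigma> = "\<lambda>i. fst (snd (\<gamma> (ax i)))"
  have T: "pullback \<gamma> (ext_deriv tform x) = (\<lambda>vs. \<Sum>i<7. wedge (?e i) (fd star_s x (\<gamma> (ax i))) vs)"
    unfolding tform_eq by (rule pullback_ext_deriv[OF x smooth_stars(1) \<gamma>])
  have S: "pullback \<gamma> (ext_deriv sform x) = (\<lambda>vs. \<Sum>i<7. wedge (?e i) (fd s_of x (\<gamma> (ax i))) vs)"
    unfolding sform_eq by (rule pullback_ext_deriv[OF x smooth_s_of \<gamma>])
  have hu: "homogeneous 2 (interior u (s_of x))" by (rule homogeneous_interior_s[OF s_of_forms])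
  have main: "wedge (interior u (s_of x)) (wedge (?e i) (fd star_s x (\<gamma> (ax i)))) std =
    - wedge (wedge (?e i) (fd s_of x (\<gamma> (ax i)))) (interior u (star_s x)) std" if i: "i < 7" for i
  proof -
    let ?A = "\<lambda>v. coord std i v *\<^sub>R u"
    have lin: "linear (coord std i)" using linear_coord i by simp
    have A: "linear ?A" by (intro linearI) (simp_all add: linear_add[OF lin] linear_scale[OF lin] scaleR_add_left)
    have ls: "lie ?A (s_of x) = wedge (?e i) (interior u (s_of x))" by (rule lie_rank_one[OF s_of_forms(1)])
    have lt: "lie ?A (star_s x) = wedge (?e i) (interior u (star_s x))" by (rule lie_rank_one[OF alternating_stars(1)[OF x]])
    have fl: "form3 (coords3 (lie ?A (s_of x))) = lie ?A (s_of x)"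
      by (intro form3_coords3 alternating_lie A s_of_forms homogeneous_lie)
    have "wedge (interior u (s_of x)) (wedge (?e i) (fd star_s x (\<gamma> (ax i)))) std =
      wedge (lie ?A (s_of x)) (fd star_s x (\<gamma> (ax i))) std"
      unfolding ls wedge_assoc[symmetric] using wedge_commute[OF hu homogeneous_covec, of "coord std i"] by simp
    also have fe: "fd star_s x (\<gamma> (ax i)) = fd star_s x (dirs (?\<sigma> i))"
      by (rule fd_only_s[OF x smooth_stars(1)]) simp
    also have "wedge (lie ?A (s_of x)) \<dots> std = wedge (form3 (?\<sigma> i)) (lie ?A (star_s x)) std"
      using fd_star_s_symmetric[OF x, of "coords3 (lie ?A (s_of x))" "?\<sigma> i"] by (simp add: fl fd_star_s[OF x A])
    also have "wedge (form3 (?\<sigma> i)) (lie ?A (star_s x)) = wedge (wedge (form3 (?\<sigma> i)) (?e i)) (interior u (star_s x))"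
      unfolding lt wedge_assoc ..
    also have "wedge (form3 (?\<sigma> i)) (?e i) = (\<lambda>l. - wedge (?e i) (form3 (?\<sigma> i)) l)"
      using wedge_commute[OF homogeneous_form3 homogeneous_covec, of "?\<sigma> i" "coord std i"] by simp
    finally show ?thesis by (simp add: wedge_minus_left fd_s_of fe)
  qed
  show ?thesis
    unfolding T S by (simp add: wedge_sum_left wedge_sum_right main sum_negf)
qed

lemma interior_s_star_b:
  assumes x: "x \<in> X"
  shows "2 / 3 * wedge (interior u (s_of x)) (star_b x) vs = 1 / 3 * wedge (interior u (s_of x)) (wedge (b_of x) (s_of x)) vs"
proof -
  note f = adapted_fr[OF x]
  have hu: "homogeneous 2 (interior u (s_of x))" by (rule homogeneous_interior_s[OF s_of_forms])
  have au: "alternating (interior u (s_of x))" by (intro alternating_interior s_of_forms)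
  have "(\<lambda>vs. 2 * wedge (interior u (s_of x)) (star_b x) vs) = wedge (interior u (s_of x)) (wedge (b_of x) (s_of x))"
  proof (rule top_form_eqI[OF _ _ _ _ frame_fr[OF x]])
    show "homogeneous 7 (\<lambda>vs. 2 * wedge (interior u (s_of x)) (star_b x) vs)"
      using homogeneous_wedge[OF hu homogeneous_stars(2)[OF x]] by (simp add: homogeneous_def)
    show "homogeneous 7 (wedge (interior u (s_of x)) (wedge (b_of x) (s_of x)))"
      using homogeneous_wedge[OF hu homogeneous_wedge[OF b_of_forms(2) s_of_forms(2)]] by simp
    show "2 * wedge (interior u (s_of x)) (star_b x) (fr x) = wedge (interior u (s_of x)) (wedge (b_of x) (s_of x)) (fr x)"
      using wedge_star_formula[OF alternating_vol[OF s_of_forms f] au hu b_of_forms(2), of "fr x"]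
        wedge_s_b_s[OF s_of_forms f b_of_forms(2), of u]
      by (simp add: star_fr[OF x b_of_forms] vol_f[OF s_of_forms f] wedge_assoc)
  qed (intro alternating_scaled alternating_wedge au alternating_stars x b_of_forms s_of_forms)+
  from fun_cong[OF this, of vs] show ?thesis by simp
qed

theorem interior_s_Upsilon5:
  assumes x: "x \<in> X" and \<gamma>: "linear \<gamma>" "\<And>v. fst (\<gamma> v) = v"
    and U4: "pullback \<gamma> (Upsilon4 x) = (\<lambda>_. 0)"
  shows "wedge (interior u (s_of x)) (pullback \<gamma> (Upsilon5 x)) std = 0"
proof -
  have pf: "pullback \<gamma> (pullback fst \<phi>) = \<phi>" for \<phi> :: "(real^7) form"
    using \<gamma>(2) by (auto simp: pullback_def o_def)
  have "pullback \<gamma> (Upsilon5 x) = (\<lambda>vs. pullback \<gamma> (ext_deriv tform x) vs + 2 / 3 * star_b x vs - 1 / 3 * wedge (b_of x) (s_of x) vs)"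
  proof -
    have "pullback \<gamma> (Upsilon5 x) = (\<lambda>vs. pullback \<gamma> (ext_deriv tform x) vs + 2 / 3 * pullback \<gamma> (pform x) vs -
      1 / 3 * pullback \<gamma> (dwedge bform sform x) vs)"
      by (simp add: Upsilon5_def pullback_def)
    then show ?thesis
      by (simp add: pform_def pf dwedge_def pullback_wedge bform_def sform_def)
  qed
  note e = this
  have "wedge (interior u (s_of x)) (pullback \<gamma> (Upsilon5 x)) std =
    wedge (interior u (s_of x)) (pullback \<gamma> (ext_deriv tform x)) std + 2 / 3 * wedge (interior u (s_of x)) (star_b x) std
    - 1 / 3 * wedge (interior u (s_of x)) (wedge (b_of x) (s_of x)) std"
    unfolding e wedge_diff_right wedge_add_right wedge_scale_right ..
  also have "\<dots> = wedge (interior u (s_of x)) (pullback \<gamma> (ext_deriv tform x)) std"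
    using interior_s_star_b[OF x, of u std] by simp
  also have "\<dots> = 0"
    unfolding interior_s_dt[OF x \<gamma>] using U4 by (simp add: Upsilon4_def wedge_zero_left)
  finally show ?thesis .
qed

section \<open>The kernel of the polar equations of a hyperplane\<close>

definition singles7 :: "nat list list" where
  "singles7 = [[0], [1], [2], [3], [4], [5], [6]]"

definition pairs7 :: "nat list list" where
  "pairs7 = [[0,1], [0,2], [0,3], [0,4], [0,5], [0,6], [1,2], [1,3], [1,4], [1,5], [1,6], [2,3], [2,4],
    [2,5], [2,6], [3,4], [3,5], [3,6], [4,5], [4,6], [5,6]]"

lemma ev_vol_append:
  assumes x: "x \<in> X" and f: "adapted (s_of x) f" and "length is + length w = 7" "set is \<subseteq> {..<7}" "set w \<subseteq> {..<7}"
  shows "fvol f (map ((!) f) is @ map ((!) f) w) = psign (is @ w)"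
  using ev_vol[OF s_of_forms f, of "is @ w"] assms(3-5) by (simp add: ev_def)

lemma ev_star_3:
  assumes x: "x \<in> X" and f: "adapted (s_of x) f" and w: "length w = 4" "set w \<subseteq> {..<7}"
  shows "ev f (star_s x) w = - psign ([0,1,2] @ w) - psign ([0,3,4] @ w) + psign ([0,5,6] @ w) - psign ([1,3,5] @ w)
    - psign ([1,4,6] @ w) - psign ([2,3,6] @ w) + psign ([2,4,5] @ w)"
proof -
  have v: "ev f (\<lambda>vs. fvol f (vs @ map ((!) f) w)) is = psign (is @ w)" if "length is = 3" "set is \<subseteq> {..<7}" for "is"
    unfolding ev_def using ev_vol_append[OF x f, of "is" w] that w by simp
  have "ev f (star_s x) w = form_inner f (s_of x) (\<lambda>vs. fvol f (vs @ map ((!) f) w))"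
    using star_eq[OF s_of_forms f s_of_forms[of x]] by (simp add: ev_def star_formula_def)
  then show ?thesis
    unfolding form_inner_ev[OF adapted_frame[OF f] s_of_forms(2)] triples7_def
    by (simp add: ev_s_phi[OF x f] v phi_values del: psign.simps append.simps)
qed

lemma ev_star_2:
  assumes x: "x \<in> X" and f: "adapted (s_of x) f" and \<beta>: "alternating \<beta>" "homogeneous 2 \<beta>"
    and w: "length w = 5" "set w \<subseteq> {..<7}"
  shows "ev f (star (s_of x) 2 \<beta>) w = (\<Sum>is\<leftarrow>pairs7. ev f \<beta> is * psign (is @ w))"
proof -
  have v: "ev f (\<lambda>vs. fvol f (vs @ map ((!) f) w)) is = psign (is @ w)" if "length is = 2" "set is \<subseteq> {..<7}" for "is"
    unfolding ev_def using ev_vol_append[OF x f, of "is" w] that w by simp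
  obtain a b c d e g h where fe: "f = [a, b, c, d, e, g, h]" using frame_cases[OF adapted_frame[OF f]] .
  have "ev f (star (s_of x) 2 \<beta>) w = form_inner f \<beta> (\<lambda>vs. fvol f (vs @ map ((!) f) w))"
    using star_eq[OF s_of_forms f \<beta>] by (simp add: ev_def star_formula_def)
  also have "\<dots> = (\<Sum>is\<leftarrow>pairs7. ev f \<beta> is * ev f (\<lambda>vs. fvol f (vs @ map ((!) f) w)) is)"
    unfolding fe form_inner_2[OF \<beta>(2)] pairs7_def ev_def by simp
  also have "\<dots> = (\<Sum>is\<leftarrow>pairs7. ev f \<beta> is * psign (is @ w))"
    unfolding pairs7_def by (simp add: v del: psign.simps append.simps)
  finally show ?thesis .
qed

lemma ev_star_1:
  assumes x: "x \<in> X" and f: "adapted (s_of x) f" and \<beta>: "alternating \<beta>" "homogeneous 1 \<beta>"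
    and w: "length w = 6" "set w \<subseteq> {..<7}"
  shows "ev f (star (s_of x) 1 \<beta>) w = (\<Sum>is\<leftarrow>singles7. ev f \<beta> is * psign (is @ w))"
proof -
  have v: "ev f (\<lambda>vs. fvol f (vs @ map ((!) f) w)) is = psign (is @ w)" if "length is = 1" "set is \<subseteq> {..<7}" for "is"
    unfolding ev_def using ev_vol_append[OF x f, of "is" w] that w by simp
  obtain a b c d e g h where fe: "f = [a, b, c, d, e, g, h]" using frame_cases[OF adapted_frame[OF f]] .
  have "ev f (star (s_of x) 1 \<beta>) w = form_inner f \<beta> (\<lambda>vs. fvol f (vs @ map ((!) f) w))"
    using star_eq[OF s_of_forms f \<beta>] by (simp add: ev_def star_formula_def)
  also have "\<dots> = (\<Sum>is\<leftarrow>singles7. ev f \<beta> is * ev f (\<lambda>vs. fvol f (vs @ map ((!) f) w)) is)"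
    unfolding fe form_inner_1[OF \<beta>(2)] singles7_def ev_def by simp
  also have "\<dots> = (\<Sum>is\<leftarrow>singles7. ev f \<beta> is * psign (is @ w))"
    unfolding singles7_def by (simp add: v del: psign.simps append.simps)
  finally show ?thesis .
qed

definition hyper :: "nat list" where "hyper = [0,1,2,3,4,5]"

definition quads :: "nat list list" where
  "quads = [[1,2,3,4], [0,2,3,4], [0,1,3,4], [0,1,2,4], [0,1,2,3], [0,1,4,5], [0,1,3,5], [0,1,2,5]]"

definition quints :: "nat list list" where
  "quints = [[1,2,3,4,5], [0,2,3,4,5], [0,1,3,4,5], [0,1,2,4,5], [0,1,2,3,5], [0,1,2,3,4]]"

lemma kernel_b:
  assumes x: "x \<in> X" and f: "adapted (s_of x) f"
    and z1: "\<And>a b. a < b \<Longrightarrow> b < 6 \<Longrightarrow> ev f (form2 \<beta>) [a, b] = 0"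
    and z2: "\<And>w. w \<in> set quints \<Longrightarrow> ev f (star (s_of x) 2 (form2 \<beta>)) w = 0"
  shows "\<beta> = 0"
proof -
  note a2 = alternating_form2[of \<beta>] and h2 = homogeneous_form2[of \<beta>]
  have "\<forall>w\<in>set quints. (\<Sum>is\<leftarrow>pairs7. ev f (form2 \<beta>) is * psign (is @ w)) = 0"
  proof
    fix w assume w: "w \<in> set quints"
    then have "length w = 5" "set w \<subseteq> {..<7}" by (auto simp: quints_def)
    then show "(\<Sum>is\<leftarrow>pairs7. ev f (form2 \<beta>) is * psign (is @ w)) = 0"
      using z2[OF w] ev_star_2[OF x f a2 h2] by simp
  qed
  then have z6: "ev f (form2 \<beta>) [a, 6] = 0" if "a < 6" for a
    using that unfolding quints_def pairs7_def by (auto simp: less_Suc_eq numeral_eq_Suc)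
  have "form2 \<beta> = (\<lambda>_. 0)"
  proof (rule frame_form_eqI[OF adapted_frame[OF f] a2 alternating_const_zero h2])
    fix "is" :: "nat list" assume hyp: "sorted_wrt (<) is" "length is = 2" "set is \<subseteq> {..<7}"
    then obtain a b where ab: "is = [a, b]" by (auto simp: numeral_eq_Suc length_Suc_conv)
    then have "a < b" "b < 7" using hyp by auto
    then show "ev f (form2 \<beta>) is = ev f (\<lambda>_. 0) is"
      using z1[of a b] z6[of a] ab by (cases "b = 6") (auto simp: ev_def)
  qed (simp add: homogeneous_def)
  then show ?thesis by (simp add: form2_zero_iff)
qed


lemma star_du_derivative_hyper:
  assumes x: "x \<in> X" and f: "adapted (s_of x) f"
  shows "lie (endo f a) (star_du i x) (map ((!) f) hyper) - star (s_of x) 1 (pullback (endo f a) (du i)) (map ((!) f) hyper) =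
    ((\<Sum>k<6. (- a k 6 - a 6 k) *\<^sub>R f ! k) + ((\<Sum>k<6. a k k) - a 6 6) *\<^sub>R f ! 6) $ i"
proof -
  note fr = adapted_frame[OF f]
  note lin = linear_endo[OF fr, of a]
  have h: "length hyper = 6" "set hyper \<subseteq> {..<7}" by (auto simp: hyper_def)
  have e: "lie (endo f a) (star_du i x) (map ((!) f) hyper) = (\<Sum>n<6. \<Sum>j<7. a (hyper ! n) j * ev f (star_du i x) (hyper[n := j]))"
    using ev_lie_endo[OF fr alternating_stars(3)[OF x] h(2), of a i] by (simp add: ev_def h(1))
  have s: "ev f (star_du i x) w = (\<Sum>is\<leftarrow>singles7. ev f (du i) is * psign (is @ w))" if "length w = 6" "set w \<subseteq> {..<7}" for w
    by (rule ev_star_1[OF x f alternating_du homogeneous_du that])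
  have d: "ev f (du i) [k] = (f ! k) $ i" for k by (simp add: ev_def du_def)
  have pd: "ev f (pullback (endo f a) (du i)) [k] = (\<Sum>j<7. a k j *\<^sub>R f ! j) $ i" if "k < 7" for k
    using that by (simp add: ev_def du_def pullback_def endo_nth[OF fr])
  have "star (s_of x) 1 (pullback (endo f a) (du i)) (map ((!) f) hyper) =
      (\<Sum>is\<leftarrow>singles7. ev f (pullback (endo f a) (du i)) is * psign (is @ hyper))"
    using ev_star_1[OF x f alternating_pullback[OF lin alternating_du] homogeneous_pullback[OF homogeneous_du] h, of i]
    by (simp add: ev_def)
  also have "\<dots> = (\<Sum>j<7. a 6 j *\<^sub>R f ! j) $ i"
    unfolding singles7_def hyper_def by (simp add: pd del: sum_component)
  finally have e2: "star (s_of x) 1 (pullback (endo f a) (du i)) (map ((!) f) hyper) = (\<Sum>j<7. a 6 j *\<^sub>R f ! j) $ i" .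
  have "(\<Sum>n<6. \<Sum>j<7. a (hyper ! n) j * ev f (star_du i x) (hyper[n := j])) =
      ((\<Sum>k<6. (- a k 6) *\<^sub>R f ! k) + (\<Sum>k<6. a k k) *\<^sub>R f ! 6) $ i"
    unfolding hyper_def sum_less_small sum_less_7
    by (simp add: s[unfolded One_nat_def]) (simp add: singles7_def d algebra_simps)
  then show ?thesis
    unfolding e e2 by (simp add: sum_less_small sum_less_7 algebra_simps)
qed

lemma kernel_s:
  assumes x: "x \<in> X" and f: "adapted (s_of x) f"
    and z1: "\<And>a b c. a < b \<Longrightarrow> b < c \<Longrightarrow> c < 6 \<Longrightarrow> ev f (form3 \<sigma>) [a, b, c] = 0"
    and z2: "\<And>w. w \<in> set quads \<Longrightarrow> ev f (fd star_s x (dirs \<sigma>)) w = 0"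
    and z3: "\<And>i. fd (star_du i) x (dirs \<sigma>) (map ((!) f) hyper) = 0"
  shows "\<sigma> = 0"
proof -
  note fr = adapted_frame[OF f]
  define \<tau> where "\<tau> = (\<lambda>l. 1 / 18 * form3 \<sigma> l)"
  have \<tau>: "alternating \<tau>" "homogeneous 3 \<tau>"
    unfolding \<tau>_def by (rule alternating_scaled[OF alternating_form3]) (use homogeneous_form3[of \<sigma>] in \<open>simp add: homogeneous_def\<close>)
  define S where "S = ev f \<tau>"
  define A where "A = endo f (amat S)"
  have A: "linear A" unfolding A_def by (rule linear_endo[OF fr])
  have lA: "lie A (s_of x) = form3 \<sigma>"
    using lie_amat[OF s_of_forms f \<tau>] unfolding A_def S_def by (simp add: \<tau>_def)
  have Szero: "S [a, b, c] = 0" if "a < b" "b < c" "c < 6" for a b c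
    using z1[OF that] by (simp add: S_def \<tau>_def ev_def)
  have "\<forall>a<7. \<forall>b<7. \<forall>c<7. a < b \<longrightarrow> b < c \<longrightarrow> c < 6 \<longrightarrow> S [a, b, c] = 0"
    using Szero by blast
  note S0 = this[unfolded all_less_7', simplified]
  note ev_unsorted[OF \<tau>(1), where f = f, folded S_def, simp] ev_not_distinct[OF \<tau>(1), where f = f, folded S_def, simp]
  note N = nmat_values[OF s_of_forms f, of S, simplified, simplified S0, simplified]
  note ev_unsorted[OF \<tau>(1), where f = f, folded S_def, simp del] ev_not_distinct[OF \<tau>(1), where f = f, folded S_def, simp del]
  define T where "T = (\<Sum>k<7. nmat S k k)"
  have rawA: "\<forall>i<7. \<forall>j<7. amat S i j = 6 * nmat S i j + 3 * nmat S j i - (if i = j then T else 0)"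
    by (simp add: amat_def T_def)
  note A' = rawA[unfolded all_less_7', simplified]
  have T: "T = nmat S 0 0 + nmat S (Suc 0) (Suc 0) + nmat S 2 2 + nmat S 3 3 + nmat S 4 4 + nmat S 5 5 + nmat S 6 6"
    unfolding T_def sum_less_7 ..
  have star_eqs: "\<forall>w\<in>set quads. (\<Sum>n<4. \<Sum>j<7. amat S (w ! n) j * ev f (star_s x) (w[n := j])) = 0"
  proof
    fix w assume w: "w \<in> set quads"
    then have l: "length w = 4" "set w \<subseteq> {..<7}" by (auto simp: quads_def)
    have "ev f (lie A (star_s x)) w = 0"
      using z2[OF w] fd_star_s[OF x A] by (simp add: lA coords3_form3)
    then show "(\<Sum>n<4. \<Sum>j<7. amat S (w ! n) j * ev f (star_s x) (w[n := j])) = 0"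
      using ev_lie_endo[OF fr alternating_stars(1)[OF x] l(2), of "amat S"] by (simp add: A_def l(1))
  qed
  have q: "(\<forall>w\<in>set quads. P w) \<longleftrightarrow> P [Suc 0,2,3,4] \<and> P [0,2,3,4] \<and> P [0,Suc 0,3,4] \<and> P [0,Suc 0,2,4] \<and>
    P [0,Suc 0,2,3] \<and> P [0,Suc 0,4,5] \<and> P [0,Suc 0,3,5] \<and> P [0,Suc 0,2,5]" for P
    by (simp add: quads_def)
  have E1: "(\<forall>w\<in>set quads. (\<Sum>n<4. \<Sum>j<7. amat S (w ! n) j * ev f (star_s x) (w[n := j])) = 0)"
    by (rule star_eqs)
  note ev_star_3[OF x f, simp]
  note E2 = E1[unfolded q sum_less_small sum_less_7, simplified, simplified]
  let ?w = "(\<Sum>k<6. (- amat S k 6 - amat S 6 k) *\<^sub>R f ! k) + ((\<Sum>k<6. amat S k k) - amat S 6 6) *\<^sub>R f ! 6"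
  have "?w $ i = 0" for i
    using z3[of i] fd_star_du[OF x A, of i "map ((!) f) hyper"] star_du_derivative_hyper[OF x f, of "amat S" i]
    unfolding lA coords3_form3 A_def[symmetric] by linarith
  then have "?w = 0" by (simp add: vec_eq_iff)
  then have "coord f k ?w = 0" if "k < 7" for k
    using linear_0[OF linear_coord[of k f]] that frame_length[OF fr] by simp
  moreover have c: "coord f k ?w = (\<Sum>j<6. (- amat S j 6 - amat S 6 j) * (if k = j then 1 else 0)) + ((\<Sum>j<6. amat S j j) - amat S 6 6) * (if k = 6 then 1 else 0)" if "k < 7" for k
  proof -
    have l: "linear (coord f k)" using linear_coord[of k f] that frame_length[OF fr] by simp
    show ?thesis
      by (subst linear_add[OF l]) (simp add: linear_sum[OF l] linear_scale[OF l] coord_nth[OF fr] that)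
  qed
  ultimately have "\<forall>k<7. (\<Sum>j<6. (- amat S j 6 - amat S 6 j) * (if k = j then 1 else 0)) + ((\<Sum>j<6. amat S j j) - amat S 6 6) * (if k = 6 then 1 else 0) = 0"
    by auto
  note E3 = this[unfolded all_less_7' sum_less_small, simplified]
  note EE = E2[simplified A' T N, simplified] E3[simplified A' T N, simplified]
  have all: "\<forall>a<7. \<forall>b<7. \<forall>c<7. a < b \<longrightarrow> b < c \<longrightarrow> S [a, b, c] = 0"
    unfolding all_less_7' using EE by (simp add: S0)
  have "\<tau> = (\<lambda>_. 0)"
  proof (rule frame_form_eqI[OF fr \<tau>(1) alternating_const_zero \<tau>(2)])
    fix "is" :: "nat list" assume hyp: "sorted_wrt (<) is" "length is = 3" "set is \<subseteq> {..<7}"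
    obtain i j k where ijk: "is = [i, j, k]" using length_3_cases[OF hyp(2)] by blast
    then show "ev f \<tau> is = ev f (\<lambda>_. 0) is" using all hyp by (auto simp: S_def) (simp add: ev_def)
  qed (simp add: homogeneous_def)
  then show ?thesis using form3_zero_iff[of \<sigma>] by (simp add: \<tau>_def fun_eq_iff)
qed

section \<open>Linear functionals with a dual family\<close>

lemma independent_of_dual:
  fixes w :: "'k \<Rightarrow> 'a::real_vector"
  assumes "finite K" and lin: "\<And>\<kappa>. \<kappa> \<in> K \<Longrightarrow> linear (\<theta> \<kappa>)"
    and dual: "\<And>\<kappa> \<kappa>'. \<kappa> \<in> K \<Longrightarrow> \<kappa>' \<in> K \<Longrightarrow> \<theta> \<kappa> (w \<kappa>') = (if \<kappa> = \<kappa>' then 1 else 0 :: real)"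
  shows "inj_on w K" and "independent (w ` K)"
proof -
  show inj: "inj_on w K"
  proof (rule inj_onI)
    fix \<kappa> \<kappa>' assume k: "\<kappa> \<in> K" "\<kappa>' \<in> K" "w \<kappa> = w \<kappa>'"
    then show "\<kappa> = \<kappa>'" using dual[OF k(1,1)] dual[OF k(1,2)] by (auto split: if_splits)
  qed
  show "independent (w ` K)"
  proof (rule independent_if_scalars_zero)
    fix c y assume c: "(\<Sum>z\<in>w ` K. c z *\<^sub>R z) = 0" and "y \<in> w ` K"
    then obtain \<kappa> where \<kappa>: "\<kappa> \<in> K" "y = w \<kappa>" by blast
    have "0 = \<theta> \<kappa> (\<Sum>\<kappa>'\<in>K. c (w \<kappa>') *\<^sub>R w \<kappa>')"
      using c linear_0[OF lin[OF \<kappa>(1)]] by (simp add: sum.reindex[OF inj])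
    also have "\<dots> = (\<Sum>\<kappa>'\<in>K. if \<kappa>' = \<kappa> then c (w \<kappa>) else 0)"
      by (simp add: linear_sum[OF lin[OF \<kappa>(1)]] linear_scale[OF lin[OF \<kappa>(1)]])
        (rule sum.cong, auto simp: dual \<kappa>)
    finally show "c y = 0" using \<kappa> assms(1) by simp
  qed (use assms(1) in simp)
qed

definition riesz :: "('a::euclidean_space \<Rightarrow> real) \<Rightarrow> 'a" where
  "riesz \<phi> = (\<Sum>b\<in>Basis. \<phi> b *\<^sub>R b)"

lemma riesz: "linear \<phi> \<Longrightarrow> riesz \<phi> \<bullet> v = \<phi> v"
proof -
  assume l: "linear \<phi>"
  have "\<phi> v = \<phi> (\<Sum>b\<in>Basis. (v \<bullet> b) *\<^sub>R b)" by (simp add: euclidean_representation)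
  also have "\<dots> = (\<Sum>b\<in>Basis. (v \<bullet> b) * \<phi> b)" by (simp add: linear_sum[OF l] linear_scale[OF l])
  finally show ?thesis by (simp add: riesz_def inner_sum_left inner_commute[of v] mult.commute)
qed

lemma functionals_onto:
  fixes \<phi> :: "'k \<Rightarrow> 'a::euclidean_space \<Rightarrow> real"
  assumes K: "finite K" "card K = DIM('a)" and lin: "\<And>\<kappa>. \<kappa> \<in> K \<Longrightarrow> linear (\<phi> \<kappa>)"
    and kernel: "\<And>v. (\<And>\<kappa>. \<kappa> \<in> K \<Longrightarrow> \<phi> \<kappa> v = 0) \<Longrightarrow> v = 0"
  obtains v where "\<And>\<kappa>. \<kappa> \<in> K \<Longrightarrow> \<phi> \<kappa> v = c \<kappa>"
proof -
  let ?w = "\<lambda>\<kappa>. riesz (\<phi> \<kappa>)"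
  have "dim {y \<in> UNIV. \<forall>x\<in>span (?w ` K). orthogonal x y} + dim (span (?w ` K)) = dim (UNIV :: 'a set)"
    by (rule dim_subspace_orthogonal_to_vectors) auto
  moreover have "{y \<in> UNIV. \<forall>x\<in>span (?w ` K). orthogonal x y} = {0}"
  proof -
    have "y = 0" if y: "\<forall>x\<in>span (?w ` K). orthogonal x y" for y
    proof (rule kernel)
      fix \<kappa> assume k: "\<kappa> \<in> K"
      then have "orthogonal (?w \<kappa>) y" using y by (simp add: span_base)
      then show "\<phi> \<kappa> y = 0" by (simp add: orthogonal_def riesz[OF lin[OF k]])
    qed
    then show ?thesis by (auto simp: orthogonal_def)
  qed
  ultimately have d: "dim (?w ` K) = DIM('a)" by (simp add: dim_UNIV)
  have "card (?w ` K) \<le> card K" "dim (?w ` K) \<le> card (?w ` K)"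
    by (intro card_image_le K dim_le_card' finite_imageI)+
  then have "card (?w ` K) = card K" using d K by simp
  then have inj: "inj_on ?w K" by (simp add: eq_card_imp_inj_on K)
  have "independent (?w ` K)"
    using card_image[OF inj] d K by (intro card_le_dim_spanning[of _ UNIV]) (auto simp: dim_eq_full)
  from linear_independent_extend[OF this, of "\<lambda>y. c (the_inv_into K ?w y)"]
  obtain g where g: "linear g" "\<forall>y\<in>?w ` K. g y = c (the_inv_into K ?w y)" by blast
  show thesis
  proof (rule that[of "riesz g"])
    fix \<kappa> assume k: "\<kappa> \<in> K"
    have "\<phi> \<kappa> (riesz g) = riesz g \<bullet> ?w \<kappa>" by (simp add: riesz[OF lin[OF k], symmetric] inner_commute)
    then show "\<phi> \<kappa> (riesz g) = c \<kappa>" using g k by (simp add: riesz the_inv_into_f_f[OF inj])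
  qed
qed

lemma dim_common_kernel:
  fixes \<phi> :: "'k \<Rightarrow> 'a::euclidean_space \<Rightarrow> real"
  assumes K: "finite K" and lin: "\<And>\<kappa>. \<kappa> \<in> K \<Longrightarrow> linear (\<phi> \<kappa>)"
    and dual: "\<And>\<kappa> \<kappa>'. \<kappa> \<in> K \<Longrightarrow> \<kappa>' \<in> K \<Longrightarrow> \<phi> \<kappa>' (d \<kappa>) = (if \<kappa> = \<kappa>' then 1 else 0)"
  shows "dim {v. \<forall>\<kappa>\<in>K. \<phi> \<kappa> v = 0} + card K = DIM('a)"
proof -
  let ?w = "\<lambda>\<kappa>. riesz (\<phi> \<kappa>)"
  have l: "linear (\<lambda>y. d \<kappa> \<bullet> y)" for \<kappa> by (intro linearI) (simp_all add: inner_add_right)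
  note ind = independent_of_dual[where \<theta> = "\<lambda>\<kappa> y. d \<kappa> \<bullet> y" and w = ?w, OF K l]
  have di: "d \<kappa> \<bullet> ?w \<kappa>' = (if \<kappa> = \<kappa>' then 1 else 0)" if "\<kappa> \<in> K" "\<kappa>' \<in> K" for \<kappa> \<kappa>'
    using that by (simp add: inner_commute[of "d \<kappa>"] riesz lin dual)
  have "dim (span (?w ` K)) = card K"
    using dim_eq_card_independent[OF ind(2)[OF di]] card_image[OF ind(1)[OF di]] by simp
  moreover have "dim {y \<in> UNIV. \<forall>x\<in>span (?w ` K). orthogonal x y} + dim (span (?w ` K)) = dim (UNIV :: 'a set)"
    by (rule dim_subspace_orthogonal_to_vectors) auto
  moreover have "{y \<in> UNIV. \<forall>x\<in>span (?w ` K). orthogonal x y} = {v. \<forall>\<kappa>\<in>K. \<phi> \<kappa> v = 0}"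
  proof -
    have "orthogonal x y" if "\<forall>\<kappa>\<in>K. \<phi> \<kappa> y = 0" "x \<in> span (?w ` K)" for x y
    proof -
      have "orthogonal y x" using that(2)
        by (rule orthogonal_to_span) (use that(1) in \<open>auto simp: orthogonal_def inner_commute[of y] riesz lin\<close>)
      then show ?thesis by (simp add: orthogonal_commute)
    qed
    moreover have "\<phi> \<kappa> y = 0" if "\<forall>x\<in>span (?w ` K). orthogonal x y" "\<kappa> \<in> K" for \<kappa> y
    proof -
      have "orthogonal (?w \<kappa>) y" using that by (simp add: span_base)
      then show ?thesis using that by (simp add: orthogonal_def riesz lin)
    qed
    ultimately show ?thesis by auto
  qed
  ultimately show ?thesis by (simp add: dim_UNIV)
qed

lemma frechet_derivative_along_line:
  fixes F :: "'a::real_normed_vector \<Rightarrow> real"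
  assumes "F differentiable (at z)" and "\<And>t. F (z + t *\<^sub>R h) = F z + t * c"
  shows "frechet_derivative F (at z) h = c"
proof -
  have "((\<lambda>t. F (z + t *\<^sub>R h)) has_real_derivative frechet_derivative F (at z) h) (at 0)"
    using DERIV_line[of F z 0 h] assms(1) by simp
  moreover have "((\<lambda>t. F z + t * c) has_real_derivative c) (at 0)"
    by (auto intro!: derivative_eq_intros)
  ultimately show ?thesis unfolding assms(2) by (rule DERIV_unique)
qed

section \<open>Integral elements and polar spaces of a generated ideal\<close>

lemma ideal_gen_vanish:
  assumes "\<alpha> \<in> ideal_gen U G" "x \<in> U" "\<And>\<psi> vs. \<psi> \<in> G \<Longrightarrow> set vs \<subseteq> E \<Longrightarrow> \<psi> x vs = 0" "set vs \<subseteq> E"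
  shows "\<alpha> x vs = 0"
  using assms(1,4)
proof (induction arbitrary: vs)
  case (wedge_left \<alpha> \<beta>)
  have "\<alpha> x (nths vs K) = 0" for K
    using wedge_left.IH[of "nths vs K"] wedge_left.prems set_nths_subset[of vs K] by blast
  then show ?case by (simp add: dwedge_def wedge_def)
next
  case (wedge_right \<alpha> \<beta>)
  have "\<alpha> x (nths vs K) = 0" for K
    using wedge_right.IH[of "nths vs K"] wedge_right.prems set_nths_subset[of vs K] by blast
  then show ?case by (simp add: dwedge_def wedge_def)
qed (auto simp: assms(2,3))

lemma integral_element_ideal_gen:
  "x \<in> U \<Longrightarrow> integral_element (ideal_gen U G) x E \<longleftrightarrow> subspace E \<and> (\<forall>\<psi>\<in>G. \<forall>vs. set vs \<subseteq> E \<longrightarrow> \<psi> x vs = 0)"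
  unfolding integral_element_def using ideal_gen_vanish[of _ U G x E] ideal_gen.gen[of _ G U] by blast

lemma exterior_differential_system_ideal_gen:
  assumes U: "open U" and G: "\<And>\<alpha>. \<alpha> \<in> G \<Longrightarrow> diff_form U \<alpha>"
    and dG: "\<And>\<alpha>. \<alpha> \<in> G \<Longrightarrow> ext_deriv \<alpha> \<in> ideal_gen U G"
    and hom: "\<And>\<alpha>. \<alpha> \<in> G \<Longrightarrow> \<exists>k. \<forall>x\<in>U. homogeneous (Suc k) (\<alpha> x)"
  shows "exterior_differential_system U (ideal_gen U G)"
  unfolding exterior_differential_system_def
proof (intro conjI ballI impI)
  show "ideal_gen U (ideal_gen U G) = ideal_gen U G" by (rule ideal_gen_idem)
  fix \<alpha> assume \<alpha>: "\<alpha> \<in> ideal_gen U G"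
  show "diff_form U \<alpha>" by (rule ideal_gen_diff_form[OF U G \<alpha>])
  show "ext_deriv \<alpha> \<in> ideal_gen U G"
  proof (rule ideal_gen_ext_deriv[OF U G dG _ \<alpha>])
    fix \<beta> assume "\<beta> \<in> G"
    then show "\<exists>k. \<forall>x\<in>U. homogeneous k (\<beta> x)" using hom by blast
  qed
  fix x assume h: "\<forall>x\<in>U. homogeneous 0 (\<alpha> x)" and x: "x \<in> U"
  have "\<alpha> x [] = 0"
  proof (rule ideal_gen_vanish[OF \<alpha> x])
    fix \<psi> vs assume "\<psi> \<in> G" "set vs \<subseteq> ({} :: 'a set)"
    then show "\<psi> x vs = 0" using hom[of \<psi>] x by (auto simp: homogeneous_def)
  qed simp
  moreover have "\<alpha> x vs = 0" if "vs \<noteq> []" for vs using h x that by (simp add: homogeneous_def)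
  ultimately show "\<alpha> x = (\<lambda>vs. 0)" by (intro ext) metis
qed

lemma polar_space_vanish:
  assumes U: "open U" "x \<in> U" and v: "v \<in> polar_space U (ideal_gen U G) x (span (set es))"
    and es: "distinct es" "independent (set es)" "v \<notin> span (set es)"
    and \<alpha>: "\<alpha> \<in> ideal_gen U G" "\<forall>y\<in>U. homogeneous (Suc (length is)) (\<alpha> y)"
    and "is": "distinct is" "set is \<subseteq> {..<length es}"
  shows "\<alpha> x (v # map ((!) es) is) = 0"
  using \<alpha> "is"
proof (induction "length es - length is" arbitrary: \<alpha> "is")
  case 0
  have le: "length is \<le> length es"
    using 0(4,5) card_mono[of "{..<length es}" "set is"] by (simp add: distinct_card)
  then have s: "set is = {..<length es}"
    using 0 by (intro card_subset_eq) (auto simp: distinct_card)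
  have "length is = length es" using s 0(4) by (metis card_lessThan distinct_card)
  moreover have "distinct (map ((!) es) is)"
    using 0(4,5) inj_on_subset[OF inj_on_nth[OF es(1)], of "{..<length es}" "set is"] by (auto simp: distinct_map)
  moreover have "set (map ((!) es) is) = set es" by (simp add: s nth_image lessThan_atLeast0)
  moreover have "dim (span (set es)) = length es"
    using dim_eq_card_independent[OF es(2)] by (simp add: distinct_card[OF es(1)])
  moreover have "independent (set (map ((!) es) is)) \<and> span (set (map ((!) es) is)) = span (set es)"
    using es(2) \<open>set (map ((!) es) is) = set es\<close> by simp
  moreover have "\<forall>y\<in>U. homogeneous (Suc (dim (span (set es)))) (\<alpha> y)"
    using 0(3) \<open>length is = length es\<close> \<open>dim (span (set es)) = length es\<close> by simp
  ultimately show ?case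
    using v 0(2) unfolding polar_space_def mem_Collect_eq by blast
next
  case (Suc n)
  have "set is \<noteq> {..<length es}" using Suc(2,5) by (metis card_lessThan distinct_card diff_self_eq_0 nat.distinct(1))
  then obtain j where j: "j < length es" "j \<notin> set is" using Suc.prems by blast
  have "independent (insert v (set es))" using es by (simp add: independent_insert)
  from linear_independent_extend[OF this, of "\<lambda>y. if y = es ! j then 1 else 0 :: real"]
  obtain \<eta> :: "'a \<Rightarrow> real" where \<eta>: "linear \<eta>" "\<forall>y\<in>insert v (set es). \<eta> y = (if y = es ! j then 1 else 0)" by blast
  have \<eta>v: "\<eta> v = 0" using \<eta>(2) es(3) j by (metis insertI1 nth_mem span_base)
  have \<eta>j: "\<eta> (es ! j) = 1" using \<eta>(2) j by simp
  have \<eta>i: "\<eta> (map ((!) es) is ! k) = 0" if "k < length is" for k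
  proof -
    have "is ! k < length es" "is ! k \<noteq> j" using that Suc.prems j by (auto simp: subset_iff)
    then show ?thesis using that \<eta>(2) es(1) j by (auto simp: nth_eq_iff_index_eq)
  qed
  let ?\<alpha> = "dwedge (\<lambda>_. covec \<eta>) \<alpha>"
  have "?\<alpha> x (v # map ((!) es) (j # is)) = 0"
  proof (rule Suc.hyps(1))
    show "?\<alpha> \<in> ideal_gen U G"
      by (intro ideal_gen.wedge_left Suc.prems diff_form_const alternating_covec \<eta>)
    show "\<forall>y\<in>U. homogeneous (Suc (length (j # is))) (?\<alpha> y)"
      using homogeneous_wedge[OF homogeneous_covec, of _ _ \<eta>] Suc.prems(2) by (simp add: dwedge_def)
  qed (use Suc j in auto)
  moreover have "wedge (covec \<eta>) \<psi> (map ((!) es) is) = 0" for \<psi>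
    unfolding wedge_covec by (rule sum.neutral) (use \<eta>i in auto)
  ultimately show ?case
    by (simp add: dwedge_def wedge_covec_Cons \<eta>v \<eta>j interior_def)
qed

lemma polar_space_ideal_gen:
  assumes U: "open U" "x \<in> U" and G: "\<And>\<psi>. \<psi> \<in> G \<Longrightarrow> diff_form U \<psi>"
    and hom: "\<And>\<psi>. \<psi> \<in> G \<Longrightarrow> \<exists>k. \<forall>y\<in>U. homogeneous (Suc k) (\<psi> y)"
    and es: "distinct es" "independent (set es)"
    and int: "\<And>\<psi> vs. \<psi> \<in> G \<Longrightarrow> set vs \<subseteq> span (set es) \<Longrightarrow> \<psi> x vs = 0"
  shows "v \<in> polar_space U (ideal_gen U G) x (span (set es)) \<longleftrightarrow>
    (\<forall>\<psi>\<in>G. \<forall>ws. set ws \<subseteq> span (set es) \<longrightarrow> \<psi> x (v # ws) = 0)" (is "?L \<longleftrightarrow> ?R")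
proof
  assume v: ?L
  show ?R
  proof (intro ballI allI impI)
    fix \<psi> ws assume \<psi>: "\<psi> \<in> G" and ws: "set ws \<subseteq> span (set es)"
    note alt = diff_form_alternating[OF G[OF \<psi>] U(2)]
    show "\<psi> x (v # ws) = 0"
    proof (cases "v \<in> span (set es)")
      case True
      then show ?thesis using int[OF \<psi>] ws by simp
    next
      case False
      obtain k where k: "\<forall>y\<in>U. homogeneous (Suc k) (\<psi> y)" using hom[OF \<psi>] by blast
      have "interior v (\<psi> x) ws = 0"
      proof (rule alternating_eq_zero_on_span[OF alternating_interior[OF alt] _ ws])
        fix "is" assume "is": "set is \<subseteq> {..<length es}" "distinct is"
        show "interior v (\<psi> x) (map ((!) es) is) = 0"
        proof (cases "length is = k")
          case True
          then show ?thesis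
            using polar_space_vanish[OF U v es False ideal_gen.gen[OF \<psi>] _ "is"(2,1)] k by (simp add: interior_def)
        next
          case False
          then show ?thesis using k U(2) by (simp add: interior_def homogeneous_def)
        qed
      qed
      then show ?thesis by (simp add: interior_def)
    qed
  qed
next
  assume R: ?R
  have zero: "\<psi> x vs = 0" if \<psi>: "\<psi> \<in> G" and vs: "set vs \<subseteq> span (set (v # es))" for \<psi> vs
  proof (rule alternating_eq_zero_on_span[OF diff_form_alternating[OF G[OF \<psi>] U(2)] _ vs])
    note alt = diff_form_alternating[OF G[OF \<psi>] U(2)]
    fix "is" assume "is": "set is \<subseteq> {..<length (v # es)}" "distinct is"
    have E: "set (map ((!) (v # es)) js) \<subseteq> span (set es)" if js: "set js \<subseteq> set is" "0 \<notin> set js" for js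
    proof
      fix y assume "y \<in> set (map ((!) (v # es)) js)"
      then obtain j where "j \<in> set js" "y = (v # es) ! j" by auto
      then obtain i where "j = Suc i" using js(2) by (metis not0_implies_Suc)
      moreover have "j < length (v # es)" using \<open>j \<in> set js\<close> js(1) "is"(1) by blast
      ultimately show "y \<in> span (set es)" using \<open>y = (v # es) ! j\<close> by (simp add: span_base)
    qed
    show "\<psi> x (map ((!) (v # es)) is) = 0"
    proof (cases "0 \<in> set is")
      case True
      then obtain as bs where ab: "is = as @ 0 # bs" by (meson split_list)
      then have "0 \<notin> set (as @ bs)" using "is"(2) by simp
      then have "set (map ((!) (v # es)) (as @ bs)) \<subseteq> span (set es)" by (intro E) (auto simp: ab)
      then have "\<psi> x (v # map ((!) (v # es)) (as @ bs)) = 0" using R \<psi> by blast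
      then show ?thesis using alternating_move[OF alt, of "map ((!) (v # es)) as" v] by (simp add: ab)
    next
      case False
      then show ?thesis using int[OF \<psi>] E[of "is"] by simp
    qed
  qed
  show ?L
    unfolding polar_space_def
  proof (intro CollectI ballI impI allI)
    fix \<psi> fs assume \<psi>: "\<psi> \<in> ideal_gen U G" and fs: "distinct fs \<and> independent (set fs) \<and> span (set fs) = span (set es)"
    have "set (v # fs) \<subseteq> span (set (v # es))"
      using fs span_superset[of "set fs"] span_mono[of "set es" "set (v # es)"] span_base[of v "set (v # es)"] by auto
    then show "\<psi> x (v # fs) = 0"
      using ideal_gen_vanish[OF \<psi> U(2), where E = "span (set (v # es))"] zero by blast
  qed
qed

lemma homogeneous_ext_deriv:
  assumes U: "open U" "x \<in> U" and "\<And>y. y \<in> U \<Longrightarrow> homogeneous k (\<alpha> y)"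
  shows "homogeneous (Suc k) (ext_deriv \<alpha> x)"
  unfolding homogeneous_def
proof (intro allI impI)
  fix vs :: "'a list" assume "length vs \<noteq> Suc k"
  then have "frechet_derivative (\<lambda>y. \<alpha> y (take i vs @ drop (Suc i) vs)) (at x) = frechet_derivative (\<lambda>y. 0) (at x)"
    if "i < length vs" for i
    using assms(3) that by (intro frechet_derivative_cong_open[OF U]) (auto simp: homogeneous_def)
  then show "ext_deriv \<alpha> x vs = 0" by (simp add: ext_deriv_def)
qed

section \<open>The generators of \<open>\<I>\<^sub>\<lambda>\<^sup>+\<close>\<close>

definition gform :: "real \<Rightarrow> nat \<Rightarrow> total dform" where
  "gform l n = (if n = 3 then Upsilon3 l else if n = 4 then Upsilon4 else if n = 5 then Upsilon5
     else if n = 6 then Upsilon6 else ext_deriv (Phi (ix (n - 7))))"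

abbreviation gens :: "real \<Rightarrow> total dform set" where
  "gens l \<equiv> gform l ` {3..<14}"

lemma I_lambda_plus_eq: "I_lambda_plus l = ideal_gen X (gens l)"
proof -
  have s: "{3..<14::nat} = {3, 4, 5, 6} \<union> (\<lambda>i. i + 7) ` {..<7}"
  proof (intro set_eqI iffI)
    fix n :: nat assume "n \<in> {3..<14}"
    then show "n \<in> {3, 4, 5, 6} \<union> (\<lambda>i. i + 7) ` {..<7}"
      by (cases "n < 7") (auto intro!: image_eqI[of _ _ "n - 7"])
  qed auto
  have "gform l ` (\<lambda>i. i + 7) ` {..<7} = (\<lambda>i. ext_deriv (Phi i)) ` (ix ` {..<7})"
    unfolding image_image by (rule image_cong) (auto simp: gform_def)
  then have "gens l = {Upsilon3 l, Upsilon4, Upsilon5, Upsilon6} \<union> range (\<lambda>i. ext_deriv (Phi i))"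
    unfolding s image_Un using bij_ix by (simp add: bij_betw_def) (simp add: gform_def)
  then show ?thesis unfolding I_lambda_plus_def I_lambda_def ideal_gen_ideal_gen_Un by simp
qed

lemma homogeneous_forms:
  assumes "x \<in> X"
  shows "homogeneous 3 (sform x)" "homogeneous 2 (bform x)" "homogeneous 4 (tform x)" "homogeneous 5 (pform x)"
    "homogeneous 6 (Phi i x)"
  unfolding sform_def bform_def tform_def pform_def Phi_def
  by (intro homogeneous_pullback s_of_forms b_of_forms homogeneous_stars assms)+

definition gdeg :: "nat \<Rightarrow> nat" where "gdeg n = min n 7"

lemma homogeneous_gform:
  assumes x: "x \<in> X" and n: "n \<ge> 3"
  shows "homogeneous (gdeg n) (gform l n x)"
proof -
  have d: "homogeneous 4 (ext_deriv sform x)" "homogeneous 3 (ext_deriv bform x)" "homogeneous 5 (ext_deriv tform x)"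
    "homogeneous 6 (ext_deriv pform x)" "homogeneous 7 (ext_deriv (Phi i) x)" for i
    using homogeneous_ext_deriv[OF open_X x homogeneous_forms(1)] homogeneous_ext_deriv[OF open_X x homogeneous_forms(2)]
      homogeneous_ext_deriv[OF open_X x homogeneous_forms(3)] homogeneous_ext_deriv[OF open_X x homogeneous_forms(4)]
      homogeneous_ext_deriv[OF open_X x homogeneous_forms(5)] by simp_all
  have w: "homogeneous 5 (dwedge bform sform x)"
    using homogeneous_wedge[OF homogeneous_forms(2,1)[OF x]] by (simp add: dwedge_def)
  have c: "homogeneous k (\<lambda>vs. \<phi> vs + r * \<psi> vs)" if "homogeneous k \<phi>" "homogeneous k \<psi>" for k r and \<phi> \<psi> :: "total form"
    using that by (simp add: homogeneous_def)
  consider "n = 3" | "n = 4" | "n = 5" | "n = 6" | "n \<ge> 7" using n by linarith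
  then show ?thesis
  proof cases
    case 1
    then show ?thesis using c[OF d(2) homogeneous_forms(1)[OF x], of "- l"] by (simp add: gform_def gdeg_def Upsilon3_def)
  next
    case 3
    then show ?thesis using c[OF c[OF d(3) homogeneous_forms(4)[OF x], of "2/3"] w, of "-1/3"]
      by (simp add: gform_def gdeg_def Upsilon5_def)
  qed (use d in \<open>simp_all add: gform_def gdeg_def Upsilon4_def Upsilon6_def\<close>)
qed

lemma diff_form_gform: "n \<ge> 3 \<Longrightarrow> diff_form X (gform l n)"
proof -
  assume n: "n \<ge> 3"
  note d = diff_form_ext_deriv[OF open_X]
  have 3: "diff_form X (Upsilon3 l)"
    using diff_form_lincomb[OF open_X d[OF diff_forms(2)] diff_forms(1), of 1 "- l"] by (simp add: Upsilon3_def)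
  have 5: "diff_form X Upsilon5"
    using diff_form_lincomb[OF open_X diff_form_lincomb[OF open_X d[OF diff_forms(3)] diff_forms(4), of 1 "2/3"]
        diff_form_dwedge[OF open_X diff_forms(2,1)], of 1 "- 1/3"] by (simp add: Upsilon5_def)
  show ?thesis using n 3 5 by (simp add: gform_def Upsilon4_def Upsilon6_def d diff_forms)
qed

lemmas alternating_gform = diff_form_alternating[OF diff_form_gform]

lemma ext_deriv_Upsilon5:
  assumes x: "x \<in> X"
  shows "ext_deriv Upsilon5 x = (\<lambda>vs. 2/3 * Upsilon6 x vs + (-1/3) * (dwedge (Upsilon3 l) sform x vs + dwedge bform Upsilon4 x vs))"
proof -
  note d = diff_form_ext_deriv[OF open_X]
  note w = diff_form_dwedge[OF open_X diff_forms(2,1)]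
  have e: "Upsilon5 = (\<lambda>x vs. 1 * (1 * ext_deriv tform x vs + 2/3 * pform x vs) + (-1/3) * dwedge bform sform x vs)"
    by (simp add: Upsilon5_def)
  have ss: "wedge (sform x) (sform x) vs = 0" for vs
    using fun_cong[OF wedge_commute[OF homogeneous_forms(1)[OF x] homogeneous_forms(1)[OF x]], of vs] by simp
  have "wedge (ext_deriv bform x) (sform x) = (\<lambda>vs. wedge (Upsilon3 l x) (sform x) vs)"
    by (simp add: Upsilon3_def wedge_diff_left wedge_scale_left ss)
  then have bs: "ext_deriv (dwedge bform sform) x = (\<lambda>vs. dwedge (Upsilon3 l) sform x vs + dwedge bform Upsilon4 x vs)"
    unfolding ext_deriv_dwedge[OF open_X diff_forms(2,1) x]
    by (simp add: hat_homogeneous[OF homogeneous_forms(2)[OF x]] dwedge_def Upsilon4_def)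
  show ?thesis
    unfolding e ext_deriv_lincomb[OF diff_form_lincomb[OF open_X d[OF diff_forms(3)] diff_forms(4)] w x]
      ext_deriv_lincomb[OF d[OF diff_forms(3)] diff_forms(4) x] bs
    by (simp add: ext_deriv_ext_deriv[OF open_X diff_forms(3) x] Upsilon6_def)
qed

lemma gens_differentially_closed:
  assumes "\<alpha> \<in> gens l"
  shows "ext_deriv \<alpha> \<in> ideal_gen X (gens l)"
proof -
  let ?I = "ideal_gen X (gens l)"
  have zero: "\<alpha> \<in> ?I" if "\<And>x. x \<in> X \<Longrightarrow> \<alpha> x = (\<lambda>vs. 0)" for \<alpha>
    by (rule ideal_gen.cong[OF ideal_gen.zero]) (rule that)
  have dd: "ext_deriv (ext_deriv \<beta>) \<in> ?I" if "diff_form X \<beta>" for \<beta>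
    by (rule zero) (rule ext_deriv_ext_deriv[OF open_X that])
  have g: "gform l n \<in> ?I" if "n \<in> {3..<14}" for n
    by (rule ideal_gen.gen) (use that in blast)
  have g': "Upsilon3 l \<in> ?I" "Upsilon4 \<in> ?I" "Upsilon6 \<in> ?I"
    using g[of 3] g[of 4] g[of 6] by (simp_all add: gform_def)
  obtain n where n: "n \<in> {3..<14}" "\<alpha> = gform l n" using assms by blast
  then consider "n = 3" | "n = 4" | "n = 5" | "n = 6" | "n \<ge> 7" by force
  then show ?thesis
  proof cases
    case 1
    have e: "Upsilon3 l = (\<lambda>x vs. 1 * ext_deriv bform x vs + (- l) * sform x vs)" by (simp add: Upsilon3_def)
    have "ext_deriv (Upsilon3 l) x = (\<lambda>vs. - l * Upsilon4 x vs)" if "x \<in> X" for x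
      unfolding e ext_deriv_lincomb[OF diff_form_ext_deriv[OF open_X diff_forms(2)] diff_forms(1) that]
      by (simp add: ext_deriv_ext_deriv[OF open_X diff_forms(2) that] Upsilon4_def)
    then have "ext_deriv (Upsilon3 l) \<in> ?I" by (rule ideal_gen.cong[OF ideal_gen_scale[OF g'(2)]])
    then show ?thesis using 1 n by (simp add: gform_def)
  next
    case 2
    then show ?thesis using n dd[OF diff_forms(1)] by (simp add: gform_def Upsilon4_def)
  next
    case 3
    have "ext_deriv Upsilon5 \<in> ?I"
      by (rule ideal_gen.cong[OF ideal_gen.add[OF ideal_gen_scale[OF g'(3)] ideal_gen_scale[OF ideal_gen.add[OF
              ideal_gen.wedge_right[OF g'(1) diff_forms(1)] ideal_gen.wedge_left[OF g'(2) diff_forms(2)]]]]])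
        (rule ext_deriv_Upsilon5)
    then show ?thesis using 3 n by (simp add: gform_def)
  next
    case 4
    then show ?thesis using n dd[OF diff_forms(4)] by (simp add: gform_def Upsilon6_def)
  next
    case 5
    then show ?thesis using n dd[OF diff_forms(5)] by (simp add: gform_def)
  qed
qed

lemma exterior_differential_system_I_lambda_plus: "exterior_differential_system X (I_lambda_plus l)"
  unfolding I_lambda_plus_eq
proof (rule exterior_differential_system_ideal_gen[OF open_X])
  fix \<alpha> assume a: "\<alpha> \<in> gens l"
  then obtain n where n: "n \<in> {3..<14}" "\<alpha> = gform l n" by blast
  then show "diff_form X \<alpha>" by (simp add: diff_form_gform)
  have "Suc (gdeg n - 1) = gdeg n" using n by (simp add: gdeg_def)
  then have "\<forall>x\<in>X. homogeneous (Suc (gdeg n - 1)) (\<alpha> x)"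
    using homogeneous_gform[of _ n l] n by simp
  then show "\<exists>k. \<forall>x\<in>X. homogeneous (Suc k) (\<alpha> x)" by blast
qed (rule gens_differentially_closed)

subsection \<open>Vertical directions\<close>

definition eta :: "nat \<Rightarrow> total \<Rightarrow> (real^7) form" where
  "eta n x = (if n = 3 then b_of x else if n = 4 then s_of x else if n = 5 then star_s x
     else if n = 6 then star_b x else star_du (ix (n - 7)) x)"

lemma smooth_eta: "smooth_on X (\<lambda>y. eta n y vs)"
  and alternating_eta: "y \<in> X \<Longrightarrow> alternating (eta n y)"
proof -
  have "eta n = b_of \<or> eta n = s_of \<or> eta n = star_s \<or> eta n = star_b \<or> eta n = star_du (ix (n - 7))"
    by (cases "n = 3"; cases "n = 4"; cases "n = 5"; cases "n = 6") (simp_all add: eta_def[abs_def])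
  then show "smooth_on X (\<lambda>y. eta n y vs)" and "y \<in> X \<Longrightarrow> alternating (eta n y)"
    by (elim disjE; simp add: smooth_s_of smooth_b_of smooth_stars alternating_stars s_of_forms b_of_forms del: One_nat_def)+
qed

lemma ext_deriv_vertical:
  assumes x: "x \<in> X" and alt: "\<And>y. y \<in> X \<Longrightarrow> alternating (\<eta> y)"
  shows "ext_deriv (\<lambda>y. pullback fst (\<eta> y)) x ((0, \<delta>) # ws) = fd \<eta> x (0, \<delta>) (map fst ws)"
proof -
  have z: "frechet_derivative (\<lambda>y. \<eta> y (0 # us)) (at x) = frechet_derivative (\<lambda>y. 0) (at x)" for us
    by (rule frechet_derivative_cong_open[OF open_X x]) (use alternating_zero[OF alt, of _ "[]"] in simp)
  show ?thesis
    by (simp add: ext_deriv_def pullback_def sum.lessThan_Suc_shift z fd_def del: sum.lessThan_Suc)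
qed

lemma gform_vertical:
  assumes x: "x \<in> X" and n: "n \<ge> 3"
  shows "gform l n x ((0, \<delta>) # ws) = fd (eta n) x (0, \<delta>) (map fst ws)"
proof -
  have z: "pullback fst \<phi> ((0, \<delta>) # ws) = 0" if "alternating \<phi>" for \<phi> :: "(real^7) form"
    using alternating_zero[OF that, of "[]"] by (simp add: pullback_def)
  have v: "ext_deriv (\<lambda>y. pullback fst (eta n y)) x ((0, \<delta>) # ws) = fd (eta n) x (0, \<delta>) (map fst ws)"
    by (rule ext_deriv_vertical[OF x alternating_eta])
  have w: "dwedge bform sform x ((0, \<delta>) # ws) = 0"
    using z[OF alternating_wedge[OF b_of_forms(1) s_of_forms(1), of x x]]
    by (simp add: dwedge_def bform_def sform_def pullback_wedge)
  consider "n = 3" | "n = 4" | "n = 5" | "n = 6" | "n \<ge> 7" using n by linarith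
  then show ?thesis
  proof cases
    case 1
    then show ?thesis using v z[OF s_of_forms(1)] by (simp add: gform_def eta_def[abs_def] Upsilon3_def bform_eq sform_eq)
  next
    case 2
    then show ?thesis using v by (simp add: gform_def eta_def[abs_def] Upsilon4_def sform_eq)
  next
    case 3
    then show ?thesis using v z[OF alternating_stars(2)[OF x]] w
      by (simp add: gform_def eta_def[abs_def] Upsilon5_def tform_eq pform_eq)
  next
    case 4
    then show ?thesis using v by (simp add: gform_def eta_def[abs_def] Upsilon6_def pform_eq)
  next
    case 5
    then show ?thesis using v by (simp add: gform_def eta_def[abs_def] Phi_eq)
  qed
qed

lemma fd_star_b_vertical:
  assumes x: "x \<in> X"
  shows "fd star_b x (0, 0, \<beta>) = star (s_of x) 2 (form2 \<beta>)"
proof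
  fix vs
  have "s_of (x + t *\<^sub>R (0, 0, \<beta>)) = s_of x" for t by (simp add: s_of_def)
  moreover have "b_of (x + t *\<^sub>R (0, 0, \<beta>)) = (\<lambda>l. b_of x l + t * form2 \<beta> l)" for t
    by (rule ext) (simp add: b_of_def linear_add[OF linear_form2] linear_scale[OF linear_form2])
  ultimately have "star_b (x + t *\<^sub>R (0, 0, \<beta>)) vs = star_b x vs + t * star (s_of x) 2 (form2 \<beta>) vs" for t
    using star_lincomb[OF x b_of_forms(1) alternating_form2 b_of_forms(2) homogeneous_form2] by simp
  then show "fd star_b x (0, 0, \<beta>) vs = star (s_of x) 2 (form2 \<beta>) vs"
    unfolding fd_def
    by (intro frechet_derivative_along_line smooth_on_differentiable[OF smooth_stars(2) x])
qed

section \<open>The keys\<close>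

text \<open>
  Along a flag spanned by \<open>e\<^sub>0, \<dots>, e\<^sub>6\<close> over an adapted frame, the polar equations of \<open>e\<^sub>0, \<dots>, e\<^sub>5\<close> amount to
  the equations \<open>\<psi>(v, e\<^sub>i, e\<^sub>j, \<dots>) = 0\<close> for the following 56 pairs of a generator \<open>\<psi>\<close> and indices \<open>i, j, \<dots>\<close>.
\<close>

definition keyl :: "(nat \<times> nat list) list" where
  "keyl = map (Pair 3) (filter (\<lambda>is. length is = 2) (subseqs [0..<6])) @
    map (Pair 4) (filter (\<lambda>is. length is = 3) (subseqs [0..<6])) @
    map (Pair 5) quads @ map (Pair 6) quints @ map (\<lambda>n. (n, hyper)) [7..<14]"

definition keys :: "nat \<Rightarrow> (nat \<times> nat list) set" where
  "keys k = {\<kappa> \<in> set keyl. set (snd \<kappa>) \<subseteq> {..<k}}"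

definition rest :: "nat list list" where
  "rest = [[2,3,4,5], [1,3,4,5], [0,3,4,5], [1,2,4,5], [1,2,3,5], [0,2,4,5], [0,2,3,5]]"

lemma subseqs_6: "subseqs [0..<6] = subseqs [0, 1, 2, 3, 4, 5::nat]"
  by (simp add: upt_rec)

lemmas key_simps = subseqs_6 Let_def quads_def quints_def hyper_def upt_rec

lemma filter_in_subseqs: "filter P xs \<in> set (subseqs xs)"
  by (induction xs) (auto simp: Let_def)

lemma sorted_in_subseqs:
  assumes "sorted_wrt (<) is" "set is \<subseteq> {..<m}"
  shows "is \<in> set (subseqs [0..<m])"
proof -
  have "is = filter (\<lambda>i. i \<in> set is) [0..<m]"
    by (rule sorted_distinct_set_unique) (use assms in \<open>auto simp: strict_sorted_iff intro: sorted_wrt_filter\<close>)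
  then show ?thesis using filter_in_subseqs by metis
qed

lemma key_exhaust:
  assumes "sorted_wrt (<) is" "set is \<subseteq> {..<6}" "Suc (length is) = gdeg n" "n \<in> {3..<14}"
  shows "(n, is) \<in> set keyl \<or> n = 5 \<and> is \<in> set rest"
proof -
  have c: "list_all (\<lambda>is. (length is = 4 \<longrightarrow> is \<in> set quads \<or> is \<in> set rest) \<and> (length is = 5 \<longrightarrow> is \<in> set quints) \<and>
    (length is = 6 \<longrightarrow> is = hyper)) (subseqs [0..<6])"
    by (simp add: key_simps rest_def)
  have sub: "is \<in> set (subseqs [0..<6])" by (rule sorted_in_subseqs[OF assms(1,2)])
  with c have c': "length is = 4 \<longrightarrow> is \<in> set quads \<or> is \<in> set rest" "length is = 5 \<longrightarrow> is \<in> set quints"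
    "length is = 6 \<longrightarrow> is = hyper"
    unfolding list_all_iff by blast+
  consider "n = 3" | "n = 4" | "n = 5" | "n = 6" | "n \<ge> 7" using assms(4) by force
  then show ?thesis
    by cases (use assms(3,4) c' sub in \<open>auto simp: gdeg_def keyl_def simp del: upt_rec_numeral\<close>)
qed

lemma rest_5: "is \<in> set rest \<Longrightarrow> 5 \<in> set is"
  by (auto simp: rest_def)

lemma keyl_bounds:
  assumes "(n, is) \<in> set keyl"
  shows "n \<in> {3..<14}" "set is \<subseteq> {..<6}" "sorted_wrt (<) is" "Suc (length is) = gdeg n"
proof -
  have "list_all (\<lambda>(n, is). 3 \<le> n \<and> n < 14 \<and> list_all (\<lambda>i. i < 6) is \<and> sorted_wrt (<) is \<and> Suc (length is) = gdeg n) keyl"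
    by (simp add: keyl_def key_simps gdeg_def)
  then show "n \<in> {3..<14}" "set is \<subseteq> {..<6}" "sorted_wrt (<) is" "Suc (length is) = gdeg n"
    using assms by (auto simp: list_all_iff)
qed

lemma card_keys:
  "card (keys 0) = 0" "card (keys 1) = 0" "card (keys 2) = 1" "card (keys 3) = 4" "card (keys 4) = 11"
  "card (keys 5) = 26" "card (keys 6) = 56" and card_keyl: "card (set keyl) = 56"
proof -
  have d: "distinct keyl" by (simp add: keyl_def key_simps)
  have e: "card (keys k) = length (filter (\<lambda>\<kappa>. list_all (\<lambda>i. i < k) (snd \<kappa>)) keyl)" for k
  proof -
    have "keys k = set (filter (\<lambda>\<kappa>. list_all (\<lambda>i. i < k) (snd \<kappa>)) keyl)"
      by (auto simp: keys_def list_all_iff)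
    then show ?thesis using distinct_card[OF distinct_filter[OF d]] by simp
  qed
  show "card (keys 0) = 0" "card (keys 1) = 0" "card (keys 2) = 1" "card (keys 3) = 4" "card (keys 4) = 11"
    "card (keys 5) = 26" "card (keys 6) = 56"
    unfolding e by (simp_all add: keyl_def key_simps)
  have "length keyl = 56" by (simp add: keyl_def key_simps)
  then show "card (set keyl) = 56" using distinct_card[OF d] by simp
qed

lemma finite_keys: "finite (keys k)"
  by (simp add: keys_def)

definition vert :: "total \<Rightarrow> nat \<times> nat list \<Rightarrow> fiber \<Rightarrow> real" where
  "vert x \<kappa> \<delta> = fd (eta (fst \<kappa>)) x (0, \<delta>) (map ((!) (fr x)) (snd \<kappa>))"

lemma linear_vert:
  assumes "x \<in> X"
  shows "linear (vert x \<kappa>)"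
proof -
  have "linear (\<lambda>\<delta>. (0, \<delta>) :: total)" by (intro linearI) simp_all
  from linear_compose[OF this linear_fd[where \<eta> = "eta (fst \<kappa>)" and vs = "map ((!) (fr x)) (snd \<kappa>)", OF assms smooth_eta]]
  show ?thesis by (simp add: o_def vert_def[abs_def])
qed

lemma vert_kernel:
  assumes x: "x \<in> X" and z: "\<And>\<kappa>. \<kappa> \<in> set keyl \<Longrightarrow> vert x \<kappa> \<delta> = 0"
  shows "\<delta> = 0"
proof -
  obtain \<sigma> \<beta> where d: "\<delta> = (\<sigma>, \<beta>)" by fastforce
  note f = adapted_fr[OF x]
  have sub: "is \<in> set (subseqs [0..<6])" if "sorted_wrt (<) is" "set is \<subseteq> {..<6}" for "is"
    by (rule sorted_in_subseqs[OF that])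
  have e: "eta 3 = b_of" "eta 4 = s_of" "eta 5 = star_s" "eta 6 = star_b"
    by (auto simp: eta_def)
  have "fd star_s x (0, \<delta>) = fd star_s x (dirs (fst (snd ((0, \<delta>) :: total))))"
    by (rule fd_only_s[OF x smooth_stars(1)]) simp
  then have f5: "fd star_s x (0, \<delta>) = fd star_s x (dirs \<sigma>)" by (simp add: d)
  have "fd (star_du i) x (0, \<delta>) = fd (star_du i) x (dirs (fst (snd ((0, \<delta>) :: total))))" for i
    by (rule fd_only_s[OF x smooth_stars(3)]) simp
  then have f7: "fd (star_du i) x (0, \<delta>) = fd (star_du i) x (dirs \<sigma>)" for i by (simp add: d)
  have "\<sigma> = 0"
  proof (rule kernel_s[OF x f])
    fix a b c :: nat assume abc: "a < b" "b < c" "c < 6"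
    then have "(4, [a, b, c]) \<in> set keyl" using sub[of "[a, b, c]"] by (auto simp: keyl_def)
    from z[OF this] show "ev (fr x) (form3 \<sigma>) [a, b, c] = 0"
      by (simp add: vert_def e fd_s_of d ev_def)
  next
    fix w assume "w \<in> set quads"
    then have "(5, w) \<in> set keyl" by (auto simp: keyl_def)
    from z[OF this] show "ev (fr x) (fd star_s x (dirs \<sigma>)) w = 0"
      by (simp add: vert_def e f5 ev_def)
  next
    fix i
    have "(7 + pos7 i, hyper) \<in> set keyl" using pos7_less[of i] by (auto simp: keyl_def simp del: upt_rec_numeral)
    moreover have "eta (7 + pos7 i) = star_du i" by (auto simp: eta_def)
    ultimately show "fd (star_du i) x (dirs \<sigma>) (map ((!) (fr x)) hyper) = 0"
      using z[of "(7 + pos7 i, hyper)"] by (simp add: vert_def f7 del: One_nat_def)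
  qed
  moreover have "\<beta> = 0"
  proof (rule kernel_b[OF x f])
    fix a b :: nat assume ab: "a < b" "b < 6"
    then have "(3, [a, b]) \<in> set keyl" using sub[of "[a, b]"] by (auto simp: keyl_def)
    from z[OF this] show "ev (fr x) (form2 \<beta>) [a, b] = 0"
      by (simp add: vert_def e fd_b_of d ev_def)
  next
    fix w assume "w \<in> set quints"
    then have "(6, w) \<in> set keyl" by (auto simp: keyl_def)
    from z[OF this] show "ev (fr x) (star (s_of x) 2 (form2 \<beta>)) w = 0"
      using fd_star_b_vertical[OF x] \<open>\<sigma> = 0\<close> by (simp add: vert_def e d ev_def)
  qed
  ultimately show ?thesis by (simp add: d zero_prod_def)
qed

lemma DIM_fiber: "DIM(fiber) = 56" and DIM_total: "DIM(total) = 63"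
  by (simp_all add: CARD_triples CARD_pairs)

lemma vert_onto:
  assumes "x \<in> X"
  obtains \<delta> where "\<And>\<kappa>. \<kappa> \<in> set keyl \<Longrightarrow> vert x \<kappa> \<delta> = c \<kappa>"
proof (rule functionals_onto[of "set keyl" "vert x" c])
  show "card (set keyl) = DIM(fiber)" unfolding card_keyl DIM_fiber ..
qed (use assms in \<open>auto simp: linear_vert intro: vert_kernel\<close>)

section \<open>Polar spaces along a flag over an adapted frame\<close>

lemma lists_over_frame:
  assumes f: "frame (map fst (e :: total list))"
  shows "length e = 7" "distinct e" "independent (set e)"
proof -
  show l: "length e = 7" using frame_length[OF f] by simp
  have lin: "linear (coord (map fst e) i \<circ> (fst :: total \<Rightarrow> real^7))" if "i \<in> {..<7}" for i
  proof (intro linear_compose linear_coord)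
    show "linear (fst :: total \<Rightarrow> real^7)" by (intro linearI) simp_all
    show "i < length (map fst e)" using that l by simp
  qed
  have dual: "(coord (map fst e) i \<circ> fst) (e ! j) = (if i = j then 1 else 0)" if "i \<in> {..<7}" "j \<in> {..<7}" for i j
    using coord_nth[OF f, of i j] that l by simp
  note ind = independent_of_dual[where K = "{..<7::nat}" and \<theta> = "\<lambda>i. coord (map fst e) i \<circ> fst" and w = "(!) e", OF _ lin dual]
  show "distinct e" using ind(1) l by (auto simp: distinct_conv_nth inj_on_def)
  have "(!) e ` {..<7} = set e" using nth_image[of 7 e] l by (simp add: lessThan_atLeast0)
  then show "independent (set e)" using ind(2) by simp
qed

lemma nth_take_span:
  assumes "set is \<subseteq> {..<k}" "k \<le> length e"
  shows "set (map ((!) e) is) \<subseteq> span (set (take k e))"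
proof
  fix y assume "y \<in> set (map ((!) e) is)"
  then obtain i where i: "i < k" "y = e ! i" using assms(1) by auto
  then have "y \<in> set (take k e)" using assms(2) by (auto simp: in_set_conv_nth intro!: exI[of _ i])
  then show "y \<in> span (set (take k e))" by (rule span_base)
qed

lemma keys_bounds:
  assumes "\<kappa> \<in> keys k"
  shows "\<kappa> \<in> set keyl" "fst \<kappa> \<in> {3..<14}" "set (snd \<kappa>) \<subseteq> {..<k}" "set (snd \<kappa>) \<subseteq> {..<6}"
  using assms keyl_bounds(1,2)[of "fst \<kappa>" "snd \<kappa>"] by (auto simp: keys_def)

lemma vertical_key:
  assumes x: "x \<in> X" and \<kappa>: "\<kappa> \<in> set keyl"
    and ws: "map fst ws = map ((!) (fr x)) (snd \<kappa>)"
  shows "gform l (fst \<kappa>) x ((0, \<delta>) # ws) = vert x \<kappa> \<delta>"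
  using gform_vertical[OF x, of "fst \<kappa>"] keyl_bounds(1)[of "fst \<kappa>" "snd \<kappa>"] \<kappa> ws by (simp add: vert_def)

lemma map_fst_nth:
  assumes "map fst e = take k fs" "k \<le> length fs" "set is \<subseteq> {..<k}"
  shows "map fst (map ((!) e) is) = map ((!) fs) is"
proof -
  have "fst (e ! i) = fs ! i" if "i \<in> set is" for i
  proof -
    have "i < k" using that assms(3) by blast
    moreover have "length e = k" using arg_cong[OF assms(1), of length] assms(2) by simp
    ultimately show ?thesis using arg_cong[OF assms(1), of "\<lambda>l. l ! i"] by simp
  qed
  then show ?thesis by simp
qed

lemma linear_gform: "x \<in> X \<Longrightarrow> n \<ge> 3 \<Longrightarrow> linear (\<lambda>v. gform l n x (v # ws))"
  using alternating_linear[OF alternating_gform, of n x l "[]" ws] by simp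

lemma vert_dual:
  assumes "x \<in> X"
  obtains D where "\<And>\<kappa> \<kappa>'. \<kappa>' \<in> set keyl \<Longrightarrow> vert x \<kappa>' (D \<kappa>) = (if \<kappa> = \<kappa>' then 1 else 0)"
proof -
  have "\<exists>\<delta>. \<forall>\<kappa>'\<in>set keyl. vert x \<kappa>' \<delta> = (if \<kappa> = \<kappa>' then 1 else 0)" for \<kappa>
    using vert_onto[OF assms, of "\<lambda>\<kappa>'. if \<kappa> = \<kappa>' then 1 else 0"] by metis
  then show thesis using that by metis
qed

lemma polar_codim_eq:
  assumes x: "x \<in> X" and e: "map fst e = fr x" and k: "k < 7"
    and int: "\<And>n vs. n \<in> {3..<14} \<Longrightarrow> set vs \<subseteq> span (set e) \<Longrightarrow> gform l n x vs = 0"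
  shows "polar_codim X (I_lambda_plus l) x (span (set (take k e))) = card (keys k)"
proof -
  have fe: "frame (map fst e)" using frame_fr[OF x] e by simp
  note le = lists_over_frame[OF fe]
  let ?\<phi> = "\<lambda>\<kappa> v. gform l (fst \<kappa>) x (v # map ((!) e) (snd \<kappa>))"
  let ?Z = "{v. \<forall>\<kappa>\<in>keys k. ?\<phi> \<kappa> v = 0}"
  let ?H = "polar_space X (I_lambda_plus l) x (span (set (take k e)))"
  have sub: "span (set (take k e)) \<subseteq> span (set e)" by (intro span_mono set_take_subset)
  obtain D where D: "\<And>\<kappa> \<kappa>'. \<kappa>' \<in> set keyl \<Longrightarrow> vert x \<kappa>' (D \<kappa>) = (if \<kappa> = \<kappa>' then 1 else 0)"
    using vert_dual[OF x] by blast
  have "map fst (map ((!) e) (snd \<kappa>)) = map ((!) (fr x)) (snd \<kappa>)" if "\<kappa> \<in> keys k" for \<kappa>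
    using map_fst_nth[of e 7 "fr x" "snd \<kappa>"] e frame_length[OF frame_fr[OF x]] keys_bounds(4)[OF that] by fastforce
  then have v: "?\<phi> \<kappa> (0, \<delta>) = vert x \<kappa> \<delta>" if "\<kappa> \<in> keys k" for \<kappa> \<delta>
    using vertical_key[OF x keys_bounds(1)[OF that]] that by simp
  have "dim ?Z + card (keys k) = DIM(total)"
  proof (rule dim_common_kernel[where d = "\<lambda>\<kappa>. (0, D \<kappa>)", OF finite_keys])
    fix \<kappa> assume \<kappa>: "\<kappa> \<in> keys k"
    show "linear (?\<phi> \<kappa>)" by (rule linear_gform[OF x]) (use keys_bounds(2)[OF \<kappa>] in simp)
    fix \<kappa>' assume \<kappa>': "\<kappa>' \<in> keys k"
    show "?\<phi> \<kappa>' (0, D \<kappa>) = (if \<kappa> = \<kappa>' then 1 else 0)"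
      unfolding v[OF \<kappa>'] by (rule D[OF keys_bounds(1)[OF \<kappa>']])
  qed
  then have dimZ: "dim ?Z + card (keys k) = 63" by (simp only: DIM_total)
  have H: "v \<in> ?H \<longleftrightarrow> (\<forall>\<psi>\<in>gens l. \<forall>ws. set ws \<subseteq> span (set (take k e)) \<longrightarrow> \<psi> x (v # ws) = 0)" for v
    unfolding I_lambda_plus_eq
  proof (rule polar_space_ideal_gen[OF open_X x])
    fix \<psi> assume "\<psi> \<in> gens l"
    then obtain n where n: "n \<in> {3..<14}" "\<psi> = gform l n" by blast
    then show "diff_form X \<psi>" by (simp add: diff_form_gform)
    have "Suc (gdeg n - 1) = gdeg n" using n by (simp add: gdeg_def)
    then have "\<forall>y\<in>X. homogeneous (Suc (gdeg n - 1)) (\<psi> y)" using homogeneous_gform[of _ n l] n by simp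
    then show "\<exists>k. \<forall>y\<in>X. homogeneous (Suc k) (\<psi> y)" by blast
    show "\<psi> x vs = 0" if "set vs \<subseteq> span (set (take k e))" for vs
      using int[OF n(1), of vs] that sub n(2) by blast
  next
    show "distinct (take k e)" using le(2) by simp
    show "independent (set (take k e))" by (rule independent_mono[OF le(3) set_take_subset])
  qed
  have HZ: "?H \<subseteq> ?Z"
  proof (intro subsetI CollectI ballI)
    fix v \<kappa> assume "v \<in> ?H" "\<kappa> \<in> keys k"
    then show "?\<phi> \<kappa> v = 0"
      using H[of v] keys_bounds[of \<kappa> k] nth_take_span[of "snd \<kappa>" k e] k le(1) by auto
  qed
  have "dim ?H = dim ?Z"
  proof (cases "k = 6")
    case True
    have "span (set e) \<subseteq> ?H"
    proof
      fix v assume v: "v \<in> span (set e)"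
      have "gform l n x (v # ws) = 0" if "n \<in> {3..<14}" "set ws \<subseteq> span (set (take k e))" for n ws
        using int[OF that(1), of "v # ws"] that(2) v sub by auto
      then show "v \<in> ?H" using H[of v] by blast
    qed
    then have "dim (span (set e)) \<le> dim ?H" by (rule dim_subset)
    moreover have "dim (span (set e)) = 7"
      using dim_eq_card_independent[OF le(3)] distinct_card[OF le(2)] le(1) by simp
    ultimately show ?thesis using dim_subset[OF HZ] dimZ card_keys(7) True by simp
  next
    case False
    have "?Z \<subseteq> ?H"
    proof
      fix v assume v: "v \<in> ?Z"
      have "gform l n x (v # ws) = 0" if n: "n \<in> {3..<14}" and ws: "set ws \<subseteq> span (set (take k e))" for n ws
      proof -
        have alt: "alternating (gform l n x)" using n x by (intro alternating_gform) auto
        have "interior v (gform l n x) ws = 0"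
        proof (rule alternating_eq_zero_on_span_nths[OF alternating_interior[OF alt] _ ws])
          fix K assume K: "K \<subseteq> {..<length (take k e)}"
          define is' where "is' = filter (\<lambda>i. i \<in> K) [0..<k]"
          have m: "nths (take k e) K = map ((!) e) is'"
            using k le(1) by (auto simp: nths_eq_map_filter is'_def)
          have i5: "set is' \<subseteq> {..<5}" "set is' \<subseteq> {..<k}" "sorted_wrt (<) is'"
            using False k by (auto simp: is'_def intro: sorted_wrt_filter)
          show "interior v (gform l n x) (nths (take k e) K) = 0"
          proof (cases "Suc (length is') = gdeg n")
            case True
            have "(n, is') \<in> set keyl"
              using key_exhaust[OF i5(3) _ True n] i5(1) rest_5[of is'] by fastforce
            then have "(n, is') \<in> keys k" using i5 by (simp add: keys_def)
            with v show ?thesis by (force simp: m interior_def)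
          next
            case False
            then show ?thesis
              using homogeneous_gform[OF x, of n l] n by (simp add: m interior_def homogeneous_def)
          qed
        qed
        then show ?thesis by (simp add: interior_def)
      qed
      then show "v \<in> ?H" using H[of v] by blast
    qed
    then show ?thesis using HZ by (simp add: subset_antisym)
  qed
  then show ?thesis unfolding polar_codim_def DIM_total using dimZ by simp
qed

section \<open>The equations of the admissible integral elements\<close>

definition frame_pairs :: "nat list list" where
  "frame_pairs = [[0,1], [0,2], [1,2], [0,3], [0,4], [1,3], [1,4]]"

definition frame_rows :: "nat list" where
  "frame_rows = [2, 1, 0, 4, 3, 5, 6]"

definition cmp :: "nat list \<Rightarrow> nat list" where
  "cmp p = filter (\<lambda>i. i \<notin> set p) [0..<7]"

text \<open>
  At \<open>x\<^sub>0\<close> the matrix \<open>s(f\<^sub>a, f\<^sub>i, f\<^sub>j)\<close>, with rows \<open>a\<close> and columns \<open>(i, j)\<close> in \<open>frame_pairs\<close>, is a signed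
  permutation matrix; it stays invertible on \<open>near x\<^sub>0\<close>.
\<close>

definition near :: "total \<Rightarrow> total set" where
  "near x\<^sub>0 = X \<inter> (\<Inter>i\<in>{..<7}. \<Inter>j\<in>{..<7}. {x. \<bar>ev (fr x\<^sub>0) (s_of x) (frame_rows ! i # frame_pairs ! j) -
     phi (frame_rows ! i # frame_pairs ! j)\<bar> < 1 / 8})"

lemma near_bound:
  assumes "x \<in> near x\<^sub>0" "i < 7" "j < 7"
  shows "\<bar>ev (fr x\<^sub>0) (s_of x) (frame_rows ! i # frame_pairs ! j) - phi (frame_rows ! i # frame_pairs ! j)\<bar> < 1 / 8"
  using assms unfolding near_def by blast

lemma open_near: "open (near x\<^sub>0)"
proof -
  have "continuous_on UNIV (\<lambda>x. s_of x vs)" for vs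
    by (rule linear_continuous_on) (simp add: linear_conv_bounded_linear[symmetric] linear_s_of)
  then show ?thesis
    unfolding near_def ev_def
    by (intro open_Int open_X open_INT finite_lessThan ballI open_Collect_less continuous_intros)
qed

lemma near_self:
  assumes "x \<in> X"
  shows "x \<in> near x"
proof -
  have "\<forall>i<7. \<forall>j<7. length (frame_rows ! i # frame_pairs ! j) = 3 \<and> set (frame_rows ! i # frame_pairs ! j) \<subseteq> {..<7}"
    unfolding all_less_7' by (simp add: frame_rows_def frame_pairs_def)
  then show ?thesis
    using assms by (simp add: near_def ev_s_phi[OF assms adapted_fr[OF assms]] del: length_Cons set_simps)
qed

lemma near_signed_identity:
  fixes m :: "nat \<Rightarrow> nat \<Rightarrow> real"
  assumes m: "\<And>i j. i < n \<Longrightarrow> j < n \<Longrightarrow> \<bar>m i j - (if i = j then \<epsilon> i else 0)\<bar> \<le> d"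
    and \<epsilon>: "\<And>i. i < n \<Longrightarrow> \<bar>\<epsilon> i\<bar> = 1" and z: "\<And>i. i < n \<Longrightarrow> (\<Sum>j<n. m i j * r j) = 0"
    and d: "real n * d < 1" and i: "i < n"
  shows "r i = 0"
proof -
  define S where "S = (\<Sum>j<n. \<bar>r j\<bar>)"
  have b: "\<bar>r i\<bar> \<le> d * S" if i: "i < n" for i
  proof -
    have "(\<Sum>j<n. (m i j - (if i = j then \<epsilon> i else 0)) * r j) = (\<Sum>j<n. m i j * r j) - (\<Sum>j<n. if j = i then \<epsilon> i * r i else 0)"
      unfolding sum_subtractf[symmetric] by (rule sum.cong) (auto simp: left_diff_distrib)
    then have "\<epsilon> i * r i = - (\<Sum>j<n. (m i j - (if i = j then \<epsilon> i else 0)) * r j)" using z[OF i] i by simp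
    then have "\<bar>r i\<bar> = \<bar>\<Sum>j<n. (m i j - (if i = j then \<epsilon> i else 0)) * r j\<bar>"
      using \<epsilon>[OF i] abs_mult[of "\<epsilon> i" "r i"] by simp
    also have "\<dots> \<le> (\<Sum>j<n. d * \<bar>r j\<bar>)"
      by (rule order_trans[OF sum_abs]) (auto simp: abs_mult intro!: sum_mono mult_right_mono m i)
    finally show ?thesis by (simp add: S_def sum_distrib_left)
  qed
  have S0: "S \<ge> 0" by (simp add: S_def sum_nonneg)
  have "S \<le> (\<Sum>j<n. d * S)" unfolding S_def[of] using b by (intro sum_mono) (auto simp: S_def)
  then have "S * (1 - real n * d) \<le> 0" by (simp add: algebra_simps)
  then have "S = 0" using S0 d by (simp add: mult_le_0_iff)
  then show ?thesis using b[OF i] by simp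
qed

lemma wedge_2_ev:
  assumes f: "frame f" and a: "homogeneous 2 a"
  shows "wedge a b f = (\<Sum>p\<leftarrow>pairs7. psign (p @ cmp p) * ev f a p * ev f b (cmp p))"
proof -
  obtain c0 c1 c2 c3 c4 c5 c6 where fe: "f = [c0, c1, c2, c3, c4, c5, c6]" using frame_cases[OF f] .
  have upt: "[0..<7] = [0, 1, 2, 3, 4, 5, 6::nat]" by (simp add: upt_rec)
  show ?thesis
    unfolding wedge_eq_shuf[OF a] fe by (simp add: pairs7_def cmp_def upt ev_def)
qed

lemma sum_frame_pairs:
  fixes F :: "nat list \<Rightarrow> real"
  assumes "\<And>p. p \<in> set pairs7 \<Longrightarrow> p \<notin> set frame_pairs \<Longrightarrow> F p = 0"
  shows "(\<Sum>p\<leftarrow>pairs7. F p) = (\<Sum>j<7. F (frame_pairs ! j))"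
proof -
  have "\<forall>p\<in>set pairs7. p \<notin> set frame_pairs \<longrightarrow> F p = 0" using assms by blast
  then show ?thesis unfolding sum_less_7 by (simp add: pairs7_def frame_pairs_def)
qed

lemma rest_vanish:
  assumes x0: "x\<^sub>0 \<in> X" and x: "x \<in> near x\<^sub>0"
    and z: "\<And>u. wedge (interior u (s_of x)) Q std = 0" and Q: "alternating Q" "homogeneous 5 Q"
    and q: "\<And>p. p \<in> set pairs7 \<Longrightarrow> p \<notin> set frame_pairs \<Longrightarrow> ev (fr x\<^sub>0) Q (cmp p) = 0"
    and r: "is \<in> set rest"
  shows "ev (fr x\<^sub>0) Q (is @ [6]) = 0"
proof -
  let ?f = "fr x\<^sub>0"
  note f = frame_fr[OF x0]
  let ?c = "\<lambda>j. psign (frame_pairs ! j @ cmp (frame_pairs ! j))"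
  let ?m = "\<lambda>i j. ev ?f (s_of x) (frame_rows ! i # frame_pairs ! j)"
  let ?\<epsilon> = "\<lambda>i. phi (frame_rows ! i # frame_pairs ! i)"
  have hu: "homogeneous 2 (interior u (s_of x))" for u by (rule homogeneous_interior_s[OF s_of_forms])
  have upt: "[0..<7] = [0, 1, 2, 3, 4, 5, 6::nat]" by (simp add: upt_rec)
  have row: "(\<Sum>j<7. ?m i j * (?c j * ev ?f Q (cmp (frame_pairs ! j)))) = 0" for i
  proof -
    let ?u = "?f ! (frame_rows ! i)"
    have "wedge (interior ?u (s_of x)) Q ?f = 0"
      using top_form_eq_std[of "wedge (interior ?u (s_of x)) Q" ?f] z[of ?u] homogeneous_wedge[OF hu Q(2), of ?u]
      by (simp add: alternating_wedge alternating_interior s_of_forms Q)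
    then have "(\<Sum>p\<leftarrow>pairs7. psign (p @ cmp p) * ev ?f (interior ?u (s_of x)) p * ev ?f Q (cmp p)) = 0"
      by (simp add: wedge_2_ev[OF f hu])
    moreover have "ev ?f (interior ?u (s_of x)) p = ev ?f (s_of x) (frame_rows ! i # p)" for p
      by (simp add: ev_def interior_def)
    ultimately have "(\<Sum>p\<leftarrow>pairs7. psign (p @ cmp p) * ev ?f (s_of x) (frame_rows ! i # p) * ev ?f Q (cmp p)) = 0"
      by simp
    moreover have "(\<Sum>p\<leftarrow>pairs7. psign (p @ cmp p) * ev ?f (s_of x) (frame_rows ! i # p) * ev ?f Q (cmp p)) =
      (\<Sum>j<7. ?c j * ?m i j * ev ?f Q (cmp (frame_pairs ! j)))"
      by (rule sum_frame_pairs) (simp add: q)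
    ultimately have "(\<Sum>j<7. ?c j * ?m i j * ev ?f Q (cmp (frame_pairs ! j))) = 0" by simp
    then show ?thesis by (simp add: mult_ac)
  qed
  have phis: "\<forall>i<7. \<forall>j<7. phi (frame_rows ! i # frame_pairs ! j) = (if i = j then ?\<epsilon> i else 0)"
    unfolding all_less_7' by (simp add: frame_rows_def frame_pairs_def phi_values)
  have eps: "\<forall>i<7. \<bar>?\<epsilon> i\<bar> = 1"
    unfolding all_less_7' by (simp add: frame_rows_def frame_pairs_def phi_values)
  have c: "\<forall>j<7. ?c j \<noteq> 0"
    unfolding all_less_7' by (simp add: frame_pairs_def cmp_def upt)
  have "?c j * ev ?f Q (cmp (frame_pairs ! j)) = 0" if "j < 7" for j
  proof (rule near_signed_identity[where n = 7 and m = ?m and \<epsilon> = ?\<epsilon> and d = "1 / 8"])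
    fix i j :: nat assume ij: "i < 7" "j < 7"
    then have b: "\<bar>?m i j - phi (frame_rows ! i # frame_pairs ! j)\<bar> < 1 / 8" by (rule near_bound[OF x])
    have s: "(if i = j then ?\<epsilon> i else 0) = phi (frame_rows ! i # frame_pairs ! j)" using phis ij by metis
    show "\<bar>?m i j - (if i = j then ?\<epsilon> i else 0)\<bar> \<le> 1 / 8" unfolding s using b by (rule less_imp_le)
  qed (use eps row that in auto)
  then have "\<forall>j<7. ev ?f Q (cmp (frame_pairs ! j)) = 0" using c by simp
  moreover have "\<exists>j<7. is @ [6] = cmp (frame_pairs ! j)"
  proof -
    have c: "\<forall>j<7. cmp (frame_pairs ! j) = rest ! j @ [6]"
      unfolding all_less_7' by (simp add: rest_def frame_pairs_def cmp_def upt)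
    obtain j where "j < length rest" "is = rest ! j" using r by (metis in_set_conv_nth)
    moreover have "length rest = 7" by (simp add: rest_def)
    ultimately show ?thesis using c by auto
  qed
  ultimately show ?thesis by auto
qed

lemma integral_of_equations:
  assumes x0: "x\<^sub>0 \<in> X" and x: "x \<in> near x\<^sub>0" and e: "map fst e = fr x\<^sub>0"
    and eqs: "\<And>k \<kappa>. k < 7 \<Longrightarrow> \<kappa> \<in> keys k \<Longrightarrow> gform l (fst \<kappa>) x (e ! k # map ((!) e) (snd \<kappa>)) = 0"
    and n: "n \<in> {3..<14}" and vs: "set vs \<subseteq> span (set e)"
  shows "gform l n x vs = 0"
proof -
  let ?f = "fr x\<^sub>0"
  note f = frame_fr[OF x0]
  have xX: "x \<in> X" using x by (simp add: near_def)
  have le: "length e = 7" using lists_over_frame(1)[of e] f e by simp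
  have alt: "alternating (gform l n x)" if "n \<in> {3..<14}" for n using that xX by (intro alternating_gform) auto
  have gen: "gform l n x (map ((!) e) is) = 0"
    if n: "n \<in> {3..<14}" and "is": "sorted_wrt (<) is" "set is \<subseteq> {..<7}" "\<not> (n = 5 \<and> butlast is \<in> set rest)" for n "is"
  proof (cases "length is = gdeg n")
    case True
    then have "is \<noteq> []" using n by (auto simp: gdeg_def)
    then obtain js k where jk: "is = js @ [k]" by (metis append_butlast_last_id)
    have k: "k < 7" "sorted_wrt (<) js" "set js \<subseteq> {..<k}" using "is" by (auto simp: jk sorted_wrt_append)
    then have "set js \<subseteq> {..<6}" by force
    then have "(n, js) \<in> keys k" using key_exhaust[of js n] k n True "is"(3) by (auto simp: jk keys_def)
    from eqs[OF k(1) this] show ?thesis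
      using alternating_move[OF alt[OF n], of "map ((!) e) js" "e ! k" "[]"] by (simp add: jk)
  next
    case False
    then show ?thesis using homogeneous_gform[OF xX, of n l] n by (simp add: homogeneous_def)
  qed
  define \<gamma> where "\<gamma> v = (\<Sum>i<7. coord ?f i v *\<^sub>R e ! i)" for v
  have lin: "linear (coord ?f i)" if "i < 7" for i using linear_coord[of i ?f] frame_length[OF f] that by simp
  have \<gamma>: "linear \<gamma>" unfolding \<gamma>_def
    by (intro linearI) (simp_all add: linear_add[OF lin] linear_scale[OF lin] scaleR_add_left sum.distrib scaleR_sum_right)
  have fst_e: "fst (e ! i) = ?f ! i" if "i < 7" for i using arg_cong[OF e, of "\<lambda>l. l ! i"] that le by simp
  have fst_\<gamma>: "fst (\<gamma> v) = v" for v
    using frame_expand[OF f, of v] by (simp add: \<gamma>_def fst_sum fst_e)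
  have \<gamma>f: "\<gamma> (?f ! i) = e ! i" if "i < 7" for i
  proof -
    have "\<gamma> (?f ! i) = (\<Sum>j<7. if j = i then e ! i else 0)"
      unfolding \<gamma>_def by (rule sum.cong) (auto simp: coord_nth[OF f] that)
    then show ?thesis using that by simp
  qed
  have pb: "ev ?f (pullback \<gamma> \<phi>) is = \<phi> (map ((!) e) is)" if "set is \<subseteq> {..<7}" for \<phi> "is"
  proof -
    have "map \<gamma> (map ((!) ?f) is) = map ((!) e) is" using that \<gamma>f by (auto simp: subset_iff)
    then show ?thesis unfolding ev_def pullback_def by (rule arg_cong)
  qed
  have "pullback \<gamma> (Upsilon4 x) = (\<lambda>_. 0)"
  proof (rule frame_form_eqI[OF f])
    show "alternating (pullback \<gamma> (Upsilon4 x))"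
      using alternating_pullback[OF \<gamma> alt[of 4]] by (simp add: gform_def)
    show "homogeneous 4 (pullback \<gamma> (Upsilon4 x))"
      using homogeneous_pullback[OF homogeneous_gform[OF xX, of 4 l], of \<gamma>] by (simp add: gform_def gdeg_def)
    fix "is" :: "nat list" assume "is": "sorted_wrt (<) is" "length is = 4" "set is \<subseteq> {..<7}"
    show "ev ?f (pullback \<gamma> (Upsilon4 x)) is = ev ?f (\<lambda>_. 0) is"
      using pb[OF "is"(3), of "Upsilon4 x"] gen[of 4 "is"] "is" by (simp add: gform_def ev_def)
  qed (simp_all add: homogeneous_def)
  note U5 = interior_s_Upsilon5[OF xX \<gamma> fst_\<gamma> this]
  have Q: "alternating (pullback \<gamma> (Upsilon5 x))" "homogeneous 5 (pullback \<gamma> (Upsilon5 x))"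
    using alternating_pullback[OF \<gamma> alt[of 5]] homogeneous_pullback[OF homogeneous_gform[OF xX, of 5 l], of \<gamma>]
    by (simp_all add: gform_def gdeg_def)
  have r: "ev ?f (pullback \<gamma> (Upsilon5 x)) (is @ [6]) = 0" if "is \<in> set rest" for "is"
  proof (rule rest_vanish[OF x0 x U5 Q _ that])
    fix p assume p: "p \<in> set pairs7" "p \<notin> set frame_pairs"
    have upt: "[0..<7] = [0, 1, 2, 3, 4, 5, 6::nat]" by (simp add: upt_rec)
    have "\<forall>p\<in>set pairs7. p \<notin> set frame_pairs \<longrightarrow> butlast (cmp p) \<notin> set rest"
      by (simp add: pairs7_def frame_pairs_def cmp_def upt rest_def)
    moreover have "sorted_wrt (<) (cmp p)" "set (cmp p) \<subseteq> {..<7}"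
      by (auto simp: cmp_def intro: sorted_wrt_filter)
    ultimately show "ev ?f (pullback \<gamma> (Upsilon5 x)) (cmp p) = 0"
      using gen[of 5 "cmp p"] p pb[of "cmp p" "Upsilon5 x"] by (simp add: gform_def)
  qed
  show ?thesis
  proof (rule alternating_eq_zero_on_span_nths[OF alt[OF n] _ vs])
    fix K assume K: "K \<subseteq> {..<length e}"
    define is' where "is' = filter (\<lambda>i. i \<in> K) [0..<7]"
    have m: "nths e K = map ((!) e) is'" by (simp add: nths_eq_map_filter is'_def le)
    have i: "sorted_wrt (<) is'" "set is' \<subseteq> {..<7}" by (auto simp: is'_def intro: sorted_wrt_filter)
    show "gform l n x (nths e K) = 0"
    proof (cases "n = 5 \<and> butlast is' \<in> set rest")
      case True
      have "is' \<noteq> []" using True by (auto simp: rest_def)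
      then obtain k where k: "is' = butlast is' @ [k]" by (metis append_butlast_last_id)
      have "sorted_wrt (<) (butlast is' @ [k])" "k < 7" using i k by (metis, metis in_set_conv_decomp lessThan_iff subsetD)
      then have "k = 6" using rest_5[of "butlast is'"] True by (auto simp: sorted_wrt_append)
      then show ?thesis using r[of "butlast is'"] True k pb[OF i(2), of "Upsilon5 x"] m by (simp add: gform_def)
    next
      case False
      then show ?thesis unfolding m using gen[OF n i] by blast
    qed
  qed
qed

lemma equations_solvable:
  assumes x: "x \<in> X"
  obtains e where "map fst e = fr x"
    and "\<And>k \<kappa>. k < 7 \<Longrightarrow> \<kappa> \<in> keys k \<Longrightarrow> gform l (fst \<kappa>) x (e ! k # map ((!) e) (snd \<kappa>)) = 0"
proof -
  have len: "length (fr x) = 7" by (rule frame_length[OF frame_fr[OF x]])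
  have "n \<le> 7 \<Longrightarrow> \<exists>e. map fst e = take n (fr x) \<and>
    (\<forall>k<n. \<forall>\<kappa>\<in>keys k. gform l (fst \<kappa>) x (e ! k # map ((!) e) (snd \<kappa>)) = 0)" for n
  proof (induction n)
    case 0
    then show ?case by simp
  next
    case (Suc n)
    then obtain e where e: "map fst e = take n (fr x)"
      and eq: "\<And>k \<kappa>. k < n \<Longrightarrow> \<kappa> \<in> keys k \<Longrightarrow> gform l (fst \<kappa>) x (e ! k # map ((!) e) (snd \<kappa>)) = 0" by auto
    have le: "length e = n" using arg_cong[OF e, of length] Suc.prems len by simp
    let ?f = "fr x ! n"
    obtain \<delta> where \<delta>: "\<And>\<kappa>. \<kappa> \<in> set keyl \<Longrightarrow> vert x \<kappa> \<delta> = - gform l (fst \<kappa>) x ((?f, 0) # map ((!) e) (snd \<kappa>))"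
      using vert_onto[OF x, of "\<lambda>\<kappa>. - gform l (fst \<kappa>) x ((?f, 0) # map ((!) e) (snd \<kappa>))"] by blast
    let ?e = "e @ [(?f, \<delta>)]"
    have me: "map ((!) ?e) is = map ((!) e) is" if "set is \<subseteq> {..<n}" for "is"
      using that le by (auto simp: nth_append subset_iff)
    have "gform l (fst \<kappa>) x (?e ! k # map ((!) ?e) (snd \<kappa>)) = 0" if k: "k < Suc n" and \<kappa>: "\<kappa> \<in> keys k" for k \<kappa>
    proof -
      have sub: "set (snd \<kappa>) \<subseteq> {..<n}" using keys_bounds(3)[OF \<kappa>] k by force
      show ?thesis
      proof (cases "k = n")
        case True
        have "(?f, \<delta>) = (?f, 0) + (0, \<delta>)" by simp
        moreover have "gform l (fst \<kappa>) x ((0, \<delta>) # map ((!) e) (snd \<kappa>)) = vert x \<kappa> \<delta>"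
          by (rule vertical_key[OF x keys_bounds(1)[OF \<kappa>] map_fst_nth[OF e _ sub]]) (use Suc.prems len in simp)
        moreover have "3 \<le> fst \<kappa>" using keys_bounds(2)[OF \<kappa>] by simp
        ultimately have "gform l (fst \<kappa>) x ((?f, \<delta>) # map ((!) e) (snd \<kappa>)) = 0"
          using linear_add[OF linear_gform[OF x, of "fst \<kappa>" l "map ((!) e) (snd \<kappa>)"], of "(?f, 0)" "(0, \<delta>)"]
            \<delta>[OF keys_bounds(1)[OF \<kappa>]] by simp
        then show ?thesis unfolding me[OF sub] using True le by (simp add: nth_append)
      next
        case False
        then show ?thesis unfolding me[OF sub] using eq[of k \<kappa>] k \<kappa> le by (simp add: nth_append)
      qed
    qed
    moreover have "map fst ?e = take (Suc n) (fr x)"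
      using e Suc.prems len by (simp add: take_Suc_conv_app_nth)
    ultimately show ?case by blast
  qed
  from this[of 7] show thesis using that len by auto
qed

section \<open>Involutivity\<close>

lemma admissible_span:
  assumes x: "x \<in> X" and e: "frame (map fst e)"
    and int: "\<And>n vs. n \<in> {3..<14} \<Longrightarrow> set vs \<subseteq> span (set e) \<Longrightarrow> gform l n x vs = 0"
  shows "(x, span (set e)) \<in> admissible 7 X (I_lambda_plus l) omega"
proof -
  note le = lists_over_frame[OF e]
  have "integral_element (I_lambda_plus l) x (span (set e))"
    unfolding I_lambda_plus_eq integral_element_ideal_gen[OF x] using int by (auto intro: subspace_span)
  moreover have "dim (span (set e)) = 7"
    using dim_eq_card_independent[OF le(3)] distinct_card[OF le(2)] le(1) by simp
  moreover have "omega x e \<noteq> 0"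
    using e frame_fr[OF x] by (simp add: omega_def pullback_def star_1_eq_vol[OF x] fvol_def frame_def)
  moreover have "set e \<subseteq> span (set e)" by (rule span_superset)
  ultimately show ?thesis using x unfolding admissible_def by blast
qed

lemma admissible_integral:
  assumes "(x, E) \<in> admissible m X (I_lambda_plus l) omega" "n \<in> {3..<14}" "set vs \<subseteq> E"
  shows "gform l n x vs = 0"
proof -
  have "x \<in> X" "integral_element (I_lambda_plus l) x E" using assms(1) by (auto simp: admissible_def)
  then show ?thesis using assms(2,3) unfolding I_lambda_plus_eq integral_element_ideal_gen[OF \<open>x \<in> X\<close>] by blast
qed

lemma admissible_basis:
  assumes E: "(x, E) \<in> admissible 7 X (I_lambda_plus l) omega" and x: "x \<in> X"
  obtains e where "map fst e = fr x" "E = span (set e)"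
proof -
  obtain vs where sE: "subspace E" and dE: "dim E = 7" and vs: "set vs \<subseteq> E" "omega x vs \<noteq> 0"
    using E by (auto simp: admissible_def integral_element_def)
  have "frame (map fst vs)"
    using vs(2) by (auto simp: omega_def pullback_def star_1_eq_vol[OF x] fvol_def frame_def)
  then have sp: "span (fst ` set vs) = (UNIV :: (real^7) set)" using frame_span[of "map fst vs"] by simp
  have lin: "linear (fst :: total \<Rightarrow> real^7)" by (intro linearI) simp_all
  have "\<exists>w\<in>E. fst w = v" for v :: "real^7"
  proof -
    have "v \<in> fst ` span (set vs)" using sp linear_span_image[OF lin, of "set vs"] by simp
    moreover have "span (set vs) \<subseteq> E" by (rule span_minimal[OF vs(1) sE])
    ultimately show ?thesis by blast
  qed
  then obtain h where h: "\<And>v :: real^7. h v \<in> E" "\<And>v. fst (h v) = v" by metis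
  let ?e = "map h (fr x)"
  have fe: "map fst ?e = fr x" by (simp add: o_def h(2))
  then have "frame (map fst ?e)" using frame_fr[OF x] by simp
  note le = lists_over_frame[OF this]
  have sub: "set ?e \<subseteq> E" using h(1) by auto
  have "E \<subseteq> span (set ?e)"
    by (rule card_ge_dim_independent[OF sub le(3)]) (use dE distinct_card[OF le(2)] le(1) in simp)
  moreover have "span (set ?e) \<subseteq> E" by (rule span_minimal[OF sub sE])
  ultimately have "E = span (set ?e)" by (rule subset_antisym)
  with fe show thesis by (rule that)
qed

definition chart :: "(real^7) list \<Rightarrow> total \<Rightarrow> total" where
  "chart f z = (\<Sum>k<7. (fst z $ ix k) *\<^sub>R f ! k, snd z)"

definition chart_basis :: "(real^7) list \<Rightarrow> fiber^7 \<Rightarrow> total list" where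
  "chart_basis f A = map (\<lambda>k. (f ! k, A $ ix k)) [0..<7]"

lemma linear_chart: "linear (chart f)"
  by (intro linearI) (simp_all add: chart_def scaleR_add_left sum.distrib scaleR_sum_right)

lemma bij_chart:
  assumes f: "frame f"
  shows "bij (chart f)"
proof -
  have "z = 0" if "chart f z = 0" for z :: total
  proof -
    have s: "(\<Sum>k<7. (fst z $ ix k) *\<^sub>R f ! k) = 0" and z2: "snd z = 0"
      using that by (auto simp: chart_def zero_prod_def)
    have "fst z $ ix j = 0" if j: "j < 7" for j
    proof -
      have l: "linear (coord f j)" using linear_coord[of j f] j frame_length[OF f] by simp
      have "0 = coord f j (\<Sum>k<7. (fst z $ ix k) *\<^sub>R f ! k)" using linear_0[OF l] s by simp
      also have "\<dots> = (\<Sum>k<7. if k = j then fst z $ ix j else 0)"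
        unfolding linear_sum[OF l] by (rule sum.cong) (auto simp: linear_scale[OF l] coord_nth[OF f] j)
      finally show ?thesis using j by simp
    qed
    then have "fst z $ i = 0" for i using pos7_less[of i] ix_pos7[of i] by metis
    then show ?thesis using z2 by (simp add: prod_eq_iff vec_eq_iff)
  qed
  then have "inj (chart f)" by (simp add: linear_injective_0[OF linear_chart])
  then show ?thesis using linear_injective_imp_surjective[OF linear_chart] by (simp add: bij_def)
qed

lemma graph_chart_eq: "graph_chart (chart f) A = span (set (chart_basis f A))"
proof -
  define G where "G v = (\<Sum>k<7. (v $ ix k) *\<^sub>R ((f ! k, A $ ix k) :: total))" for v :: "real^7"
  have "graph_chart (chart f) A = range G"
    by (auto simp: graph_chart_def chart_def G_def sum_7 image_def prod_eq_iff fst_sum snd_sum)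
  moreover have "range G = span (set (chart_basis f A))"
  proof
    have "G v \<in> span (set (chart_basis f A))" for v
      unfolding G_def by (intro span_sum span_scale span_base) (auto simp: chart_basis_def)
    then show "range G \<subseteq> span (set (chart_basis f A))" by blast
    have "linear G"
      unfolding G_def by (intro linearI) (simp_all only: vector_add_component vector_scaleR_component scaleR_add_left
          sum.distrib scaleR_sum_right scaleR_scaleR real_scaleR_def)
    then have "subspace (range G)" by (rule linear_subspace_image[OF _ subspace_UNIV])
    moreover have "(f ! j, A $ ix j) = G (ax j)" if j: "j < 7" for j
    proof -
      have "G (ax j) = (\<Sum>k<7. if k = j then (f ! j, A $ ix j) else 0)"
        unfolding G_def by (rule sum.cong) (auto simp: ax_component j zero_prod_def)
      then show ?thesis using j by simp
    qed
    then have "set (chart_basis f A) \<subseteq> range G" by (auto simp: chart_basis_def)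
    ultimately show "span (set (chart_basis f A)) \<subseteq> range G" by (intro span_minimal)
  qed
  ultimately show ?thesis by simp
qed

lemma length_chart_basis [simp]: "length (chart_basis f A) = 7"
  by (simp add: chart_basis_def)

lemma nth_chart_basis: "k < 7 \<Longrightarrow> chart_basis f A ! k = (f ! k, A $ ix k)"
  by (simp add: chart_basis_def)

lemma map_fst_chart_basis: "length f = 7 \<Longrightarrow> map fst (chart_basis f A) = f"
  by (rule nth_equalityI) (simp_all add: nth_chart_basis)

definition equation :: "real \<Rightarrow> (real^7) list \<Rightarrow> nat \<times> nat \<times> nat list \<Rightarrow> total \<times> (fiber^7) \<Rightarrow> real" where
  "equation l f j z = gform l (fst (snd j)) (fst z) (map ((!) (chart_basis f (snd z))) (fst j # snd (snd j)))"

abbreviation equations :: "(nat \<times> nat \<times> nat list) set" where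
  "equations \<equiv> SIGMA k:{..<7}. keys k"

lemma smooth_equation:
  assumes N: "open N" "N \<subseteq> X \<times> UNIV" and j: "j \<in> equations"
  shows "smooth_on N (equation l f j)"
proof -
  obtain k n "is" where jk: "j = (k, n, is)" "k < 7" "(n, is) \<in> keys k" using j by auto
  have n: "n \<ge> 3" and sub: "set is \<subseteq> {..<6}" using keys_bounds(2,4)[OF jk(3)] by auto
  let ?g = "\<lambda>i (z :: total \<times> (fiber^7)). (f ! i, snd z $ ix i)"
  have sm: "smooth_on N (\<lambda>z. gform l n (fst z) (map (\<lambda>g. g z) (map ?g (k # is))))"
  proof (rule smooth_on_diff_form_eval[OF open_X N(1), where L = fst])
    show "fst ` N \<subseteq> X" using N(2) by auto
    show "(fst has_derivative fst) (at y)" for y :: "total \<times> (fiber^7)"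
      by (rule bounded_linear_imp_has_derivative[OF bounded_linear_fst])
    show "diff_form X (gform l n)" by (rule diff_form_gform[OF n])
    fix g and b :: total assume "g \<in> set (map ?g (k # is))"
    then obtain i where g: "g = ?g i" by auto
    have "linear (\<lambda>z :: total \<times> (fiber^7). (snd z $ ix i) \<bullet> snd b)"
      by (intro linearI) (simp_all add: inner_add_left)
    then have "smooth_on N (\<lambda>z. f ! i \<bullet> fst b + (snd z $ ix i) \<bullet> snd b)"
      by (intro smooth_on_add smooth_on_const smooth_on_linear N)
    then show "smooth_on N (\<lambda>y. g y \<bullet> b)" by (simp add: g inner_prod_def)
  qed
  have m: "map ((!) (chart_basis f A)) (k # is) = map (\<lambda>i. (f ! i, A $ ix i)) (k # is)" for A
    using jk(2) sub by (auto simp: nth_chart_basis subset_iff)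
  have eq: "equation l f j = (\<lambda>z. gform l n (fst z) (map (\<lambda>g. g z) (map ?g (k # is))))"
    by (rule ext) (simp only: equation_def jk(1) fst_conv snd_conv m map_map o_def)
  show ?thesis unfolding eq by (rule sm)
qed

lemma equation_derivative:
  assumes x: "x \<in> X" and N: "open N" "N \<subseteq> X \<times> UNIV" "(x, A) \<in> N" and j: "(k', \<kappa>) \<in> equations" "k' \<le> k" and k: "k < 7"
  shows "frechet_derivative (equation l (fr x) (k', \<kappa>)) (at (x, A)) (0, \<chi> i. if i = ix k then \<delta> else 0) =
    (if k' = k then vert x \<kappa> \<delta> else 0)"
proof (rule frechet_derivative_along_line)
  let ?f = "fr x" and ?h = "\<chi> i. if i = ix k then \<delta> else (0 :: fiber)"
  show "equation l ?f (k', \<kappa>) differentiable (at (x, A))"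
    by (rule smooth_on_differentiable[OF smooth_equation[OF N(1,2) j(1)] N(3)])
  have \<kappa>: "\<kappa> \<in> keys k'" "k' < 7" using j(1) by auto
  have n: "fst \<kappa> \<ge> 3" using keys_bounds(2)[OF \<kappa>(1)] by simp
  fix t
  let ?ws = "map ((!) (chart_basis ?f A)) (snd \<kappa>)"
  have ws: "map ((!) (chart_basis ?f (A + t *\<^sub>R ?h))) (snd \<kappa>) = ?ws"
  proof (rule map_cong[OF refl])
    fix i assume "i \<in> set (snd \<kappa>)"
    then have "i < k'" using keys_bounds(3)[OF \<kappa>(1)] by blast
    then show "chart_basis ?f (A + t *\<^sub>R ?h) ! i = chart_basis ?f A ! i"
      using j(2) k by (simp add: nth_chart_basis ix_eq_iff)
  qed
  have e: "equation l ?f (k', \<kappa>) ((x, A) + t *\<^sub>R (0, ?h)) = gform l (fst \<kappa>) x (chart_basis ?f (A + t *\<^sub>R ?h) ! k' # ?ws)"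
    unfolding equation_def fst_conv snd_conv fst_add snd_add fst_scaleR snd_scaleR list.map ws by simp
  show "equation l ?f (k', \<kappa>) ((x, A) + t *\<^sub>R (0, ?h)) = equation l ?f (k', \<kappa>) (x, A) + t * (if k' = k then vert x \<kappa> \<delta> else 0)"
  proof (cases "k' = k")
    case True
    have cb: "chart_basis ?f (A + t *\<^sub>R ?h) ! k = chart_basis ?f A ! k + t *\<^sub>R (0, \<delta>)"
      using k by (simp add: nth_chart_basis)
    have v: "gform l (fst \<kappa>) x ((0, \<delta>) # ?ws) = vert x \<kappa> \<delta>"
    proof (rule vertical_key[OF x keys_bounds(1)[OF \<kappa>(1)] map_fst_nth])
      show "map fst (chart_basis ?f A) = take 7 ?f" "7 \<le> length ?f"
        using map_fst_chart_basis[of ?f A] frame_length[OF frame_fr[OF x]] by simp_all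
      show "set (snd \<kappa>) \<subseteq> {..<7}" using keys_bounds(4)[OF \<kappa>(1)] by fastforce
    qed
    note lin = linear_gform[OF x n, of l ?ws]
    show ?thesis
      unfolding e unfolding True cb linear_add[OF lin] linear_scale[OF lin] v by (simp add: equation_def)
  next
    case False
    then have "chart_basis ?f (A + t *\<^sub>R ?h) ! k' = chart_basis ?f A ! k'"
      using j(2) k by (simp add: nth_chart_basis ix_eq_iff)
    then show ?thesis unfolding e using False by (simp add: equation_def)
  qed
qed

text \<open>
  The equation with first index \<open>k\<close> involves only \<open>A\<^sub>0, \<dots>, A\<^sub>k\<close>, so the differentials are block triangular.
\<close>

lemma equations_independent:
  assumes x: "x \<in> X" and N: "open N" "N \<subseteq> X \<times> UNIV" "(x, A) \<in> N"
    and z: "\<And>h. (\<Sum>j\<in>equations. \<rho> j * frechet_derivative (equation l (fr x) j) (at (x, A)) h) = 0"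
    and j: "j \<in> equations"
  shows "\<rho> j = 0"
proof -
  obtain D where D: "\<And>\<kappa> \<kappa>'. \<kappa>' \<in> set keyl \<Longrightarrow> vert x \<kappa>' (D \<kappa>) = (if \<kappa> = \<kappa>' then 1 else 0)"
    using vert_dual[OF x] by blast
  have main: "\<rho> (k, \<kappa>) = 0" if "k < 7" "\<kappa> \<in> keys k" for k \<kappa>
    using that
  proof (induction "7 - k" arbitrary: k \<kappa> rule: less_induct)
    case less
    let ?h = "(0, \<chi> i. if i = ix k then D \<kappa> else 0) :: total \<times> (fiber^7)"
    have d: "\<rho> (k', \<kappa>') * frechet_derivative (equation l (fr x) (k', \<kappa>')) (at (x, A)) ?h =
        (if k' = k then if \<kappa>' = \<kappa> then \<rho> (k, \<kappa>) else 0 else 0)" if k': "k' < 7" "\<kappa>' \<in> keys k'" for k' \<kappa>'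
    proof (cases "k' \<le> k")
      case True
      then show ?thesis
        using equation_derivative[OF x N _ True less.prems(1), of \<kappa>' l "D \<kappa>"] k' D[OF keys_bounds(1)[OF k'(2)], of \<kappa>]
        by auto
    next
      case False
      then have "\<rho> (k', \<kappa>') = 0" using less.hyps[of k' \<kappa>'] k' less.prems(1) by simp
      then show ?thesis using False by auto
    qed
    have "0 = (\<Sum>k'<7. \<Sum>\<kappa>'\<in>keys k'. \<rho> (k', \<kappa>') * frechet_derivative (equation l (fr x) (k', \<kappa>')) (at (x, A)) ?h)"
      unfolding z[of ?h, symmetric] by (subst sum.Sigma) (auto simp: finite_keys case_prod_unfold)
    also have "\<dots> = (\<Sum>k'<7. \<Sum>\<kappa>'\<in>keys k'. if k' = k then if \<kappa>' = \<kappa> then \<rho> (k, \<kappa>) else 0 else 0)"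
      by (intro sum.cong refl d) auto
    also have "\<dots> = (\<Sum>k'<7. if k' = k then \<rho> (k, \<kappa>) else 0)"
      by (intro sum.cong refl) (auto simp: finite_keys less.prems)
    finally show ?case using less.prems by simp
  qed
  then show ?thesis using j by auto
qed

lemma equations_admissible:
  assumes x0: "x\<^sub>0 \<in> X" and x: "x \<in> near x\<^sub>0"
  shows "(x, graph_chart (chart (fr x\<^sub>0)) A) \<in> admissible 7 X (I_lambda_plus l) omega \<longleftrightarrow>
    (\<forall>j\<in>equations. equation l (fr x\<^sub>0) j (x, A) = 0)" (is "?L \<longleftrightarrow> ?R")
proof
  let ?e = "chart_basis (fr x\<^sub>0) A"
  have xX: "x \<in> X" using x by (simp add: near_def)
  have e: "map fst ?e = fr x\<^sub>0" by (rule map_fst_chart_basis[OF frame_length[OF frame_fr[OF x0]]])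
  {
    assume L: ?L
    show ?R
    proof
      fix j assume "j \<in> equations"
      then obtain k \<kappa> where j: "j = (k, \<kappa>)" "k < 7" "\<kappa> \<in> keys k" by auto
      have "set (map ((!) ?e) (k # snd \<kappa>)) \<subseteq> span (set (take 7 ?e))"
        by (rule nth_take_span) (use j keys_bounds(4)[OF j(3)] in auto)
      then have "gform l (fst \<kappa>) x (map ((!) ?e) (k # snd \<kappa>)) = 0"
        by (intro admissible_integral[OF L keys_bounds(2)[OF j(3)]]) (simp add: graph_chart_eq)
      then show "equation l (fr x\<^sub>0) j (x, A) = 0" by (simp add: equation_def j)
    qed
  next
    assume R: ?R
    have "gform l (fst \<kappa>) x (?e ! k # map ((!) ?e) (snd \<kappa>)) = 0" if "k < 7" "\<kappa> \<in> keys k" for k \<kappa>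
      using R[THEN bspec, of "(k, \<kappa>)"] that by (simp add: equation_def)
    from integral_of_equations[OF x0 x e this] show ?L
      unfolding graph_chart_eq by (intro admissible_span xX) (use e frame_fr[OF x0] in auto)
  }
qed

lemma admissible_submanifold:
  assumes x: "x \<in> X" and e: "map fst e = fr x"
  shows "grassmann_submanifold_near X (admissible 7 X (I_lambda_plus l) omega) x (span (set e)) (\<Sum>k<7. card (keys k))"
proof -
  let ?f = "fr x" and ?N = "near x \<times> (UNIV :: (fiber^7) set)"
  have f: "frame ?f" "length ?f = 7" using frame_fr[OF x] frame_length by auto
  define A where "A = (\<chi> i. snd (e ! pos7 i))"
  have le: "length e = 7" using arg_cong[OF e, of length] f by simp
  have "fst (e ! k) = ?f ! k" if "k < 7" for k using arg_cong[OF e, of "\<lambda>l. l ! k"] that le by simp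
  then have ee: "e = chart_basis ?f A"
    using le by (intro nth_equalityI) (simp_all add: nth_chart_basis A_def prod_eq_iff)
  have N: "open ?N" "?N \<subseteq> X \<times> UNIV" "(x, A) \<in> ?N"
    using near_self[OF x] by (auto intro: open_Times open_near) (simp_all add: near_def)
  have fin: "finite equations" by (auto simp: finite_keys)
  have c: "(\<Sum>k<7. card (keys k)) = card equations" by (simp add: finite_keys)
  obtain g where g: "bij_betw g {0..<card equations} equations" using ex_bij_betw_nat_finite[OF fin] by blast
  then have g: "bij_betw g {..<card equations} equations" by (simp add: lessThan_atLeast0)
  have gE: "g j \<in> equations" if "j < card equations" for j using g that by (auto simp: bij_betw_def)
  have ind: "\<forall>j<card equations. r j = 0"
    if z: "\<And>h. (\<Sum>j<card equations. r j * frechet_derivative (equation l ?f (g j)) (at (x, A)) h) = 0" for r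
  proof (intro allI impI)
    fix i assume i: "i < card equations"
    let ?\<rho> = "\<lambda>j. r (the_inv_into {..<card equations} g j)"
    have inv: "the_inv_into {..<card equations} g (g j) = j" if "j < card equations" for j
      using g that by (intro the_inv_into_f_f) (auto simp: bij_betw_def)
    have "?\<rho> (g i) = 0"
    proof (rule equations_independent[OF x N _ gE[OF i]])
      fix h
      show "(\<Sum>j\<in>equations. ?\<rho> j * frechet_derivative (equation l ?f j) (at (x, A)) h) = 0"
        unfolding sum.reindex_bij_betw[OF g, symmetric] using z[of h] by (simp add: inv)
    qed
    then show "r i = 0" by (simp add: inv i)
  qed
  have iff: "(y, graph_chart (chart ?f) B) \<in> admissible 7 X (I_lambda_plus l) omega \<longleftrightarrow>
      (\<forall>j<card equations. equation l ?f (g j) (y, B) = 0)" if "y \<in> near x" for y B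
  proof -
    have im: "g ` {..<card equations} = equations" using g by (rule bij_betw_imp_surj_on)
    have "(\<forall>j\<in>g ` {..<card equations}. P j) \<longleftrightarrow> (\<forall>j<card equations. P (g j))" for P by blast
    then show ?thesis unfolding im equations_admissible[OF x that] .
  qed
  show ?thesis
    unfolding grassmann_submanifold_near_def c
  proof (intro exI conjI)
    show "linear (chart ?f)" "bij (chart ?f)" by (rule linear_chart, rule bij_chart[OF f(1)])
    show "span (set e) = graph_chart (chart ?f) A" by (simp add: graph_chart_eq ee)
    show "open ?N" "(x, A) \<in> ?N" "?N \<subseteq> X \<times> UNIV" using N by auto
    show "\<forall>j<card equations. smooth_on ?N (equation l ?f (g j))"
      using smooth_equation[OF N(1,2)] gE by blast
    show "\<forall>r. (\<forall>h. (\<Sum>j<card equations. r j * frechet_derivative (equation l ?f (g j)) (at (x, A)) h) = 0) \<longrightarrow>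
        (\<forall>j<card equations. r j = 0)"
      using ind by blast
    show "\<forall>(y, B)\<in>?N. ((y, graph_chart (chart ?f) B) \<in> admissible 7 X (I_lambda_plus l) omega) =
        (\<forall>j<card equations. equation l ?f (g j) (y, B) = 0)"
      using iff by auto
  qed
qed

lemma characters_of_keys:
  assumes "\<And>k. k < 7 \<Longrightarrow> polar_codim X \<I> x (F k) = card (keys k)"
  shows "characters 7 X \<I> x F = [0, 0, 1, 3, 7, 15, 30, 0]"
proof -
  have "[1..<7] = [1, 2, 3, 4, 5, 6::nat]" by (simp add: upt_rec)
  then show ?thesis unfolding characters_def Let_def DIM_total using card_keys by (simp add: assms)
qed

theorem mainTheorem2:
  fixes l :: real
  shows "involutive X (I_lambda_plus l) omega [0, 0, 1, 3, 7, 15, 30, 0]"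
proof -
  let ?I = "I_lambda_plus l"
  have exist: "\<exists>E. (x, E) \<in> admissible 7 X ?I omega" if x: "x \<in> X" for x
  proof -
    obtain e where e: "map fst e = fr x"
      and eqs: "\<And>k \<kappa>. k < 7 \<Longrightarrow> \<kappa> \<in> keys k \<Longrightarrow> gform l (fst \<kappa>) x (e ! k # map ((!) e) (snd \<kappa>)) = 0"
      using equations_solvable[OF x] by blast
    have "(x, span (set e)) \<in> admissible 7 X ?I omega"
      by (rule admissible_span[OF x _ integral_of_equations[OF x near_self[OF x] e eqs]]) (use e frame_fr[OF x] in auto)
    then show ?thesis by blast
  qed
  have flag: "\<exists>F. regular_flag X ?I omega x E F \<and> characters 7 X ?I x F = [0, 0, 1, 3, 7, 15, 30, 0]"
    if x: "x \<in> X" and E: "(x, E) \<in> admissible 7 X ?I omega" for x E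
  proof -
    obtain e where e: "map fst e = fr x" "E = span (set e)" using admissible_basis[OF E x] by blast
    have "frame (map fst e)" using e(1) frame_fr[OF x] by simp
    note le = lists_over_frame[OF this]
    let ?F = "\<lambda>k. span (set (take k e))"
    have codim: "polar_codim X ?I x (?F k) = card (keys k)" if "k < 7" for k
      by (rule polar_codim_eq[OF x e(1) that]) (use admissible_integral[OF E] e(2) in blast)
    have "dim (?F k) = k" if "k \<le> 7" for k
    proof -
      have ind: "independent (set (take k e))" by (rule independent_mono[OF le(3) set_take_subset])
      then show ?thesis using dim_eq_card_independent[OF ind] distinct_card[of "take k e"] le(1,2) that by simp
    qed
    moreover have "?F k \<subseteq> ?F (Suc k)" for k by (intro span_mono set_take_subset_set_take) simp
    ultimately have "flag 7 E ?F" using e(2) le(1) by (simp add: flag_def)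
    moreover have "grassmann_submanifold_near X (admissible 7 X ?I omega) x E (\<Sum>k<7. polar_codim X ?I x (?F k))"
      using admissible_submanifold[OF x e(1), of l] e(2) codim by simp
    ultimately have "regular_flag X ?I omega x E ?F" by (simp add: regular_flag_def)
    moreover have "characters 7 X ?I x ?F = [0, 0, 1, 3, 7, 15, 30, 0]"
      by (rule characters_of_keys) (rule codim)
    ultimately show ?thesis by blast
  qed
  show ?thesis
    unfolding involutive_def using exterior_differential_system_I_lambda_plus exist flag by simp
qed

end
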